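(* Suppose that $f, g\in \mathcal C$ with $F(s)G(s)=1$ (equivalently, $g$ is the Dirichlet convolution inverse of $f$: $(f*g)(n)=1$ if $n=1$ and $0$ otherwise). Then: (a) If the Bombieri-Vinogradov Hypothesis holds for both $f$ and $g$, then the Bombieri-Vinogradov Hypothesis holds for $f\cdot 1_{\mathcal P}$; and (b) If the Bombieri-Vinogradov Hypothesis holds for $f\cdot 1_{\mathcal P}$ and the Siegel-Walfisz criterion holds for $f$, then the Bombieri-Vinogradov Hypothesis holds for $f$.
   Context: For an arithmetic function $h:\mathbb N\to\mathbb C$, $x\ge 2$, and integers $q\ge 1$, $a$ with $(a,q)=1$, put $$\Delta(h,x;q,a):=\sum_{\substack{n\leq x \\ n\equiv a \pmod q}} h(n) - \frac 1{\varphi(q)} \sum_{\substack{n\leq x \\ (n,q)=1}} h(n).$$ The Bombieri-Vinogradov Hypothesis for $h$: for every $A>0$ there exists a constant $B=B(A)$ such that, for all $x\ge 2$, $$\sum_{q\leq \sqrt{x}/(\log x)^B} \max_{a:\ (a,q)=1} |\Delta(h,x;q,a)| \ll_A \frac x{(\log x)^A},$$ with implied constant independent of $x$ (it may depend on $h$ and $A$). The Siegel-Walfisz criterion for $h$: for every $A>0$, all $x\ge2$, and all $a,q$ with $(a,q)=1$, $|\Delta(h,x;q,a)|\ll_A x/(\log x)^A$, with implied constant independent of $x,q,a$. For a multiplicative function $f$ let $F(s)=\sum_{n\ge1} f(n)n^{-s}$, and define $\Lambda_f$ by $-F'(s)/F(s)=\sum_{n\ge2}\Lambda_f(n)n^{-s}$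 for $\mathrm{Re}(s)>1$ (equivalently $f(n)\log n=\sum_{d\mid n}\Lambda_f(d)f(n/d)$ for all $n\geq 1$). $\mathcal C$ is the class of multiplicative functions $f$ with $|\Lambda_f(n)|\le\Lambda(n)$ for all $n\ge1$, where $\Lambda$ is the von Mangoldt function. $G(s)=\sum_{n\geq 1} g(n)n^{-s}$. $\mathcal P$ is the set of primes, and $f\cdot 1_{\mathcal P}$ is the function equal to $f$ on primes and $0$ elsewhere. *)

theory Defs
  imports Complex_Main "HOL-Number_Theory.Number_Theory"
begin

text \<open>
  Arithmetic functions on the positive integers are functions \<^typ>\<open>nat \<Rightarrow> complex\<close>; their value at
  \<open>0\<close> is never inspected by the definitions below.
\<close>

definition multiplicative_fun :: "(nat \<Rightarrow> complex) \<Rightarrow> bool" where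
  "multiplicative_fun f \<longleftrightarrow>
     f 1 = 1 \<and> (\<forall>m n. m > 0 \<longrightarrow> n > 0 \<longrightarrow> coprime m n \<longrightarrow> f (m * n) = f m * f n)"

definition dirichlet_conv :: "(nat \<Rightarrow> complex) \<Rightarrow> (nat \<Rightarrow> complex) \<Rightarrow> nat \<Rightarrow> complex" where
  "dirichlet_conv f g n = (\<Sum>d | d dvd n. f d * g (n div d))"

text \<open>
  The coefficients \<open>\<Lambda>\<^sub>f\<close> of \<open>- F' / F\<close>, where \<open>F\<close> is the Dirichlet series of \<open>f\<close>: comparing
  coefficients in \<open>- F' = (- F' / F) \<cdot> F\<close> gives \<open>f \<cdot> log = \<Lambda>\<^sub>f * f\<close>. The value at \<open>0\<close> is fixed
  to make the description definite.
\<close>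

definition Lambda_of :: "(nat \<Rightarrow> complex) \<Rightarrow> nat \<Rightarrow> complex" where
  "Lambda_of f = (THE L. L 0 = 0 \<and>
     (\<forall>n>0. f n * complex_of_real (ln (real n)) = dirichlet_conv L f n))"

definition class_C :: "(nat \<Rightarrow> complex) set" where
  "class_C = {f. multiplicative_fun f \<and> (\<forall>n\<ge>1. cmod (Lambda_of f n) \<le> mangoldt n)}"

definition prime_restrict :: "(nat \<Rightarrow> complex) \<Rightarrow> nat \<Rightarrow> complex" where
  "prime_restrict f n = (if prime n then f n else 0)"

definition AP_discrepancy :: "(nat \<Rightarrow> complex) \<Rightarrow> real \<Rightarrow> nat \<Rightarrow> int \<Rightarrow> complex" where
  "AP_discrepancy h x q a =
     (\<Sum>n | n \<ge> 1 \<and> real n \<le> x \<and> [int n = a] (mod int q). h n)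
     - 1 / of_nat (totient q) * (\<Sum>n | n \<ge> 1 \<and> real n \<le> x \<and> coprime n q. h n)"

text \<open>
  The maximum is over all integers \<open>a\<close> coprime to \<open>q\<close>; only finitely many values occur since
  the discrepancy is periodic in \<open>a\<close> (lemma \<open>AP_discrepancy_values\<close> below).
\<close>

definition bombieri_vinogradov_hyp :: "(nat \<Rightarrow> complex) \<Rightarrow> bool" where
  "bombieri_vinogradov_hyp h \<longleftrightarrow>
     (\<forall>A::real. A > 0 \<longrightarrow> (\<exists>B::real. \<exists>C::real. \<forall>x::real. x \<ge> 2 \<longrightarrow>
        (\<Sum>q | q \<ge> 1 \<and> real q \<le> sqrt x / ln x powr B.
            Max {cmod (AP_discrepancy h x q a) | a::int. coprime a (int q)})
        \<le> C * (x / ln x powr A)))"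

definition siegel_walfisz_crit :: "(nat \<Rightarrow> complex) \<Rightarrow> bool" where
  "siegel_walfisz_crit h \<longleftrightarrow>
     (\<forall>A::real. A > 0 \<longrightarrow> (\<exists>C::real. \<forall>x::real. x \<ge> 2 \<longrightarrow>
        (\<forall>(q::nat) (a::int). q \<ge> 1 \<longrightarrow> coprime a (int q) \<longrightarrow>
           cmod (AP_discrepancy h x q a) \<le> C * (x / ln x powr A))))"


text \<open>The description of \<open>\<Lambda>\<^sub>f\<close> is definite as soon as \<open>f(1) = 1\<close>.\<close>

function Lambda_rec :: "(nat \<Rightarrow> complex) \<Rightarrow> nat \<Rightarrow> complex" where
  "Lambda_rec f n = (if n = 0 then 0 else
     f n * complex_of_real (ln (real n))
     - (\<Sum>d\<in>{d. d dvd n \<and> d < n}. Lambda_rec f d * f (n div d)))"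
  by pat_completeness auto
termination by (relation "measure snd") auto

declare Lambda_rec.simps [simp del]

lemma dirichlet_conv_split_last:
  assumes "n > 0" "f 1 = 1"
  shows "dirichlet_conv L f n = L n + (\<Sum>d\<in>{d. d dvd n \<and> d < n}. L d * f (n div d))"
proof -
  have "{d. d dvd n} = insert n {d. d dvd n \<and> d < n}"
    using assms(1) by (auto dest: dvd_imp_le)
  then show ?thesis
    using assms by (simp add: dirichlet_conv_def)
qed

lemma Lambda_of_ex1:
  assumes "f 1 = 1"
  shows "\<exists>!L. L 0 = 0 \<and> (\<forall>n>0. f n * complex_of_real (ln (real n)) = dirichlet_conv L f n)"
proof (rule ex1I[of _ "Lambda_rec f"])
  show "Lambda_rec f 0 = 0 \<and>
      (\<forall>n>0. f n * complex_of_real (ln (real n)) = dirichlet_conv (Lambda_rec f) f n)"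
  proof (intro conjI allI impI)
    fix n :: nat assume n: "n > 0"
    have "Lambda_rec f n = f n * complex_of_real (ln (real n))
        - (\<Sum>d\<in>{d. d dvd n \<and> d < n}. Lambda_rec f d * f (n div d))"
      using n by (subst Lambda_rec.simps) simp
    then show "f n * complex_of_real (ln (real n)) = dirichlet_conv (Lambda_rec f) f n"
      unfolding dirichlet_conv_split_last[of n f, OF n assms] by simp
  qed (simp add: Lambda_rec.simps)
next
  fix L assume L: "L 0 = 0 \<and>
    (\<forall>n>0. f n * complex_of_real (ln (real n)) = dirichlet_conv L f n)"
  show "L = Lambda_rec f"
  proof
    fix n show "L n = Lambda_rec f n"
    proof (induction n rule: less_induct)
      case (less n)
      show ?case
      proof (cases "n = 0")
        case True
        then show ?thesis using L by (simp add: Lambda_rec.simps)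
      next
        case False
        then have n: "n > 0" by simp
        have "f n * complex_of_real (ln (real n))
            = L n + (\<Sum>d\<in>{d. d dvd n \<and> d < n}. L d * f (n div d))"
          using L n dirichlet_conv_split_last[of n f L, OF n assms] by simp
        moreover have "(\<Sum>d\<in>{d. d dvd n \<and> d < n}. L d * f (n div d))
            = (\<Sum>d\<in>{d. d dvd n \<and> d < n}. Lambda_rec f d * f (n div d))"
          using less by (intro sum.cong) auto
        ultimately show ?thesis
          using n by (subst Lambda_rec.simps) (simp add: algebra_simps)
      qed
    qed
  qed
qed

lemma Lambda_of_conv:
  assumes "f 1 = 1" "n > 0"
  shows "f n * complex_of_real (ln (real n)) = dirichlet_conv (Lambda_of f) f n"
  using theI'[OF Lambda_of_ex1[of f, OF assms(1)], folded Lambda_of_def] assms(2) by blast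

lemma AP_discrepancy_mod: "AP_discrepancy h x q (a mod int q) = AP_discrepancy h x q a"
  by (simp add: AP_discrepancy_def cong_def)

lemma AP_discrepancy_values:
  assumes "q \<ge> 1"
  shows "finite {cmod (AP_discrepancy h x q a) | a::int. coprime a (int q)}"
    and "{cmod (AP_discrepancy h x q a) | a::int. coprime a (int q)} \<noteq> {}"
proof -
  have "{cmod (AP_discrepancy h x q a) | a::int. coprime a (int q)}
      \<subseteq> (\<lambda>a. cmod (AP_discrepancy h x q a)) ` {0..<int q}"
  proof safe
    fix a :: int
    have "a mod int q \<in> {0..<int q}" using assms by simp
    then show "cmod (AP_discrepancy h x q a) \<in> (\<lambda>a. cmod (AP_discrepancy h x q a)) ` {0..<int q}"
      using AP_discrepancy_mod[of h x q a] by (metis image_eqI)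
  qed
  then show "finite {cmod (AP_discrepancy h x q a) | a::int. coprime a (int q)}"
    by (rule finite_subset) simp
  show "{cmod (AP_discrepancy h x q a) | a::int. coprime a (int q)} \<noteq> {}"
    using coprime_1_left by blast
qed

end

theory Submission
  imports Defs "HOL-Analysis.Analysis" "HOL-Real_Asymp.Real_Asymp" "HOL-Library.Real_Mod"
begin

text \<open>
  Since \<open>f\<close> and \<open>g\<close> are inverse to each other, \<open>\<Lambda>\<^sub>f = (f \<cdot> log) * g\<close> and \<open>f \<cdot> log = \<Lambda>\<^sub>f * f\<close>, and prime powers
  and factors \<open>log\<close> are harmless. So the theorem rests on one fact about convolutions: if \<open>\<alpha>\<close> and
  \<open>\<beta>\<close> satisfy the Siegel-Walfisz criterion and the Bombieri-Vinogradov estimate with a saving of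
  \<open>(log x)\<^sup>k\<close>, then \<open>\<alpha> * \<beta>\<close> satisfies that estimate with a saving of \<open>(log x)\<^sup>k\<^sup>-\<^sup>1\<^sup>/\<^sup>2\<close>. In part (a) the
  Siegel-Walfisz criterion follows from the hypotheses, and every \<open>k\<close> is available at once. In part
  (b) a saving of \<open>(log x)\<^sup>k\<close> for \<open>f\<close> gives \<open>(log x)\<^sup>k\<^sup>-\<^sup>1\<^sup>/\<^sup>2\<close> for \<open>f \<cdot> log\<close>, hence \<open>(log x)\<^sup>k\<^sup>+\<^sup>1\<^sup>/\<^sup>2\<close> for \<open>f\<close> by partial
  summation, and one iterates, starting from the trivial bound.

  In \<open>\<alpha> * \<beta>\<close> the terms \<open>\<alpha>(u) \<beta>(v)\<close> with \<open>u\<close> or \<open>v\<close> at most a power of \<open>log x\<close> are treated with the estimate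
  for the other factor. The remaining bilinear sum is treated with the large sieve, but without
  Dirichlet characters: functions on the reduced residues modulo \<open>q\<close> are split by averaging
  operators into parts of exact level \<open>r\<close>, one for each \<open>r dvd q\<close>. The splitting is compatible with
  multiplicative convolution, so the Cauchy-Schwarz inequality applies to each part. A part of small
  level \<open>r > 1\<close> is controlled by the Siegel-Walfisz criterion, and one of large level by the values
  of exponential sums at the reduced fractions with denominator \<open>r\<close>.
\<close>

section \<open>Reduced residues\<close>

text \<open>The large sieve says nothing at small levels, so the Siegel-Walfisz criterion must be
  available for both factors of a convolution. Estimates at all exponents imply it. In (b) this
  covers \<open>Lambda_of f\<close>, but for f, whose distribution is the goal, it has to be a
  hypothesis. The same circularity forces the iteration: in f log = \<Lambda>_f * f, the terms whose
  factor \<Lambda>_f(u) has a small u rest on an estimate for f at x / u. The total weight of the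
  small u is a power of log log x, so the convolution loses less than any positive power of log x;
  the 1/2 is a convenient choice, and any loss below 1 would let the iteration advance, because
  dividing by the logarithm gains 1.

  What shapes the treatment of small levels is that the part of level r modulo q = r s sees only
  integers coprime to s, a condition absent from the criterion. It is removed by inclusion and
  exclusion, at the price of larger moduli, which the criterion admits because it is uniform in q.
  Membership in the class enters through |f|, |g| \<le> 1 and |\<Lambda>_f| \<le> \<Lambda>, which
  keep all losses logarithmic.\<close>

lemma totatives_rep_ex:
  assumes "q > 0" "coprime k q"
  shows "\<exists>k'\<in>totatives q. [k' = k] (mod q)"
\<comment> \<open>\<open>totatives 1\<close> is \<open>{1}\<close>, whereas \<open>k mod 1\<close>
  is 0: here the remainder is not the representative.\<close>
proof (cases "q = 1")
  case True
  then show ?thesis by auto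
next
  case False
  have "k mod q \<noteq> 0"
  proof
    assume "k mod q = 0"
    then have "q dvd k" by auto
    then have "gcd k q = q" by (simp add: gcd_nat.absorb2)
    with assms False show False by simp
  qed
  then have "k mod q \<in> totatives q" using assms
    by (auto simp: in_totatives_iff less_imp_le coprime_commute)
  then show ?thesis by (intro bexI[of _ "k mod q"]) (auto simp: unique_euclidean_semiring_class.cong_def)
qed

lemma totatives_cong_imp_eq:
  assumes "k \<in> totatives q" "k' \<in> totatives q" "[k = k'] (mod q)"
  shows "k = k'"
proof (cases "q \<le> 1")
  case True
  then show ?thesis using assms by (auto simp: in_totatives_iff)
next
  case False
  then have "k < q" "k' < q" using totatives_less assms by auto
  then show ?thesis using assms(3) by (auto simp: unique_euclidean_semiring_class.cong_def)
qed

text \<open>A multiple of l is added to c whose cofactor t collects the primes of q that do not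
  divide c. Each prime p of q then divides exactly one of c and \<open>l * t\<close>: if
  \<open>p dvd c\<close>, then p divides neither l, by coprimality, nor t; otherwise p divides
  t.\<close>

lemma coprime_lift_ex:
  fixes c l q :: nat
  assumes "q > 0" "l dvd q" "coprime c l"
  shows "\<exists>k. [k = c] (mod l) \<and> coprime k q"
proof -
  define t where "t = \<Prod>{p\<in>prime_factors q. \<not> p dvd c}"
  have fin: "finite {p\<in>prime_factors q. \<not> p dvd c}" by simp
  have "coprime (c + l * t) q"
  proof (rule ccontr)
    assume "\<not> coprime (c + l * t) q"
    then have "gcd (c + l * t) q \<noteq> 1" using coprime_iff_gcd_eq_1 by blast
    from prime_factor_nat[OF this] obtain p where "prime p" "p dvd gcd (c + l * t) q" by blast
    then have p: "prime p" "p dvd c + l * t" "p dvd q" by auto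
    show False
    proof (cases "p dvd c")
      case True
      then have "p dvd l * t" using p(2) by (simp add: dvd_add_right_iff)
      then consider "p dvd l" | "p dvd t" using p(1) prime_dvd_mult_iff by blast
      then show False
      proof cases
        case 1
        then show False using True assms(3) p(1)
          by (meson coprime_common_divisor not_prime_unit)
      next
        case 2
        then obtain p' where "p' \<in> {p\<in>prime_factors q. \<not> p dvd c}" "p dvd p'"
          unfolding t_def using prime_dvd_prod_iff[OF fin p(1), of "\<lambda>x. x"] by auto
        then have "p' = p" using p(1) primes_dvd_imp_eq by (auto simp: in_prime_factors_iff)
        with \<open>p' \<in> _\<close> True show False by auto
      qed
    next
      case False
      then have "p dvd t" unfolding t_def using p assms(1)
        by (intro dvd_prod_eqI[OF fin, of p]) (auto simp: in_prime_factors_iff)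
      then have "p dvd c" using p(2) by (simp add: dvd_add_left_iff)
      with False show False by simp
    qed
  qed
  moreover have "[c + l * t = c] (mod l)" by (simp add: unique_euclidean_semiring_class.cong_def)
  ultimately show ?thesis by blast
qed

lemma totatives_lift_ex:
  assumes "q > 0" "l dvd q" "coprime c l"
  shows "\<exists>k\<in>totatives q. [k = c] (mod l)"
proof -
  obtain k where k: "[k = c] (mod l)" "coprime k q" using coprime_lift_ex[OF assms] by blast
  obtain k' where k': "k' \<in> totatives q" "[k' = k] (mod q)"
    using totatives_rep_ex[OF assms(1) k(2)] by blast
  have "[k' = k] (mod l)" using k'(2) assms(2) by (rule cong_dvd_modulus_nat)
  with k k' show ?thesis by (meson cong_trans)
qed

text \<open>The map sends b to a / b modulo q. Substituting it turns the convolution at a into a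
  pairing of two functions. That it respects congruence modulo every divisor of q, in both
  directions, is what makes it commute with averages over residue classes.\<close>

lemma totatives_quotient_bij:
  assumes "q > 0" "coprime a q"
  obtains s where "bij_betw s (totatives q) (totatives q)"
    "\<And>b c. b \<in> totatives q \<Longrightarrow> c \<in> totatives q \<Longrightarrow> [b * c = a] (mod q) \<longleftrightarrow> c = s b"
    "\<And>b c d. b \<in> totatives q \<Longrightarrow> c \<in> totatives q \<Longrightarrow> d dvd q \<Longrightarrow> [s b = s c] (mod d) \<longleftrightarrow> [b = c] (mod d)"
proof -
  have ex: "\<exists>c\<in>totatives q. [b * c = a] (mod q)" if "b \<in> totatives q" for b
  proof -
    have "coprime b q" using that by (simp add: in_totatives_iff)
    then obtain y where y: "[b * y = 1] (mod q)" using cong_solve_coprime_nat by auto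
    have "[b * (y * a) = a] (mod q)" using cong_mult[OF y cong_refl[of a]] by (simp add: mult.assoc)
    moreover from this have "coprime (y * a) q"
      by (metis assms(2) cong_imp_coprime cong_sym coprime_mult_left_iff)
    then obtain c where "c \<in> totatives q" "[c = y * a] (mod q)"
      using totatives_rep_ex[OF assms(1)] by blast
    ultimately show ?thesis by (meson cong_scalar_left cong_trans)
  qed
  define s where "s b = (SOME c. c \<in> totatives q \<and> [b * c = a] (mod q))" for b
  have s: "s b \<in> totatives q" "[b * s b = a] (mod q)" if "b \<in> totatives q" for b
    using someI_ex[of "\<lambda>c. c \<in> totatives q \<and> [b * c = a] (mod q)"] ex[OF that] unfolding s_def by blast+
  have uniq: "[b * c = a] (mod q) \<longleftrightarrow> c = s b" if "b \<in> totatives q" "c \<in> totatives q" for b c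
  proof
    assume "[b * c = a] (mod q)"
    then have "[b * c = b * s b] (mod q)" using s(2)[OF that(1)] by (meson cong_sym cong_trans)
    then have "[c = s b] (mod q)"
      using that(1) by (simp add: cong_mult_lcancel_nat in_totatives_iff)
    then show "c = s b" using totatives_cong_imp_eq that s by blast
  qed (use s that in auto)
  have eqv: "[s b = s c] (mod d) \<longleftrightarrow> [b = c] (mod d)"
    if "b \<in> totatives q" "c \<in> totatives q" "d dvd q" for b c d
  proof -
    have cop: "coprime x d" if "x \<in> totatives q" for x
      using that \<open>d dvd q\<close> by (meson coprime_divisors dvd_refl in_totatives_iff)
    have e: "[b * s b = c * s c] (mod d)"
      using s(2)[OF that(1)] s(2)[OF that(2)] that(3) by (meson cong_dvd_modulus_nat cong_sym cong_trans)
    show ?thesis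
    proof
      assume "[s b = s c] (mod d)"
      then have "[b * s b = b * s c] (mod d)" by (simp add: cong_scalar_left)
      then have "[b * s c = c * s c] (mod d)" using e by (meson cong_sym cong_trans)
      then show "[b = c] (mod d)" using cop[OF s(1)[OF that(2)]] by (simp add: cong_mult_rcancel_nat)
    next
      assume "[b = c] (mod d)"
      then have "[b * s c = c * s c] (mod d)" by (simp add: cong_scalar_right)
      then have "[b * s b = b * s c] (mod d)" using e by (meson cong_sym cong_trans)
      then show "[s b = s c] (mod d)" using cop[OF that(1)] by (simp add: cong_mult_lcancel_nat)
    qed
  qed
  have inj: "inj_on s (totatives q)"
  proof (rule inj_onI)
    fix b c assume "b \<in> totatives q" "c \<in> totatives q" "s b = s c"
    then show "b = c" using eqv[of b c q] totatives_cong_imp_eq by (metis cong_refl dvd_refl)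
  qed
  have "bij_betw s (totatives q) (totatives q)"
    using inj s(1) by (intro bij_betw_imageI endo_inj_surj) auto
  then show ?thesis using that uniq eqv by blast
qed

text \<open>Reduction modulo d is onto, and its fibers have equal size: if k and k' lie over c and
  c', the map that sends m to k k' / m modulo q takes the fiber of c onto the fiber of c'.\<close>

lemma card_totatives_fiber:
  assumes "q > 0" "d dvd q" "coprime c d"
  shows "card {k\<in>totatives q. [k = c] (mod d)} * totient d = totient q"
proof -
  have le: "card {k\<in>totatives q. [k = c] (mod d)} = card {k\<in>totatives q. [k = c'] (mod d)}"
    if c: "coprime c d" "coprime c' d" for c c'
  proof -
    obtain k where k: "k \<in> totatives q" "[k = c] (mod d)"
      using totatives_lift_ex[OF assms(1,2) c(1)] by blast
    obtain k' where k': "k' \<in> totatives q" "[k' = c'] (mod d)"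
      using totatives_lift_ex[OF assms(1,2) c(2)] by blast
    have "coprime (k * k') q" using k k' by (auto simp: in_totatives_iff)
    then obtain s where s: "bij_betw s (totatives q) (totatives q)"
      "\<And>b c. b \<in> totatives q \<Longrightarrow> c \<in> totatives q \<Longrightarrow> [b * c = k * k'] (mod q) \<longleftrightarrow> c = s b"
      "\<And>b c d. b \<in> totatives q \<Longrightarrow> c \<in> totatives q \<Longrightarrow> d dvd q \<Longrightarrow> [s b = s c] (mod d) \<longleftrightarrow> [b = c] (mod d)"
      using assms(1) totatives_quotient_bij by blast
    have "s k = k'" using s(2)[OF k(1) k'(1)] by auto
    have mem: "m \<in> totatives q \<Longrightarrow> [s m = c'] (mod d) \<longleftrightarrow> [m = c] (mod d)" for m
      using s(3)[of m k d] k k' assms(2) \<open>s k = k'\<close> by (metis cong_sym cong_trans)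
    have "bij_betw s {m\<in>totatives q. [m = c] (mod d)} {m\<in>totatives q. [m = c'] (mod d)}"
      unfolding bij_betw_def
    proof
      show "inj_on s {m\<in>totatives q. [m = c] (mod d)}"
        using s(1) by (auto simp: bij_betw_def inj_on_def)
      show "s ` {m\<in>totatives q. [m = c] (mod d)} = {m\<in>totatives q. [m = c'] (mod d)}"
      proof (intro equalityI subsetI)
        fix y assume "y \<in> s ` {m\<in>totatives q. [m = c] (mod d)}"
        then show "y \<in> {m\<in>totatives q. [m = c'] (mod d)}" using mem s(1) by (auto simp: bij_betw_def)
      next
        fix y assume y: "y \<in> {m\<in>totatives q. [m = c'] (mod d)}"
        then obtain m where "m \<in> totatives q" "y = s m" using s(1) by (auto simp: bij_betw_def)
        then show "y \<in> s ` {m\<in>totatives q. [m = c] (mod d)}" using mem y by auto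
      qed
    qed
    then show ?thesis by (rule bij_betw_same_card)
  qed
  have d: "d > 0" using assms by (auto intro!: Nat.gr0I)
  have "totient q = card (\<Union>x\<in>totatives d. {k\<in>totatives q. [k = x] (mod d)})"
    unfolding totient_def
  proof (intro arg_cong[where f = card] equalityI subsetI)
    fix k assume "k \<in> totatives q"
    moreover from this have "coprime k d" using assms(2)
      by (meson coprime_divisors dvd_refl in_totatives_iff)
    from totatives_rep_ex[OF d this] obtain x where "x \<in> totatives d" "[x = k] (mod d)" by blast
    ultimately show "k \<in> (\<Union>x\<in>totatives d. {k\<in>totatives q. [k = x] (mod d)})"
      by (auto simp: cong_sym_eq)
  qed auto
  also have "\<dots> = (\<Sum>x\<in>totatives d. card {k\<in>totatives q. [k = x] (mod d)})"
  proof (rule card_UN_disjoint)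
    show "\<forall>i\<in>totatives d. \<forall>j\<in>totatives d. i \<noteq> j \<longrightarrow>
      {k\<in>totatives q. [k = i] (mod d)} \<inter> {k\<in>totatives q. [k = j] (mod d)} = {}"
    proof (intro ballI impI)
      fix i j assume ij: "i \<in> totatives d" "j \<in> totatives d" "i \<noteq> j"
      then have "\<not> [i = j] (mod d)" using totatives_cong_imp_eq by blast
      then show "{k\<in>totatives q. [k = i] (mod d)} \<inter> {k\<in>totatives q. [k = j] (mod d)} = {}"
        by (auto simp: unique_euclidean_semiring_class.cong_def)
    qed
  qed auto
  also have "\<dots> = (\<Sum>x\<in>totatives d. card {k\<in>totatives q. [k = c] (mod d)})"
    by (rule sum.cong[OF refl], rule le[OF _ assms(3)]) (simp add: in_totatives_iff)
  also have "\<dots> = card {k\<in>totatives q. [k = c] (mod d)} * totient d" by (simp add: totient_def)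
  finally show ?thesis by simp
qed

lemma cong_pair_solvable_nat:
  fixes c m d d' :: nat
  assumes "d > 0" "d' > 0" "[c = m] (mod gcd d d')"
  shows "\<exists>z. [z = c] (mod d) \<and> [z = m] (mod d')"
proof -
  define g where "g = gcd d d'"
  \<comment> \<open>Replaces m by a representative modulo d' that is at least c, so that
    \<open>m' - c\<close> is an honest difference of natural numbers.\<close>
  define m' where "m' = m + d' * c"
  have m': "m' \<ge> c" unfolding m'_def using assms(2) by (cases d') auto
  have "[m' = c] (mod g)"
  proof -
    have "[m' = m] (mod d')" by (simp add: m'_def unique_euclidean_semiring_class.cong_def)
    then have "[m' = m] (mod g)" unfolding g_def by (rule cong_dvd_modulus_nat) simp
    then show ?thesis using assms(3) unfolding g_def by (meson cong_sym cong_trans)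
  qed
  then have "g dvd m' - c" using m' by (simp add: cong_altdef_nat)
  then obtain j where j: "m' - c = g * j" by blast
  obtain x where x: "[d * x = g] (mod d')" using cong_solve_nat[of d d'] assms(1) unfolding g_def by auto
  have "[c + d * x * j = c + g * j] (mod d')"
    using x by (intro cong_add cong_mult cong_refl)
  moreover have "c + g * j = m'" using j m' by simp
  moreover have "[m' = m] (mod d')" by (simp add: m'_def unique_euclidean_semiring_class.cong_def)
  ultimately have "[c + d * (x * j) = m] (mod d')" by (metis cong_trans mult.assoc)
  moreover have "[c + d * (x * j) = c] (mod d)" by (simp add: unique_euclidean_semiring_class.cong_def)
  ultimately show ?thesis by blast
qed

lemma cong_lcm_iff_nat:
  fixes a b d d' :: nat
  shows "[a = b] (mod lcm d d') \<longleftrightarrow> [a = b] (mod d) \<and> [a = b] (mod d')"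
proof -
  have "[a = b] (mod n) \<longleftrightarrow> int n dvd int a - int b" for n
    by (simp add: cong_int_iff[symmetric] cong_iff_dvd_diff)
  then show ?thesis by (simp only: lcm_int_int_eq[symmetric] lcm_least_iff)
qed

lemma coprime_totatives_dvd: "c \<in> totatives q \<Longrightarrow> d dvd q \<Longrightarrow> coprime c d"
  by (meson coprime_divisors dvd_refl in_totatives_iff)

section \<open>Decomposition of functions on reduced residues by level\<close>

text \<open>For \<open>d dvd q\<close> the weight is the reciprocal of the number of reduced
  residues in the class of c, by \<open>card_totatives_fiber\<close>. The value 0 off
  \<open>totatives q\<close> lets identities between averages hold as equations of
  functions.\<close>

definition fiber_avg :: "nat \<Rightarrow> nat \<Rightarrow> (nat \<Rightarrow> complex) \<Rightarrow> nat \<Rightarrow> complex" where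
  "fiber_avg q d F c = (if c \<in> totatives q
     then of_nat (totient d) / of_nat (totient q) * (\<Sum>k | k \<in> totatives q \<and> [k = c] (mod d). F k) else 0)"

lemma fiber_avg_sum:
  "fiber_avg q d (\<lambda>c. \<Sum>i\<in>I. w i * F i c) c = (\<Sum>i\<in>I. w i * fiber_avg q d (F i) c)"
proof (cases "c \<in> totatives q")
  case True
  have "(\<Sum>k | k \<in> totatives q \<and> [k = c] (mod d). \<Sum>i\<in>I. w i * F i k)
      = (\<Sum>i\<in>I. w i * (\<Sum>k | k \<in> totatives q \<and> [k = c] (mod d). F i k))"
    by (subst sum.swap) (simp add: sum_distrib_left)
  then show ?thesis using True by (simp add: fiber_avg_def sum_distrib_left mult_ac)
qed (simp add: fiber_avg_def)

lemma fiber_avg_cong: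
  "(\<And>c. c \<in> totatives q \<Longrightarrow> F c = H c) \<Longrightarrow> fiber_avg q d F = fiber_avg q d H"
  unfolding fiber_avg_def by (intro ext if_cong refl arg_cong2[where f = "(*)"] sum.cong) auto

lemma cnj_fiber_avg: "cnj (fiber_avg q d F c) = fiber_avg q d (\<lambda>c. cnj (F c)) c"
  by (simp add: fiber_avg_def)

text \<open>A count with the Chinese remainder theorem: given c and m, the reduced k that agree with
  c modulo d and with m modulo d' form one class modulo \<open>lcm d d'\<close> if c and m agree
  modulo \<open>gcd d d'\<close>, and there are none otherwise. The weights match because
  \<open>totient d * totient d' = totient (gcd d d') * totient (lcm d d')\<close>.\<close>

lemma fiber_avg_fiber_avg:
  assumes q: "q > 0" and d: "d dvd q" and d': "d' dvd q"
  shows "fiber_avg q d (fiber_avg q d' F) = fiber_avg q (gcd d d') F"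
proof
  fix c
  show "fiber_avg q d (fiber_avg q d' F) c = fiber_avg q (gcd d d') F c"
  proof (cases "c \<in> totatives q")
    case c: True
    let ?T = "totatives q"
    define t where "t = (\<lambda>n. complex_of_real (real (totient n)))"
    have pos: "d > 0" "d' > 0" using assms by (auto intro!: Nat.gr0I)
    have cnt: "of_nat (card {k\<in>?T. [k = c] (mod d) \<and> [m = k] (mod d')}) * (t d * t d')
        = (if [m = c] (mod gcd d d') then t q * t (gcd d d') else 0)" if m: "m \<in> ?T" for m
    proof (cases "[m = c] (mod gcd d d')")
      case True
      then have "[c = m] (mod gcd d d')" by (simp add: cong_sym_eq)
      from cong_pair_solvable_nat[OF pos this] obtain z where z: "[z = c] (mod d)" "[z = m] (mod d')"
        by blast
      have "{k\<in>?T. [k = c] (mod d) \<and> [m = k] (mod d')} = {k\<in>?T. [k = z] (mod lcm d d')}"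
        unfolding cong_lcm_iff_nat using z
        by (intro Collect_cong) (metis cong_sym cong_trans)
      moreover have "coprime z (lcm d d')"
      proof -
        have "coprime z d" using z(1) coprime_totatives_dvd[OF c d] cong_imp_coprime cong_sym by metis
        moreover have "coprime z d'" using z(2) coprime_totatives_dvd[OF m d'] cong_imp_coprime cong_sym by metis
        ultimately have "coprime z (d * d')" by simp
        moreover have "lcm d d' dvd d * d'" by simp
        ultimately show ?thesis by (meson coprime_divisors dvd_refl)
      qed
      ultimately have e: "card {k\<in>?T. [k = c] (mod d) \<and> [m = k] (mod d')} * totient (lcm d d') = totient q"
        using card_totatives_fiber[OF q lcm_least[OF d d']] by simp
      have "card {k\<in>?T. [k = c] (mod d) \<and> [m = k] (mod d')} * (totient d * totient d')
          = card {k\<in>?T. [k = c] (mod d) \<and> [m = k] (mod d')} * (totient (gcd d d') * totient (lcm d d'))"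
        by (simp only: totient_gcd_lcm)
      also have "\<dots> = totient q * totient (gcd d d')" by (simp only: e[symmetric] ac_simps)
      finally have "card {k\<in>?T. [k = c] (mod d) \<and> [m = k] (mod d')} * (totient d * totient d')
          = totient q * totient (gcd d d')" .
      then have "complex_of_nat (card {k\<in>?T. [k = c] (mod d) \<and> [m = k] (mod d')} * (totient d * totient d'))
          = of_nat (totient q * totient (gcd d d'))" by simp
      then show ?thesis using True unfolding t_def by simp
    next
      case False
      have "{k\<in>?T. [k = c] (mod d) \<and> [m = k] (mod d')} = {}"
      proof (rule ccontr)
        assume "\<not> ?thesis"
        then obtain k where "[k = c] (mod d)" "[m = k] (mod d')" by auto
        then have "[k = c] (mod gcd d d')" "[m = k] (mod gcd d d')"
          using cong_dvd_modulus_nat gcd_dvd1 gcd_dvd2 by blast+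
        with False show False by (meson cong_trans)
      qed
      then show ?thesis using False by simp
    qed
    have tq: "t q \<noteq> 0" using q by (simp add: t_def)
    have "fiber_avg q d (fiber_avg q d' F) c
       = t d / t q * (\<Sum>k | k \<in> ?T \<and> [k = c] (mod d). t d' / t q * (\<Sum>m | m \<in> ?T \<and> [m = k] (mod d'). F m))"
      using c by (simp add: fiber_avg_def t_def)
    also have "(\<Sum>k | k \<in> ?T \<and> [k = c] (mod d). t d' / t q * (\<Sum>m | m \<in> ?T \<and> [m = k] (mod d'). F m))
       = (\<Sum>k\<in>?T. \<Sum>m\<in>?T. (if [k = c] (mod d) \<and> [m = k] (mod d') then t d' / t q * F m else 0))"
      by (subst sum.inter_filter) (auto simp: sum.inter_filter sum_distrib_left if_distrib intro!: sum.cong)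
    also have "\<dots> = (\<Sum>m\<in>?T. \<Sum>k\<in>?T. (if [k = c] (mod d) \<and> [m = k] (mod d') then t d' / t q * F m else 0))"
      by (rule sum.swap)
    also have "\<dots> = (\<Sum>m\<in>?T. of_nat (card {k\<in>?T. [k = c] (mod d) \<and> [m = k] (mod d')}) * (t d' / t q * F m))"
      by (simp add: sum.inter_filter[symmetric])
    also have "t d / t q * \<dots> = (\<Sum>m\<in>?T. (of_nat (card {k\<in>?T. [k = c] (mod d) \<and> [m = k] (mod d')}) * (t d * t d')) * (F m / (t q * t q)))"
      by (simp add: sum_distrib_left mult_ac)
    also have "\<dots> = (\<Sum>m\<in>?T. (if [m = c] (mod gcd d d') then t q * t (gcd d d') else 0) * (F m / (t q * t q)))"
      by (intro sum.cong refl arg_cong2[where f = "(*)"] cnt)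
    also have "\<dots> = (\<Sum>m\<in>?T. (if [m = c] (mod gcd d d') then t (gcd d d') / t q * F m else 0))"
      using tq by (intro sum.cong) (auto simp: field_simps)
    also have "\<dots> = t (gcd d d') / t q * (\<Sum>m | m \<in> ?T \<and> [m = c] (mod gcd d d'). F m)"
      by (simp add: sum.inter_filter[symmetric] sum_distrib_left)
    also have "\<dots> = fiber_avg q (gcd d d') F c" using c by (simp add: fiber_avg_def t_def)
    finally show ?thesis .
  qed (simp add: fiber_avg_def)
qed

lemma fiber_avg_level:
  assumes q: "q > 0" and d: "d dvd q" and c: "c \<in> totatives q"
    and F: "\<And>k. k \<in> totatives q \<Longrightarrow> [k = c] (mod d) \<Longrightarrow> F k = F c"
  shows "fiber_avg q d F c = F c"
proof -
  have "(\<Sum>k | k \<in> totatives q \<and> [k = c] (mod d). F k) = (\<Sum>k | k \<in> totatives q \<and> [k = c] (mod d). F c)"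
    using F by (intro sum.cong) auto
  also have "\<dots> = of_nat (card {k\<in>totatives q. [k = c] (mod d)}) * F c" by simp
  finally have "of_nat (totient d) * (\<Sum>k | k \<in> totatives q \<and> [k = c] (mod d). F k)
      = of_nat (card {k\<in>totatives q. [k = c] (mod d)} * totient d) * F c" by simp
  also have "\<dots> = of_nat (totient q) * F c"
    using card_totatives_fiber[OF q d coprime_totatives_dvd[OF c d]] by simp
  finally show ?thesis using c q by (simp add: fiber_avg_def field_simps)
qed

text \<open>The pairing is bilinear, without complex conjugation, since this is the one that a
  convolution produces; being congruent modulo d is a symmetric relation.\<close>

lemma fiber_avg_selfadjoint:
  "(\<Sum>c\<in>totatives q. fiber_avg q d F c * H c) = (\<Sum>c\<in>totatives q. F c * fiber_avg q d H c)"
proof -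
  let ?T = "totatives q" and ?w = "of_nat (totient d) / of_nat (totient q) :: complex"
  have "(\<Sum>c\<in>?T. fiber_avg q d F c * H c)
      = (\<Sum>c\<in>?T. \<Sum>k\<in>?T. if [k = c] (mod d) then ?w * F k * H c else 0)"
    by (intro sum.cong refl) (simp add: fiber_avg_def sum_distrib_left sum_distrib_right flip: sum.inter_filter)
  also have "\<dots> = (\<Sum>k\<in>?T. \<Sum>c\<in>?T. if [k = c] (mod d) then ?w * F k * H c else 0)"
    by (rule sum.swap)
  also have "\<dots> = (\<Sum>k\<in>?T. F k * fiber_avg q d H k)"
    by (intro sum.cong refl) (simp add: fiber_avg_def sum_distrib_left mult_ac cong_sym_eq flip: sum.inter_filter)
  finally show ?thesis .
qed

lemma fiber_avg_comp_bij:
  assumes s: "bij_betw s (totatives q) (totatives q)"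
    "\<And>b c. b \<in> totatives q \<Longrightarrow> c \<in> totatives q \<Longrightarrow> [s b = s c] (mod d) \<longleftrightarrow> [b = c] (mod d)"
    and c: "c \<in> totatives q"
  shows "fiber_avg q d (\<lambda>k. F (s k)) c = fiber_avg q d F (s c)"
proof -
  have sc: "s c \<in> totatives q" using s(1) c by (auto simp: bij_betw_def)
  have "(\<Sum>k | k \<in> totatives q \<and> [k = c] (mod d). F (s k))
      = (\<Sum>k\<in>totatives q. if [s k = s c] (mod d) then F (s k) else 0)"
    using c s(2) by (simp add: sum.inter_filter)
  also have "\<dots> = (\<Sum>k\<in>totatives q. if [k = s c] (mod d) then F k else 0)"
    using sum.reindex_bij_betw[OF s(1)] .
  also have "\<dots> = (\<Sum>k | k \<in> totatives q \<and> [k = s c] (mod d). F k)" by (simp add: sum.inter_filter)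
  finally show ?thesis using c sc by (simp add: fiber_avg_def)
qed

text \<open>
  In terms of Dirichlet characters, \<open>fiber_avg q d\<close> is the projection of functions on the reduced
  residues modulo \<open>q\<close> to the span of the characters of conductor dividing \<open>d\<close>, and \<open>level_part q r\<close>
  is the projection to the span of the characters of conductor exactly \<open>r\<close>.
\<close>

function level_part :: "nat \<Rightarrow> nat \<Rightarrow> (nat \<Rightarrow> complex) \<Rightarrow> nat \<Rightarrow> complex" where
  "level_part q r F c = fiber_avg q r F c - (\<Sum>r'\<in>{r'. r' dvd r \<and> r' < r}. level_part q r' F c)"
  by pat_completeness auto
termination by (relation "Wellfounded.measure (\<lambda>(q, r, F, c). r)") auto

declare level_part.simps [simp del]

lemma level_part_sum:
  "level_part q r (\<lambda>c. \<Sum>i\<in>I. w i * F i c) c = (\<Sum>i\<in>I. w i * level_part q r (F i) c)"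
proof (induction r rule: less_induct)
  case (less r)
  have "level_part q r (\<lambda>c. \<Sum>i\<in>I. w i * F i c) c = (\<Sum>i\<in>I. w i * fiber_avg q r (F i) c)
      - (\<Sum>r'\<in>{r'. r' dvd r \<and> r' < r}. \<Sum>i\<in>I. w i * level_part q r' (F i) c)"
    using less by (subst level_part.simps) (simp add: fiber_avg_sum)
  also have "(\<Sum>r'\<in>{r'. r' dvd r \<and> r' < r}. \<Sum>i\<in>I. w i * level_part q r' (F i) c)
      = (\<Sum>i\<in>I. w i * (\<Sum>r'\<in>{r'. r' dvd r \<and> r' < r}. level_part q r' (F i) c))"
    by (subst sum.swap) (simp add: sum_distrib_left)
  also have "(\<Sum>i\<in>I. w i * fiber_avg q r (F i) c) - \<dots> = (\<Sum>i\<in>I. w i * level_part q r (F i) c)"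
    by (subst (2) level_part.simps) (simp add: right_diff_distrib sum_subtractf)
  finally show ?case .
qed

lemma level_part_diff:
  "level_part q r (\<lambda>c. F c - H c) c = level_part q r F c - level_part q r H c"
  using level_part_sum[of q r "\<lambda>b. if b then 1 else - 1" "\<lambda>b. if b then F else H" "UNIV :: bool set" c]
  by (simp add: UNIV_bool)

lemma level_part_scale: "level_part q r (\<lambda>c. w * F c) c = w * level_part q r F c"
  using level_part_sum[of q r "\<lambda>_. w" "\<lambda>_. F" "{()}" c] by simp

lemma level_part_sum1: "level_part q r (\<lambda>c. \<Sum>i\<in>I. F i c) c = (\<Sum>i\<in>I. level_part q r (F i) c)"
  using level_part_sum[of q r "\<lambda>_. 1" F I c] by simp

lemma level_part_cong:
  assumes "\<And>c. c \<in> totatives q \<Longrightarrow> F c = H c"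
  shows "level_part q r F = level_part q r H"
proof (induction r rule: less_induct)
  case (less r)
  have "level_part q r F c = level_part q r H c" for c
    using less fiber_avg_cong[of q F H r] assms by (subst (1 2) level_part.simps) simp
  then show ?case by blast
qed

text \<open>The recursion for \<open>level_part\<close> is this identity solved for its last term;
  it performs the Moebius inversion over the divisors of r without the Moebius function.\<close>

lemma sum_level_part:
  assumes "r > 0"
  shows "(\<Sum>r' | r' dvd r. level_part q r' F c) = fiber_avg q r F c"
proof -
  have "{r'. r' dvd r} = insert r {r'. r' dvd r \<and> r' < r}"
    using assms by (auto dest: dvd_imp_le)
  moreover have "finite {r'. r' dvd r \<and> r' < r}" by simp
  ultimately show ?thesis by (subst (2) level_part.simps[of q r] | simp add: level_part.simps[of q r])+
qed

text \<open>Averaging of level d turns each average of level r into one of level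
  \<open>gcd r d\<close>. If r does not divide d, the induction hypothesis keeps just the levels
  that divide \<open>gcd r d\<close>, and these add up to that average, so the difference is 0.
  Orthogonality and idempotence both rest on this.\<close>

lemma level_part_fiber_avg:
  assumes q: "q > 0" and "r dvd q" "d dvd q"
  shows "level_part q r (fiber_avg q d F) = (\<lambda>c. if r dvd d then level_part q r F c else 0)"
  using assms(2)
proof (induction r rule: less_induct)
  case (less r)
  have r: "r > 0" using less.prems q by (auto intro!: Nat.gr0I)
  have IH: "level_part q r' (fiber_avg q d F) c = (if r' dvd d then level_part q r' F c else 0)"
    if "r' dvd r" "r' < r" for r' c
    using less.IH[of r'] that less.prems by (meson dvd_trans)
  have fin: "finite {r'. r' dvd r \<and> r' < r}" by simp
  have main: "level_part q r (fiber_avg q d F) c = fiber_avg q (gcd r d) F c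
      - (\<Sum>r'\<in>{r'. r' dvd r \<and> r' < r}. if r' dvd d then level_part q r' F c else 0)" for c
    by (subst level_part.simps) (simp add: fiber_avg_fiber_avg[OF q less.prems assms(3)] IH)
  show ?case
  proof (cases "r dvd d")
    case True
    have "(\<Sum>r'\<in>{r'. r' dvd r \<and> r' < r}. if r' dvd d then level_part q r' F c else 0)
        = (\<Sum>r'\<in>{r'. r' dvd r \<and> r' < r}. level_part q r' F c)" for c
      using True by (intro sum.cong) (auto intro: dvd_trans)
    moreover have "gcd r d = r" using True by (simp add: gcd_nat.absorb1)
    ultimately show ?thesis using main True by (simp add: level_part.simps[of q r F])
  next
    case False
    have "(\<Sum>r'\<in>{r'. r' dvd r \<and> r' < r}. if r' dvd d then level_part q r' F c else 0)
        = (\<Sum>r' | r' dvd gcd r d. level_part q r' F c)" for c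
    proof (rule sum.mono_neutral_cong)
      show "finite {r'. r' dvd r \<and> r' < r}" by (rule fin)
      show "finite {r'. r' dvd gcd r d}" using r by simp
      show "(if i dvd d then level_part q i F c else 0) = 0"
        if "i \<in> {r'. r' dvd r \<and> r' < r} - {r'. r' dvd gcd r d}" for i using that by auto
      show "level_part q i F c = 0"
        if "i \<in> {r'. r' dvd gcd r d} - {r'. r' dvd r \<and> r' < r}" for i
      proof -
        have "i dvd r" "i dvd d" "\<not> i < r" using that by auto
        then have "i = r" using r dvd_imp_le[of i r] by simp
        with \<open>i dvd d\<close> False show ?thesis by simp
      qed
      show "(if i dvd d then level_part q i F c else 0) = level_part q i F c"
        if "i \<in> {r'. r' dvd r \<and> r' < r} \<inter> {r'. r' dvd gcd r d}" for i using that by auto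
    qed
    moreover have "(\<Sum>r' | r' dvd gcd r d. level_part q r' F c) = fiber_avg q (gcd r d) F c" for c
      using r by (intro sum_level_part) simp
    ultimately show ?thesis using main False by simp
  qed
qed

lemma level_part_orthogonal:
  assumes q: "q > 0" and r: "r dvd q" and "r' dvd q" "\<not> r dvd r'"
  shows "level_part q r (level_part q r' F) = (\<lambda>c. 0)"
  using assms(3,4)
proof (induction r' rule: less_induct)
  case (less r')
  have "level_part q r (level_part q t F) c = 0" if "t dvd r'" "t < r'" for t c
    using less.IH[of t] that less.prems by (meson dvd_trans)
  moreover have "level_part q r' F = (\<lambda>c. fiber_avg q r' F c - (\<Sum>t\<in>{t. t dvd r' \<and> t < r'}. level_part q t F c))"
    by (rule ext) (rule level_part.simps)
  ultimately show ?case
    using less.prems by (simp add: level_part_diff level_part_sum1 level_part_fiber_avg[OF q r])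
qed

text \<open>When the inner part is expanded by its recursion, the lower levels are annihilated by
  \<open>level_part_orthogonal\<close>, and averaging of level r leaves the part of level r
  unchanged.\<close>

lemma level_part_idem:
  assumes q: "q > 0" and r: "r dvd q"
  shows "level_part q r (level_part q r F) = level_part q r F"
proof -
  have "r > 0" using assms by (auto intro!: Nat.gr0I)
  have "level_part q r (level_part q t F) c = 0" if "t dvd r" "t < r" for t c
  proof -
    have "t > 0" using that \<open>r > 0\<close> by (auto intro!: Nat.gr0I)
    then have "\<not> r dvd t" using that by (auto dest: dvd_imp_le)
    then show ?thesis using level_part_orthogonal[OF q r, of t F] that r by (simp add: dvd_trans[OF that(1) r])
  qed
  moreover have "level_part q r F = (\<lambda>c. fiber_avg q r F c - (\<Sum>t\<in>{t. t dvd r \<and> t < r}. level_part q t F c))"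
    by (rule ext) (rule level_part.simps)
  ultimately have "level_part q r (level_part q r F) c = level_part q r (fiber_avg q r F) c" for c
    by (simp add: level_part_diff level_part_sum1)
  then show ?thesis by (simp add: fun_eq_iff level_part_fiber_avg[OF q r r])
qed

lemma level_part_selfadjoint:
  "(\<Sum>c\<in>totatives q. level_part q r F c * H c) = (\<Sum>c\<in>totatives q. F c * level_part q r H c)"
proof (induction r rule: less_induct)
  case (less r)
  let ?D = "{r'. r' dvd r \<and> r' < r}"
  have "(\<Sum>c\<in>totatives q. level_part q r F c * H c) = (\<Sum>c\<in>totatives q. fiber_avg q r F c * H c)
      - (\<Sum>r'\<in>?D. \<Sum>c\<in>totatives q. level_part q r' F c * H c)"
    by (subst level_part.simps, subst sum.swap) (simp add: left_diff_distrib sum_subtractf sum_distrib_right)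
  also have "\<dots> = (\<Sum>c\<in>totatives q. F c * fiber_avg q r H c)
      - (\<Sum>r'\<in>?D. \<Sum>c\<in>totatives q. F c * level_part q r' H c)"
    using less by (simp add: fiber_avg_selfadjoint)
  also have "\<dots> = (\<Sum>c\<in>totatives q. F c * level_part q r H c)"
    by (subst sum.swap, subst (2) level_part.simps) (simp add: right_diff_distrib sum_subtractf sum_distrib_left)
  finally show ?case .
qed

lemma cnj_level_part: "cnj (level_part q r F c) = level_part q r (\<lambda>c. cnj (F c)) c"
proof (induction r rule: less_induct)
  case (less r)
  then show ?case by (subst (1 2) level_part.simps) (simp add: cnj_fiber_avg)
qed

lemma level_part_comp_bij:
  assumes "bij_betw s (totatives q) (totatives q)"
    "\<And>b c d. b \<in> totatives q \<Longrightarrow> c \<in> totatives q \<Longrightarrow> d dvd q \<Longrightarrow> [s b = s c] (mod d) \<longleftrightarrow> [b = c] (mod d)"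
    and c: "c \<in> totatives q" and "r dvd q"
  shows "level_part q r (\<lambda>k. F (s k)) c = level_part q r F (s c)"
  using assms(4)
proof (induction r rule: less_induct)
  case (less r)
  have "fiber_avg q r (\<lambda>k. F (s k)) c = fiber_avg q r F (s c)"
    by (intro fiber_avg_comp_bij assms less.prems)
  moreover have "level_part q t (\<lambda>k. F (s k)) c = level_part q t F (s c)" if "t dvd r" "t < r" for t
    using less that by (meson dvd_trans)
  ultimately show ?case by (subst (1 2) level_part.simps) simp
qed

section \<open>Norms on the reduced residues and the Cauchy-Schwarz inequality\<close>

definition sq_norm :: "nat \<Rightarrow> (nat \<Rightarrow> complex) \<Rightarrow> real" where
  "sq_norm q F = (\<Sum>c\<in>totatives q. (cmod (F c))\<^sup>2)"

lemma sq_norm_nonneg: "sq_norm q F \<ge> 0"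
  by (simp add: sq_norm_def sum_nonneg)

lemma cmod_sum_mult_le:
  "cmod (\<Sum>i\<in>I. a i * b i) \<le> sqrt (\<Sum>i\<in>I. (cmod (a i))\<^sup>2) * sqrt (\<Sum>i\<in>I. (cmod (b i))\<^sup>2)"
proof -
  have "cmod (\<Sum>i\<in>I. a i * b i) \<le> (\<Sum>i\<in>I. \<bar>cmod (a i)\<bar> * \<bar>cmod (b i)\<bar>)"
    by (rule order_trans[OF norm_sum]) (simp add: norm_mult)
  also have "\<dots> \<le> L2_set (\<lambda>i. cmod (a i)) I * L2_set (\<lambda>i. cmod (b i)) I"
    by (rule L2_set_mult_ineq)
  finally show ?thesis by (simp add: L2_set_def)
qed

text \<open>An orthogonal projection P is a contraction: by idempotence and symmetry the squared
  norm of P F is the pairing of F with the conjugate of P F, and the Cauchy-Schwarz inequality lets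
  one norm of P F cancel.\<close>

lemma sq_norm_level_part_le:
  assumes q: "q > 0" and r: "r dvd q"
  shows "sq_norm q (level_part q r F) \<le> sq_norm q F"
proof -
  let ?P = "level_part q r F"
  have "complex_of_real (sq_norm q ?P) = (\<Sum>c\<in>totatives q. ?P c * cnj (?P c))"
    unfolding sq_norm_def of_real_sum by (intro sum.cong refl complex_norm_square)
  also have "\<dots> = (\<Sum>c\<in>totatives q. F c * cnj (?P c))"
    by (simp add: cnj_level_part level_part_selfadjoint level_part_idem[OF q r])
  finally have "sq_norm q ?P = cmod (\<Sum>c\<in>totatives q. F c * cnj (?P c))"
    using sq_norm_nonneg[of q ?P] by (metis norm_of_real abs_of_nonneg)
  also have "\<dots> \<le> sqrt (sq_norm q F) * sqrt (sq_norm q ?P)"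
    using cmod_sum_mult_le[of F "\<lambda>c. cnj (?P c)" "totatives q"] by (simp add: sq_norm_def)
  finally have *: "sqrt (sq_norm q ?P) * sqrt (sq_norm q ?P) \<le> sqrt (sq_norm q F) * sqrt (sq_norm q ?P)"
    using sq_norm_nonneg[of q ?P] by simp
  show ?thesis
  proof (cases "sq_norm q ?P = 0")
    case True
    then show ?thesis using sq_norm_nonneg by simp
  next
    case False
    then have "sqrt (sq_norm q ?P) > 0" using sq_norm_nonneg[of q ?P] by simp
    with * have "sqrt (sq_norm q ?P) \<le> sqrt (sq_norm q F)" using mult_right_le_imp_le by blast
    then show ?thesis by simp
  qed
qed

text \<open>With the bijection s that sends b to a / b, the convolution is the pairing of A with
  \<open>B (s b)\<close>. Since s commutes with \<open>level_part\<close>, only parts of equal level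
  meet. The part of level 1 is the mean value, so its contribution is exactly the main term that is
  subtracted.\<close>

lemma twisted_convolution_bound:
  fixes A B :: "nat \<Rightarrow> complex"
  assumes q: "q > 0" and a: "coprime a q"
  shows "cmod ((\<Sum>b\<in>totatives q. \<Sum>c\<in>totatives q. if [b * c = a] (mod q) then A b * B c else 0)
      - (\<Sum>b\<in>totatives q. A b) * (\<Sum>c\<in>totatives q. B c) / of_nat (totient q))
    \<le> (\<Sum>r | r dvd q \<and> r \<noteq> 1. sqrt (sq_norm q (level_part q r A)) * sqrt (sq_norm q (level_part q r B)))"
proof -
  let ?T = "totatives q"
  obtain s where s: "bij_betw s ?T ?T"
    "\<And>b c. b \<in> ?T \<Longrightarrow> c \<in> ?T \<Longrightarrow> [b * c = a] (mod q) \<longleftrightarrow> c = s b"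
    "\<And>b c d. b \<in> ?T \<Longrightarrow> c \<in> ?T \<Longrightarrow> d dvd q \<Longrightarrow> [s b = s c] (mod d) \<longleftrightarrow> [b = c] (mod d)"
    using totatives_quotient_bij[OF q a] by blast
  have sT: "s b \<in> ?T" if "b \<in> ?T" for b using s(1) that by (auto simp: bij_betw_def)
  have conv: "(\<Sum>b\<in>?T. \<Sum>c\<in>?T. if [b * c = a] (mod q) then A b * B c else 0) = (\<Sum>b\<in>?T. A b * B (s b))"
  proof (intro sum.cong refl)
    fix b assume b: "b \<in> ?T"
    have "(\<Sum>c\<in>?T. if [b * c = a] (mod q) then A b * B c else 0) = (\<Sum>c\<in>?T. if c = s b then A b * B c else 0)"
      using s(2)[OF b] by (intro sum.cong) auto
    also have "\<dots> = A b * B (s b)" using sT[OF b] by simp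
    finally show "(\<Sum>c\<in>?T. if [b * c = a] (mod q) then A b * B c else 0) = A b * B (s b)" .
  qed
  have expand: "A b = (\<Sum>r | r dvd q. level_part q r A b)" if "b \<in> ?T" for b
  proof -
    have "fiber_avg q q A b = A b"
      using that q totatives_cong_imp_eq by (intro fiber_avg_level) auto
    then show ?thesis using sum_level_part[OF q] by simp
  qed
  have part: "(\<Sum>b\<in>?T. level_part q r A b * B (s b)) = (\<Sum>b\<in>?T. level_part q r A b * level_part q r B (s b))"
    if r: "r dvd q" for r
  proof -
    have "(\<Sum>b\<in>?T. level_part q r A b * B (s b)) = (\<Sum>b\<in>?T. level_part q r (level_part q r A) b * B (s b))"
      by (simp add: level_part_idem[OF q r])
    also have "\<dots> = (\<Sum>b\<in>?T. level_part q r A b * level_part q r (\<lambda>k. B (s k)) b)"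
      by (rule level_part_selfadjoint)
    also have "\<dots> = (\<Sum>b\<in>?T. level_part q r A b * level_part q r B (s b))"
      by (intro sum.cong refl arg_cong2[where f = "(*)"] level_part_comp_bij[OF s(1) s(3) _ r])
    finally show ?thesis .
  qed
  have one: "level_part q (Suc 0) F c = (\<Sum>k\<in>?T. F k) / of_nat (totient q)" if "c \<in> ?T" for F c
  proof -
    have "(\<Sum>r'\<in>{r'. r' dvd Suc 0 \<and> r' < Suc 0}. level_part q r' F c) = 0" by (intro sum.neutral) auto
    then show ?thesis using that by (simp add: level_part.simps[of q "Suc 0"] fiber_avg_def)
  qed
  define J where "J r = (\<Sum>b\<in>?T. level_part q r A b * level_part q r B (s b))" for r
  have "(\<Sum>b\<in>?T. A b * B (s b)) = (\<Sum>b\<in>?T. \<Sum>r | r dvd q. level_part q r A b * B (s b))"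
    by (intro sum.cong refl) (subst expand, auto simp: sum_distrib_right)
  also have "\<dots> = (\<Sum>r | r dvd q. J r)"
    unfolding J_def by (subst sum.swap) (intro sum.cong refl part, auto)
  also have "{r. r dvd q} = insert 1 {r. r dvd q \<and> r \<noteq> 1}" by auto
  also have "(\<Sum>r\<in>\<dots>. J r) = J 1 + (\<Sum>r | r dvd q \<and> r \<noteq> 1. J r)"
    using q by (subst sum.insert) auto
  also have "J 1 = (\<Sum>b\<in>?T. (\<Sum>k\<in>?T. A k) / of_nat (totient q) * ((\<Sum>k\<in>?T. B k) / of_nat (totient q)))"
    unfolding J_def One_nat_def using sT by (intro sum.cong refl arg_cong2[where f = "(*)"] one)
  also have "\<dots> = (\<Sum>b\<in>?T. A b) * (\<Sum>c\<in>?T. B c) / of_nat (totient q)"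
    using q by (simp add: totient_def[symmetric])
  finally have eq: "(\<Sum>b\<in>?T. A b * B (s b)) - (\<Sum>b\<in>?T. A b) * (\<Sum>c\<in>?T. B c) / of_nat (totient q)
     = (\<Sum>r | r dvd q \<and> r \<noteq> 1. J r)" by simp
  have "cmod (\<Sum>r | r dvd q \<and> r \<noteq> 1. J r) \<le> (\<Sum>r | r dvd q \<and> r \<noteq> 1. cmod (J r))"
    by (rule norm_sum)
  also have "\<dots> \<le> (\<Sum>r | r dvd q \<and> r \<noteq> 1. sqrt (sq_norm q (level_part q r A)) * sqrt (sq_norm q (level_part q r B)))"
  proof (rule sum_mono)
    fix r
    have "(\<Sum>b\<in>?T. (cmod (level_part q r B (s b)))\<^sup>2) = sq_norm q (level_part q r B)"
      unfolding sq_norm_def by (rule sum.reindex_bij_betw[OF s(1)])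
    then show "cmod (J r)
        \<le> sqrt (sq_norm q (level_part q r A)) * sqrt (sq_norm q (level_part q r B))"
      using cmod_sum_mult_le[of "level_part q r A" "\<lambda>b. level_part q r B (s b)" ?T]
      by (simp add: sq_norm_def J_def)
  qed
  finally show ?thesis unfolding conv eq .
qed

section \<open>The additive large sieve\<close>

definition geom_cis :: "nat \<Rightarrow> real \<Rightarrow> complex" where
  "geom_cis N \<theta> = (\<Sum>n\<in>{1..N}. cis (2 * pi * real n * \<theta>))"

lemma cis_plus_int: "cis (2 * pi * real n * (t + of_int z)) = cis (2 * pi * real n * t)"
proof -
  have "cis (2 * pi * real n * (t + of_int z)) = cis (2 * pi * real n * t) * cis (2 * pi * of_int (int n * z))"
    by (simp add: cis_mult algebra_simps)
  also have "cis (2 * pi * of_int (int n * z)) = 1"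
    by (metis cis_multiple_2pi Ints_of_int)
  finally show ?thesis by simp
qed

lemma sum_powers_telescope:
  fixes z :: complex
  shows "(\<Sum>n\<in>{1..N}. z ^ n) * (1 - z) = z - z ^ Suc N"
proof (induction N)
  case (Suc N)
  have "(\<Sum>n\<in>{1..Suc N}. z ^ n) * (1 - z) = (\<Sum>n\<in>{1..N}. z ^ n) * (1 - z) + z ^ Suc N * (1 - z)"
    by (simp add: distrib_right)
  also have "\<dots> = (z - z ^ Suc N) + z ^ Suc N * (1 - z)" by (simp only: Suc.IH)
  also have "\<dots> = z - z ^ Suc (Suc N)" by (simp add: algebra_simps)
  finally show ?case .
qed simp

lemma geom_cis_plus_int: "geom_cis N (t + of_int z) = geom_cis N t"
  unfolding geom_cis_def cis_plus_int ..

lemma cmod_geom_cis_le: "cmod (geom_cis N \<theta>) \<le> real N"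
  unfolding geom_cis_def by (rule order_trans[OF norm_sum]) simp

lemma cmod_geom_cis_uminus: "cmod (geom_cis N (- \<theta>)) = cmod (geom_cis N \<theta>)"
proof -
  have "geom_cis N (- \<theta>) = cnj (geom_cis N \<theta>)" by (simp add: geom_cis_def cis_cnj)
  then show ?thesis by simp
qed

text \<open>The Taylor polynomial gives \<open>sin x \<ge> x - x ^ 3 / 6\<close>; since
  \<open>pi / 2 < 1.7\<close> and \<open>1.7 ^ 2 / 6 < 1 / 2\<close>, half of x remains.\<close>

lemma sin_ge_half:
  fixes x :: real
  assumes "0 \<le> x" "x \<le> pi / 2"
  shows "sin x \<ge> x / 2"
proof -
  have "\<bar>sin x - (\<Sum>m<3. sin_coeff m * x ^ m)\<bar> \<le> inverse (fact 3) * \<bar>x\<bar> ^ 3"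
    by (rule Maclaurin_sin_bound)
  moreover have "(\<Sum>m<3. sin_coeff m * x ^ m) = x"
    by (simp add: numeral_3_eq_3 sin_coeff_def)
  moreover have "inverse (fact 3) * \<bar>x\<bar> ^ 3 = x * (x\<^sup>2 / 6)"
    using assms by (simp add: fact_numeral power3_eq_cube power2_eq_square)
  ultimately have "sin x \<ge> x - x * (x\<^sup>2 / 6)" by linarith
  moreover have "x \<le> 1.7" using assms pi_less_4 pi_approx by simp
  then have "x\<^sup>2 \<le> 1.7\<^sup>2" using assms by (intro power_mono) auto
  then have "x * (x\<^sup>2 / 6) \<le> x * (1 / 2)" using assms by (intro mult_left_mono) (auto simp: power2_eq_square)
  ultimately show ?thesis by simp
qed

text \<open>A geometric series: the numerator is at most 2 in modulus, and |1 - z| = 2 |sin (pi t)|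
  \<ge> 2 |t|.\<close>

lemma cmod_geom_cis_le_inverse:
  assumes "t \<noteq> 0" "\<bar>t\<bar> \<le> 1 / 2"
  shows "cmod (geom_cis N t) \<le> 1 / \<bar>t\<bar>"
proof -
  define z where "z = cis (2 * pi * t)"
  have "geom_cis N t = (\<Sum>n\<in>{1..N}. z ^ n)"
    unfolding geom_cis_def z_def by (intro sum.cong refl) (simp add: Complex.DeMoivre mult_ac)
  also have "(\<Sum>n\<in>{1..N}. z ^ n) * (1 - z) = z - z ^ Suc N" by (rule sum_powers_telescope)
  finally have "cmod (geom_cis N t) * cmod (1 - z) = cmod (z - z ^ Suc N)"
    by (metis norm_mult)
  also have "\<dots> \<le> cmod z + cmod (z ^ Suc N)" by (rule norm_triangle_ineq4)
  also have "\<dots> = 2" by (simp add: z_def norm_power norm_mult)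
  finally have 1: "cmod (geom_cis N t) * cmod (1 - z) \<le> 2" .
  have "cmod (1 - z) = 2 * \<bar>sin (pi * t)\<bar>"
    using dist_exp_i_1[of "2 * pi * t"] by (simp add: z_def cis_conv_exp norm_minus_commute mult_ac)
  moreover have "\<bar>sin (pi * t)\<bar> = sin (pi * \<bar>t\<bar>)"
  proof -
    have "0 \<le> sin (pi * \<bar>t\<bar>)" using assms by (intro sin_ge_zero) auto
    then show ?thesis by (cases "t \<ge> 0") auto
  qed
  moreover have "sin (pi * \<bar>t\<bar>) \<ge> pi * \<bar>t\<bar> / 2" using assms by (intro sin_ge_half) auto
  moreover have "pi * \<bar>t\<bar> \<ge> 3 * \<bar>t\<bar>" using pi_gt3 by (intro mult_right_mono) auto
  ultimately have "cmod (1 - z) \<ge> 2 * \<bar>t\<bar>" by linarith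
  then have "cmod (geom_cis N t) * (2 * \<bar>t\<bar>) \<le> cmod (geom_cis N t) * cmod (1 - z)"
    by (intro mult_left_mono) auto
  with 1 show ?thesis using assms by (simp add: field_simps)
qed

lemma sum_inverse_le_ln:
  assumes "n \<ge> 1"
  shows "(\<Sum>m\<in>{1..n}. 1 / real m) \<le> 1 + ln (real n)"
proof -
  have "harm n - ln (of_nat n) \<le> harm 1 - ln (of_nat 1 :: real)"
    using assms by (intro euler_mascheroni_sequence_decreasing) auto
  then show ?thesis by (simp add: harm_def field_simps)
qed

text \<open>Modulo 1 the differences are moved to [-1/2, 1/2], which is cut into cells of length
  \<delta>; by the spacing each cell holds at most one of them. The two cells next to 0 get the
  trivial bound N, the others the reciprocal distance to 0, and a harmonic sum remains. The
  logarithm that this loses against the sharp large sieve does no harm here.\<close>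

lemma spaced_geom_cis_sum:
  fixes x :: "'i \<Rightarrow> real"
  assumes fin: "finite I" and \<delta>: "0 < \<delta>" "\<delta> \<le> 1"
    and spaced: "\<And>i j z. i \<in> I \<Longrightarrow> j \<in> I \<Longrightarrow> i \<noteq> j \<Longrightarrow> \<bar>x i - x j - of_int z\<bar> \<ge> \<delta>"
  shows "(\<Sum>i\<in>I. cmod (geom_cis N (x i - \<xi>))) \<le> 2 * real N + 2 / \<delta> * (1 + ln (1 / \<delta>))"
proof -
  define t where "t i = (x i - \<xi>) - of_int (round (x i - \<xi>))" for i
  define f where "f i = \<lfloor>t i / \<delta>\<rfloor>" for i
  define J where "J = nat \<lfloor>1 / (2 * \<delta>)\<rfloor>"
  \<comment> \<open>\<open>w j\<close> bounds the kernel on the cell number j, which runs from j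
    \<delta> to (j + 1) \<delta>. For negative j the end nearer to 0 is (j + 1) \<delta>, hence the
    shift by 1.\<close>
  define w where "w j = (if j = 0 \<or> j = -1 then real N else if j > 0 then 1 / (of_int j * \<delta>)
      else 1 / (of_int (- 1 - j) * \<delta>))" for j :: int
  have w0: "w j \<ge> 0" for j using \<delta> by (auto simp: w_def intro!: divide_nonneg_nonneg mult_nonneg_nonneg)
  have t: "\<bar>t i\<bar> \<le> 1 / 2" for i
    unfolding t_def by (metis abs_minus_commute of_int_round_abs_le)
  have fl: "of_int (f i) * \<delta> \<le> t i" "t i < (of_int (f i) + 1) * \<delta>" for i
    using \<delta> floor_divide_lower[of \<delta> "t i"] floor_divide_upper[of \<delta> "t i"] unfolding f_def by auto
  have inj: "inj_on f I"
  proof (rule inj_onI, rule ccontr)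
    fix i j assume ij: "i \<in> I" "j \<in> I" "f i = f j" "i \<noteq> j"
    have "\<bar>t i - t j\<bar> < \<delta>" using fl[of i] fl[of j] ij(3) by (simp add: algebra_simps abs_if)
    moreover have "t i - t j = x i - x j - of_int (round (x i - \<xi>) - round (x j - \<xi>))"
      by (simp add: t_def)
    ultimately show False using spaced[OF ij(1,2,4)] by (metis not_le)
  qed
  have K: "cmod (geom_cis N (x i - \<xi>)) \<le> w (f i)" for i
  proof -
    have eq: "geom_cis N (x i - \<xi>) = geom_cis N (t i)"
      using geom_cis_plus_int[of N "t i" "round (x i - \<xi>)"] by (simp add: t_def)
    consider "f i = 0 \<or> f i = -1" | "f i > 0" | "f i < - 1" by linarith
    then show ?thesis
    proof cases
      case 1
      then show ?thesis using cmod_geom_cis_le by (auto simp: w_def)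
    next
      case 2
      have p: "of_int (f i) * \<delta> > 0" using 2 \<delta> by simp
      then have "t i > 0" using fl(1)[of i] by linarith
      then have "cmod (geom_cis N (t i)) \<le> 1 / t i"
        using cmod_geom_cis_le_inverse[of "t i" N] t[of i] by simp
      also have "\<dots> \<le> 1 / (of_int (f i) * \<delta>)" using p fl(1)[of i] by (intro divide_left_mono) auto
      finally show ?thesis using 2 by (simp add: w_def eq)
    next
      case 3
      have p: "of_int (- 1 - f i) * \<delta> > 0" using 3 \<delta> by (intro mult_pos_pos) auto
      have q: "of_int (- 1 - f i) * \<delta> \<le> - t i" using fl(2)[of i] by (simp add: algebra_simps)
      then have "t i < 0" using p by linarith
      then have "cmod (geom_cis N (t i)) \<le> 1 / (- t i)"
        using cmod_geom_cis_le_inverse[of "t i" N] t[of i] by simp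
      also have "\<dots> \<le> 1 / (of_int (- 1 - f i) * \<delta>)" by (rule frac_le) (use p q in auto)
      finally show ?thesis using 3 by (simp add: w_def eq)
    qed
  qed
  let ?A = "{0, -1 :: int}" and ?B = "int ` {1..J}" and ?C = "(\<lambda>m. - 1 - int m) ` {1..J}"
  have sub: "f ` I \<subseteq> ?A \<union> (?B \<union> ?C)"
  proof
    fix j assume "j \<in> f ` I"
    then obtain i where i: "j = f i" by auto
    have up: "real_of_int j \<le> 1 / (2 * \<delta>)"
      using fl(1)[of i] t[of i] \<delta> unfolding i by (simp add: field_simps abs_le_iff)
    have lo: "real_of_int (- 1 - j) \<le> 1 / (2 * \<delta>)"
      using fl(2)[of i] t[of i] \<delta> unfolding i by (simp add: field_simps abs_le_iff)
    have J: "k \<le> int J" if "real_of_int k \<le> 1 / (2 * \<delta>)" for k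
      using that \<delta> unfolding J_def by (simp add: le_floor_iff)
    consider "j = 0 \<or> j = -1" | "j > 0" | "j < - 1" by linarith
    then show "j \<in> ?A \<union> (?B \<union> ?C)"
    proof cases
      case 2
      then have "j = int (nat j)" "nat j \<in> {1..J}" using J[OF up] by auto
      then show ?thesis by blast
    next
      case 3
      then have "j = - 1 - int (nat (- 1 - j))" "nat (- 1 - j) \<in> {1..J}" using J[OF lo] by auto
      then show ?thesis by blast
    qed auto
  qed
  have h: "(\<Sum>m\<in>{1..J}. 1 / real m) \<le> 1 + ln (1 / \<delta>)"
  proof (cases "J \<ge> 1")
    case True
    have "real J \<le> 1 / (2 * \<delta>)" unfolding J_def using \<delta> by (simp add: of_nat_floor)
    also have "\<dots> \<le> 1 / \<delta>" using \<delta> by (simp add: field_simps)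
    finally have "ln (real J) \<le> ln (1 / \<delta>)" using True \<delta> by (subst ln_le_cancel_iff) auto
    then show ?thesis using sum_inverse_le_ln[OF True] by linarith
  next
    case False
    then have "J = 0" by simp
    moreover have "ln (1 / \<delta>) \<ge> 0" using \<delta> by (intro ln_ge_zero) simp
    ultimately show ?thesis by (simp del: ln_ge_zero_iff)
  qed
  have "(\<Sum>i\<in>I. cmod (geom_cis N (x i - \<xi>))) \<le> (\<Sum>i\<in>I. w (f i))" by (intro sum_mono K)
  also have "\<dots> = (\<Sum>j\<in>f ` I. w j)" using inj by (simp add: sum.reindex)
  also have "\<dots> \<le> (\<Sum>j\<in>?A \<union> (?B \<union> ?C). w j)" using sub w0 by (intro sum_mono2) auto
  also have "\<dots> = (\<Sum>j\<in>?A. w j) + ((\<Sum>j\<in>?B. w j) + (\<Sum>j\<in>?C. w j))"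
    by (subst sum.union_disjoint, auto)+
  also have "(\<Sum>j\<in>?A. w j) = 2 * real N" by (simp add: w_def)
  also have "(\<Sum>j\<in>?B. w j) = (\<Sum>m\<in>{1..J}. 1 / real m) / \<delta>"
    by (subst sum.reindex) (auto simp: w_def sum_divide_distrib intro!: sum.cong)
  also have "(\<Sum>j\<in>?C. w j) = (\<Sum>m\<in>{1..J}. 1 / real m) / \<delta>"
    by (subst sum.reindex) (auto simp: w_def sum_divide_distrib inj_on_def intro!: sum.cong)
  also have "2 * real N + ((\<Sum>m\<in>{1..J}. 1 / real m) / \<delta> + (\<Sum>m\<in>{1..J}. 1 / real m) / \<delta>)
      = 2 * real N + 2 / \<delta> * (\<Sum>m\<in>{1..J}. 1 / real m)" by (simp add: field_simps)
  also have "\<dots> \<le> 2 * real N + 2 / \<delta> * (1 + ln (1 / \<delta>))"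
    using h \<delta> by (intro add_left_mono mult_left_mono) auto
  finally show ?thesis .
qed

text \<open>Schur's test: opening the square gives a Hermitian form in the \<open>c i\<close> with
  the kernel \<open>geom_cis N (x i - x j)\<close>, and by 2 |c_i c_j| \<le> |c_i|^2 + |c_j|^2 it is
  enough to bound the row sums and column sums of the kernel.\<close>

lemma large_sieve_dual:
  fixes x :: "'i \<Rightarrow> real" and c :: "'i \<Rightarrow> complex"
  assumes fin: "finite I" and \<delta>: "0 < \<delta>" "\<delta> \<le> 1"
    and spaced: "\<And>i j z. i \<in> I \<Longrightarrow> j \<in> I \<Longrightarrow> i \<noteq> j \<Longrightarrow> \<bar>x i - x j - of_int z\<bar> \<ge> \<delta>"
  shows "(\<Sum>n\<in>{1..N}. (cmod (\<Sum>i\<in>I. c i * cis (2 * pi * real n * x i)))\<^sup>2)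
    \<le> (2 * real N + 2 / \<delta> * (1 + ln (1 / \<delta>))) * (\<Sum>i\<in>I. (cmod (c i))\<^sup>2)"
proof -
  define D where "D = 2 * real N + 2 / \<delta> * (1 + ln (1 / \<delta>))"
  define K where "K i j = cmod (geom_cis N (x i - x j))" for i j
  have K: "(\<Sum>i\<in>I. K i j) \<le> D" for j
    unfolding K_def D_def by (rule spaced_geom_cis_sum[OF fin \<delta> spaced])
  have K': "(\<Sum>j\<in>I. K i j) \<le> D" for i
  proof -
    have "K i j = K j i" for j
      unfolding K_def using cmod_geom_cis_uminus[of N "x i - x j"] by simp
    then show ?thesis using K[of i] by simp
  qed
  have "complex_of_real (\<Sum>n\<in>{1..N}. (cmod (\<Sum>i\<in>I. c i * cis (2 * pi * real n * x i)))\<^sup>2)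
     = (\<Sum>n\<in>{1..N}. \<Sum>i\<in>I. \<Sum>j\<in>I. (c i * cis (2 * pi * real n * x i)) * cnj (c j * cis (2 * pi * real n * x j)))"
    unfolding of_real_sum complex_norm_square cnj_sum sum_product ..
  also have "\<dots> = (\<Sum>n\<in>{1..N}. \<Sum>i\<in>I. \<Sum>j\<in>I. c i * cnj (c j) * cis (2 * pi * real n * (x i - x j)))"
  proof (intro sum.cong refl)
    fix n i j
    have "cis (2 * pi * real n * (x i - x j)) = cis (2 * pi * real n * x i) * cnj (cis (2 * pi * real n * x j))"
      by (simp add: cis_cnj cis_mult right_diff_distrib)
    then show "(c i * cis (2 * pi * real n * x i)) * cnj (c j * cis (2 * pi * real n * x j))
        = c i * cnj (c j) * cis (2 * pi * real n * (x i - x j))" by (simp add: mult_ac)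
  qed
  also have "\<dots> = (\<Sum>i\<in>I. \<Sum>j\<in>I. \<Sum>n\<in>{1..N}. c i * cnj (c j) * cis (2 * pi * real n * (x i - x j)))"
    by (subst sum.swap, intro sum.cong refl, subst sum.swap) (rule refl)
  also have "\<dots> = (\<Sum>i\<in>I. \<Sum>j\<in>I. c i * cnj (c j) * geom_cis N (x i - x j))"
    by (simp add: geom_cis_def sum_distrib_left)
  finally have "(\<Sum>n\<in>{1..N}. (cmod (\<Sum>i\<in>I. c i * cis (2 * pi * real n * x i)))\<^sup>2)
      = cmod (\<Sum>i\<in>I. \<Sum>j\<in>I. c i * cnj (c j) * geom_cis N (x i - x j))"
    by (metis (no_types, lifting) norm_of_real abs_of_nonneg sum_nonneg zero_le_power2)
  also have "\<dots> \<le> (\<Sum>i\<in>I. \<Sum>j\<in>I. cmod (c i) * cmod (c j) * K i j)"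
    by (intro order_trans[OF norm_sum] sum_mono) (simp add: norm_mult K_def)
  also have "\<dots> \<le> (\<Sum>i\<in>I. \<Sum>j\<in>I. ((cmod (c i))\<^sup>2 / 2 + (cmod (c j))\<^sup>2 / 2) * K i j)"
  proof (intro sum_mono mult_right_mono)
    fix i j
    have "0 \<le> (cmod (c i) - cmod (c j))\<^sup>2" by simp
    then show "cmod (c i) * cmod (c j) \<le> (cmod (c i))\<^sup>2 / 2 + (cmod (c j))\<^sup>2 / 2"
      by (simp add: power2_diff)
    show "K i j \<ge> 0" by (simp add: K_def)
  qed
  also have "\<dots> = (\<Sum>i\<in>I. (cmod (c i))\<^sup>2 / 2 * (\<Sum>j\<in>I. K i j)) + (\<Sum>j\<in>I. (cmod (c j))\<^sup>2 / 2 * (\<Sum>i\<in>I. K i j))"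
  proof -
    have "(\<Sum>i\<in>I. \<Sum>j\<in>I. (cmod (c j))\<^sup>2 / 2 * K i j) = (\<Sum>j\<in>I. (cmod (c j))\<^sup>2 / 2 * (\<Sum>i\<in>I. K i j))"
      by (subst sum.swap) (simp add: sum_distrib_left)
    then show ?thesis by (simp add: distrib_right sum.distrib sum_distrib_left)
  qed
  also have "\<dots> \<le> (\<Sum>i\<in>I. (cmod (c i))\<^sup>2 / 2 * D) + (\<Sum>j\<in>I. (cmod (c j))\<^sup>2 / 2 * D)"
    by (intro add_mono sum_mono mult_left_mono K K') auto
  also have "\<dots> = D * (\<Sum>i\<in>I. (cmod (c i))\<^sup>2)"
    by (simp add: sum_distrib_left sum_divide_distrib flip: sum.distrib)
  finally show ?thesis unfolding D_def .
qed

text \<open>Duality: the left side T is the pairing of \<gamma> with the dual sum whose coefficients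
  are the conjugates of \<open>S i\<close>. The Cauchy-Schwarz inequality and the dual bound give
  T^2 \<le> G D T, and one T cancels.\<close>

lemma large_sieve:
  fixes x :: "'i \<Rightarrow> real" and \<gamma> :: "nat \<Rightarrow> complex"
  assumes fin: "finite I" and \<delta>: "0 < \<delta>" "\<delta> \<le> 1"
    and spaced: "\<And>i j z. i \<in> I \<Longrightarrow> j \<in> I \<Longrightarrow> i \<noteq> j \<Longrightarrow> \<bar>x i - x j - of_int z\<bar> \<ge> \<delta>"
  shows "(\<Sum>i\<in>I. (cmod (\<Sum>n\<in>{1..N}. \<gamma> n * cis (2 * pi * real n * x i)))\<^sup>2)
    \<le> (2 * real N + 2 / \<delta> * (1 + ln (1 / \<delta>))) * (\<Sum>n\<in>{1..N}. (cmod (\<gamma> n))\<^sup>2)"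
proof -
  define D where "D = 2 * real N + 2 / \<delta> * (1 + ln (1 / \<delta>))"
  define S where "S i = (\<Sum>n\<in>{1..N}. \<gamma> n * cis (2 * pi * real n * x i))" for i
  define T where "T = (\<Sum>i\<in>I. (cmod (S i))\<^sup>2)"
  define G where "G = (\<Sum>n\<in>{1..N}. (cmod (\<gamma> n))\<^sup>2)"
  have T0: "T \<ge> 0" "G \<ge> 0" by (auto simp: T_def G_def sum_nonneg)
  have "complex_of_real T = (\<Sum>i\<in>I. S i * cnj (S i))"
    unfolding T_def of_real_sum complex_norm_square ..
  also have "\<dots> = (\<Sum>i\<in>I. \<Sum>n\<in>{1..N}. \<gamma> n * (cnj (S i) * cis (2 * pi * real n * x i)))"
    by (subst S_def) (simp add: sum_distrib_right sum_distrib_left mult_ac)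
  also have "\<dots> = (\<Sum>n\<in>{1..N}. \<gamma> n * (\<Sum>i\<in>I. cnj (S i) * cis (2 * pi * real n * x i)))"
    by (subst sum.swap) (simp add: sum_distrib_left)
  finally have "T = cmod (\<Sum>n\<in>{1..N}. \<gamma> n * (\<Sum>i\<in>I. cnj (S i) * cis (2 * pi * real n * x i)))"
    using T0 by (metis norm_of_real abs_of_nonneg)
  also have "\<dots> \<le> sqrt G * sqrt (\<Sum>n\<in>{1..N}. (cmod (\<Sum>i\<in>I. cnj (S i) * cis (2 * pi * real n * x i)))\<^sup>2)"
    unfolding G_def by (rule cmod_sum_mult_le)
  also have "\<dots> \<le> sqrt G * sqrt (D * (\<Sum>i\<in>I. (cmod (cnj (S i)))\<^sup>2))"
    unfolding D_def by (intro mult_left_mono real_sqrt_le_mono large_sieve_dual[OF fin \<delta> spaced]) (use T0 in auto)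
  also have "\<dots> = sqrt (G * D * T)" by (simp add: T_def real_sqrt_mult)
  finally have "T \<le> sqrt (G * D * T)" .
  then have "T\<^sup>2 \<le> G * D * T" using T0
    by (metis abs_of_nonneg real_le_lsqrt real_sqrt_abs real_sqrt_le_iff)
  then have "T * T \<le> (D * G) * T" by (simp add: power2_eq_square mult_ac)
  moreover have "D * G \<ge> 0"
    using T0 \<delta> by (auto simp: D_def intro!: mult_nonneg_nonneg add_nonneg_nonneg ln_ge_zero)
  ultimately have "T \<le> D * G" using T0 by (cases "T = 0") auto
  then show ?thesis unfolding T_def S_def D_def G_def .
qed

section \<open>Exponential sums at Farey fractions\<close>

definition farey_energy :: "nat \<Rightarrow> (nat \<Rightarrow> complex) \<Rightarrow> nat \<Rightarrow> real" where
  "farey_energy N \<gamma> r =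
     (\<Sum>a\<in>totatives r. (cmod (\<Sum>n\<in>{1..N}. \<gamma> n * cis (2 * pi * real n * (real a / real r))))\<^sup>2)"

text \<open>The difference is an integer m divided by \<open>r * s\<close>. If m were 0, coprimality
  of numerators and denominators would give r = s, and then a and b would agree modulo r; so |m|
  \<ge> 1.\<close>

lemma farey_spaced:
  assumes "r > 0" "s > 0" "real r \<le> R" "real s \<le> R" "a \<in> totatives r" "b \<in> totatives s" "(r, a) \<noteq> (s, b)"
  shows "\<bar>real a / real r - real b / real s - of_int z\<bar> \<ge> 1 / R\<^sup>2"
proof -
  define m where "m = int a * int s - int b * int r - z * int r * int s"
  have eq: "real a / real r - real b / real s - of_int z = of_int m / (real r * real s)"
    using assms by (simp add: m_def field_simps)
  have "m \<noteq> 0"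
  proof
    assume "m = 0"
    then have e: "int a * int s = int r * (int b + z * int s)" by (simp add: m_def algebra_simps)
    have "coprime (int r) (int a)" using assms by (simp add: in_totatives_iff coprime_commute)
    moreover have "int r dvd int a * int s" by (simp add: e)
    ultimately have rs: "int r dvd int s" by (simp add: coprime_dvd_mult_right_iff)
    have e': "int b * int r = int s * (int a - z * int r)" using e by (simp add: algebra_simps)
    have "coprime (int s) (int b)" using assms by (simp add: in_totatives_iff coprime_commute)
    moreover have "int s dvd int b * int r" by (simp add: e')
    ultimately have "int s dvd int r" by (simp add: coprime_dvd_mult_right_iff)
    with rs have "r = s" by (metis dvd_antisym int_dvd_int_iff)
    with e have "int r * int a = int r * (int b + z * int r)" by (simp add: mult_ac)
    with assms(1) have "int a = int b + z * int r" by simp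
    then have "[a = b] (mod r)"
      by (simp add: cong_iff_dvd_diff flip: cong_int_iff)
    with assms \<open>r = s\<close> show False using totatives_cong_imp_eq by auto
  qed
  then have "\<bar>real_of_int m\<bar> \<ge> 1" by linarith
  moreover have "real r * real s \<le> R\<^sup>2"
    using assms unfolding power2_eq_square by (intro mult_mono) auto
  ultimately have "1 / R\<^sup>2 \<le> \<bar>real_of_int m\<bar> / (real r * real s)"
    using assms by (intro frac_le) auto
  also have "\<dots> = \<bar>real a / real r - real b / real s - of_int z\<bar>" unfolding eq by simp
  finally show ?thesis .
qed

lemma farey_large_sieve:
  assumes "R \<ge> 1"
  shows "(\<Sum>r | 1 \<le> r \<and> real r \<le> R. farey_energy N \<gamma> r)
    \<le> (2 * real N + 2 * R\<^sup>2 * (1 + 2 * ln R)) * (\<Sum>n\<in>{1..N}. (cmod (\<gamma> n))\<^sup>2)"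
proof -
  let ?F = "{r. 1 \<le> r \<and> real r \<le> R}"
  have fin: "finite ?F" by (rule finite_subset[of _ "{..nat \<lfloor>R\<rfloor>}"]) (auto simp: le_nat_floor)
  define x where "x p = real (snd p) / real (fst p)" for p :: "nat \<times> nat"
  have "(\<Sum>r | 1 \<le> r \<and> real r \<le> R. farey_energy N \<gamma> r)
     = (\<Sum>p\<in>Sigma ?F totatives. (cmod (\<Sum>n\<in>{1..N}. \<gamma> n * cis (2 * pi * real n * x p)))\<^sup>2)"
    unfolding farey_energy_def using fin by (subst sum.Sigma) (auto simp: x_def case_prod_unfold)
  also have "\<dots> \<le> (2 * real N + 2 / (1 / R\<^sup>2) * (1 + ln (1 / (1 / R\<^sup>2)))) * (\<Sum>n\<in>{1..N}. (cmod (\<gamma> n))\<^sup>2)"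
  proof (rule large_sieve)
    show "finite (Sigma ?F totatives)" using fin by (intro finite_SigmaI) auto
    show "1 / R\<^sup>2 \<le> 1" using assms by (simp add: field_simps)
    show "0 < 1 / R\<^sup>2" using assms by simp
    show "1 / R\<^sup>2 \<le> \<bar>x i - x j - of_int z\<bar>"
      if "i \<in> Sigma ?F totatives" "j \<in> Sigma ?F totatives" "i \<noteq> j" for i j z
      unfolding x_def by (rule farey_spaced) (use that in \<open>auto simp: prod_eq_iff\<close>)
  qed
  also have "ln (1 / (1 / R\<^sup>2)) = 2 * ln R" using assms by (simp add: ln_realpow)
  finally show ?thesis by simp
qed

section \<open>From additive to multiplicative frequencies\<close>

lemma additive_orthogonality:
  fixes m :: int
  assumes "r > 0"
  shows "(\<Sum>a\<in>{1..r}. cis (2 * pi * real a * (of_int m / real r))) = (if int r dvd m then of_nat r else 0)"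
proof -
  define z where "z = cis (2 * pi * (of_int m / real r))"
  have one: "cis (2 * pi * of_int k) = 1" for k by (rule cis_multiple_2pi) simp
  have pw: "cis (2 * pi * real a * (of_int m / real r)) = z ^ a" for a
    unfolding z_def Complex.DeMoivre by (rule arg_cong[where f = cis]) simp
  have zr: "z ^ r = 1"
    using pw[of r] one[of m] assms by (simp add: mult.assoc)
  show ?thesis
  proof (cases "int r dvd m")
    case True
    then obtain k where "m = int r * k" by blast
    then have "z = cis (2 * pi * of_int k)" using assms by (simp add: z_def)
    then have "z = 1" by (simp only: one)
    then show ?thesis using True unfolding pw by simp
  next
    case False
    have "z \<noteq> 1"
    proof
      assume "z = 1"
      then obtain n :: int where "2 * pi * (of_int m / real r) = of_int n * (2 * pi)"
        unfolding z_def cis_eq_1_iff by blast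
      then have "(of_int m / real r) * (2 * pi) = of_int n * (2 * pi)" by (simp only: mult_ac)
      then have "of_int m / real r = of_int n" by (subst (asm) mult_right_cancel) auto
      then have "real_of_int m = real_of_int (n * int r)" using assms by (simp add: field_simps)
      then have "m = n * int r" by linarith
      with False show False by simp
    qed
    moreover have "(\<Sum>a\<in>{1..r}. z ^ a) * (1 - z) = 0"
      unfolding sum_powers_telescope by (simp add: zr)
    ultimately show ?thesis using False unfolding pw by simp
  qed
qed

text \<open>The discrepancy as a linear functional: summing h against this kernel gives
  \<open>AP_discrepancy\<close>, see \<open>AP_discrepancy_eq\<close>. All conditions on n thus sit
  in one factor that does not depend on h.\<close>

definition ap_kernel :: "nat \<Rightarrow> int \<Rightarrow> nat \<Rightarrow> complex" where
  "ap_kernel q a n = (if [int n = a] (mod int q) then 1 else 0)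
     - (if coprime n q then 1 / of_nat (totient q) else 0)"

definition restrict_coprime :: "nat \<Rightarrow> (nat \<Rightarrow> complex) \<Rightarrow> nat \<Rightarrow> complex" where
  "restrict_coprime s \<alpha> n = (if coprime n s then \<alpha> n else 0)"

definition residue_sum :: "nat \<Rightarrow> (nat \<Rightarrow> complex) \<Rightarrow> nat \<Rightarrow> nat \<Rightarrow> complex" where
  "residue_sum N \<alpha> q c = (\<Sum>n\<in>{1..N}. if [n = c] (mod q) then \<alpha> n else 0)"

lemma sum_totatives_residue:
  fixes h :: "nat \<Rightarrow> complex"
  assumes "q > 0" and h: "\<And>n b. [n = b] (mod q) \<Longrightarrow> h n = h b"
  shows "(\<Sum>b\<in>totatives q. residue_sum N \<alpha> q b * h b)
      = (\<Sum>n\<in>{1..N}. if coprime n q then \<alpha> n * h n else 0)"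
proof -
  have "(\<Sum>b\<in>totatives q. residue_sum N \<alpha> q b * h b)
      = (\<Sum>n\<in>{1..N}. \<Sum>b\<in>totatives q. if [n = b] (mod q) then \<alpha> n * h n else 0)"
    unfolding residue_sum_def sum_distrib_right
    by (subst sum.swap) (intro sum.cong refl, auto simp: h)
  also have "\<dots> = (\<Sum>n\<in>{1..N}. if coprime n q then \<alpha> n * h n else 0)"
  proof (intro sum.cong refl)
    fix n
    show "(\<Sum>b\<in>totatives q. if [n = b] (mod q) then \<alpha> n * h n else 0)
        = (if coprime n q then \<alpha> n * h n else 0)"
    proof (cases "coprime n q")
      case True
      then obtain b0 where b0: "b0 \<in> totatives q" "[b0 = n] (mod q)"
        using totatives_rep_ex[OF assms(1)] by blast
      have "[n = b] (mod q) \<longleftrightarrow> b = b0" if "b \<in> totatives q" for b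
        using b0 that totatives_cong_imp_eq by (meson cong_sym cong_trans)
      then have "(\<Sum>b\<in>totatives q. if [n = b] (mod q) then \<alpha> n * h n else 0)
          = (\<Sum>b\<in>totatives q. if b = b0 then \<alpha> n * h n else 0)" by (intro sum.cong) auto
      also have "\<dots> = \<alpha> n * h n" using b0(1) by simp
      finally show ?thesis using True by simp
    next
      case False
      have "\<not> [n = b] (mod q)" if "b \<in> totatives q" for b
        using False that by (metis cong_imp_coprime cong_sym in_totatives_iff)
      then show ?thesis using False by (simp add: sum.neutral)
    qed
  qed
  finally show ?thesis .
qed

text \<open>This is where \<open>restrict_coprime\<close> comes from. Averaging down to the modulus
  r retains the integers coprime to q in the class of c. Coprimality to r is automatic there, but
  coprimality to the cofactor s stays behind as a condition on \<alpha>.\<close>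

lemma fiber_avg_residue_sum:
  assumes q: "q > 0" "q = r * s" and c: "c \<in> totatives q"
  shows "fiber_avg q r (residue_sum N \<alpha> q) c
    = of_nat (totient r) / of_nat (totient q) * residue_sum N (restrict_coprime s \<alpha>) r c"
proof -
  have rq: "r dvd q" using q by simp
  have cr: "coprime c r" using coprime_totatives_dvd[OF c rq] .
  have "(\<Sum>k | k \<in> totatives q \<and> [k = c] (mod r). residue_sum N \<alpha> q k)
     = (\<Sum>k\<in>totatives q. residue_sum N \<alpha> q k * (if [k = c] (mod r) then 1 else 0))"
    by (simp add: sum.inter_filter)
       (intro sum.cong, auto)
  also have "\<dots> = (\<Sum>n\<in>{1..N}. if coprime n q then \<alpha> n * (if [n = c] (mod r) then 1 else 0) else 0)"
  proof (rule sum_totatives_residue[OF q(1)])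
    fix n b assume "[n = b] (mod q)"
    then have "[n = b] (mod r)" using rq by (rule cong_dvd_modulus_nat)
    then have "[n = c] (mod r) \<longleftrightarrow> [b = c] (mod r)" by (meson cong_sym cong_trans)
    then show "(if [n = c] (mod r) then 1 else 0) = (if [b = c] (mod r) then 1 else (0::complex))" by simp
  qed
  also have "\<dots> = residue_sum N (restrict_coprime s \<alpha>) r c"
    unfolding residue_sum_def restrict_coprime_def
  proof (intro sum.cong refl)
    fix n
    have "[n = c] (mod r) \<Longrightarrow> coprime n r" using cr by (metis cong_imp_coprime cong_sym)
    then show "(if coprime n q then \<alpha> n * (if [n = c] (mod r) then 1 else 0) else 0) =
       (if [n = c] (mod r) then if coprime n s then \<alpha> n else 0 else 0)"
      unfolding q(2) by auto
  qed
  finally show ?thesis using c by (simp add: fiber_avg_def)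
qed

lemma level_part_via_fiber_avg:
  assumes "q > 0" "r dvd q"
  shows "level_part q r F = level_part q r (fiber_avg q r F)"
  using level_part_fiber_avg[OF assms(1) assms(2) assms(2), of F] by simp

lemma sq_norm_scale: "sq_norm q (\<lambda>c. w * F c) = (cmod w)\<^sup>2 * sq_norm q F"
  by (simp add: sq_norm_def norm_mult power_mult_distrib sum_distrib_left)

lemma sq_norm_cong: "(\<And>c. c \<in> totatives q \<Longrightarrow> F c = H c) \<Longrightarrow> sq_norm q F = sq_norm q H"
  by (simp add: sq_norm_def)

text \<open>
  A frequency \<open>a / r\<close> that is not in lowest terms has level a proper divisor of \<open>r\<close>. So only the
  reduced fractions contribute to the part of level \<open>r\<close>; this takes the place of Gauss sums.
\<close>

lemma level_part_additive_char:
  assumes q: "q > 0" "r dvd q" and a: "a \<in> {1..r} - totatives r"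
  shows "level_part q r (\<lambda>c. cis (2 * pi * real a * (- real c / real r))) c = 0"
proof -
  let ?F = "\<lambda>c. cis (2 * pi * real a * (- real c / real r))"
  define g where "g = gcd a r"
  \<comment> \<open>The denominator of \<open>a / r\<close> in lowest terms: the exponential has
    period d, and d is a proper divisor of r.\<close>
  define d where "d = r div g"
  have r: "r > 0" using q by (auto intro!: Nat.gr0I)
  have "\<not> coprime a r" using a by (auto simp: in_totatives_iff)
  then have g: "g \<noteq> 1" unfolding g_def using coprime_iff_gcd_eq_1 by blast
  have "g dvd r" "g > 0" using r by (auto simp: g_def)
  then have rd: "r = d * g" by (simp add: d_def)
  have dd: "d dvd r" using rd by simp
  have "d > 0" using rd r by (auto intro!: Nat.gr0I)
  then have nd: "\<not> r dvd d" using rd g \<open>g > 0\<close> by (auto dest!: dvd_imp_le)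
  obtain b where b: "a = b * g" unfolding g_def by (metis dvd_def gcd_dvd1 mult.commute)
  have lev: "?F k = ?F c" if "[k = c] (mod d)" for k c
  proof -
    have "int d dvd int k - int c" using that by (simp add: cong_iff_dvd_diff flip: cong_int_iff)
    then obtain j where j: "int k - int c = int d * j" by blast
    have fr: "2 * pi * real a * (- x / real r) = 2 * pi * real b * (- x / real d)" for x
      unfolding b rd using \<open>g > 0\<close> \<open>d > 0\<close> by simp
    have "?F k = cis (2 * pi * real b * (- real k / real d))" by (simp only: fr)
    also have "- real k / real d = - real c / real d + of_int (- j)"
    proof -
      have "real k = real c + real d * of_int j"
        using arg_cong[OF j, of real_of_int] by simp
      then show ?thesis using \<open>d > 0\<close> by (simp add: field_simps)
    qed
    also have "cis (2 * pi * real b * (- real c / real d + of_int (- j))) = cis (2 * pi * real b * (- real c / real d))"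
      by (rule cis_plus_int)
    also have "\<dots> = ?F c" by (simp only: fr)
    finally show ?thesis .
  qed
  have dq: "d dvd q" using dd q(2) by (rule dvd_trans)
  have "fiber_avg q d ?F c = ?F c" if "c \<in> totatives q" for c
    using lev that by (intro fiber_avg_level[OF q(1) dq]) auto
  then have "level_part q r ?F = level_part q r (fiber_avg q d ?F)"
    by (intro level_part_cong) simp
  also have "\<dots> = (\<lambda>c. 0)" using level_part_fiber_avg[OF q dq] nd by simp
  finally show ?thesis by (rule fun_cong)
qed

lemma sum_totatives_periodic:
  fixes h :: "nat \<Rightarrow> real"
  assumes q: "q > 0" "r dvd q" and h: "\<And>k c. [k = c] (mod r) \<Longrightarrow> h k = h c"
  shows "(\<Sum>c\<in>totatives q. h c) = real (totient q) / real (totient r) * (\<Sum>b\<in>totatives r. h b)"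
proof -
  have r: "r > 0" using q by (auto intro!: Nat.gr0I)
  have ex1: "(\<Sum>b\<in>totatives r. if [c = b] (mod r) then h b else 0) = h c" if c: "c \<in> totatives q" for c
  proof -
    obtain b0 where b0: "b0 \<in> totatives r" "[b0 = c] (mod r)"
      using totatives_rep_ex[OF r coprime_totatives_dvd[OF c q(2)]] by blast
    have "[c = b] (mod r) \<longleftrightarrow> b = b0" if "b \<in> totatives r" for b
      using b0 that totatives_cong_imp_eq by (meson cong_sym cong_trans)
    then have "(\<Sum>b\<in>totatives r. if [c = b] (mod r) then h b else 0)
        = (\<Sum>b\<in>totatives r. if b = b0 then h b else 0)" by (intro sum.cong) auto
    also have "\<dots> = h b0" using b0(1) by simp
    finally show ?thesis using h[OF b0(2)] by simp
  qed
  have "(\<Sum>c\<in>totatives q. h c) = (\<Sum>c\<in>totatives q. \<Sum>b\<in>totatives r. if [c = b] (mod r) then h b else 0)"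
    using ex1 by simp
  also have "\<dots> = (\<Sum>b\<in>totatives r. \<Sum>c\<in>totatives q. if [c = b] (mod r) then h b else 0)"
    by (rule sum.swap)
  also have "\<dots> = (\<Sum>b\<in>totatives r. real (card {c\<in>totatives q. [c = b] (mod r)}) * h b)"
    by (simp add: sum.inter_filter[symmetric])
  also have "\<dots> = (\<Sum>b\<in>totatives r. real (totient q) / real (totient r) * h b)"
  proof (intro sum.cong refl)
    fix b assume "b \<in> totatives r"
    then have "card {c\<in>totatives q. [c = b] (mod r)} * totient r = totient q"
      by (intro card_totatives_fiber q) (simp add: in_totatives_iff)
    then have "real (card {c\<in>totatives q. [c = b] (mod r)}) * real (totient r) = real (totient q)"
      by (metis of_nat_mult)
    then show "real (card {c\<in>totatives q. [c = b] (mod r)}) * h b = real (totient q) / real (totient r) * h b"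
      using r by (simp add: field_simps)
  qed
  finally show ?thesis by (simp add: sum_distrib_left)
qed

text \<open>The averaged residue sum is expanded into additive characters modulo r, and the
  projection to level r deletes the frequencies that are not reduced. The rest is bounded by
  contraction and Parseval's identity. The factor \<open>totient r / totient q\<close> is the
  squared weight of the average times the number of reduced residues modulo q over each one modulo
  r.\<close>

lemma sq_norm_level_part_large:
  assumes q: "q > 0" "q = r * s"
  shows "sq_norm q (level_part q r (residue_sum N \<alpha> q))
    \<le> real (totient r) / real (totient q) * (1 / real r) * farey_energy N (restrict_coprime s \<alpha>) r"
proof -
  have r: "r > 0" "r dvd q" using q by (auto intro!: Nat.gr0I)
  define w :: complex where "w = of_nat (totient r) / of_nat (totient q)"
  define S where "S a = (\<Sum>n\<in>{1..N}. restrict_coprime s \<alpha> n * cis (2 * pi * real n * (real a / real r)))" for a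
  define e where "e a c = cis (2 * pi * real a * (- real c / real r))" for a c
  define W where "W c = (\<Sum>a\<in>totatives r. S a / of_nat r * e a c)" for c
  have expand: "residue_sum N (restrict_coprime s \<alpha>) r c = (\<Sum>a\<in>{1..r}. S a / of_nat r * e a c)" for c
  proof -
    have "(\<Sum>a\<in>{1..r}. S a / of_nat r * e a c)
      = (\<Sum>a\<in>{1..r}. \<Sum>n\<in>{1..N}. restrict_coprime s \<alpha> n / of_nat r * cis (2 * pi * real a * (of_int (int n - int c) / real r)))"
    proof (intro sum.cong refl)
      fix a
      have "cis (2 * pi * real n * (real a / real r)) * e a c = cis (2 * pi * real a * (of_int (int n - int c) / real r))" for n
        unfolding e_def cis_mult using r by (simp add: field_simps)
      then show "S a / of_nat r * e a c
        = (\<Sum>n\<in>{1..N}. restrict_coprime s \<alpha> n / of_nat r * cis (2 * pi * real a * (of_int (int n - int c) / real r)))"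
        unfolding S_def sum_divide_distrib sum_distrib_right
        by (intro sum.cong refl) (metis (no_types, lifting) mult.assoc times_divide_eq_left)
    qed
    also have "\<dots> = (\<Sum>n\<in>{1..N}. restrict_coprime s \<alpha> n / of_nat r * (\<Sum>a\<in>{1..r}. cis (2 * pi * real a * (of_int (int n - int c) / real r))))"
      by (subst sum.swap) (simp only: sum_distrib_left)
    also have "\<dots> = (\<Sum>n\<in>{1..N}. if [n = c] (mod r) then restrict_coprime s \<alpha> n else 0)"
      unfolding additive_orthogonality[OF r(1)]
      using r by (intro sum.cong refl) (auto simp: cong_iff_dvd_diff simp flip: cong_int_iff)
    finally show ?thesis by (simp add: residue_sum_def)
  qed
  have split: "{1..r} = totatives r \<union> ({1..r} - totatives r)" by (auto simp: in_totatives_iff)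
  have P: "level_part q r (residue_sum N \<alpha> q) c = w * level_part q r W c" for c
  proof -
    have "level_part q r (residue_sum N \<alpha> q) = level_part q r (fiber_avg q r (residue_sum N \<alpha> q))"
      by (rule level_part_via_fiber_avg[OF q(1) r(2)])
    also have "\<dots> = level_part q r (\<lambda>c. w * (\<Sum>a\<in>{1..r}. S a / of_nat r * e a c))"
      unfolding expand[symmetric] w_def by (intro level_part_cong fiber_avg_residue_sum q)
    finally have "level_part q r (residue_sum N \<alpha> q) c = level_part q r (\<lambda>c. w * (\<Sum>a\<in>{1..r}. S a / of_nat r * e a c)) c"
      by (rule fun_cong)
    also have "\<dots> = w * (\<Sum>a\<in>{1..r}. S a / of_nat r * level_part q r (e a) c)"
      by (simp only: level_part_scale level_part_sum)
    also have "(\<Sum>a\<in>{1..r}. S a / of_nat r * level_part q r (e a) c) = (\<Sum>a\<in>totatives r. S a / of_nat r * level_part q r (e a) c)"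
    proof (rule sum.mono_neutral_right)
      show "totatives r \<subseteq> {1..r}" using split by blast
      show "\<forall>a\<in>{1..r} - totatives r. S a / of_nat r * level_part q r (e a) c = 0"
        using level_part_additive_char[OF q(1) r(2)] unfolding e_def by auto
    qed simp
    also have "\<dots> = level_part q r W c" unfolding W_def by (simp only: level_part_sum)
    finally show ?thesis .
  qed
  have per: "W k = W c" if "[k = c] (mod r)" for k c
  proof -
    have "int r dvd int k - int c" using that by (simp add: cong_iff_dvd_diff flip: cong_int_iff)
    then obtain j where j: "int k - int c = int r * j" by blast
    have "- real k / real r = - real c / real r + of_int (- j)"
    proof -
      have "real k = real c + real r * of_int j"
        using arg_cong[OF j, of real_of_int] by simp
      then show ?thesis using r by (simp add: field_simps)
    qed
    then have "e a k = e a c" for a unfolding e_def by (simp only: cis_plus_int)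
    then show ?thesis by (simp add: W_def)
  qed
  have pars: "(\<Sum>c\<in>{1..r}. (cmod (W c))\<^sup>2) = 1 / real r * (\<Sum>a\<in>totatives r. (cmod (S a))\<^sup>2)"
  proof -
    have ee: "(\<Sum>c\<in>{1..r}. e a c * cnj (e b c)) = (if a = b then of_nat r else 0)"
      if "a \<in> totatives r" "b \<in> totatives r" for a b
    proof -
      have "e a c * cnj (e b c) = cis (2 * pi * real c * (of_int (int b - int a) / real r))" for c
        unfolding e_def cis_cnj cis_mult using r by (simp add: field_simps)
      then have "(\<Sum>c\<in>{1..r}. e a c * cnj (e b c)) = (if int r dvd int b - int a then of_nat r else 0)"
        by (simp only: additive_orthogonality[OF r(1)])
      moreover have "int r dvd int b - int a \<longleftrightarrow> a = b"
      proof -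
        have "int r dvd int b - int a \<longleftrightarrow> [b = a] (mod r)"
          by (simp add: cong_iff_dvd_diff flip: cong_int_iff)
        also have "\<dots> \<longleftrightarrow> a = b" using totatives_cong_imp_eq that by auto
        finally show ?thesis .
      qed
      ultimately show ?thesis by simp
    qed
    have "complex_of_real (\<Sum>c\<in>{1..r}. (cmod (W c))\<^sup>2) = (\<Sum>c\<in>{1..r}. W c * cnj (W c))"
      unfolding of_real_sum by (intro sum.cong refl complex_norm_square)
    also have "\<dots> = (\<Sum>c\<in>{1..r}. \<Sum>a\<in>totatives r. \<Sum>b\<in>totatives r.
        (S a * cnj (S b) / (of_nat r)\<^sup>2) * (e a c * cnj (e b c)))"
      unfolding W_def cnj_sum sum_product by (intro sum.cong refl) (simp add: power2_eq_square)
    also have "\<dots> = (\<Sum>a\<in>totatives r. \<Sum>c\<in>{1..r}. \<Sum>b\<in>totatives r. 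
        (S a * cnj (S b) / (of_nat r)\<^sup>2) * (e a c * cnj (e b c)))"
      by (rule sum.swap)
    also have "\<dots> = (\<Sum>a\<in>totatives r. \<Sum>b\<in>totatives r. \<Sum>c\<in>{1..r}.
        (S a * cnj (S b) / (of_nat r)\<^sup>2) * (e a c * cnj (e b c)))"
      by (rule sum.cong[OF refl]) (rule sum.swap)
    also have "\<dots> = (\<Sum>a\<in>totatives r. \<Sum>b\<in>totatives r.
        (S a * cnj (S b) / (of_nat r)\<^sup>2) * (if a = b then of_nat r else 0))"
      by (rule sum.cong[OF refl], rule sum.cong[OF refl]) (simp only: ee flip: sum_distrib_left)
    also have "\<dots> = (\<Sum>a\<in>totatives r. (S a * cnj (S a) / (of_nat r)\<^sup>2) * of_nat r)"
      by (intro sum.cong refl) (simp add: if_distrib cong: if_cong)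
    also have "\<dots> = complex_of_real (1 / real r * (\<Sum>a\<in>totatives r. (cmod (S a))\<^sup>2))"
      using r unfolding of_real_mult of_real_sum complex_norm_square
      by (simp add: sum_distrib_left power2_eq_square)
    finally show ?thesis using of_real_eq_iff by blast
  qed
  have t: "totient r > 0" "totient q > 0" using r q by auto
  have "sq_norm q (level_part q r (residue_sum N \<alpha> q)) = (cmod w)\<^sup>2 * sq_norm q (level_part q r W)"
    unfolding P by (rule sq_norm_scale)
  also have "\<dots> \<le> (cmod w)\<^sup>2 * sq_norm q W"
    by (intro mult_left_mono sq_norm_level_part_le q r) simp
  also have "sq_norm q W = real (totient q) / real (totient r) * (\<Sum>b\<in>totatives r. (cmod (W b))\<^sup>2)"
    unfolding sq_norm_def using per by (intro sum_totatives_periodic q(1) r(2)) metis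
  \<comment> \<open>The sum is enlarged from the reduced residues to all residues modulo r, where
    Parseval's identity \<open>pars\<close> holds exactly.\<close>
  also have "(cmod w)\<^sup>2 * (real (totient q) / real (totient r) * (\<Sum>b\<in>totatives r. (cmod (W b))\<^sup>2))
      \<le> (cmod w)\<^sup>2 * (real (totient q) / real (totient r) * (\<Sum>c\<in>{1..r}. (cmod (W c))\<^sup>2))"
    by (intro mult_left_mono sum_mono2) (auto simp: in_totatives_iff)
  also have "\<dots> = (real (totient r) / real (totient q))\<^sup>2 * (real (totient q) / real (totient r)) * (1 / real r) * farey_energy N (restrict_coprime s \<alpha>) r"
    unfolding pars farey_energy_def S_def[symmetric] by (simp add: w_def norm_divide)
  also have "(real (totient r) / real (totient q))\<^sup>2 * (real (totient q) / real (totient r)) = real (totient r) / real (totient q)"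
    using t by (simp add: power2_eq_square)
  finally show ?thesis .
qed

text \<open>For the factor from which no saving is expected: at small levels all of it comes from
  the other factor of the convolution.\<close>

lemma sq_norm_level_part_trivial:
  assumes q: "q > 0" "q = r * s" and K: "\<And>n. n \<in> {1..N} \<Longrightarrow> cmod (\<alpha> n) \<le> K" "K \<ge> 0"
  shows "sq_norm q (level_part q r (residue_sum N \<alpha> q)) \<le> (real (totient r))\<^sup>2 / real (totient q) * (K * real N)\<^sup>2"
proof -
  have r: "r > 0" "r dvd q" using q by (auto intro!: Nat.gr0I)
  have rs: "cmod (residue_sum N (restrict_coprime s \<alpha>) r c) \<le> K * real N" for c
  proof -
    have "cmod (residue_sum N (restrict_coprime s \<alpha>) r c) \<le> (\<Sum>n\<in>{1..N}. K)"
      unfolding residue_sum_def restrict_coprime_def using K by (intro order_trans[OF norm_sum] sum_mono) auto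
    then show ?thesis by (simp add: mult.commute)
  qed
  have "sq_norm q (level_part q r (residue_sum N \<alpha> q)) \<le> sq_norm q (fiber_avg q r (residue_sum N \<alpha> q))"
    by (subst level_part_via_fiber_avg[OF q(1) r(2)]) (rule sq_norm_level_part_le[OF q(1) r(2)])
  also have "\<dots> = sq_norm q (\<lambda>c. of_nat (totient r) / of_nat (totient q) * residue_sum N (restrict_coprime s \<alpha>) r c)"
    by (intro sq_norm_cong fiber_avg_residue_sum q)
  also have "\<dots> = (real (totient r) / real (totient q))\<^sup>2 * sq_norm q (residue_sum N (restrict_coprime s \<alpha>) r)"
    by (subst sq_norm_scale) (simp add: norm_divide)
  also have "\<dots> \<le> (real (totient r) / real (totient q))\<^sup>2 * (\<Sum>c\<in>totatives q. (K * real N)\<^sup>2)"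
    unfolding sq_norm_def by (intro mult_left_mono sum_mono power_mono rs) auto
  also have "\<dots> = (real (totient r))\<^sup>2 / real (totient q) * (K * real N)\<^sup>2"
    using q(1) by (simp add: power2_eq_square totient_def[symmetric])
  finally show ?thesis .
qed

text \<open>For r other than 1 the average of level 1 has no part of level r and may be subtracted
  from the average of level r. What is left is \<open>totient r / totient q\<close> times the
  discrepancy modulo r of \<beta> restricted to integers coprime to s, which is what M
  bounds.\<close>

lemma sq_norm_level_part_small:
  assumes q: "q > 0" "q = r * s" and r1: "r \<noteq> 1"
    and M: "\<And>c. coprime c r \<Longrightarrow> cmod (\<Sum>n\<in>{1..N}. restrict_coprime s \<beta> n * ap_kernel r (int c) n) \<le> M"
  shows "sq_norm q (level_part q r (residue_sum N \<beta> q)) \<le> (real (totient r))\<^sup>2 / real (totient q) * M\<^sup>2"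
proof -
  have r: "r > 0" "r dvd q" using q by (auto intro!: Nat.gr0I)
  let ?B = "residue_sum N \<beta> q"
  define w :: complex where "w = of_nat (totient r) / of_nat (totient q)"
  have w0: "of_nat (totient r) \<noteq> (0::complex)" "of_nat (totient q) \<noteq> (0::complex)" using r q by auto
  define H where "H c = fiber_avg q r ?B c - fiber_avg q 1 ?B c" for c
  have E1: "fiber_avg q 1 ?B c = 1 / of_nat (totient q) * (\<Sum>n\<in>{1..N}. if coprime n q then \<beta> n else 0)"
    if "c \<in> totatives q" for c
  proof -
    have "{k. k \<in> totatives q \<and> [k = c] (mod Suc 0)} = totatives q" by auto
    moreover have "(\<Sum>b\<in>totatives q. ?B b * 1) = (\<Sum>n\<in>{1..N}. if coprime n q then \<beta> n * 1 else 0)"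
      by (rule sum_totatives_residue[OF q(1)]) simp
    ultimately show ?thesis using that by (simp add: fiber_avg_def cong: if_cong)
  qed
  have H: "H c = w * (\<Sum>n\<in>{1..N}. restrict_coprime s \<beta> n * ap_kernel r (int c) n)" if c: "c \<in> totatives q" for c
  proof -
    have cq: "coprime n q \<longleftrightarrow> coprime n r \<and> coprime n s" for n unfolding q(2) by simp
    have "(\<Sum>n\<in>{1..N}. restrict_coprime s \<beta> n * ap_kernel r (int c) n)
      = residue_sum N (restrict_coprime s \<beta>) r c
        - 1 / of_nat (totient r) * (\<Sum>n\<in>{1..N}. if coprime n q then \<beta> n else 0)"
      unfolding ap_kernel_def residue_sum_def restrict_coprime_def cong_int_iff sum_distrib_left sum_subtractf[symmetric]
      by (intro sum.cong refl) (auto simp: cq right_diff_distrib)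
    then show ?thesis
      unfolding H_def E1[OF c] fiber_avg_residue_sum[OF q c] w_def using w0
      by (simp add: right_diff_distrib)
  qed
  have "level_part q r ?B c = level_part q r H c" for c
  proof -
    have "level_part q r H c = level_part q r (fiber_avg q r ?B) c - level_part q r (fiber_avg q 1 ?B) c"
      unfolding H_def by (rule level_part_diff)
    also have "level_part q r (fiber_avg q 1 ?B) c = 0"
      using level_part_fiber_avg[OF q(1) r(2), of 1 ?B] r1 by simp
    finally show ?thesis using level_part_via_fiber_avg[OF q(1) r(2), of ?B] by simp
  qed
  then have "sq_norm q (level_part q r ?B) = sq_norm q (level_part q r H)" by (intro sq_norm_cong)
  also have "\<dots> \<le> sq_norm q H" by (rule sq_norm_level_part_le[OF q(1) r(2)])
  also have "\<dots> \<le> (\<Sum>c\<in>totatives q. (cmod w * M)\<^sup>2)"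
    unfolding sq_norm_def
  proof (intro sum_mono power_mono)
    fix c assume c: "c \<in> totatives q"
    show "cmod (H c) \<le> cmod w * M"
      unfolding H[OF c] norm_mult by (intro mult_left_mono M coprime_totatives_dvd[OF c r(2)]) simp
  qed simp
  also have "\<dots> = (real (totient r))\<^sup>2 / real (totient q) * M\<^sup>2"
    using q(1) by (simp add: w_def norm_divide power2_eq_square totient_def[symmetric])
  finally show ?thesis .
qed

text \<open>A product congruent to a has both factors coprime to q, so grouping u and v by reduced
  residues loses nothing; the second term of the kernel factors and becomes the main term of
  \<open>twisted_convolution_bound\<close>.\<close>

lemma bilinear_modulus_bound:
  assumes q: "q > 0" and a: "coprime a q"
  shows "cmod (\<Sum>u\<in>{1..N}. \<Sum>v\<in>{1..N'}. \<alpha> u * \<beta> v * ap_kernel q (int a) (u * v))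
    \<le> (\<Sum>r | r dvd q \<and> r \<noteq> 1. sqrt (sq_norm q (level_part q r (residue_sum N \<alpha> q)))
         * sqrt (sq_norm q (level_part q r (residue_sum N' \<beta> q))))"
proof -
  let ?T = "totatives q" and ?A = "residue_sum N \<alpha> q" and ?B = "residue_sum N' \<beta> q"
  have main: "(\<Sum>b\<in>?T. \<Sum>c\<in>?T. if [b * c = a] (mod q) then ?A b * ?B c else 0)
     = (\<Sum>u\<in>{1..N}. \<Sum>v\<in>{1..N'}. if [u * v = a] (mod q) then \<alpha> u * \<beta> v else 0)"
  proof -
    define h where "h b = (\<Sum>v\<in>{1..N'}. if coprime v q then \<beta> v * (if [b * v = a] (mod q) then 1 else 0) else 0)" for b
    have "(\<Sum>c\<in>?T. if [b * c = a] (mod q) then ?A b * ?B c else 0) = ?A b * h b" for b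
    proof -
      have "(\<Sum>c\<in>?T. if [b * c = a] (mod q) then ?A b * ?B c else 0)
         = ?A b * (\<Sum>c\<in>?T. ?B c * (if [b * c = a] (mod q) then 1 else 0))"
        unfolding sum_distrib_left by (intro sum.cong) auto
      also have "(\<Sum>c\<in>?T. ?B c * (if [b * c = a] (mod q) then 1 else 0)) = h b"
        unfolding h_def
      proof (rule sum_totatives_residue[OF q])
        fix n c assume "[n = c] (mod q)"
        then have "[b * n = b * c] (mod q)" by (rule cong_scalar_left)
        then have "[b * n = a] (mod q) \<longleftrightarrow> [b * c = a] (mod q)" by (meson cong_sym cong_trans)
        then show "(if [b * n = a] (mod q) then 1 else 0) = (if [b * c = a] (mod q) then 1 else (0::complex))" by simp
      qed
      finally show ?thesis .
    qed
    then have "(\<Sum>b\<in>?T. \<Sum>c\<in>?T. if [b * c = a] (mod q) then ?A b * ?B c else 0) = (\<Sum>b\<in>?T. ?A b * h b)" by simp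
    also have "\<dots> = (\<Sum>u\<in>{1..N}. if coprime u q then \<alpha> u * h u else 0)"
    proof (rule sum_totatives_residue[OF q])
      fix n b assume "[n = b] (mod q)"
      then have "[n * v = b * v] (mod q)" for v by (rule cong_scalar_right)
      then have "[n * v = a] (mod q) \<longleftrightarrow> [b * v = a] (mod q)" for v by (meson cong_sym cong_trans)
      then show "h n = h b" by (simp add: h_def cong: if_cong)
    qed
    also have "\<dots> = (\<Sum>u\<in>{1..N}. \<Sum>v\<in>{1..N'}. if [u * v = a] (mod q) then \<alpha> u * \<beta> v else 0)"
    proof (intro sum.cong refl)
      fix u
      have cop: "coprime u q \<and> coprime v q" if "[u * v = a] (mod q)" for v
        using a that by (metis cong_imp_coprime cong_sym coprime_mult_left_iff)
      show "(if coprime u q then \<alpha> u * h u else 0) = (\<Sum>v\<in>{1..N'}. if [u * v = a] (mod q) then \<alpha> u * \<beta> v else 0)"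
      proof (cases "coprime u q")
        case True
        then show ?thesis unfolding h_def sum_distrib_left by (auto intro!: sum.cong dest: cop)
      next
        case False
        then have "(if [u * v = a] (mod q) then \<alpha> u * \<beta> v else 0) = 0" for v using cop by auto
        then show ?thesis using False by (simp only: sum.neutral_const if_False)
      qed
    qed
    finally show ?thesis .
  qed
  have tot: "(\<Sum>b\<in>?T. residue_sum n \<gamma> q b) = (\<Sum>u\<in>{1..n}. if coprime u q then \<gamma> u else 0)" for n \<gamma>
    using sum_totatives_residue[OF q, of "\<lambda>_. 1" n \<gamma>] by (simp cong: if_cong)
  have "(\<Sum>b\<in>?T. ?A b) * (\<Sum>c\<in>?T. ?B c)
     = (\<Sum>u\<in>{1..N}. \<Sum>v\<in>{1..N'}. if coprime (u * v) q then \<alpha> u * \<beta> v else 0)"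
    unfolding tot sum_product by (intro sum.cong refl) auto
  then have "(\<Sum>u\<in>{1..N}. \<Sum>v\<in>{1..N'}. \<alpha> u * \<beta> v * ap_kernel q (int a) (u * v))
     = (\<Sum>b\<in>?T. \<Sum>c\<in>?T. if [b * c = a] (mod q) then ?A b * ?B c else 0)
      - (\<Sum>b\<in>?T. ?A b) * (\<Sum>c\<in>?T. ?B c) / of_nat (totient q)"
    unfolding main sum_divide_distrib sum_subtractf[symmetric] ap_kernel_def cong_int_iff
    by (simp only:) (simp only: sum_divide_distrib, simp only: sum_subtractf[symmetric], intro sum.cong refl, auto simp: right_diff_distrib)
  with twisted_convolution_bound[OF q a, of ?A ?B] show ?thesis by simp
qed

section \<open>Removing coprimality conditions\<close>

text \<open>The class of c modulo r, restricted to integers coprime to e, is a union of reduced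
  classes modulo \<open>r * e\<close>. There are \<open>totient (r * e) / totient r\<close> of them,
  so that the expected main terms agree too. In this way a coprimality condition costs only a larger
  modulus.\<close>

lemma ap_kernel_lift:
  assumes "r > 0" "e > 0" "coprime c r"
  shows "(\<Sum>c' | c' \<in> totatives (r * e) \<and> [c' = c] (mod r). ap_kernel (r * e) (int c') v)
    = (if coprime v e then ap_kernel r (int c) v else 0)"
proof -
  let ?C = "{c'. c' \<in> totatives (r * e) \<and> [c' = c] (mod r)}"
  have re: "r * e > 0" using assms by simp
  have fin: "finite ?C" by simp
  have card: "real (card ?C) * real (totient r) = real (totient (r * e))"
    using card_totatives_fiber[OF re _ assms(3)] by (metis dvd_triv_left of_nat_mult)
  have tr: "real (totient r) > 0" "real (totient (r * e)) > 0" using assms by auto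
  have w: "real (card ?C) / real (totient (r * e)) = 1 / real (totient r)"
    using card tr by (simp add: field_simps)
  have wc: "of_nat (card ?C) * (1 / of_nat (totient (r * e))) = (1 / of_nat (totient r) :: complex)"
    using arg_cong[OF w, of complex_of_real] by simp
  have ind: "(\<Sum>c'\<in>?C. if [v = c'] (mod (r * e)) then 1 else 0)
      = (if coprime v e \<and> [v = c] (mod r) then 1 else (0::complex))"
  proof (cases "coprime v e \<and> [v = c] (mod r)")
    case True
    then have "coprime v r" using assms(3) by (metis cong_imp_coprime cong_sym)
    then have "coprime v (r * e)" using True by simp
    then obtain c0 where c0: "c0 \<in> totatives (r * e)" "[c0 = v] (mod (r * e))"
      using totatives_rep_ex[OF re] by blast
    have "[c0 = v] (mod r)" using c0(2) by (rule cong_dvd_modulus_nat) simp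
    then have mem: "c0 \<in> ?C" using c0(1) True by (auto intro: cong_trans)
    have "[v = c'] (mod (r * e)) \<longleftrightarrow> c' = c0" if "c' \<in> ?C" for c'
      using c0 that totatives_cong_imp_eq by (metis (no_types, lifting) cong_sym cong_trans mem_Collect_eq)
    then have "(\<Sum>c'\<in>?C. if [v = c'] (mod (r * e)) then 1 else 0) = (\<Sum>c'\<in>?C. if c' = c0 then 1 else (0::complex))"
      by (intro sum.cong) auto
    also have "\<dots> = 1" using mem fin by (subst sum.delta) auto
    finally show ?thesis using True by simp
  next
    case False
    have "\<not> [v = c'] (mod (r * e))" if "c' \<in> ?C" for c'
    proof
      assume h: "[v = c'] (mod (r * e))"
      have "coprime v (r * e)" using h that by (metis (no_types, lifting) cong_imp_coprime cong_sym in_totatives_iff mem_Collect_eq)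
      moreover have "[v = c'] (mod r)" using h by (rule cong_dvd_modulus_nat) simp
      then have "[v = c] (mod r)" using that by (auto intro: cong_trans)
      ultimately show False using False by simp
    qed
    then show ?thesis using False by (simp add: sum.neutral)
  qed
  have "[v = c] (mod r) \<Longrightarrow> coprime v r" using assms(3) by (metis cong_imp_coprime cong_sym)
  have "(\<Sum>c'\<in>?C. ap_kernel (r * e) (int c') v)
     = (\<Sum>c'\<in>?C. if [v = c'] (mod (r * e)) then 1 else 0) - of_nat (card ?C) * (if coprime v (r * e) then 1 / of_nat (totient (r * e)) else 0)"
    by (simp add: ap_kernel_def cong_int_iff sum_subtractf del: of_nat_mult)
  also have "of_nat (card ?C) * (if coprime v (r * e) then 1 / of_nat (totient (r * e)) else 0)
     = (if coprime v (r * e) then 1 / of_nat (totient r) else (0::complex))" using wc by simp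
  also have "(\<Sum>c'\<in>?C. if [v = c'] (mod (r * e)) then 1 else 0) - \<dots> = (if coprime v e then ap_kernel r (int c) v else 0)"
    unfolding ind ap_kernel_def cong_int_iff by auto
  finally show ?thesis .
qed

lemma cmod_ap_kernel_le:
  assumes "q > 0"
  shows "cmod (ap_kernel q a n) \<le> (if [int n = a] (mod int q) then 1 else 0) + (if coprime n q then 1 / real (totient q) else 0)"
  unfolding ap_kernel_def by (rule order_trans[OF norm_triangle_ineq4]) (auto simp: norm_divide)

lemma cmod_ap_kernel_le_1:
  assumes "q > 0"
  shows "cmod (ap_kernel q a n) \<le> 1"
proof -
  have "real (totient q) \<ge> 1" using assms by (simp add: Suc_le_eq)
  then have "1 / real (totient q) \<le> 1 / 1" using assms by (intro divide_left_mono) auto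
  then have t: "1 / real (totient q) \<le> 1" "1 / real (totient q) \<ge> 0" by auto
  have "ap_kernel q a n = complex_of_real ((if [int n = a] (mod int q) then 1 else 0)
     - (if coprime n q then 1 / real (totient q) else 0))" by (simp add: ap_kernel_def)
  then have "cmod (ap_kernel q a n) = \<bar>(if [int n = a] (mod int q) then 1 else 0)
     - (if coprime n q then 1 / real (totient q) else 0)\<bar>" by (simp only: norm_of_real)
  then show ?thesis using t by (auto simp: abs_if)
qed

text \<open>The predicate is arbitrary so that the identity serves in both directions: with
  divisibility in the place of Q it expands a coprimality condition, with non-divisibility it
  expands a divisibility condition into coprimality conditions.\<close>

lemma inclusion_exclusion_of_bool:
  assumes "finite S"
  shows "(of_bool (\<forall>p\<in>S. \<not> Q p) :: complex) = (\<Sum>X\<in>Pow S. (-1) ^ card X * of_bool (\<forall>p\<in>X. Q p))"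
proof -
  have pb: "(\<Prod>p\<in>A. of_bool (R p)) = (of_bool (\<forall>p\<in>A. R p) :: complex)" if "finite A" for A and R :: "'a \<Rightarrow> bool"
    using that by (induction A rule: finite_induct) auto
  have "(of_bool (\<forall>p\<in>S. \<not> Q p) :: complex) = (\<Prod>p\<in>S. 1 - of_bool (Q p))"
    using pb[OF assms, of "\<lambda>p. \<not> Q p"] by (simp add: of_bool_not_iff)
  also have "\<dots> = (\<Sum>X\<in>Pow S. (-1) ^ card X * (\<Prod>p\<in>X. of_bool (Q p)) * (\<Prod>p\<in>S - X. 1))"
    by (rule prod_diff_conv_sum[OF assms])
  also have "\<dots> = (\<Sum>X\<in>Pow S. (-1) ^ card X * of_bool (\<forall>p\<in>X. Q p))"
    using assms by (intro sum.cong refl) (auto simp: pb finite_subset)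
  finally show ?thesis .
qed

lemma coprime_prod_primes_iff:
  assumes "finite S" "\<And>p. p \<in> S \<Longrightarrow> prime p"
  shows "coprime v (\<Prod>S) \<longleftrightarrow> (\<forall>p\<in>S. \<not> p dvd (v::nat))"
proof
  assume c: "coprime v (\<Prod>S)"
  show "\<forall>p\<in>S. \<not> p dvd v"
  proof
    fix p assume p: "p \<in> S"
    then have "p dvd \<Prod>S" using assms(1) by (simp add: dvd_prodI[of S p "\<lambda>x. x"])
    then show "\<not> p dvd v" using c assms(2)[OF p] by (meson coprime_common_divisor not_prime_unit)
  qed
next
  assume "\<forall>p\<in>S. \<not> p dvd v"
  then have "coprime p v" if "p \<in> S" for p using that assms(2) prime_imp_coprime by blast
  then show "coprime v (\<Prod>S)" by (intro prod_coprime_right) (simp add: coprime_commute)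
qed

text \<open>A set of primes is recovered as the set of prime divisors of its product. So a sum over
  sets of primes can be read as a sum over distinct integers d.\<close>

lemma inj_on_prod_primes: "inj_on (\<lambda>S. \<Prod>S) {S. finite S \<and> (\<forall>p\<in>S. prime (p::nat))}"
proof (rule inj_onI)
  have *: "S = {p. prime p \<and> p dvd \<Prod>S}" if S: "finite S" "\<forall>p\<in>S. prime p" for S :: "nat set"
  proof (intro equalityI subsetI)
    fix p assume "p \<in> S"
    then show "p \<in> {p. prime p \<and> p dvd \<Prod>S}" using S dvd_prodI[of S p "\<lambda>x. x"] by auto
  next
    fix p assume "p \<in> {p. prime p \<and> p dvd \<Prod>S}"
    then have "prime p" "\<exists>x\<in>S. p dvd x" using prime_dvd_prod_iff[OF S(1), of p "\<lambda>x. x"] by auto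
    then show "p \<in> S" using S(2) primes_dvd_imp_eq by blast
  qed
  fix S T :: "nat set"
  assume "S \<in> {S. finite S \<and> (\<forall>p\<in>S. prime p)}" "T \<in> {S. finite S \<and> (\<forall>p\<in>S. prime p)}" "\<Prod>S = \<Prod>T"
  then show "S = T" using *[of S] *[of T] by simp
qed

lemma prod_primes_dvd:
  fixes v :: nat
  assumes "finite S" "\<And>p. p \<in> S \<Longrightarrow> prime p" "\<And>p. p \<in> S \<Longrightarrow> p dvd v"
  shows "\<Prod>S dvd v"
  using assms
proof (induction S rule: finite_induct)
  case (insert p S)
  have "coprime p (\<Prod>S)"
    using insert by (intro prod_coprime_right primes_coprime) auto
  then show ?case using insert by (simp add: divides_mult)
qed simp

lemma two_power_card_le_prod:
  assumes "finite S" "\<And>p. p \<in> S \<Longrightarrow> p \<ge> (2::nat)"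
  shows "2 ^ card S \<le> \<Prod>S"
  using prod_mono[of S "\<lambda>_. 2::nat" "\<lambda>x. x"] assms by simp

lemma card_multiples_le:
  assumes "d > 0"
  shows "real (card {v\<in>{1..N}. d dvd v}) \<le> real N / real d"
proof -
  have "{v\<in>{1..N}. d dvd v} \<subseteq> (\<lambda>k. d * k) ` {1..N div d}"
  proof
    fix v assume "v \<in> {v\<in>{1..N}. d dvd v}"
    then obtain k where k: "v = d * k" "1 \<le> v" "v \<le> N" by auto
    then have "k \<ge> 1" by (cases k) auto
    moreover have "k \<le> N div d" using k assms by (simp add: less_eq_div_iff_mult_less_eq mult.commute)
    ultimately show "v \<in> (\<lambda>k. d * k) ` {1..N div d}" using k by auto
  qed
  then have "card {v\<in>{1..N}. d dvd v} \<le> N div d"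
    by (metis (no_types, lifting) card_image_le card_mono finite_atLeastAtMost finite_imageI le_trans card_atLeastAtMost diff_Suc_1)
  then have "real (card {v\<in>{1..N}. d dvd v}) \<le> real (N div d)" by simp
  also have "\<dots> \<le> real N / real d"
  proof -
    have "real (N div d) * real d \<le> real N" by (metis div_times_less_eq_dividend of_nat_le_iff of_nat_mult)
    then show ?thesis using assms by (simp add: field_simps)
  qed
  finally show ?thesis .
qed

text \<open>
  Inclusion and exclusion is applied twice. The condition that \<open>v\<close> is coprime to \<open>s\<close> is expanded into
  divisibility conditions \<open>d dvd v\<close> with \<open>d dvd s\<close>, where \<open>d > D\<close> is estimated trivially; each
  remaining condition is expanded back into coprimality conditions with a small modulus, which are
  unions of reduced residue classes.
\<close>

lemma coprime_restricted_discrepancy: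
  fixes \<beta> :: "nat \<Rightarrow> complex"
  assumes \<delta>: "\<And>m a. m > 0 \<Longrightarrow> coprime a m \<Longrightarrow> cmod (\<Sum>v\<in>{1..N}. \<beta> v * ap_kernel m (int a) v) \<le> \<delta>"
    and K: "\<And>v. v \<in> {1..N} \<Longrightarrow> cmod (\<beta> v) \<le> K" "K \<ge> 0"
    and rs: "r > 0" "s > 0" and c: "coprime c r"
  shows "cmod (\<Sum>v\<in>{1..N}. restrict_coprime s \<beta> v * ap_kernel r (int c) v)
    \<le> real r * real D ^ 3 * \<delta> + K * (\<Sum>d | d dvd s \<and> d > D. real N / real d)"
proof -
  define P where "P = prime_factors s"
  have P: "finite P" "\<And>p. p \<in> P \<Longrightarrow> prime p" "\<And>p. p \<in> P \<Longrightarrow> p dvd s" by (auto simp: P_def)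
  have Ssub: "finite S" "\<And>p. p \<in> S \<Longrightarrow> prime p" if "S \<in> Pow P" for S
    using that P finite_subset by auto
  have \<delta>0: "\<delta> \<ge> 0" using \<delta>[of 1 1] norm_ge_zero order_trans by (metis coprime_1_left zero_less_one)
  have cop: "coprime v s \<longleftrightarrow> (\<forall>p\<in>P. \<not> p dvd v)" for v
  proof
    assume "coprime v s"
    then show "\<forall>p\<in>P. \<not> p dvd v" using P by (meson coprime_common_divisor not_prime_unit)
  next
    assume h: "\<forall>p\<in>P. \<not> p dvd v"
    show "coprime v s"
    proof (rule ccontr)
      assume "\<not> coprime v s"
      then have "gcd v s \<noteq> 1" using coprime_iff_gcd_eq_1 by blast
      from prime_factor_nat[OF this] obtain p where "prime p" "p dvd gcd v s" by blast
      then have "p \<in> P" "p dvd v" using rs by (auto simp: P_def in_prime_factors_iff)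
      with h show False by blast
    qed
  qed
  define T where "T S = (\<Sum>v\<in>{1..N}. of_bool (\<forall>p\<in>S. p dvd v) * (\<beta> v * ap_kernel r (int c) v))" for S
  have eq: "(\<Sum>v\<in>{1..N}. restrict_coprime s \<beta> v * ap_kernel r (int c) v) = (\<Sum>S\<in>Pow P. (-1) ^ card S * T S)"
  proof -
    have "restrict_coprime s \<beta> v * ap_kernel r (int c) v
        = of_bool (\<forall>p\<in>P. \<not> p dvd v) * (\<beta> v * ap_kernel r (int c) v)" for v
      by (simp add: restrict_coprime_def cop)
    then have "(\<Sum>v\<in>{1..N}. restrict_coprime s \<beta> v * ap_kernel r (int c) v)
       = (\<Sum>v\<in>{1..N}. \<Sum>S\<in>Pow P. (-1) ^ card S * of_bool (\<forall>p\<in>S. p dvd v) * (\<beta> v * ap_kernel r (int c) v))"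
      by (simp only: inclusion_exclusion_of_bool[OF P(1)] sum_distrib_right)
    then show ?thesis unfolding T_def sum_distrib_left by (subst sum.swap) (simp only: mult.assoc)
  qed
  \<comment> \<open>The set S has \<open>2 ^ card S \<le> \<Prod>S \<le> D\<close> subsets X, and
    each of them splits the class of c into at most \<open>r * D\<close> classes: this gives two
    factors D. The third, in the final bound, is the number of sets S with product at most
    D.\<close>
  have small: "cmod (T S) \<le> real r * real D ^ 2 * \<delta>" if S: "S \<in> Pow P" "\<Prod>S \<le> D" for S
  proof -
    note Sf = Ssub[OF S(1)]
    define V where "V X = (\<Sum>v\<in>{1..N}. \<beta> v * (if coprime v (\<Prod>X) then ap_kernel r (int c) v else 0))" for X
    have "T S = (\<Sum>v\<in>{1..N}. \<Sum>X\<in>Pow S. (-1) ^ card X * of_bool (\<forall>p\<in>X. \<not> p dvd v) * (\<beta> v * ap_kernel r (int c) v))"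
      unfolding T_def using inclusion_exclusion_of_bool[OF Sf(1), of "\<lambda>p. \<not> p dvd v" for v]
      by (simp only: not_not sum_distrib_right)
    also have "\<dots> = (\<Sum>X\<in>Pow S. (-1) ^ card X * V X)"
      unfolding V_def sum_distrib_left
    proof (subst sum.swap, intro sum.cong refl)
      fix X v assume "X \<in> Pow S"
      then have "coprime v (\<Prod>X) \<longleftrightarrow> (\<forall>p\<in>X. \<not> p dvd v)"
        using Sf finite_subset by (intro coprime_prod_primes_iff) auto
      then show "(-1) ^ card X * of_bool (\<forall>p\<in>X. \<not> p dvd v) * (\<beta> v * ap_kernel r (int c) v)
        = (-1) ^ card X * (\<beta> v * (if coprime v (\<Prod>X) then ap_kernel r (int c) v else 0))"
        by simp
    qed
    finally have "cmod (T S) \<le> (\<Sum>X\<in>Pow S. cmod (V X))"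
      by (simp only:) (rule order_trans[OF norm_sum], simp add: norm_mult norm_power)
    also have "\<dots> \<le> (\<Sum>X\<in>Pow S. real r * real D * \<delta>)"
    proof (rule sum_mono)
      fix X assume X: "X \<in> Pow S"
      let ?e = "\<Prod>X"
      have Xf: "finite X" "\<And>p. p \<in> X \<Longrightarrow> prime p" using X Sf finite_subset by auto
      have e0: "?e > 0" using Xf by (simp add: prime_gt_0_nat prod_pos)
      have eD: "?e \<le> D"
      proof -
        have "?e dvd \<Prod>S" using X Sf by (intro prod_dvd_prod_subset) auto
        moreover have "\<Prod>S > 0" using Sf by (simp add: prime_gt_0_nat prod_pos)
        ultimately show ?thesis using S(2) dvd_imp_le order_trans by blast
      qed
      let ?C = "{c'. c' \<in> totatives (r * ?e) \<and> [c' = c] (mod r)}"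
      have "V X = (\<Sum>v\<in>{1..N}. \<Sum>c'\<in>?C. \<beta> v * ap_kernel (r * ?e) (int c') v)"
        unfolding V_def ap_kernel_lift[OF rs(1) e0 c, symmetric] sum_distrib_left ..
      also have "\<dots> = (\<Sum>c'\<in>?C. \<Sum>v\<in>{1..N}. \<beta> v * ap_kernel (r * ?e) (int c') v)" by (rule sum.swap)
      finally have "cmod (V X) \<le> (\<Sum>c'\<in>?C. cmod (\<Sum>v\<in>{1..N}. \<beta> v * ap_kernel (r * ?e) (int c') v))"
        by (simp only: norm_sum)
      also have "\<dots> \<le> (\<Sum>c'\<in>?C. \<delta>)"
      proof (rule sum_mono)
        fix c' assume "c' \<in> ?C"
        then have "coprime c' (r * ?e)" unfolding in_totatives_iff mem_Collect_eq by blast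
        then show "cmod (\<Sum>v\<in>{1..N}. \<beta> v * ap_kernel (r * ?e) (int c') v) \<le> \<delta>"
          using rs e0 by (intro \<delta>) simp
      qed
      also have "\<dots> = real (card ?C) * \<delta>" by simp
      also have "card ?C \<le> r * D"
      proof -
        have "card ?C \<le> card (totatives (r * ?e))" by (intro card_mono) auto
        also have "\<dots> \<le> r * ?e" using totient_le[of "r * ?e"] by (simp add: totient_def)
        also have "\<dots> \<le> r * D" using eD by simp
        finally show ?thesis .
      qed
      finally show "cmod (V X) \<le> real r * real D * \<delta>" using \<delta>0
        by (simp add: mult_right_mono flip: of_nat_mult)
    qed
    also have "\<dots> = real (2 ^ card S) * (real r * real D * \<delta>)" using Sf by (simp add: card_Pow)
    also have "\<dots> \<le> real D * (real r * real D * \<delta>)"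
    proof (intro mult_right_mono)
      have "2 ^ card S \<le> \<Prod>S" using Sf by (intro two_power_card_le_prod) (auto simp: prime_ge_2_nat)
      then have "2 ^ card S \<le> D" using S(2) by simp
      then show "real (2 ^ card S) \<le> real D" by (rule of_nat_mono)
    qed (use \<delta>0 in simp)
    finally show ?thesis by (simp add: power2_eq_square mult_ac)
  qed
  have big: "cmod (T S) \<le> K * (real N / real (\<Prod>S))" if S: "S \<in> Pow P" for S
  proof -
    note Sf = Ssub[OF S]
    have e0: "\<Prod>S > 0" using Sf by (simp add: prime_gt_0_nat prod_pos)
    have dv: "(\<forall>p\<in>S. p dvd v) \<Longrightarrow> \<Prod>S dvd v" for v
      using Sf by (intro prod_primes_dvd) auto
    have "cmod (T S) \<le> (\<Sum>v\<in>{1..N}. if \<Prod>S dvd v then K else 0)"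
      unfolding T_def
    proof (intro order_trans[OF norm_sum] sum_mono)
      fix v assume v: "v \<in> {1..N}"
      have "cmod (\<beta> v) * cmod (ap_kernel r (int c) v) \<le> K * 1"
        using K v cmod_ap_kernel_le_1[OF rs(1)] by (intro mult_mono) auto
      then show "cmod (of_bool (\<forall>p\<in>S. p dvd v) * (\<beta> v * ap_kernel r (int c) v)) \<le> (if \<Prod>S dvd v then K else 0)"
        using dv[of v] K by (auto simp: norm_mult)
    qed
    also have "\<dots> = real (card {v\<in>{1..N}. \<Prod>S dvd v}) * K" by (simp flip: sum.inter_filter)
    also have "\<dots> \<le> real N / real (\<Prod>S) * K" using card_multiples_le[OF e0] K by (intro mult_right_mono) auto
    finally show ?thesis by (simp add: mult.commute)
  qed
  let ?A = "{S\<in>Pow P. \<Prod>S \<le> D}" and ?B = "{S\<in>Pow P. \<Prod>S > D}"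
  have finA: "finite ?A" "finite ?B" using P by auto
  have injA: "inj_on (\<lambda>S. \<Prod>S) (Pow P)"
    by (rule inj_on_subset[OF inj_on_prod_primes]) (use Ssub in auto)
  have cardA: "card ?A \<le> D"
  proof -
    have "card ?A = card ((\<lambda>S. \<Prod>S) ` ?A)" using injA by (intro card_image[symmetric]) (auto simp: inj_on_def)
    also have "\<dots> \<le> card {1..D}"
      using Ssub by (intro card_mono) (auto simp: Suc_le_eq prime_gt_0_nat intro!: prod_pos)
    finally show ?thesis by simp
  qed
  have "cmod (\<Sum>S\<in>Pow P. (-1) ^ card S * T S) \<le> (\<Sum>S\<in>Pow P. cmod (T S))"
    by (rule order_trans[OF norm_sum]) (simp add: norm_mult norm_power)
  also have "(\<Sum>S\<in>Pow P. cmod (T S)) = (\<Sum>S\<in>?A. cmod (T S)) + (\<Sum>S\<in>?B. cmod (T S))"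
    using finA by (subst sum.union_disjoint[symmetric]) (auto intro!: sum.cong)
  also have "(\<Sum>S\<in>?A. cmod (T S)) \<le> (\<Sum>S\<in>?A. real r * real D ^ 2 * \<delta>)" using small by (intro sum_mono) auto
  also have "\<dots> = real (card ?A) * (real r * real D ^ 2 * \<delta>)" by simp
  also have "\<dots> \<le> real D * (real r * real D ^ 2 * \<delta>)" using cardA \<delta>0 by (intro mult_right_mono) auto
  also have "\<dots> = real r * real D ^ 3 * \<delta>" by (simp add: power2_eq_square power3_eq_cube)
  also have "(\<Sum>S\<in>?B. cmod (T S)) \<le> (\<Sum>S\<in>?B. K * (real N / real (\<Prod>S)))" using big by (intro sum_mono) auto
  also have "\<dots> = (\<Sum>d\<in>(\<lambda>S. \<Prod>S) ` ?B. K * (real N / real d))"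
    using injA by (subst sum.reindex) (auto simp: inj_on_def)
  also have "\<dots> \<le> (\<Sum>d | d dvd s \<and> d > D. K * (real N / real d))"
  proof (rule sum_mono2)
    show "finite {d. d dvd s \<and> d > D}" using rs by simp
    show "(\<lambda>S. \<Prod>S) ` ?B \<subseteq> {d. d dvd s \<and> d > D}"
    proof clarsimp
      fix S assume "S \<subseteq> P"
      then show "\<Prod>S dvd s" using Ssub[of S] P
        by (intro prod_primes_dvd) auto
    qed
  qed (use K in auto)
  finally show ?thesis unfolding eq by (simp add: sum_distrib_left)
qed

section \<open>Sums over moduli\<close>

text \<open>The i-th smallest element of A is at least i + 1, so the product is at least that of 1 -
  1 / (i + 1) = i / (i + 1), which telescopes. The induction takes off the largest element.\<close>

lemma prod_one_minus_inverse_ge: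
  fixes A :: "nat set"
  assumes "finite A" "\<And>p. p \<in> A \<Longrightarrow> p \<ge> 2"
  shows "(\<Prod>p\<in>A. 1 - 1 / real p) \<ge> 1 / (real (card A) + 1)"
  using assms
proof (induction "card A" arbitrary: A)
  case 0
  then show ?case by simp
next
  case (Suc n)
  define m where "m = Max A"
  have ne: "A \<noteq> {}" using Suc by auto
  have m: "m \<in> A" "\<And>p. p \<in> A \<Longrightarrow> p \<le> m" using Suc.prems ne by (auto simp: m_def)
  have cn: "card (A - {m}) = n" using Suc m by simp
  have "A \<subseteq> {2..m}" using m Suc.prems by auto
  then have "card A \<le> m - 1" using card_mono[of "{2..m}" A] by simp
  then have mn: "m \<ge> n + 2" using Suc.hyps(2) by simp
  have IH: "(\<Prod>p\<in>A - {m}. 1 - 1 / real p) \<ge> 1 / (real n + 1)"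
    using Suc.hyps(1)[of "A - {m}"] cn Suc.prems by auto
  have "1 / (real n + 2) = (1 / (real n + 1)) * (1 - 1 / (real n + 2))" by (simp add: field_simps)
  also have "\<dots> \<le> (\<Prod>p\<in>A - {m}. 1 - 1 / real p) * (1 - 1 / real m)"
  proof (intro mult_mono IH prod_nonneg)
    show "1 - 1 / real p \<ge> 0" if "p \<in> A - {m}" for p
      using Suc.prems(2)[of p] that by auto
  qed (use mn in \<open>auto simp: field_simps\<close>)
  also have "\<dots> = (\<Prod>p\<in>A. 1 - 1 / real p)"
    using prod.remove[OF Suc.prems(1) m(1), of "\<lambda>p. 1 - 1 / real p"] by (simp add: mult.commute)
  finally show ?case unfolding Suc.hyps(2)[symmetric] by (simp add: add_ac)
qed

text \<open>If s has w distinct prime factors, then 2^w \<le> s makes w at most a multiple of the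
  logarithm, and the preceding lemma gives \<open>totient s \<ge> s / (w + 1)\<close>. An elementary
  bound for the totient that gives away one logarithm is enough.\<close>

lemma inverse_totient_le:
  assumes "1 \<le> s" "s \<le> Q"
  shows "1 / real (totient s) \<le> 2 * (1 + ln (real Q)) / real s"
proof -
  define w where "w = card (prime_factors s)"
  have "2 ^ w \<le> \<Prod>(prime_factors s)" unfolding w_def
    by (intro two_power_card_le_prod) (auto dest: in_prime_factors_imp_prime simp: prime_ge_2_nat)
  also have "\<Prod>(prime_factors s) dvd s"
    by (intro prod_primes_dvd) (auto dest: in_prime_factors_imp_prime in_prime_factors_imp_dvd)
  then have "\<Prod>(prime_factors s) \<le> s" using assms by (intro dvd_imp_le) auto
  finally have "real (2 ^ w) \<le> real s" by (rule of_nat_mono)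
  then have "ln (2 ^ w) \<le> ln (real s)" using assms by (subst ln_le_cancel_iff) auto
  then have "real w * ln 2 \<le> ln (real s)" by (simp add: ln_realpow)
  moreover have "real w * (1 / 2) \<le> real w * ln 2" using ln2_ge_two_thirds by (intro mult_left_mono) auto
  moreover have "ln (real s) \<le> ln (real Q)" using assms by simp
  ultimately have "real w * (1 / 2) \<le> ln (real Q)" by (meson order_trans)
  then have w: "real w + 1 \<le> 2 * (1 + ln (real Q))" by simp
  have "real (totient s) = real s * (\<Prod>p\<in>prime_factors s. 1 - 1 / real p)" by (rule totient_formula2)
  also have "\<dots> \<ge> real s * (1 / (real w + 1))" unfolding w_def
    by (intro mult_left_mono prod_one_minus_inverse_ge) (auto dest: in_prime_factors_imp_prime simp: prime_ge_2_nat)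
  finally have "1 / real (totient s) \<le> 1 / (real s * (1 / (real w + 1)))"
    using assms by (intro divide_left_mono) auto
  also have "\<dots> = (real w + 1) / real s" by simp
  also have "\<dots> \<le> 2 * (1 + ln (real Q)) / real s" using w by (intro divide_right_mono) auto
  finally show ?thesis .
qed

lemma sum_inverse_totient_le:
  assumes "Q \<ge> 1"
  shows "(\<Sum>s\<in>{1..Q}. 1 / real (totient s)) \<le> 2 * (1 + ln (real Q))\<^sup>2"
proof -
  have "(\<Sum>s\<in>{1..Q}. 1 / real (totient s)) \<le> (\<Sum>s\<in>{1..Q}. 2 * (1 + ln (real Q)) * (1 / real s))"
    using inverse_totient_le by (intro sum_mono) auto
  also have "\<dots> = 2 * (1 + ln (real Q)) * (\<Sum>s\<in>{1..Q}. 1 / real s)" by (simp add: sum_distrib_left)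
  also have "\<dots> \<le> 2 * (1 + ln (real Q)) * (1 + ln (real Q))"
    using assms by (intro mult_left_mono sum_inverse_le_ln) auto
  finally show ?thesis by (simp only: power2_eq_square mult.assoc)
qed

lemma sum_inverse_square_tail:
  assumes "D \<ge> 1"
  shows "(\<Sum>d\<in>{D<..Q}. 1 / (real d)\<^sup>2) \<le> 1 / real D"
proof -
  have "(\<Sum>d\<in>{D<..D+n}. 1 / (real d)\<^sup>2) \<le> 1 / real D - 1 / real (D + n)" for n
  proof (induction n)
    case (Suc n)
    have "{D<..D + Suc n} = insert (D + Suc n) {D<..D+n}" by auto
    then have "(\<Sum>d\<in>{D<..D+Suc n}. 1 / (real d)\<^sup>2) = 1 / (real (D + Suc n))\<^sup>2 + (\<Sum>d\<in>{D<..D+n}. 1 / (real d)\<^sup>2)"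
      by simp
    also have "1 / (real (D + Suc n))\<^sup>2 \<le> 1 / real (D + n) - 1 / real (D + Suc n)"
    proof -
      define x where "x = real (D + n)"
      have x: "x > 0" using assms by (simp add: x_def)
      have "1 / (x + 1)\<^sup>2 \<le> 1 / (x * (x + 1))"
        using x unfolding power2_eq_square by (intro divide_left_mono mult_right_mono mult_pos_pos) auto
      also have "\<dots> = 1 / x - 1 / (x + 1)" using x by (simp add: field_simps)
      finally show ?thesis by (simp add: x_def add_ac)
    qed
    finally show ?case using Suc by simp
  qed simp
  then have *: "(\<Sum>d\<in>{D<..D+n}. 1 / (real d)\<^sup>2) \<le> 1 / real D" for n
    by (rule order_trans) simp
  show ?thesis
  proof (cases "Q \<ge> D")
    case True
    then show ?thesis using *[of "Q - D"] by simp
  qed simp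
qed

text \<open>With s = d t the weight 1 / (s d) becomes 1 / (d^2 t), a tail of the inverse squares
  times a harmonic sum. On average over s, the gain 1 / D pays for the divisors beyond D that
  \<open>coprime_restricted_discrepancy\<close> treats trivially.\<close>

lemma sum_divisor_tail_le:
  assumes "Q \<ge> 1" "D \<ge> 1"
  shows "(\<Sum>s\<in>{1..Q}. 1 / real (totient s) * (\<Sum>d | d dvd s \<and> d > D. 1 / real d)) \<le> 2 * (1 + ln (real Q))\<^sup>2 / real D"
proof -
  define l where "l = 1 + ln (real Q)"
  have l: "l \<ge> 1" using assms by (simp add: l_def)
  have "(\<Sum>s\<in>{1..Q}. 1 / real (totient s) * (\<Sum>d | d dvd s \<and> d > D. 1 / real d))
     \<le> (\<Sum>s\<in>{1..Q}. \<Sum>d | d dvd s \<and> d > D. 2 * l / (real s * real d))"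
  proof (rule sum_mono)
    fix s assume "s \<in> {1..Q}"
    then have "1 / real (totient s) \<le> 2 * l / real s" unfolding l_def by (intro inverse_totient_le) auto
    then have "1 / real (totient s) * (\<Sum>d | d dvd s \<and> d > D. 1 / real d) \<le> 2 * l / real s * (\<Sum>d | d dvd s \<and> d > D. 1 / real d)"
      by (intro mult_right_mono sum_nonneg) auto
    then show "1 / real (totient s) * (\<Sum>d | d dvd s \<and> d > D. 1 / real d) \<le> (\<Sum>d | d dvd s \<and> d > D. 2 * l / (real s * real d))"
      by (simp add: sum_distrib_left)
  qed
  also have "\<dots> = (\<Sum>(s, d)\<in>Sigma {1..Q} (\<lambda>s. {d. d dvd s \<and> d > D}). 2 * l / (real s * real d))"
    by (subst sum.Sigma) auto
  also have "\<dots> \<le> (\<Sum>(d, t)\<in>{D<..Q} \<times> {1..Q}. 2 * l * (1 / (real d)\<^sup>2 * (1 / real t)))"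
  proof (rule sum_le_included[where i = "\<lambda>(d, t). (d * t, d)"])
    show "finite (Sigma {1..Q} (\<lambda>s. {d. d dvd s \<and> d > D}))" by (intro finite_SigmaI) auto
    show "\<forall>x\<in>Sigma {1..Q} (\<lambda>s. {d. d dvd s \<and> d > D}). \<exists>y\<in>{D<..Q} \<times> {1..Q}. (case y of (d, t) \<Rightarrow> (d * t, d)) = x \<and>
      (case x of (s, d) \<Rightarrow> 2 * l / (real s * real d)) \<le> (case y of (d, t) \<Rightarrow> 2 * l * (1 / (real d)\<^sup>2 * (1 / real t)))"
    proof clarify
      fix s d assume h: "s \<in> {1..Q}" "d dvd s" "D < d"
      then obtain t where t: "s = d * t" by blast
      have "t \<ge> 1" using t h by (cases t) auto
      have "d \<le> s" "t \<le> s" using h t dvd_imp_le by auto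
      then have "(d, t) \<in> {D<..Q} \<times> {1..Q}" using h \<open>t \<ge> 1\<close> by auto
      moreover have "2 * l / (real s * real d) \<le> 2 * l * (1 / (real d)\<^sup>2 * (1 / real t))"
        unfolding t by (simp add: power2_eq_square mult_ac)
      ultimately show "\<exists>y\<in>{D<..Q} \<times> {1..Q}. (case y of (d, t) \<Rightarrow> (d * t, d)) = (s, d) \<and>
          2 * l / (real s * real d) \<le> (case y of (d, t) \<Rightarrow> 2 * l * (1 / (real d)\<^sup>2 * (1 / real t)))"
        using t by (intro bexI[of _ "(d, t)"]) auto
    qed
  qed (use l in auto)
  also have "\<dots> = 2 * l * ((\<Sum>d\<in>{D<..Q}. 1 / (real d)\<^sup>2) * (\<Sum>t\<in>{1..Q}. 1 / real t))"
    by (subst sum_product, subst sum_distrib_left, subst sum_distrib_left, subst sum.cartesian_product) (rule refl)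
  also have "\<dots> \<le> 2 * l * (1 / real D * l)"
    using assms l sum_inverse_le_ln[of Q] unfolding l_def
    by (intro mult_left_mono mult_mono sum_inverse_square_tail) (auto intro!: sum_nonneg)
  also have "\<dots> = 2 * l\<^sup>2 / real D" by (simp add: power2_eq_square)
  finally show ?thesis unfolding l_def .
qed

text \<open>
  Here \<open>1 / r\<close> is written as a sum of \<open>1 / (k (k + 1))\<close> over \<open>k \<ge> r\<close>, which replaces a dyadic
  decomposition.
\<close>

lemma weighted_sum_bound:
  fixes c :: "nat \<Rightarrow> real"
  assumes c: "\<And>r. c r \<ge> 0" and abd: "a \<ge> 0" "b \<ge> 0" "d \<ge> 0" and R: "R \<ge> 1"
    and C: "\<And>k. 1 \<le> k \<Longrightarrow> k \<le> Q \<Longrightarrow> (\<Sum>r\<in>{1..k}. c r) \<le> a + b * real k + d * (real k)\<^sup>2"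
  shows "(\<Sum>r\<in>{R<..Q}. c r / real r) \<le> 2 * a / real R + b * (2 + ln (real Q)) + 2 * d * real Q"
proof (cases "R < Q")
  case False
  then have e: "{R<..Q} = {}" by auto
  show ?thesis
  proof (cases "Q \<ge> 1")
    case True
    then show ?thesis using abd unfolding e by (simp add: add_nonneg_nonneg)
  next
    case False
    then have "Q = 0" by simp
    then show ?thesis using abd unfolding e by simp
  qed
next
  case RQ: True
  define w where "w k = 1 / (real k * (real k + 1))" for k :: nat
  have w0: "w k \<ge> 0" for k by (simp add: w_def)
  have tele: "1 / x = 1 / (x + 1) + 1 / (x * (x + 1))" if "x > 0" for x :: real
  proof -
    have "1 / x = (x + 1) / (x * (x + 1))" using that by simp
    also have "\<dots> = 1 / (x + 1) + 1 / (x * (x + 1))" using that by (subst add_divide_distrib) simp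
    finally show ?thesis .
  qed
  \<comment> \<open>The series over k is cut at Q. Its remainder 1 / (Q + 1) leads to the separate
    term with \<open>C' Q\<close>.\<close>
  have inv: "1 / real r = 1 / (real Q + 1) + (\<Sum>k\<in>{r..Q}. w k)" if "1 \<le> r" "r \<le> Q" for r
    using that(2)
  proof (induction Q rule: dec_induct)
    case base
    then show ?case using tele[of "real r"] that by (simp add: w_def)
  next
    case (step n)
    have "1 / (real n + 1) = 1 / (real (Suc n) + 1) + w (Suc n)"
      using tele[of "real (Suc n)"] by (simp add: w_def add_ac)
    then show ?case using step by (simp add: add_ac)
  qed
  define C' where "C' k = (\<Sum>r\<in>{R<..k}. c r)" for k
  have C': "C' k \<le> a + b * real k + d * (real k)\<^sup>2" if "1 \<le> k" "k \<le> Q" for k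
  proof -
    have "C' k \<le> (\<Sum>r\<in>{1..k}. c r)" unfolding C'_def using c R by (intro sum_mono2) auto
    then show ?thesis using C[OF that] by linarith
  qed
  have "(\<Sum>r\<in>{R<..Q}. c r / real r) = (\<Sum>r\<in>{R<..Q}. c r * (1 / (real Q + 1)) + c r * (\<Sum>k\<in>{r..Q}. w k))"
  proof (rule sum.cong[OF refl])
    fix r assume "r \<in> {R<..Q}"
    then have "1 / real r = 1 / (real Q + 1) + (\<Sum>k\<in>{r..Q}. w k)" using R by (intro inv) auto
    then show "c r / real r = c r * (1 / (real Q + 1)) + c r * (\<Sum>k\<in>{r..Q}. w k)"
      by (metis distrib_left mult.right_neutral times_divide_eq_right)
  qed
  also have "\<dots> = C' Q / (real Q + 1) + (\<Sum>r\<in>{R<..Q}. \<Sum>k\<in>{R<..Q}. if r \<le> k then c r * w k else 0)"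
  proof -
    have "c r * (\<Sum>k\<in>{r..Q}. w k) = (\<Sum>k\<in>{R<..Q}. if r \<le> k then c r * w k else 0)" if "r \<in> {R<..Q}" for r
    proof -
      have "{k\<in>{R<..Q}. r \<le> k} = {r..Q}" using that by auto
      then show ?thesis by (simp add: sum_distrib_left flip: sum.inter_filter)
    qed
    then show ?thesis unfolding C'_def by (simp add: sum.distrib sum_divide_distrib)
  qed
  also have "(\<Sum>r\<in>{R<..Q}. \<Sum>k\<in>{R<..Q}. if r \<le> k then c r * w k else 0) = (\<Sum>k\<in>{R<..Q}. C' k * w k)"
  proof (subst sum.swap, rule sum.cong[OF refl])
    fix k assume "k \<in> {R<..Q}"
    then have "{r\<in>{R<..Q}. r \<le> k} = {R<..k}" by auto
    then show "(\<Sum>r\<in>{R<..Q}. if r \<le> k then c r * w k else 0) = C' k * w k"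
      unfolding C'_def by (simp add: sum_distrib_right flip: sum.inter_filter)
  qed
  also have "(\<Sum>k\<in>{R<..Q}. C' k * w k) \<le> (\<Sum>k\<in>{R<..Q}. a * (1 / real k - 1 / (real k + 1)) + b * (1 / real k) + d)"
  proof (rule sum_mono)
    fix k assume k: "k \<in> {R<..Q}"
    then have k1: "real k \<ge> 1" using R by auto
    have "C' k * w k \<le> (a + b * real k + d * (real k)\<^sup>2) * w k" using k w0 R by (intro mult_right_mono C') auto
    also have "\<dots> = a * w k + b * (real k * w k) + d * ((real k)\<^sup>2 * w k)" by (simp add: algebra_simps)
    also have "\<dots> \<le> a * (1 / real k - 1 / (real k + 1)) + b * (1 / real k) + d * 1"
    proof (intro add_mono mult_left_mono abd)
      show "w k \<le> 1 / real k - 1 / (real k + 1)" using k1 tele[of "real k"] by (simp add: w_def)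
      have "real k * w k = 1 / (real k + 1)" using k1 by (simp add: w_def)
      also have "\<dots> \<le> 1 / real k" using k1 by (intro divide_left_mono) auto
      finally show "real k * w k \<le> 1 / real k" .
      have "(real k)\<^sup>2 * w k = real k / (real k + 1)" using k1 by (simp add: w_def power2_eq_square)
      also have "\<dots> \<le> 1" using k1 by simp
      finally show "(real k)\<^sup>2 * w k \<le> 1" .
    qed
    finally show "C' k * w k \<le> a * (1 / real k - 1 / (real k + 1)) + b * (1 / real k) + d" by simp
  qed
  also have "\<dots> = a * (\<Sum>k\<in>{R<..Q}. 1 / real k - 1 / (real k + 1)) + b * (\<Sum>k\<in>{R<..Q}. 1 / real k) + d * real (Q - R)"
    by (simp add: sum.distrib sum_distrib_left)
  also have "\<dots> \<le> a * (1 / real R) + b * (1 + ln (real Q)) + d * real Q"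
  proof (intro add_mono mult_left_mono abd)
    have "(\<Sum>k\<in>{R<..R+n}. 1 / real k - 1 / (real k + 1)) = 1 / (real R + 1) - 1 / (real R + real n + 1)" for n
    proof (induction n)
      case (Suc n)
      have "{R<..R + Suc n} = insert (R + Suc n) {R<..R+n}" by auto
      then show ?case using Suc by (simp add: add_ac)
    qed simp
    from this[of "Q - R"] have "(\<Sum>k\<in>{R<..Q}. 1 / real k - 1 / (real k + 1)) \<le> 1 / (real R + 1)" using RQ by simp
    also have "\<dots> \<le> 1 / real R" using R by (intro divide_left_mono) auto
    finally show "(\<Sum>k\<in>{R<..Q}. 1 / real k - 1 / (real k + 1)) \<le> 1 / real R" .
    have "(\<Sum>k\<in>{R<..Q}. 1 / real k) \<le> (\<Sum>k\<in>{1..Q}. 1 / real k)" by (intro sum_mono2) auto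
    also have "\<dots> \<le> 1 + ln (real Q)" using RQ R by (intro sum_inverse_le_ln) auto
    finally show "(\<Sum>k\<in>{R<..Q}. 1 / real k) \<le> 1 + ln (real Q)" .
  qed simp
  finally have 1: "(\<Sum>r\<in>{R<..Q}. c r / real r) \<le> C' Q / (real Q + 1) + (a * (1 / real R) + b * (1 + ln (real Q)) + d * real Q)"
    by simp
  have "C' Q / (real Q + 1) \<le> (a + b * real Q + d * (real Q)\<^sup>2) / (real Q + 1)"
    using RQ R by (intro divide_right_mono C') auto
  also have "\<dots> = a * (1 / (real Q + 1)) + b * (real Q / (real Q + 1)) + d * ((real Q)\<^sup>2 / (real Q + 1))"
    by (simp add: add_divide_distrib)
  also have "\<dots> \<le> a * (1 / real R) + b * 1 + d * real Q"
  proof (intro add_mono mult_left_mono abd)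
    show "1 / (real Q + 1) \<le> 1 / real R" using RQ R by (intro divide_left_mono) auto
    show "real Q / (real Q + 1) \<le> 1" by simp
    show "(real Q)\<^sup>2 / (real Q + 1) \<le> real Q" by (simp add: field_simps power2_eq_square)
  qed
  finally have "(\<Sum>r\<in>{R<..Q}. c r / real r)
      \<le> (a * (1 / real R) + b + d * real Q) + (a * (1 / real R) + b * (1 + ln (real Q)) + d * real Q)"
    using 1 by simp
  also have "\<dots> = 2 * a / real R + b * (2 + ln (real Q)) + 2 * d * real Q"
    using R by (simp add: field_simps)
  finally show ?thesis .
qed

section \<open>Bilinear forms in arithmetic progressions\<close>

lemma farey_energy_nonneg: "farey_energy N \<gamma> r \<ge> 0"
  by (simp add: farey_energy_def sum_nonneg)

text \<open>The bound is written as a multiple of a square, using N + k^2 \<le> (sqrt N + k)^2, so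
  that the square roots produced by the Cauchy-Schwarz inequality can be taken.\<close>

lemma sum_farey_energy_le:
  assumes "1 \<le> k" "k \<le> Q" and K: "\<And>n. n \<in> {1..N} \<Longrightarrow> cmod (\<gamma> n) \<le> K" "K \<ge> 0"
  shows "(\<Sum>r\<in>{1..k}. farey_energy N \<gamma> r)
    \<le> 4 * (1 + ln (real Q)) * ((sqrt (real N) + real k) * (K * sqrt (real N)))\<^sup>2"
proof -
  define l where "l = 1 + ln (real Q)"
  have "ln (real k) \<le> ln (real Q)" using assms by simp
  moreover have "ln (real k) \<ge> 0" using assms by simp
  ultimately have l: "1 + 2 * ln (real k) \<le> 2 * l" "l \<ge> 1" by (simp_all add: l_def)
  have "{r. 1 \<le> r \<and> real r \<le> real k} = {1..k}" by auto
  then have "(\<Sum>r\<in>{1..k}. farey_energy N \<gamma> r)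
     \<le> (2 * real N + 2 * (real k)\<^sup>2 * (1 + 2 * ln (real k))) * (\<Sum>n\<in>{1..N}. (cmod (\<gamma> n))\<^sup>2)"
    using farey_large_sieve[of "real k" N \<gamma>] assms by simp
  also have "\<dots> \<le> (4 * l * (sqrt (real N) + real k)\<^sup>2) * (K\<^sup>2 * real N)"
  proof (intro mult_mono)
    have "2 * (real k)\<^sup>2 * (1 + 2 * ln (real k)) \<le> 2 * (real k)\<^sup>2 * (2 * l)" by (intro mult_left_mono l) auto
    moreover have "2 * real N * 1 \<le> 2 * real N * (2 * l)" using l by (intro mult_left_mono) auto
    moreover have "4 * l * (sqrt (real N) + real k)\<^sup>2 \<ge> 4 * l * (real N + (real k)\<^sup>2)"
      using l by (intro mult_left_mono) (auto simp: power2_sum)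
    ultimately show "2 * real N + 2 * (real k)\<^sup>2 * (1 + 2 * ln (real k)) \<le> 4 * l * (sqrt (real N) + real k)\<^sup>2"
      by (simp add: algebra_simps)
    have "(\<Sum>n\<in>{1..N}. (cmod (\<gamma> n))\<^sup>2) \<le> (\<Sum>n\<in>{1..N}. K\<^sup>2)" using K by (intro sum_mono power_mono) auto
    then show "(\<Sum>n\<in>{1..N}. (cmod (\<gamma> n))\<^sup>2) \<le> K\<^sup>2 * real N" by (simp add: mult.commute)
  qed (use l in \<open>auto intro!: sum_nonneg\<close>)
  also have "\<dots> = 4 * l * ((sqrt (real N) + real k) * (K * sqrt (real N)))\<^sup>2"
    by (simp add: power_mult_distrib)
  finally show ?thesis unfolding l_def .
qed

text \<open>After the Cauchy-Schwarz inequality over r the partial sums up to k are bounded by a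
  quadratic polynomial in k, which is the shape that \<open>weighted_sum_bound\<close> expects. Its
  constant term gains a factor R because levels up to R are left out.\<close>

lemma sum_large_levels_le:
  assumes Q: "Q \<ge> 1" and R: "R \<ge> 1"
    and \<alpha>: "\<And>n. n \<in> {1..N} \<Longrightarrow> cmod (\<alpha> n) \<le> K" and \<beta>: "\<And>n. n \<in> {1..N'} \<Longrightarrow> cmod (\<beta> n) \<le> K" and K: "K \<ge> 0"
  shows "(\<Sum>r\<in>{R<..Q}. sqrt (farey_energy N \<alpha> r) * sqrt (farey_energy N' \<beta> r) / real r)
    \<le> 8 * (1 + ln (real Q))\<^sup>2 * K\<^sup>2 * sqrt (real N) * sqrt (real N')
        * (sqrt (real N) * sqrt (real N') / real R + sqrt (real N) + sqrt (real N') + real Q)"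
proof -
  define l where "l = 1 + ln (real Q)"
  define X where "X = sqrt (real N)"
  define Y where "Y = sqrt (real N')"
  define L where "L = 4 * l * K\<^sup>2 * X * Y"
  have l: "l \<ge> 1" using Q by (simp add: l_def)
  have XY: "X \<ge> 0" "Y \<ge> 0" by (auto simp: X_def Y_def)
  have L: "L \<ge> 0" using l XY by (simp add: L_def)
  have "(\<Sum>r\<in>{R<..Q}. (sqrt (farey_energy N \<alpha> r) * sqrt (farey_energy N' \<beta> r)) / real r)
     \<le> 2 * (L * (X * Y)) / real R + (L * (X + Y)) * (2 + ln (real Q)) + 2 * L * real Q"
  proof (rule weighted_sum_bound)
    fix k assume k: "1 \<le> k" "k \<le> Q"
    have "(\<Sum>r\<in>{1..k}. sqrt (farey_energy N \<alpha> r) * sqrt (farey_energy N' \<beta> r))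
       \<le> (\<Sum>r\<in>{1..k}. \<bar>sqrt (farey_energy N \<alpha> r)\<bar> * \<bar>sqrt (farey_energy N' \<beta> r)\<bar>)"
      by (intro sum_mono) (simp add: farey_energy_nonneg)
    also have "\<dots> \<le> L2_set (\<lambda>r. sqrt (farey_energy N \<alpha> r)) {1..k} * L2_set (\<lambda>r. sqrt (farey_energy N' \<beta> r)) {1..k}"
      by (rule L2_set_mult_ineq)
    also have "\<dots> = sqrt (\<Sum>r\<in>{1..k}. farey_energy N \<alpha> r) * sqrt (\<Sum>r\<in>{1..k}. farey_energy N' \<beta> r)"
      by (simp add: L2_set_def farey_energy_nonneg)
    also have "\<dots> \<le> sqrt (4 * l * ((X + real k) * (K * X))\<^sup>2) * sqrt (4 * l * ((Y + real k) * (K * Y))\<^sup>2)"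
      unfolding l_def X_def Y_def using k K \<alpha> \<beta>
      by (intro mult_mono real_sqrt_le_mono sum_farey_energy_le) (auto intro!: sum_nonneg farey_energy_nonneg)
    also have "\<dots> = (4 * l) * (((X + real k) * (K * X)) * ((Y + real k) * (K * Y)))"
    proof -
      define x where "x = (X + real k) * (K * X)"
      define y where "y = (Y + real k) * (K * Y)"
      have xy: "x \<ge> 0" "y \<ge> 0" using XY K by (simp_all add: x_def y_def)
      have "sqrt (4 * l * x\<^sup>2) * sqrt (4 * l * y\<^sup>2) = (sqrt (4 * l) * sqrt (4 * l)) * (x * y)"
        unfolding real_sqrt_mult real_sqrt_abs using xy by simp
      also have "sqrt (4 * l) * sqrt (4 * l) = 4 * l" using l by simp
      finally show ?thesis unfolding x_def y_def .
    qed
    also have "\<dots> = L * (X * Y) + L * (X + Y) * real k + L * (real k)\<^sup>2"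
      by (simp add: L_def algebra_simps power2_eq_square)
    finally show "(\<Sum>r\<in>{1..k}. sqrt (farey_energy N \<alpha> r) * sqrt (farey_energy N' \<beta> r))
       \<le> L * (X * Y) + L * (X + Y) * real k + L * (real k)\<^sup>2" .
  qed (use L XY R in \<open>auto simp: farey_energy_nonneg\<close>)
  also have "\<dots> \<le> L * (2 * l * (X * Y / real R + X + Y + real Q))"
  proof -
    have "2 * (X * Y / real R) \<le> 2 * l * (X * Y / real R)" using l XY by (intro mult_right_mono) auto
    moreover have "(X + Y) * (2 + ln (real Q)) \<le> (X + Y) * (2 * l)" using l XY by (intro mult_left_mono) (auto simp: l_def)
    moreover have "2 * real Q \<le> 2 * l * real Q" using l by (intro mult_right_mono) auto
    ultimately have "2 * (X * Y / real R) + (X + Y) * (2 + ln (real Q)) + 2 * real Q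
      \<le> 2 * l * (X * Y / real R + X + Y + real Q)" by (simp add: algebra_simps)
    then have "L * (2 * (X * Y / real R) + (X + Y) * (2 + ln (real Q)) + 2 * real Q)
      \<le> L * (2 * l * (X * Y / real R + X + Y + real Q))" using L by (rule mult_left_mono)
    then show ?thesis by (simp add: algebra_simps)
  qed
  also have "\<dots> = 8 * l\<^sup>2 * K\<^sup>2 * X * Y * (X * Y / real R + X + Y + real Q)"
    by (simp add: L_def power2_eq_square)
  finally show ?thesis unfolding l_def X_def Y_def by simp
qed

text \<open>Moduli are written as q = r s with r the level, and
  \<open>totient r * totient s \<le> totient (r * s)\<close> leaves the weight 1 /
  \<open>totient s\<close>, so that the sum over s costs only logarithms. For fixed s the levels
  above R go to the large sieve. At the levels up to R, \<alpha> is estimated trivially and \<beta>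
  by \<delta>; the cube of R counts the levels, the size of the totient of r, and the factor r from
  \<open>coprime_restricted_discrepancy\<close>.\<close>

lemma bilinear_bound:
  fixes \<alpha> \<beta> :: "nat \<Rightarrow> complex" and a :: "nat \<Rightarrow> nat"
  defines "l Q \<equiv> 1 + ln (real Q)"
  assumes Q: "Q \<ge> 1" and R: "R \<ge> 1" and D: "D \<ge> 1"
    and \<alpha>: "\<And>n. n \<in> {1..N} \<Longrightarrow> cmod (\<alpha> n) \<le> K" and \<beta>: "\<And>n. n \<in> {1..N'} \<Longrightarrow> cmod (\<beta> n) \<le> K" and K: "K \<ge> 0"
    and \<delta>: "\<And>m a. m > 0 \<Longrightarrow> coprime a m \<Longrightarrow> cmod (\<Sum>v\<in>{1..N'}. \<beta> v * ap_kernel m (int a) v) \<le> \<delta>"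
    and a: "\<And>q. q \<in> {1..Q} \<Longrightarrow> coprime (a q) q"
  shows "(\<Sum>q\<in>{1..Q}. cmod (\<Sum>u\<in>{1..N}. \<Sum>v\<in>{1..N'}. \<alpha> u * \<beta> v * ap_kernel q (int (a q)) (u * v)))
    \<le> 16 * (l Q) ^ 4 * K\<^sup>2 * sqrt (real N) * sqrt (real N')
        * (sqrt (real N) * sqrt (real N') / real R + sqrt (real N) + sqrt (real N') + real Q)
      + 2 * (l Q)\<^sup>2 * real R ^ 3 * K * real N * (real D ^ 3 * \<delta> + K * real N' / real D)"
proof -
  define Z where "Z s = (\<Sum>d | d dvd s \<and> d > D. 1 / real d)" for s
  define M where "M s = real R * real D ^ 3 * \<delta> + K * (real N' * Z s)" for s
  define B where "B = 8 * (l Q)\<^sup>2 * K\<^sup>2 * sqrt (real N) * sqrt (real N')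
        * (sqrt (real N) * sqrt (real N') / real R + sqrt (real N) + sqrt (real N') + real Q)"
  define g where "g q r = sqrt (sq_norm q (level_part q r (residue_sum N \<alpha> q)))
         * sqrt (sq_norm q (level_part q r (residue_sum N' \<beta> q)))" for q r
  \<comment> \<open>A nonnegative bound for \<open>g (r * s) r\<close>. It allows the sum over q and
    the divisors r of q to be enlarged to a sum over independent r and s up to Q.\<close>
  define G where "G s r = 1 / real (totient s) * (if r \<le> R then real R * (K * real N) * M s
      else sqrt (farey_energy N (restrict_coprime s \<alpha>) r) * sqrt (farey_energy N' (restrict_coprime s \<beta>) r) / real r)" for s r
  have \<delta>0: "\<delta> \<ge> 0" using \<delta>[of 1 1] norm_ge_zero order_trans by (metis coprime_1_left zero_less_one)
  have Z0: "Z s \<ge> 0" for s unfolding Z_def by (intro sum_nonneg) auto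
  have M0: "M s \<ge> 0" for s using \<delta>0 K Z0 by (simp add: M_def)
  have G0: "G s r \<ge> 0" for s r using K M0 by (auto simp: G_def farey_energy_nonneg)
  have l1: "l Q \<ge> 1" using Q by (simp add: l_def)
  have gG: "g (r * s) r \<le> G s r" if "r > 1" "s \<ge> 1" for r s
  proof -
    let ?q = "r * s"
    have q: "?q > 0" using that by simp
    have t: "real (totient r) > 0" "real (totient s) > 0" "real (totient ?q) > 0" using that by auto
    have "totient r * totient s \<le> totient ?q"
    proof -
      have "totient r * totient s * totient (gcd r s) \<le> totient r * totient s * gcd r s"
        using totient_le by (intro mult_left_mono) auto
      also have "\<dots> = totient ?q * totient (gcd r s)" using totient_gcd[of r s] by simp
      finally show ?thesis using that by simp
    qed
    then have "real (totient r) * real (totient s) \<le> real (totient ?q)" by (metis of_nat_le_iff of_nat_mult)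
    then have tt: "real (totient r) / real (totient ?q) \<le> 1 / real (totient s)"
      using t by (simp add: field_simps)
    show ?thesis
    proof (cases "r \<le> R")
      case True
      have "sq_norm ?q (level_part ?q r (residue_sum N \<alpha> ?q)) \<le> (real (totient r))\<^sup>2 / real (totient ?q) * (K * real N)\<^sup>2"
        by (rule sq_norm_level_part_trivial[OF q refl \<alpha> K])
      moreover have "sq_norm ?q (level_part ?q r (residue_sum N' \<beta> ?q)) \<le> (real (totient r))\<^sup>2 / real (totient ?q) * (M s)\<^sup>2"
      proof (rule sq_norm_level_part_small[OF q refl])
        fix c assume c: "coprime c r"
        have "cmod (\<Sum>n\<in>{1..N'}. restrict_coprime s \<beta> n * ap_kernel r (int c) n)
          \<le> real r * real D ^ 3 * \<delta> + K * (\<Sum>d | d dvd s \<and> d > D. real N' / real d)"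
          using that by (intro coprime_restricted_discrepancy[OF \<delta> \<beta> K _ _ c]) auto
        also have "\<dots> \<le> M s" unfolding M_def Z_def using True \<delta>0
          by (intro add_mono mult_right_mono) (auto simp: sum_distrib_left)
        finally show "cmod (\<Sum>n\<in>{1..N'}. restrict_coprime s \<beta> n * ap_kernel r (int c) n) \<le> M s" .
      qed (use that in simp)
      ultimately have "g ?q r \<le> sqrt ((real (totient r))\<^sup>2 / real (totient ?q) * (K * real N)\<^sup>2) * sqrt ((real (totient r))\<^sup>2 / real (totient ?q) * (M s)\<^sup>2)"
        unfolding g_def by (intro mult_mono real_sqrt_le_mono) (auto simp: sq_norm_nonneg)
      also have "\<dots> = (sqrt ((real (totient r))\<^sup>2 / real (totient ?q)))\<^sup>2 * ((K * real N) * M s)"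
        using K M0[of s] by (simp only: real_sqrt_mult real_sqrt_abs power2_eq_square abs_mult) (simp add: mult_ac)
      also have "\<dots> = real (totient r) / real (totient ?q) * (real (totient r) * ((K * real N) * M s))"
        by (simp add: power2_eq_square)
      also have "\<dots> \<le> 1 / real (totient s) * (real R * ((K * real N) * M s))"
      proof (rule mult_mono[OF tt])
        have "real (totient r) \<le> real R" using totient_le[of r] True by linarith
        then show "real (totient r) * ((K * real N) * M s) \<le> real R * ((K * real N) * M s)"
          using K M0[of s] by (intro mult_right_mono) auto
      qed (use K M0[of s] in auto)
      also have "\<dots> = G s r" using True by (simp add: G_def)
      finally show ?thesis .
    next
      case False
      define w where "w = real (totient r) / real (totient ?q) * (1 / real r)"
      have w0: "w \<ge> 0" by (simp add: w_def)
      have "g ?q r \<le> sqrt (w * farey_energy N (restrict_coprime s \<alpha>) r) * sqrt (w * farey_energy N' (restrict_coprime s \<beta>) r)"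
        unfolding g_def w_def
        by (intro mult_mono real_sqrt_le_mono sq_norm_level_part_large[OF q refl])
           (auto simp: sq_norm_nonneg farey_energy_nonneg)
      also have "\<dots> = w * (sqrt (farey_energy N (restrict_coprime s \<alpha>) r) * sqrt (farey_energy N' (restrict_coprime s \<beta>) r))"
      proof -
        have "sqrt w * sqrt w = w" using w0 by simp
        then have "(sqrt w * x) * (sqrt w * y) = w * (x * y)" for x y by (metis mult.assoc mult.left_commute)
        then show ?thesis unfolding real_sqrt_mult .
      qed
      also have "\<dots> \<le> (1 / real (totient s) * (1 / real r)) * (sqrt (farey_energy N (restrict_coprime s \<alpha>) r) * sqrt (farey_energy N' (restrict_coprime s \<beta>) r))"
        unfolding w_def by (intro mult_right_mono tt) (auto simp: farey_energy_nonneg)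
      also have "\<dots> = G s r" using False by (simp add: G_def)
      finally show ?thesis .
    qed
  qed
  have "(\<Sum>q\<in>{1..Q}. cmod (\<Sum>u\<in>{1..N}. \<Sum>v\<in>{1..N'}. \<alpha> u * \<beta> v * ap_kernel q (int (a q)) (u * v)))
     \<le> (\<Sum>q\<in>{1..Q}. \<Sum>r | r dvd q \<and> r \<noteq> 1. g q r)"
    unfolding g_def by (intro sum_mono bilinear_modulus_bound a) auto
  also have "\<dots> = (\<Sum>(q, r)\<in>Sigma {1..Q} (\<lambda>q. {r. r dvd q \<and> r \<noteq> 1}). g q r)"
    by (subst sum.Sigma) auto
  also have "\<dots> \<le> (\<Sum>(s, r)\<in>{1..Q} \<times> {1<..Q}. G s r)"
  proof (rule sum_le_included[where i = "\<lambda>(s, r). (r * s, r)"])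
    show "finite (Sigma {1..Q} (\<lambda>q. {r. r dvd q \<and> r \<noteq> 1}))" by (intro finite_SigmaI) auto
    show "\<forall>x\<in>Sigma {1..Q} (\<lambda>q. {r. r dvd q \<and> r \<noteq> 1}). \<exists>y\<in>{1..Q} \<times> {1<..Q}.
        (case y of (s, r) \<Rightarrow> (r * s, r)) = x \<and> (case x of (q, r) \<Rightarrow> g q r) \<le> (case y of (s, r) \<Rightarrow> G s r)"
    proof clarify
      fix q r assume h: "q \<in> {1..Q}" "r dvd q" "r \<noteq> 1"
      then obtain s where s: "q = r * s" by blast
      have s1: "s \<ge> 1" "r \<ge> 1" using s h by (cases s; cases r; auto)+
      have "r \<le> q" "s \<le> q" using h s dvd_imp_le[of r q] dvd_imp_le[of s q] by auto
      then have "(s, r) \<in> {1..Q} \<times> {1<..Q}" using h s1 by auto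
      moreover have "g q r \<le> G s r" unfolding s using s1 h by (intro gG) auto
      ultimately show "\<exists>y\<in>{1..Q} \<times> {1<..Q}. (case y of (s, r) \<Rightarrow> (r * s, r)) = (q, r) \<and> g q r \<le> (case y of (s, r) \<Rightarrow> G s r)"
        using s by (intro bexI[of _ "(s, r)"]) auto
    qed
  qed (use G0 in auto)
  also have "\<dots> = (\<Sum>s\<in>{1..Q}. \<Sum>r\<in>{1<..Q}. G s r)" by (rule sum.cartesian_product[symmetric])
  also have "\<dots> \<le> (\<Sum>s\<in>{1..Q}. 1 / real (totient s) * (real R * (real R * (K * real N) * M s) + B))"
  proof (rule sum_mono)
    fix s assume s: "s \<in> {1..Q}"
    have "(\<Sum>r\<in>{1<..Q}. G s r) \<le> (\<Sum>r\<in>{1..R} \<union> {R<..Q}. G s r)"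
      using G0 by (intro sum_mono2) auto
    also have "\<dots> = (\<Sum>r\<in>{1..R}. G s r) + (\<Sum>r\<in>{R<..Q}. G s r)" by (intro sum.union_disjoint) auto
    also have "(\<Sum>r\<in>{1..R}. G s r) = real R * (1 / real (totient s) * (real R * (K * real N) * M s))"
      by (simp add: G_def)
    also have "(\<Sum>r\<in>{R<..Q}. G s r) = 1 / real (totient s) * (\<Sum>r\<in>{R<..Q}.
       sqrt (farey_energy N (restrict_coprime s \<alpha>) r) * sqrt (farey_energy N' (restrict_coprime s \<beta>) r) / real r)"
      unfolding sum_distrib_left by (intro sum.cong) (auto simp: G_def)
    also have "\<dots> \<le> 1 / real (totient s) * B"
      unfolding B_def l_def
    proof (intro mult_left_mono sum_large_levels_le Q R K)
      show "cmod (restrict_coprime s \<alpha> n) \<le> K" if "n \<in> {1..N}" for n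
        using \<alpha>[OF that] K by (simp add: restrict_coprime_def)
      show "cmod (restrict_coprime s \<beta> n) \<le> K" if "n \<in> {1..N'}" for n
        using \<beta>[OF that] K by (simp add: restrict_coprime_def)
    qed simp
    finally show "(\<Sum>r\<in>{1<..Q}. G s r) \<le> 1 / real (totient s) * (real R * (real R * (K * real N) * M s) + B)"
      by (simp add: distrib_left mult_ac)
  qed
  also have "\<dots> = (B + real R ^ 3 * (K * real N) * (real D ^ 3 * \<delta>)) * (\<Sum>s\<in>{1..Q}. 1 / real (totient s))
      + real R ^ 2 * (K * real N) * (K * real N') * (\<Sum>s\<in>{1..Q}. 1 / real (totient s) * Z s)"
    unfolding M_def sum_distrib_left sum.distrib[symmetric]
    by (intro sum.cong refl) (simp add: algebra_simps power2_eq_square power3_eq_cube add_divide_distrib)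
  also have "\<dots> \<le> (B + real R ^ 3 * (K * real N) * (real D ^ 3 * \<delta>)) * (2 * (l Q)\<^sup>2)
      + real R ^ 3 * (K * real N) * (K * real N') * (2 * (l Q)\<^sup>2 / real D)"
  proof (intro add_mono mult_mono)
    show "(\<Sum>s\<in>{1..Q}. 1 / real (totient s)) \<le> 2 * (l Q)\<^sup>2" unfolding l_def by (rule sum_inverse_totient_le[OF Q])
    show "(\<Sum>s\<in>{1..Q}. 1 / real (totient s) * Z s) \<le> 2 * (l Q)\<^sup>2 / real D"
      unfolding l_def Z_def by (rule sum_divisor_tail_le[OF Q D])
    show "real R ^ 2 \<le> real R ^ 3" using R by (intro power_increasing) auto
    show "0 \<le> B + real R ^ 3 * (K * real N) * (real D ^ 3 * \<delta>)"
      using K \<delta>0 by (auto simp: B_def intro!: add_nonneg_nonneg mult_nonneg_nonneg)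
  qed (use K Z0 \<delta>0 in \<open>auto intro!: sum_nonneg mult_nonneg_nonneg\<close>)
  also have "\<dots> = 2 * (l Q)\<^sup>2 * B + 2 * (l Q)\<^sup>2 * real R ^ 3 * K * real N * (real D ^ 3 * \<delta> + K * real N' / real D)"
    by (simp add: algebra_simps)
  also have "2 * (l Q)\<^sup>2 * B = 16 * (l Q) ^ 4 * K\<^sup>2 * sqrt (real N) * sqrt (real N')
        * (sqrt (real N) * sqrt (real N') / real R + sqrt (real N) + sqrt (real N') + real Q)"
    unfolding B_def by (simp add: power4_eq_xxxx power2_eq_square)
  finally show ?thesis .
qed

section \<open>Levels of distribution\<close>

definition nat_discrepancy :: "(nat \<Rightarrow> complex) \<Rightarrow> nat \<Rightarrow> nat \<Rightarrow> int \<Rightarrow> complex" where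
  "nat_discrepancy h N q a = (\<Sum>n\<in>{1..N}. h n * ap_kernel q a n)"

lemma real_le_iff_le_floor: "n \<ge> 1 \<Longrightarrow> real n \<le> x \<longleftrightarrow> n \<le> nat \<lfloor>x\<rfloor>"
  by (cases "x \<ge> 0") (auto simp: le_nat_floor, linarith+)

lemma AP_discrepancy_eq: "AP_discrepancy h x q a = nat_discrepancy h (nat \<lfloor>x\<rfloor>) q a"
proof -
  have 1: "{n. n \<ge> 1 \<and> real n \<le> x \<and> [int n = a] (mod int q)} = {n\<in>{1..nat \<lfloor>x\<rfloor>}. [int n = a] (mod int q)}"
    using real_le_iff_le_floor by auto
  have 2: "{n. n \<ge> 1 \<and> real n \<le> x \<and> coprime n q} = {n\<in>{1..nat \<lfloor>x\<rfloor>}. coprime n q}"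
    using real_le_iff_le_floor by auto
  have "AP_discrepancy h x q a = (\<Sum>n\<in>{1..nat \<lfloor>x\<rfloor>}. if [int n = a] (mod int q) then h n else 0)
     - 1 / of_nat (totient q) * (\<Sum>n\<in>{1..nat \<lfloor>x\<rfloor>}. if coprime n q then h n else 0)"
    unfolding AP_discrepancy_def 1 2 by (simp only: sum.inter_filter finite_atLeastAtMost)
  also have "\<dots> = nat_discrepancy h (nat \<lfloor>x\<rfloor>) q a"
    unfolding nat_discrepancy_def ap_kernel_def sum_distrib_left sum_subtractf[symmetric]
    by (intro sum.cong refl) (auto simp: right_diff_distrib)
  finally show ?thesis .
qed

lemma ap_kernel_cong: "[a = b] (mod int q) \<Longrightarrow> ap_kernel q a n = ap_kernel q b n"
  by (simp add: ap_kernel_def unique_euclidean_semiring_class.cong_def)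

lemma ap_kernel_mult_not_coprime:
  assumes "coprime a q" "\<not> coprime u q"
  shows "ap_kernel q (int a) (u * v) = 0"
proof -
  have "\<not> coprime (u * v) q" using assms by simp
  moreover from this have "\<not> [u * v = a] (mod q)"
    using assms(1) by (metis cong_imp_coprime cong_sym)
  then have "\<not> [int (u * v) = int a] (mod int q)" by (simp only: cong_int_iff not_False_eq_True)
  ultimately show ?thesis unfolding ap_kernel_def by (simp only: if_False diff_self)
qed

text \<open>Division of the residue by u. For fixed u, a sum over v is thereby again a discrepancy
  modulo q, but for a residue that depends on u; the maximum over all residues in the hypotheses
  takes care of that.\<close>

lemma ap_kernel_mult_coprime:
  assumes "coprime a q" "coprime u q" "q > 0"
  shows "\<exists>a'. coprime a' q \<and> (\<forall>v. ap_kernel q (int a) (u * v) = ap_kernel q (int a') v)"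
proof -
  obtain y where y: "[u * y = 1] (mod q)" using cong_solve_coprime_nat[OF assms(2)] by auto
  define a' where "a' = y * a"
  have ua: "[u * a' = a] (mod q)"
    using cong_mult[OF y cong_refl[of a]] by (simp add: a'_def mult.assoc)
  have "coprime (u * a') q" using ua assms(1) by (metis cong_imp_coprime cong_sym)
  then have "coprime a' q" by simp
  moreover have "ap_kernel q (int a) (u * v) = ap_kernel q (int a') v" for v
  proof -
    have "[u * v = a] (mod q) \<longleftrightarrow> [u * v = u * a'] (mod q)" using ua by (meson cong_sym cong_trans)
    also have "\<dots> \<longleftrightarrow> [v = a'] (mod q)" using assms(2) by (simp add: cong_mult_lcancel_nat)
    finally have "[int (u * v) = int a] (mod int q) \<longleftrightarrow> [int v = int a'] (mod int q)"
      by (simp only: cong_int_iff)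
    moreover have "coprime (u * v) q \<longleftrightarrow> coprime v q" using assms(2) by simp
    ultimately show ?thesis by (simp only: ap_kernel_def)
  qed
  ultimately show ?thesis by blast
qed

lemma card_residue_interval:
  assumes "q > 0"
  shows "real (card {n\<in>{M<..N}. [int n = a] (mod int q)}) \<le> real (N - M) / real q + 1"
proof (cases "M < N")
  case True
  let ?S = "{n\<in>{M<..N}. [int n = a] (mod int q)}"
  have "inj_on (\<lambda>n. (n - M - 1) div q) ?S"
  proof (rule inj_onI)
    fix n n' assume n: "n \<in> ?S" "n' \<in> ?S" and e: "(n - M - 1) div q = (n' - M - 1) div q"
    have "[n = n'] (mod q)" using n cong_int_iff by (metis (no_types, lifting) cong_sym cong_trans mem_Collect_eq)
    moreover have "n = (M + 1) + (n - M - 1)" "n' = (M + 1) + (n' - M - 1)" using n by auto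
    ultimately have "[n - M - 1 = n' - M - 1] (mod q)" by (metis cong_add_lcancel_nat)
    then have "(n - M - 1) mod q = (n' - M - 1) mod q" by (simp add: unique_euclidean_semiring_class.cong_def)
    with e have "n - M - 1 = n' - M - 1" by (metis div_mult_mod_eq)
    then show "n = n'" using n by auto
  qed
  then have "card ?S = card ((\<lambda>n. (n - M - 1) div q) ` ?S)" by (simp add: card_image)
  also have "\<dots> \<le> card {..(N - M) div q}"
    by (intro card_mono) (auto intro!: div_le_mono)
  finally have "card ?S \<le> (N - M) div q + 1" by simp
  then have "real (card ?S) \<le> real ((N - M) div q) + 1" by linarith
  also have "real ((N - M) div q) \<le> real (N - M) / real q"
  proof -
    have "real ((N - M) div q) * real q \<le> real (N - M)" by (metis div_times_less_eq_dividend of_nat_le_iff of_nat_mult)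
    then show ?thesis using assms by (simp add: field_simps)
  qed
  finally show ?thesis by simp
next
  case False
  then have "{n\<in>{M<..N}. [int n = a] (mod int q)} = {}" by auto
  then show ?thesis by (simp only: card.empty) simp
qed

lemma card_coprime_interval:
  assumes "q > 0"
  shows "real (card {n\<in>{M<..N}. coprime n q}) \<le> real (totient q) * (real (N - M) / real q + 1)"
proof -
  have "{n\<in>{M<..N}. coprime n q} \<subseteq> (\<Union>b\<in>totatives q. {n\<in>{M<..N}. [int n = int b] (mod int q)})"
  proof
    fix n assume n: "n \<in> {n\<in>{M<..N}. coprime n q}"
    then obtain b where "b \<in> totatives q" "[b = n] (mod q)" using totatives_rep_ex[OF assms] by blast
    then show "n \<in> (\<Union>b\<in>totatives q. {n\<in>{M<..N}. [int n = int b] (mod int q)})"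
      using n by (auto simp: cong_int_iff cong_sym_eq)
  qed
  then have "card {n\<in>{M<..N}. coprime n q} \<le> (\<Sum>b\<in>totatives q. card {n\<in>{M<..N}. [int n = int b] (mod int q)})"
    by (intro order_trans[OF card_mono card_UN_le]) auto
  then have "real (card {n\<in>{M<..N}. coprime n q}) \<le> (\<Sum>b\<in>totatives q. real (card {n\<in>{M<..N}. [int n = int b] (mod int q)}))"
    by (simp only: of_nat_le_iff flip: of_nat_sum)
  also have "\<dots> \<le> (\<Sum>b\<in>totatives q. real (N - M) / real q + 1)"
    by (intro sum_mono card_residue_interval assms)
  finally show ?thesis by (simp add: totient_def)
qed

lemma sum_ap_kernel_interval_le:
  assumes "q > 0"
  shows "(\<Sum>n\<in>{M<..N}. cmod (ap_kernel q a n)) \<le> 2 * (real (N - M) / real q + 1)"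
proof -
  have t: "real (totient q) > 0" using assms by simp
  have "(\<Sum>n\<in>{M<..N}. cmod (ap_kernel q a n)) \<le> (\<Sum>n\<in>{M<..N}. (if [int n = a] (mod int q) then 1 else 0)
     + (if coprime n q then 1 / real (totient q) else 0))"
    by (intro sum_mono cmod_ap_kernel_le assms)
  also have "\<dots> = real (card {n\<in>{M<..N}. [int n = a] (mod int q)})
     + real (card {n\<in>{M<..N}. coprime n q}) * (1 / real (totient q))"
    by (simp add: sum.distrib flip: sum.inter_filter)
  also have "\<dots> \<le> (real (N - M) / real q + 1) + (real (totient q) * (real (N - M) / real q + 1)) * (1 / real (totient q))"
    by (intro add_mono mult_right_mono card_residue_interval card_coprime_interval assms) auto
  also have "\<dots> = 2 * (real (N - M) / real q + 1)" using t by simp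
  finally show ?thesis .
qed

section \<open>Discrepancies summed over the moduli\<close>

definition bv_sum :: "(nat \<Rightarrow> complex) \<Rightarrow> nat \<Rightarrow> nat \<Rightarrow> real" where
  "bv_sum h N Q = (\<Sum>q\<in>{1..Q}. Max {cmod (nat_discrepancy h N q a) | a::int. coprime a (int q)})"

lemma nat_discrepancy_values:
  assumes "q \<ge> 1"
  shows "finite {cmod (nat_discrepancy h N q a) | a::int. coprime a (int q)}"
    and "{cmod (nat_discrepancy h N q a) | a::int. coprime a (int q)} \<noteq> {}"
  using AP_discrepancy_values[OF assms, of h "real N"] unfolding AP_discrepancy_eq by simp_all

lemma nat_discrepancy_le_Max:
  assumes "q \<ge> 1" "coprime a (int q)"
  shows "cmod (nat_discrepancy h N q a) \<le> Max {cmod (nat_discrepancy h N q a) | a::int. coprime a (int q)}"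
  using assms by (intro Max_ge nat_discrepancy_values) auto

lemma Max_nat_discrepancy_nonneg:
  assumes "q \<ge> 1"
  shows "0 \<le> Max {cmod (nat_discrepancy h N q a) | a::int. coprime a (int q)}"
  using nat_discrepancy_le_Max[OF assms, of 1 h N] by (rule order_trans[rotated]) simp_all

lemma bv_sum_nonneg: "0 \<le> bv_sum h N Q"
  unfolding bv_sum_def by (intro sum_nonneg Max_nat_discrepancy_nonneg) simp

lemma sum_nat_discrepancy_le_bv_sum:
  assumes "\<And>q. q \<in> {1..Q} \<Longrightarrow> coprime (a q) (int q)"
  shows "(\<Sum>q\<in>{1..Q}. cmod (nat_discrepancy h N q (a q))) \<le> bv_sum h N Q"
  unfolding bv_sum_def using assms by (intro sum_mono nat_discrepancy_le_Max) auto

text \<open>The maxima are attained, and by periodicity at natural numbers. Together with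
  \<open>bv_sum_le\<close> this replaces the maxima by an arbitrary choice of residues
  \<open>a q\<close>, for which the estimates are proved.\<close>

lemma bv_sum_attained:
  obtains a :: "nat \<Rightarrow> nat" where "\<And>q. q \<in> {1..Q} \<Longrightarrow> coprime (a q) q"
    "bv_sum h N Q = (\<Sum>q\<in>{1..Q}. cmod (nat_discrepancy h N q (int (a q))))"
proof -
  have "\<exists>b::nat. coprime b q \<and> Max {cmod (nat_discrepancy h N q a) | a::int. coprime a (int q)} = cmod (nat_discrepancy h N q (int b))"
    if "q \<in> {1..Q}" for q
  proof -
    have q: "q \<ge> 1" using that by simp
    from Max_in[OF nat_discrepancy_values[OF q]]
    obtain a :: int where a: "coprime a (int q)"
      "Max {cmod (nat_discrepancy h N q a) | a::int. coprime a (int q)} = cmod (nat_discrepancy h N q a)" by auto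
    define b where "b = nat (a mod int q)"
    have b: "int b = a mod int q" using q by (simp add: b_def)
    have "coprime (int b) (int q)" unfolding b using a(1) q by simp
    then have "coprime b q" by simp
    moreover have "[int b = a] (mod int q)" unfolding b by simp
    then have "nat_discrepancy h N q (int b) = nat_discrepancy h N q a"
      unfolding nat_discrepancy_def by (intro sum.cong refl arg_cong2[where f = "(*)"] ap_kernel_cong)
    ultimately show ?thesis using a(2) by auto
  qed
  then have "\<forall>q\<in>{1..Q}. \<exists>b. coprime b q \<and>
     Max {cmod (nat_discrepancy h N q a) | a::int. coprime a (int q)} = cmod (nat_discrepancy h N q (int b))" by blast
  from bchoice[OF this] obtain a :: "nat \<Rightarrow> nat" where a: "\<forall>q\<in>{1..Q}. coprime (a q) q \<and>
     Max {cmod (nat_discrepancy h N q a) | a::int. coprime a (int q)} = cmod (nat_discrepancy h N q (int (a q)))" ..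
  show ?thesis
  proof (rule that[of a])
    show "coprime (a q) q" if "q \<in> {1..Q}" for q using a that by blast
    show "bv_sum h N Q = (\<Sum>q\<in>{1..Q}. cmod (nat_discrepancy h N q (int (a q))))"
      unfolding bv_sum_def using a by (intro sum.cong refl) blast
  qed
qed

lemma bv_sum_le:
  assumes "\<And>a :: nat \<Rightarrow> nat. (\<And>q. q \<in> {1..Q} \<Longrightarrow> coprime (a q) q)
    \<Longrightarrow> (\<Sum>q\<in>{1..Q}. cmod (nat_discrepancy h N q (int (a q)))) \<le> T"
  shows "bv_sum h N Q \<le> T"
  by (rule bv_sum_attained[of Q h N]) (use assms in auto)

lemma bv_sum_mono: "Q \<le> Q' \<Longrightarrow> bv_sum h N Q \<le> bv_sum h N Q'"
  unfolding bv_sum_def by (intro sum_mono2) (auto intro!: Max_nat_discrepancy_nonneg)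

lemma nat_discrepancy_trivial:
  assumes "q > 0" and K: "\<And>n. n \<in> {1..N} \<Longrightarrow> cmod (h n) \<le> K" "K \<ge> 0"
  shows "cmod (nat_discrepancy h N q a) \<le> 2 * K * (real N / real q + 1)"
proof -
  have "cmod (nat_discrepancy h N q a) \<le> (\<Sum>n\<in>{1..N}. K * cmod (ap_kernel q a n))"
    unfolding nat_discrepancy_def
    by (intro order_trans[OF norm_sum] sum_mono) (auto simp: norm_mult intro!: mult_right_mono K)
  also have "{1..N} = {0<..N}" by auto
  also have "(\<Sum>n\<in>{0<..N}. K * cmod (ap_kernel q a n)) = K * (\<Sum>n\<in>{0<..N}. cmod (ap_kernel q a n))"
    by (simp add: sum_distrib_left)
  also have "\<dots> \<le> K * (2 * (real (N - 0) / real q + 1))"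
    by (intro mult_left_mono sum_ap_kernel_interval_le assms)
  finally show ?thesis by (simp add: mult_ac)
qed

lemma bv_sum_trivial:
  assumes K: "\<And>n. n \<in> {1..N} \<Longrightarrow> cmod (h n) \<le> K" "K \<ge> 0" and Q: "Q \<ge> 1"
  shows "bv_sum h N Q \<le> 2 * K * (real N * (1 + ln (real Q)) + real Q)"
proof (rule bv_sum_le)
  fix a :: "nat \<Rightarrow> nat"
  have "(\<Sum>q\<in>{1..Q}. cmod (nat_discrepancy h N q (int (a q)))) \<le> (\<Sum>q\<in>{1..Q}. 2 * K * (real N * (1 / real q) + 1))"
    using nat_discrepancy_trivial[OF _ K] by (intro sum_mono) auto
  also have "\<dots> = 2 * K * (real N * (\<Sum>q\<in>{1..Q}. 1 / real q) + real Q)"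
    by (simp only: sum_distrib_left[symmetric] sum.distrib) simp
  also have "\<dots> \<le> 2 * K * (real N * (1 + ln (real Q)) + real Q)"
    using K sum_inverse_le_ln[OF Q] by (intro mult_left_mono add_mono) auto
  finally show "(\<Sum>q\<in>{1..Q}. cmod (nat_discrepancy h N q (int (a q)))) \<le> 2 * K * (real N * (1 + ln (real Q)) + real Q)" .
qed

lemma bv_sum_0 [simp]: "bv_sum h N 0 = 0"
  by (simp add: bv_sum_def)

text \<open>
  The estimate of the Bombieri-Vinogradov Hypothesis for the single exponent \<open>k\<close>, which may be
  negative, and for large \<open>x\<close> only.
\<close>

definition bv_level :: "(nat \<Rightarrow> complex) \<Rightarrow> real \<Rightarrow> bool" where
  "bv_level h k \<longleftrightarrow> (\<exists>m::nat. \<exists>C. \<forall>\<^sub>F x in at_top. \<forall>Q::nat.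
     real Q \<le> sqrt x / ln x ^ m \<longrightarrow> bv_sum h (nat \<lfloor>x\<rfloor>) Q \<le> C * (x / ln x powr k))"

text \<open>No upper limit is set for q: the removal of coprimality conditions passes to the larger
  moduli \<open>r * e\<close>.\<close>

definition sw_bound :: "(nat \<Rightarrow> complex) \<Rightarrow> bool" where
  "sw_bound h \<longleftrightarrow> (\<forall>k::nat. \<exists>C. \<forall>\<^sub>F x in at_top. \<forall>q a.
     q > 0 \<longrightarrow> coprime a q \<longrightarrow> cmod (nat_discrepancy h (nat \<lfloor>x\<rfloor>) q (int a)) \<le> C * (x / ln x ^ k))"

text \<open>The common majorant of the functions in question: members of \<open>class_C\<close> are
  bounded by 1, and \<open>Lambda_of f\<close> and f times the logarithm are bounded by
  \<open>ln n\<close>.\<close>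

definition log_bounded :: "(nat \<Rightarrow> complex) \<Rightarrow> bool" where
  "log_bounded h \<longleftrightarrow> (\<forall>n\<ge>1. cmod (h n) \<le> 1 + ln (real n))"

lemma log_boundedD:
  assumes "log_bounded h" "n \<in> {1..N}" "real N \<le> x"
  shows "cmod (h n) \<le> 1 + ln x"
proof -
  have "cmod (h n) \<le> 1 + ln (real n)" using assms by (auto simp: log_bounded_def)
  also have "\<dots> \<le> 1 + ln x" using assms by (auto intro!: add_left_mono)
  finally show ?thesis .
qed

lemma siegel_walfisz_imp_sw_bound:
  assumes "siegel_walfisz_crit h"
  shows "sw_bound h"
  unfolding sw_bound_def
proof
  fix k :: nat
  \<comment> \<open>The exponent k + 1 is positive also for k = 0, as the criterion demands.\<close>
  obtain C where C: "\<And>x q a. x \<ge> 2 \<Longrightarrow> q \<ge> 1 \<Longrightarrow> coprime a (int q) \<Longrightarrow>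
      cmod (AP_discrepancy h x q a) \<le> C * (x / ln x powr (real k + 1))"
    using assms unfolding siegel_walfisz_crit_def by (metis add_nonneg_pos of_nat_0_le_iff zero_less_one)
  show "\<exists>C. \<forall>\<^sub>F x in at_top. \<forall>q a. q > 0 \<longrightarrow> coprime a q \<longrightarrow>
      cmod (nat_discrepancy h (nat \<lfloor>x\<rfloor>) q (int a)) \<le> C * (x / ln x ^ k)"
  proof (intro exI[of _ "max C 0"], use eventually_ge_at_top[of "exp 1 :: real"] in eventually_elim, intro allI impI)
    fix x :: real and q a :: nat assume x: "exp 1 \<le> x" and q: "0 < q" "coprime a q"
    have x2: "x \<ge> 2" using x exp_ge_add_one_self[of 1] by linarith
    have L: "ln x \<ge> 1" using x x2 by (simp add: ln_ge_iff)
    have "cmod (nat_discrepancy h (nat \<lfloor>x\<rfloor>) q (int a)) \<le> C * (x / ln x powr (real k + 1))"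
      using C[OF x2, of q "int a"] q by (simp add: AP_discrepancy_eq)
    also have "\<dots> \<le> max C 0 * (x / ln x powr real k)"
      using L x2 by (intro mult_mono divide_left_mono powr_mono) auto
    also have "ln x powr real k = ln x ^ k" using L by (simp add: powr_realpow)
    finally show "cmod (nat_discrepancy h (nat \<lfloor>x\<rfloor>) q (int a)) \<le> max C 0 * (x / ln x ^ k)" .
  qed
qed

text \<open>The point is the passage from large x to all x \<ge> 2: below \<open>x0\<close> there
  are finitely many values of \<open>nat \<lfloor>x\<rfloor>\<close>, and the moduli stay below
  \<open>Q0\<close> because \<open>ln x \<ge> ln 2\<close>. The constant T collects all of these
  sums.\<close>

lemma bombieri_vinogradov_iff_bv_level: "bombieri_vinogradov_hyp h \<longleftrightarrow> (\<forall>k>0. bv_level h k)"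
proof -
  have set_eq: "{q. q \<ge> 1 \<and> real q \<le> y} = {1..nat \<lfloor>y\<rfloor>}" for y
    using real_le_iff_le_floor by auto
  have bv: "(\<Sum>q | q \<ge> 1 \<and> real q \<le> y. Max {cmod (AP_discrepancy h x q a) | a::int. coprime a (int q)})
     = bv_sum h (nat \<lfloor>x\<rfloor>) (nat \<lfloor>y\<rfloor>)" for x y
    unfolding set_eq bv_sum_def AP_discrepancy_eq ..
  show ?thesis
  proof (intro iffI allI impI)
    fix k :: real assume h: "bombieri_vinogradov_hyp h" and k: "k > 0"
    then obtain B C where C: "\<And>x. x \<ge> 2 \<Longrightarrow> bv_sum h (nat \<lfloor>x\<rfloor>) (nat \<lfloor>sqrt x / ln x powr B\<rfloor>) \<le> C * (x / ln x powr k)"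
      unfolding bombieri_vinogradov_hyp_def bv by blast
    show "bv_level h k"
      unfolding bv_level_def
    proof (intro exI[of _ "nat \<lceil>B\<rceil>"] exI[of _ C], use eventually_ge_at_top[of "exp 1 :: real"] in eventually_elim, intro allI impI)
      fix x :: real and Q :: nat assume x: "exp 1 \<le> x" and Q: "real Q \<le> sqrt x / ln x ^ nat \<lceil>B\<rceil>"
      have x2: "x \<ge> 2" using x exp_ge_add_one_self[of 1] by linarith
      have L: "ln x \<ge> 1" using x x2 by (simp add: ln_ge_iff)
      have "B \<le> real (nat \<lceil>B\<rceil>)" by linarith
      then have "ln x powr B \<le> ln x powr real (nat \<lceil>B\<rceil>)" using L by (intro powr_mono) auto
      also have "\<dots> = ln x ^ nat \<lceil>B\<rceil>" using L by (simp add: powr_realpow)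
      finally have "sqrt x / ln x ^ nat \<lceil>B\<rceil> \<le> sqrt x / ln x powr B" using L x2 by (intro divide_left_mono) auto
      with Q have "real Q \<le> sqrt x / ln x powr B" by linarith
      then have "Q \<le> nat \<lfloor>sqrt x / ln x powr B\<rfloor>" by (rule le_nat_floor)
      then show "bv_sum h (nat \<lfloor>x\<rfloor>) Q \<le> C * (x / ln x powr k)"
        using bv_sum_mono C[OF x2] order_trans by blast
    qed
  next
    assume h: "\<forall>k>0. bv_level h k"
    show "bombieri_vinogradov_hyp h"
      unfolding bombieri_vinogradov_hyp_def bv
    proof (intro allI impI)
      fix A :: real assume A: "A > 0"
      with h obtain m C x0' where C: "\<And>x Q. x \<ge> x0' \<Longrightarrow> real Q \<le> sqrt x / ln x ^ m \<Longrightarrow> bv_sum h (nat \<lfloor>x\<rfloor>) Q \<le> C * (x / ln x powr A)"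
        unfolding bv_level_def eventually_at_top_linorder by meson
      define x0 where "x0 = max x0' (exp 1)"
      have x0: "x0 \<ge> exp 1" "x0 \<ge> x0'" by (auto simp: x0_def)
      have x02: "x0 \<ge> 2" using x0 exp_ge_add_one_self[of 1] by linarith
      have L0: "ln x0 \<ge> 1" using x0 x02 by (simp add: ln_ge_iff)
      define Q0 where "Q0 = nat \<lfloor>sqrt x0 / ln 2 ^ m\<rfloor>"
      define T where "T = (\<Sum>N\<in>{..nat \<lfloor>x0\<rfloor>}. bv_sum h N Q0)"
      have T0: "T \<ge> 0" unfolding T_def by (intro sum_nonneg bv_sum_nonneg)
      define C' where "C' = \<bar>C\<bar> + T * (ln x0 powr A)"
      have C0: "C' \<ge> 0" using T0 by (simp add: C'_def)
      show "\<exists>B C. \<forall>x\<ge>2. bv_sum h (nat \<lfloor>x\<rfloor>) (nat \<lfloor>sqrt x / ln x powr B\<rfloor>) \<le> C * (x / ln x powr A)"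
      proof (rule exI[of _ "real m"], rule exI[of _ C'], intro allI impI)
        fix x :: real assume x: "x \<ge> 2"
        have Lx: "ln x > 0" using x by simp
        have pw: "ln x powr real m = ln x ^ m" using Lx by (simp add: powr_realpow)
        let ?Q = "nat \<lfloor>sqrt x / ln x powr real m\<rfloor>"
        have r0: "x / ln x powr A \<ge> 0" using x by simp
        show "bv_sum h (nat \<lfloor>x\<rfloor>) ?Q \<le> C' * (x / ln x powr A)"
        proof (cases "x \<ge> x0")
          case True
          have "real ?Q \<le> sqrt x / ln x ^ m" unfolding pw[symmetric] using x by (simp add: of_nat_floor)
          then have "bv_sum h (nat \<lfloor>x\<rfloor>) ?Q \<le> C * (x / ln x powr A)" using True x0 by (intro C) auto
          also have "\<dots> \<le> C' * (x / ln x powr A)"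
            using r0 T0 by (intro mult_right_mono) (auto simp: C'_def intro: order_trans[OF abs_ge_self])
          finally show ?thesis .
        next
          case False
          have "sqrt x / ln x powr real m \<le> sqrt x0 / ln 2 ^ m"
            unfolding pw using False x by (intro frac_le power_mono) auto
          then have "?Q \<le> Q0" unfolding Q0_def by (intro nat_mono floor_mono)
          then have "bv_sum h (nat \<lfloor>x\<rfloor>) ?Q \<le> bv_sum h (nat \<lfloor>x\<rfloor>) Q0" by (rule bv_sum_mono)
          also have "\<dots> \<le> T" unfolding T_def
            using False by (intro member_le_sum bv_sum_nonneg) (auto intro!: nat_mono floor_mono)
          also have "\<dots> = (T * ln x0 powr A) * (1 / ln x0 powr A)" using L0 by simp
          also have "\<dots> \<le> C' * (x / ln x powr A)"
          proof (intro mult_mono frac_le)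
            show "ln x powr A \<le> ln x0 powr A" using False x A Lx by (intro powr_mono2) auto
          qed (use x C0 Lx T0 L0 in \<open>auto simp: C'_def\<close>)
          finally show ?thesis .
        qed
      qed
    qed
  qed
qed

section \<open>Partial summation\<close>

lemma eventually_ln_powr_le:
  fixes k e :: real
  assumes "e > 0"
  shows "\<forall>\<^sub>F x in at_top. ln x powr k \<le> x powr e"
proof -
  have "((\<lambda>x. ln x powr k / x powr e) \<longlongrightarrow> 0) at_top"
    using assms by real_asymp
  then have "\<forall>\<^sub>F x in at_top. ln x powr k / x powr e < 1"
    by (rule order_tendstoD) simp
  then show ?thesis using eventually_gt_at_top[of 0]
    by eventually_elim (simp add: divide_less_eq)
qed

lemma eventually_ln_power_le_sqrt: "\<forall>\<^sub>F x in at_top. ln x ^ k \<le> sqrt x"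
proof -
  have "\<forall>\<^sub>F x in at_top. ln x powr real k \<le> x powr (1/2)" by (rule eventually_ln_powr_le) simp
  then show ?thesis using eventually_ge_at_top[of "exp 1 :: real"]
  proof eventually_elim
    case (elim x)
    have x: "x > 0" using elim(2) exp_gt_zero[of 1] by linarith
    have "ln x \<ge> 1" using elim(2) x by (simp add: ln_ge_iff)
    then have "ln x powr real k = ln x ^ k" by (simp add: powr_realpow)
    then show ?case using elim(1) x by (simp add: powr_half_sqrt)
  qed
qed

lemma eventually_ln_ge: "\<forall>\<^sub>F x in at_top. c \<le> ln (x::real)"
  using ln_at_top by (auto simp: filterlim_at_top)

lemma eventually_all_ge_sqrt:
  assumes "\<forall>\<^sub>F x in at_top. P (x::real)"
  shows "\<forall>\<^sub>F x in at_top. \<forall>y. sqrt x \<le> y \<longrightarrow> P y"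
proof -
  from assms obtain x0 where x0: "\<And>y. y \<ge> x0 \<Longrightarrow> P y" by (auto simp: eventually_at_top_linorder)
  show ?thesis using eventually_ge_at_top[of "(max x0 0)\<^sup>2"]
  proof eventually_elim
    case (elim x)
    then have "max x0 0 \<le> sqrt x" by (rule real_le_rsqrt)
    then show ?case using x0 by auto
  qed
qed

text \<open>For negative k the power decreases and t \<le> L is used in place of L / 2 \<le> t. Both
  signs occur, since levels may be negative.\<close>

lemma powr_ge_of_half:
  fixes L t k :: real
  assumes "0 < L" "L / 2 \<le> t" "t \<le> L"
  shows "L powr k / 2 powr \<bar>k\<bar> \<le> t powr k"
proof (cases "k \<ge> 0")
  case True
  have "L powr k / 2 powr \<bar>k\<bar> = (L / 2) powr k" using True assms by (simp add: powr_divide)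
  also have "\<dots> \<le> t powr k" using True assms by (intro powr_mono2) auto
  finally show ?thesis .
next
  case False
  have "1 \<le> 2 powr \<bar>k\<bar>" by (rule ge_one_powr_ge_zero) auto
  then have "L powr k / 2 powr \<bar>k\<bar> \<le> L powr k / 1" by (intro divide_left_mono) auto
  also have "L powr k \<le> t powr k" using False assms by (intro powr_mono2') auto
  finally show ?thesis by simp
qed

lemma nat_discrepancy_weighted:
  assumes "N \<ge> 1"
  shows "nat_discrepancy (\<lambda>n. h n * of_real (w n)) N q a
    = of_real (w N) * nat_discrepancy h N q a + (\<Sum>m\<in>{1..<N}. of_real (w m - w (Suc m)) * nat_discrepancy h m q a)"
  using assms
proof (induction N rule: dec_induct)
  case base
  then show ?case by (simp add: nat_discrepancy_def)
next
  case (step N)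
  have S: "nat_discrepancy h' (Suc N) q a = nat_discrepancy h' N q a + h' (Suc N) * ap_kernel q a (Suc N)" for h'
    by (simp add: nat_discrepancy_def)
  have "{1..<Suc N} = insert N {1..<N}" using step by auto
  then have "(\<Sum>m\<in>{1..<Suc N}. of_real (w m - w (Suc m)) * nat_discrepancy h m q a)
     = of_real (w N - w (Suc N)) * nat_discrepancy h N q a + (\<Sum>m\<in>{1..<N}. of_real (w m - w (Suc m)) * nat_discrepancy h m q a)"
    by simp
  then show ?case using step.IH S[of h] S[of "\<lambda>n. h n * of_real (w n)"] by (simp add: algebra_simps)
qed

lemma bv_sum_weighted_le:
  assumes "N \<ge> 1"
  shows "bv_sum (\<lambda>n. h n * of_real (w n)) N Q
    \<le> \<bar>w N\<bar> * bv_sum h N Q + (\<Sum>m\<in>{1..<N}. \<bar>w m - w (Suc m)\<bar> * bv_sum h m Q)"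
proof (rule bv_sum_le)
  fix a :: "nat \<Rightarrow> nat" assume a: "\<And>q. q \<in> {1..Q} \<Longrightarrow> coprime (a q) q"
  have le: "(\<Sum>q\<in>{1..Q}. cmod (nat_discrepancy h m q (int (a q)))) \<le> bv_sum h m Q" for m
    using a by (intro sum_nat_discrepancy_le_bv_sum) simp
  have "(\<Sum>q\<in>{1..Q}. cmod (nat_discrepancy (\<lambda>n. h n * of_real (w n)) N q (int (a q))))
     \<le> (\<Sum>q\<in>{1..Q}. \<bar>w N\<bar> * cmod (nat_discrepancy h N q (int (a q)))
         + (\<Sum>m\<in>{1..<N}. \<bar>w m - w (Suc m)\<bar> * cmod (nat_discrepancy h m q (int (a q)))))"
    unfolding nat_discrepancy_weighted[OF assms]
  proof (intro sum_mono order_trans[OF norm_triangle_ineq] add_mono)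
    fix q
    show "cmod (of_real (w N) * nat_discrepancy h N q (int (a q))) \<le> \<bar>w N\<bar> * cmod (nat_discrepancy h N q (int (a q)))"
      by (simp add: norm_mult)
    show "cmod (\<Sum>m\<in>{1..<N}. of_real (w m - w (Suc m)) * nat_discrepancy h m q (int (a q)))
      \<le> (\<Sum>m\<in>{1..<N}. \<bar>w m - w (Suc m)\<bar> * cmod (nat_discrepancy h m q (int (a q))))"
      by (rule order_trans[OF norm_sum]) (simp add: norm_mult flip: of_real_diff)
  qed
  also have "\<dots> = \<bar>w N\<bar> * (\<Sum>q\<in>{1..Q}. cmod (nat_discrepancy h N q (int (a q))))
      + (\<Sum>m\<in>{1..<N}. \<bar>w m - w (Suc m)\<bar> * (\<Sum>q\<in>{1..Q}. cmod (nat_discrepancy h m q (int (a q)))))"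
    unfolding sum.distrib sum_distrib_left by (subst (2) sum.swap) (rule refl)
  also have "\<dots> \<le> \<bar>w N\<bar> * bv_sum h N Q + (\<Sum>m\<in>{1..<N}. \<bar>w m - w (Suc m)\<bar> * bv_sum h m Q)"
    by (intro add_mono sum_mono mult_left_mono le) auto
  finally show "(\<Sum>q\<in>{1..Q}. cmod (nat_discrepancy (\<lambda>n. h n * of_real (w n)) N q (int (a q))))
    \<le> \<bar>w N\<bar> * bv_sum h N Q + (\<Sum>m\<in>{1..<N}. \<bar>w m - w (Suc m)\<bar> * bv_sum h m Q)" .
qed

lemma bv_sum_log_bounded:
  assumes lb: "log_bounded h" and x: "1 \<le> ln x" "real N \<le> x" "real Q \<le> sqrt x"
  shows "bv_sum h N Q \<le> 4 * ln x * (2 * ln x * real N + real Q)"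
proof (cases "Q \<ge> 1")
  case True
  have x1: "x \<ge> 1"
  proof (rule ccontr)
    assume "\<not> x \<ge> 1"
    moreover have "sqrt x \<ge> 0" using x(3) of_nat_0_le_iff order_trans by blast
    ultimately have "0 \<le> x" "x < 1" by auto
    then have "ln x \<le> 0" by (cases "x = 0") auto
    with x(1) show False by simp
  qed
  have "sqrt x \<le> x" using x1 by (intro real_le_lsqrt) (auto simp: power2_eq_square)
  then have "ln (real Q) \<le> ln x" using x(3) True by (subst ln_le_cancel_iff) auto
  have lQ: "0 \<le> ln (real Q)" using True by simp
  have "bv_sum h N Q \<le> 2 * (1 + ln x) * (real N * (1 + ln (real Q)) + real Q)"
    using x by (intro bv_sum_trivial True log_boundedD[OF lb]) auto
  also have "\<dots> \<le> 2 * (2 * ln x) * (real N * (2 * ln x) + real Q)"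
    using x \<open>ln (real Q) \<le> ln x\<close> by (intro mult_mono add_mono mult_left_mono) (use lQ in \<open>auto intro!: add_nonneg_nonneg mult_nonneg_nonneg\<close>)
  finally show ?thesis by (simp add: mult_ac)
next
  case False
  then have "Q = 0" by simp
  then show ?thesis using x by simp
qed

text \<open>The start of the iteration. One logarithm is the size of h, the other is the sum of 1 /
  q over the moduli.\<close>

lemma bv_level_minus_2:
  assumes "log_bounded h"
  shows "bv_level h (-2)"
  unfolding bv_level_def
proof (intro exI[of _ "0::nat"] exI[of _ "12::real"], use eventually_ln_ge[of 1] eventually_ge_at_top[of 1] in eventually_elim, intro allI impI)
  fix x :: real and Q :: nat assume x: "1 \<le> ln x" "1 \<le> x" "real Q \<le> sqrt x / ln x ^ 0"
  have sx: "sqrt x \<le> x" using x(2) by (intro real_le_lsqrt) (auto simp: power2_eq_square)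
  have N: "real (nat \<lfloor>x\<rfloor>) \<le> x" using x by simp
  have "bv_sum h (nat \<lfloor>x\<rfloor>) Q \<le> 4 * ln x * (2 * ln x * real (nat \<lfloor>x\<rfloor>) + real Q)"
    using x N by (intro bv_sum_log_bounded assms) auto
  also have "\<dots> \<le> 4 * ln x * (2 * ln x * x + ln x * x)"
  proof (intro mult_left_mono add_mono)
    have "real Q \<le> 1 * x" using x sx by simp
    also have "\<dots> \<le> ln x * x" using x by (intro mult_right_mono) auto
    finally show "real Q \<le> ln x * x" .
  qed (use x N in auto)
  also have "\<dots> = 12 * (x / ln x powr (-2))"
    using x by (simp add: powr_minus_divide powr_numeral power2_eq_square)
  finally show "bv_sum h (nat \<lfloor>x\<rfloor>) Q \<le> 12 * (x / ln x powr (-2))" .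
qed

lemma bv_level_mono:
  assumes "bv_level h k" "k' \<le> k"
  shows "bv_level h k'"
proof -
  from assms(1) obtain m C where ev: "\<forall>\<^sub>F x in at_top. \<forall>Q::nat. real Q \<le> sqrt x / ln x ^ m \<longrightarrow> bv_sum h (nat \<lfloor>x\<rfloor>) Q \<le> C * (x / ln x powr k)"
    unfolding bv_level_def by blast
  show ?thesis unfolding bv_level_def
  proof (intro exI[of _ m] exI[of _ "\<bar>C\<bar>"], use ev eventually_ln_ge[of 1] eventually_ge_at_top[of 1] in eventually_elim, intro allI impI)
    fix x :: real and Q :: nat
    assume h: "\<forall>Q::nat. real Q \<le> sqrt x / ln x ^ m \<longrightarrow> bv_sum h (nat \<lfloor>x\<rfloor>) Q \<le> C * (x / ln x powr k)"
      and x: "1 \<le> ln x" "1 \<le> x" and Q: "real Q \<le> sqrt x / ln x ^ m"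
    have "bv_sum h (nat \<lfloor>x\<rfloor>) Q \<le> C * (x / ln x powr k)" using h Q by blast
    also have "\<dots> \<le> \<bar>C\<bar> * (x / ln x powr k')"
      using x assms(2) by (intro mult_mono divide_left_mono powr_mono mult_pos_pos) (auto simp del: zero_less_mult_iff)
    finally show "bv_sum h (nat \<lfloor>x\<rfloor>) Q \<le> \<bar>C\<bar> * (x / ln x powr k')" .
  qed
qed

text \<open>For y between \<open>sqrt x\<close> and x the logarithms of x and y agree up to a factor
  2, so powers of \<open>ln x\<close> may be used throughout at the price of a constant 2 to the
  power |k|. Partial summation and the removal of a small factor both compare one Q with many
  y.\<close>

lemma bv_level_obtain:
  assumes "bv_level h k"
  obtains m :: nat and C :: real where "C \<ge> 0"
    "\<forall>\<^sub>F x in at_top. \<forall>y Q. sqrt x \<le> y \<and> y \<le> x \<and> real Q \<le> sqrt y / ln x ^ m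
       \<longrightarrow> bv_sum h (nat \<lfloor>y\<rfloor>) Q \<le> C * (y / ln x powr k)"
proof -
  from assms obtain m C where ev: "\<forall>\<^sub>F x in at_top. \<forall>Q::nat. real Q \<le> sqrt x / ln x ^ m \<longrightarrow> bv_sum h (nat \<lfloor>x\<rfloor>) Q \<le> C * (x / ln x powr k)"
    unfolding bv_level_def by blast
  show ?thesis
  proof (rule that[of "\<bar>C\<bar> * 2 powr \<bar>k\<bar>" m])
    show "\<forall>\<^sub>F x in at_top. \<forall>y Q. sqrt x \<le> y \<and> y \<le> x \<and> real Q \<le> sqrt y / ln x ^ m
       \<longrightarrow> bv_sum h (nat \<lfloor>y\<rfloor>) Q \<le> \<bar>C\<bar> * 2 powr \<bar>k\<bar> * (y / ln x powr k)"
    proof (use eventually_all_ge_sqrt[OF ev] eventually_ln_ge[of 2] eventually_ge_at_top[of 1] in eventually_elim, intro allI impI, elim conjE)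
      fix x y :: real and Q :: nat
      assume h: "\<forall>y. sqrt x \<le> y \<longrightarrow> (\<forall>Q::nat. real Q \<le> sqrt y / ln y ^ m \<longrightarrow> bv_sum h (nat \<lfloor>y\<rfloor>) Q \<le> C * (y / ln y powr k))"
        and x: "2 \<le> ln x" "1 \<le> x" and y: "sqrt x \<le> y" "y \<le> x" and Q: "real Q \<le> sqrt y / ln x ^ m"
      have s1: "sqrt x \<ge> 1" using x by simp
      then have y1: "y \<ge> 1" using y by linarith
      have "ln (sqrt x) \<le> ln y" using y s1 y1 by (subst ln_le_cancel_iff) auto
      then have ly: "ln x / 2 \<le> ln y" using x by (simp add: ln_sqrt)
      have ly': "ln y \<le> ln x" using y y1 by simp
      have pos: "ln x > 0" "ln y > 0" using x ly by linarith+
      have gt1: "x > 1" "y > 1" using pos x y1 by (simp_all add: ln_gt_zero_iff)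
      have "sqrt y / ln x ^ m \<le> sqrt y / ln y ^ m"
        using ly' pos y1 by (intro divide_left_mono power_mono mult_pos_pos zero_less_power) (auto simp: gt1 pos)
      then have "bv_sum h (nat \<lfloor>y\<rfloor>) Q \<le> C * (y / ln y powr k)" using h y Q by auto
      also have "\<dots> \<le> \<bar>C\<bar> * (y / (ln x powr k / 2 powr \<bar>k\<bar>))"
      proof (intro mult_mono divide_left_mono powr_ge_of_half)
        show "0 < ln y powr k * (ln x powr k / 2 powr \<bar>k\<bar>)"
          using pos by (intro mult_pos_pos divide_pos_pos) (auto simp: gt1)
      qed (use x ly ly' y1 gt1 in auto)
      also have "\<dots> = \<bar>C\<bar> * 2 powr \<bar>k\<bar> * (y / ln x powr k)" by simp
      finally show "bv_sum h (nat \<lfloor>y\<rfloor>) Q \<le> \<bar>C\<bar> * 2 powr \<bar>k\<bar> * (y / ln x powr k)" .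
    qed
  qed simp
qed

text \<open>
  The weights in use are \<open>ln\<close> with \<open>j = 1\<close> and \<open>1 / ln\<close> with \<open>j = -1\<close>.
\<close>

lemma bv_level_weight:
  fixes w :: "nat \<Rightarrow> real" and c j k :: real
  assumes lb: "log_bounded h" and lv: "bv_level h k" and c: "c \<ge> 0"
    and W1: "\<And>n. n \<ge> 1 \<Longrightarrow> \<bar>w n - w (Suc n)\<bar> \<le> c / real n"
    and W2: "\<forall>\<^sub>F x in at_top. \<forall>n::nat. sqrt x \<le> real n \<and> real n \<le> x
      \<longrightarrow> \<bar>w n - w (Suc n)\<bar> \<le> c * ln x powr j / real n \<and> \<bar>w n\<bar> \<le> c * ln x powr j"
  shows "bv_level (\<lambda>n. h n * of_real (w n)) (k - j)"
proof -
  obtain m C where C: "C \<ge> 0" and ev: "\<forall>\<^sub>F x in at_top. \<forall>y Q. sqrt x \<le> y \<and> y \<le> x \<and> real Q \<le> sqrt y / ln x ^ m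
       \<longrightarrow> bv_sum h (nat \<lfloor>y\<rfloor>) Q \<le> C * (y / ln x powr k)"
    using bv_level_obtain[OF lv] by blast
  \<comment> \<open>Terms n \<le> y = x / L^p are bounded trivially with a loss of L^2, so p - 2
    \<ge> k - j makes them negligible. The extra L^p in the range of Q ensures that the level
    condition holds for every n > y.\<close>
  define p where "p = nat \<lceil>\<bar>k - j\<bar>\<rceil> + 2"
  have p: "real p - 2 \<ge> k - j" unfolding p_def by linarith
  show ?thesis unfolding bv_level_def
  proof (intro exI[of _ "m + p"] exI[of _ "c * C + (16 * c + c * C)"],
      use ev W2 eventually_ln_ge[of 2] eventually_ge_at_top[of 4] eventually_ln_power_le_sqrt[of p] in eventually_elim,
      intro allI impI)
    fix x :: real and Q :: nat
    assume B: "\<forall>y Q. sqrt x \<le> y \<and> y \<le> x \<and> real Q \<le> sqrt y / ln x ^ m \<longrightarrow> bv_sum h (nat \<lfloor>y\<rfloor>) Q \<le> C * (y / ln x powr k)"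
      and W: "\<forall>n::nat. sqrt x \<le> real n \<and> real n \<le> x
        \<longrightarrow> \<bar>w n - w (Suc n)\<bar> \<le> c * ln x powr j / real n \<and> \<bar>w n\<bar> \<le> c * ln x powr j"
      and L2: "2 \<le> ln x" and x: "4 \<le> x" and Lp: "ln x ^ p \<le> sqrt x" and Q: "real Q \<le> sqrt x / ln x ^ (m + p)"
    define L where "L = ln x"
    define N where "N = nat \<lfloor>x\<rfloor>"
    define y where "y = x / L ^ p"
    have L: "L \<ge> 2" using L2 by (simp add: L_def)
    have Lp0: "L ^ p \<ge> 1" "L ^ p > 0" "L ^ m > 0" using L by (auto intro: one_le_power)
    have sq: "sqrt x * sqrt x = x" using x by simp
    have s2: "sqrt x \<ge> 2" using x real_le_rsqrt[of 2 x] by simp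
    have N: "real N \<le> x" "x - 1 \<le> real N" "N \<ge> 1" using x unfolding N_def by linarith+
    have sN: "sqrt x \<le> real N"
    proof -
      have "sqrt x * 2 \<le> sqrt x * sqrt x" using s2 x by (intro mult_left_mono) auto
      then show ?thesis using N(2) s2 sq by linarith
    qed
    have ysq: "sqrt x \<le> y"
    proof -
      have "sqrt x * L ^ p \<le> sqrt x * sqrt x" using Lp x unfolding L_def by (intro mult_left_mono) auto
      then show ?thesis unfolding y_def sq using Lp0 by (simp add: pos_le_divide_eq)
    qed
    have Qs: "real Q \<le> sqrt x"
    proof -
      have "sqrt x / L ^ (m + p) \<le> sqrt x / 1" using L x by (intro divide_left_mono) (auto intro: one_le_power)
      then show ?thesis using Q unfolding L_def by simp
    qed
    have Qy: "real Q \<le> sqrt z / L ^ m" if "y \<le> z" for z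
    proof -
      have "sqrt y \<ge> sqrt x / L ^ p"
      proof -
        have "sqrt y = sqrt x / sqrt (L ^ p)" unfolding y_def by (rule real_sqrt_divide)
        also have "sqrt (L ^ p) \<le> L ^ p" using Lp0 by (intro real_le_lsqrt) (auto simp: power2_eq_square)
        then have "sqrt x / sqrt (L ^ p) \<ge> sqrt x / L ^ p" using Lp0 x by (intro divide_left_mono) auto
        finally show ?thesis .
      qed
      also have "sqrt y \<le> sqrt z" using that by simp
      finally have "sqrt x / L ^ p / L ^ m \<le> sqrt z / L ^ m" using Lp0 by (intro divide_right_mono) auto
      then show ?thesis using Q by (simp add: L_def power_add mult.commute)
    qed
    have xk: "L powr j * (x / L powr k) = x / L powr (k - j)"
      using L by (simp add: powr_diff)
    have A: "\<bar>w N\<bar> * bv_sum h N Q \<le> c * C * (x / L powr (k - j))"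
    proof -
      have "bv_sum h N Q \<le> C * (x / L powr k)"
      proof -
        have "y \<le> x" unfolding y_def using Lp0 x by (simp add: pos_divide_le_eq)
        then show ?thesis using B Qy ysq order_trans s2 unfolding N_def L_def by (metis (no_types, lifting) order_refl)
      qed
      moreover have "\<bar>w N\<bar> \<le> c * L powr j" using W sN N unfolding L_def by blast
      ultimately have "\<bar>w N\<bar> * bv_sum h N Q \<le> (c * L powr j) * (C * (x / L powr k))"
        using c bv_sum_nonneg by (intro mult_mono) auto
      also have "\<dots> = c * C * (L powr j * (x / L powr k))" by (simp only: mult_ac)
      finally show ?thesis unfolding xk .
    qed
    have T: "\<bar>w n - w (Suc n)\<bar> * bv_sum h n Q
        \<le> (if real n \<le> y then 8 * c * L\<^sup>2 else 0) + 4 * c * L * real Q * (1 / real n) + c * C * (1 / L powr (k - j))"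
      if n: "n \<in> {1..<N}" for n
    proof (cases "real n \<le> y")
      case True
      have "\<bar>w n - w (Suc n)\<bar> * bv_sum h n Q \<le> (c / real n) * (4 * L * (2 * L * real n + real Q))"
        using n N W1[of n] Qs L unfolding L_def by (intro mult_mono bv_sum_log_bounded lb) (auto simp: bv_sum_nonneg)
      also have "\<dots> = 8 * c * L\<^sup>2 + 4 * c * L * real Q * (1 / real n)"
        using n by (simp add: field_simps power2_eq_square)
      also have "\<dots> \<le> 8 * c * L\<^sup>2 + 4 * c * L * real Q * (1 / real n) + c * C * (1 / L powr (k - j))"
        using c C by simp
      finally show ?thesis using True by simp
    next
      case False
      have nx: "sqrt x \<le> real n" "real n \<le> x" using False ysq n N by auto
      have "bv_sum h (nat \<lfloor>real n\<rfloor>) Q \<le> C * (real n / L powr k)"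
        using B[rule_format, of "real n" Q] nx Qy[of "real n"] False unfolding L_def by simp
      then have "\<bar>w n - w (Suc n)\<bar> * bv_sum h n Q \<le> (c * L powr j / real n) * (C * (real n / L powr k))"
        using W nx c unfolding L_def by (intro mult_mono) (auto simp: bv_sum_nonneg)
      also have "\<dots> = c * C * (L powr j * (1 / L powr k))" using n by simp
      also have "L powr j * (1 / L powr k) = 1 / L powr (k - j)" using L by (simp add: powr_diff)
      also have "c * C * (1 / L powr (k - j)) \<le> 4 * c * L * real Q * (1 / real n) + c * C * (1 / L powr (k - j))"
        using c L by simp
      finally show ?thesis using False by simp
    qed
    have lnN: "1 + ln (real N) \<le> 2 * L"
    proof -
      have "ln (real N) \<le> L" unfolding L_def using N by simp
      then show ?thesis using L by linarith
    qed
    have cnt: "(\<Sum>n\<in>{1..<N}. if real n \<le> y then 8 * c * L\<^sup>2 else 0) \<le> y * (8 * c * L\<^sup>2)"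
    proof -
      have "{n\<in>{1..<N}. real n \<le> y} \<subseteq> {1..nat \<lfloor>y\<rfloor>}" by (auto intro: le_nat_floor)
      then have "card {n\<in>{1..<N}. real n \<le> y} \<le> nat \<lfloor>y\<rfloor>" using card_mono[of "{1..nat \<lfloor>y\<rfloor>}"] by fastforce
      then have "real (card {n\<in>{1..<N}. real n \<le> y}) \<le> y" using ysq s2 by linarith
      then have "real (card {n\<in>{1..<N}. real n \<le> y}) * (8 * c * L\<^sup>2) \<le> y * (8 * c * L\<^sup>2)" using c by (intro mult_right_mono) auto
      then show ?thesis by (simp flip: sum.inter_filter)
    qed
    have small: "16 * c * L\<^sup>2 * y \<le> 16 * c * (x / L powr (k - j))"
    proof -
      have "L\<^sup>2 * y = x / (L ^ p / L\<^sup>2)" unfolding y_def by simp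
      also have "L ^ p / L\<^sup>2 = L powr (real p - 2)" using L by (simp add: powr_diff powr_realpow powr_numeral)
      also have "x / L powr (real p - 2) \<le> x / L powr (k - j)"
        using p L x by (intro divide_left_mono powr_mono) auto
      finally have "16 * c * (L\<^sup>2 * y) \<le> 16 * c * (x / L powr (k - j))" using c by (intro mult_left_mono) auto
      then show ?thesis by (simp add: mult.assoc)
    qed
    have "bv_sum (\<lambda>n. h n * of_real (w n)) N Q
      \<le> \<bar>w N\<bar> * bv_sum h N Q + (\<Sum>n\<in>{1..<N}. \<bar>w n - w (Suc n)\<bar> * bv_sum h n Q)"
      by (rule bv_sum_weighted_le[OF N(3)])
    also have "(\<Sum>n\<in>{1..<N}. \<bar>w n - w (Suc n)\<bar> * bv_sum h n Q)
      \<le> (\<Sum>n\<in>{1..<N}. (if real n \<le> y then 8 * c * L\<^sup>2 else 0) + 4 * c * L * real Q * (1 / real n) + c * C * (1 / L powr (k - j)))"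
      by (rule sum_mono) (rule T)
    also have "\<dots> = (\<Sum>n\<in>{1..<N}. if real n \<le> y then 8 * c * L\<^sup>2 else 0) + 4 * c * L * real Q * (\<Sum>n\<in>{1..<N}. 1 / real n)
      + real (N - 1) * (c * C * (1 / L powr (k - j)))"
      by (simp only: sum.distrib sum_distrib_left) simp
    also have "\<dots> \<le> y * (8 * c * L\<^sup>2) + 4 * c * L * y * (2 * L) + x * (c * C * (1 / L powr (k - j)))"
    proof (intro add_mono cnt mult_mono)
      have "(\<Sum>n\<in>{1..<N}. 1 / real n) \<le> (\<Sum>n\<in>{1..N}. 1 / real n)" by (intro sum_mono2) auto
      also have "\<dots> \<le> 2 * L" using sum_inverse_le_ln[OF N(3)] lnN by linarith
      finally show "(\<Sum>n\<in>{1..<N}. 1 / real n) \<le> 2 * L" .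
      show "real Q \<le> y" using Qs ysq by linarith
    qed (use c C L N x ysq s2 in \<open>auto intro!: sum_nonneg\<close>)
    also have "\<dots> = 16 * c * L\<^sup>2 * y + c * C * (x / L powr (k - j))" by (simp add: power2_eq_square)
    also have "\<dots> \<le> 16 * c * (x / L powr (k - j)) + c * C * (x / L powr (k - j))" using small by simp
    finally have fin: "bv_sum (\<lambda>n. h n * of_real (w n)) N Q
      \<le> \<bar>w N\<bar> * bv_sum h N Q + (16 * c * (x / L powr (k - j)) + c * C * (x / L powr (k - j)))" by simp
    have "bv_sum (\<lambda>n. h n * of_real (w n)) N Q
      \<le> c * C * (x / L powr (k - j)) + (16 * c * (x / L powr (k - j)) + c * C * (x / L powr (k - j)))"
      using fin A by linarith
    also have "\<dots> = (c * C + (16 * c + c * C)) * (x / L powr (k - j))" by (simp only: distrib_right)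
    finally show "bv_sum (\<lambda>n. h n * of_real (w n)) (nat \<lfloor>x\<rfloor>) Q \<le> (c * C + (16 * c + c * C)) * (x / ln x powr (k - j))"
      unfolding N_def L_def .
  qed
qed

text \<open>A modulus up to a power of the logarithm lies in the range of the sum over q, and its
  discrepancy is at most the whole sum. Beyond that power the trivial bound of order x / q, times a
  logarithm from the size of h, suffices; the threshold exponent k + 2 covers this with one
  logarithm to spare.\<close>

lemma bv_levels_imp_sw_bound:
  assumes lb: "log_bounded h" and lv: "\<And>k. k > 0 \<Longrightarrow> bv_level h k"
  shows "sw_bound h"
  unfolding sw_bound_def
proof
  fix k :: nat
  obtain m C where C: "\<forall>\<^sub>F x in at_top. \<forall>Q::nat. real Q \<le> sqrt x / ln x ^ m \<longrightarrow> bv_sum h (nat \<lfloor>x\<rfloor>) Q \<le> C * (x / ln x powr (real k + 1))"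
    using lv[of "real k + 1"] unfolding bv_level_def by auto
  show "\<exists>C. \<forall>\<^sub>F x in at_top. \<forall>q a. q > 0 \<longrightarrow> coprime a q \<longrightarrow> cmod (nat_discrepancy h (nat \<lfloor>x\<rfloor>) q (int a)) \<le> C * (x / ln x ^ k)"
  proof (intro exI[of _ "max \<bar>C\<bar> 8"], use C eventually_ln_ge[of 1] eventually_ge_at_top[of 1] eventually_ln_power_le_sqrt[of "k + 2 + m"] in eventually_elim, intro allI impI)
    fix x :: real and q a :: nat
    assume B: "\<forall>Q::nat. real Q \<le> sqrt x / ln x ^ m \<longrightarrow> bv_sum h (nat \<lfloor>x\<rfloor>) Q \<le> C * (x / ln x powr (real k + 1))"
      and L: "1 \<le> ln x" and x: "1 \<le> x" and Ls: "ln x ^ (k + 2 + m) \<le> sqrt x" and q: "0 < q" "coprime a q"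
    have lx: "ln x > 0" using L by linarith
    have x1: "x > 1" using lx x by (simp add: ln_gt_zero_iff)
    have sx: "sqrt x \<le> x" using x by (intro real_le_lsqrt) (auto simp: power2_eq_square)
    have N: "real (nat \<lfloor>x\<rfloor>) \<le> x" using x by simp
    show "cmod (nat_discrepancy h (nat \<lfloor>x\<rfloor>) q (int a)) \<le> max \<bar>C\<bar> 8 * (x / ln x ^ k)"
    proof (cases "real q \<le> ln x ^ (k + 2)")
      case True
      have "real q \<le> sqrt x / ln x ^ m"
      proof -
        have "real q * ln x ^ m \<le> ln x ^ (k + 2) * ln x ^ m" using True L by (intro mult_right_mono) auto
        also have "\<dots> \<le> sqrt x" using Ls by (simp only: power_add)
        finally show ?thesis using lx by (simp add: pos_le_divide_eq)
      qed
      then have bb: "bv_sum h (nat \<lfloor>x\<rfloor>) q \<le> C * (x / ln x powr (real k + 1))" using B by blast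
      have "cmod (nat_discrepancy h (nat \<lfloor>x\<rfloor>) q (int a)) \<le> Max {cmod (nat_discrepancy h (nat \<lfloor>x\<rfloor>) q a) |a. coprime a (int q)}"
        using q by (intro nat_discrepancy_le_Max) auto
      also have "\<dots> \<le> bv_sum h (nat \<lfloor>x\<rfloor>) q"
        unfolding bv_sum_def using q by (intro member_le_sum[of q "{1..q}" "\<lambda>q. Max {cmod (nat_discrepancy h (nat \<lfloor>x\<rfloor>) q a) |a. coprime a (int q)}"])
           (auto intro!: Max_nat_discrepancy_nonneg)
      also have "\<dots> \<le> C * (x / ln x powr (real k + 1))" by (rule bb)
      also have "\<dots> \<le> max \<bar>C\<bar> 8 * (x / ln x powr real k)"
        using x L by (intro mult_mono divide_left_mono powr_mono mult_pos_pos) (auto simp: x1)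
      also have "ln x powr real k = ln x ^ k" using x1 by (simp add: powr_realpow)
      finally show ?thesis .
    next
      case False
      have "cmod (nat_discrepancy h (nat \<lfloor>x\<rfloor>) q (int a)) \<le> 2 * (1 + ln x) * (real (nat \<lfloor>x\<rfloor>) / real q + 1)"
        using N L by (intro nat_discrepancy_trivial q log_boundedD[OF lb]) auto
      also have "\<dots> \<le> 2 * (2 * ln x) * (x / ln x ^ (k + 2) + x / ln x ^ (k + 2))"
      proof (intro mult_mono add_mono frac_le)
        have "ln x ^ (k + 2) \<le> ln x ^ (k + 2 + m)" using L by (intro power_increasing) auto
        also have "\<dots> \<le> x" using Ls sx by linarith
        finally show "1 \<le> x / ln x ^ (k + 2)" using lx by (simp add: pos_le_divide_eq)
        show "0 < ln x ^ (k + 2)" using lx by simp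
      qed (use N L x False in auto)
      also have "\<dots> = 8 * (x / ln x ^ (k + 1))" using L by simp
      also have "\<dots> \<le> max \<bar>C\<bar> 8 * (x / ln x ^ k)"
        using L x by (intro mult_mono divide_left_mono power_increasing mult_pos_pos zero_less_power) (auto simp: x1)
      finally show ?thesis .
    qed
  qed
qed

section \<open>Hyperbolic bilinear sums\<close>

text \<open>\<open>bilinear_bound\<close> with its parameters chosen in powers of P = L^k. The term
  with 1 / R asks for R about P. The Siegel-Walfisz term R^3 (D^3 \<delta> + V / D), with D about
  P^5 and a saving P^20 in \<delta>, is about V / P^2. Since U and V are at least P^2, their square
  roots, like Q, are at most \<open>sqrt x / P\<close>. Of the six logarithms four come from the
  sums over moduli and levels and two from the coefficients.\<close>

lemma bilinear_block_bound:
  fixes \<alpha> \<beta> :: "nat \<Rightarrow> complex" and a :: "nat \<Rightarrow> nat" and x L U V C :: real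
  assumes L: "L \<ge> 1" "L = ln x" and UV: "U * V = x" "L ^ (2 * k) \<le> U" "L ^ (2 * k) \<le> V"
    and N: "real N \<le> U" "real N' \<le> V"
    and \<alpha>: "\<And>n. n \<in> {1..N} \<Longrightarrow> cmod (\<alpha> n) \<le> 2 * L" and \<beta>: "\<And>n. n \<in> {1..N'} \<Longrightarrow> cmod (\<beta> n) \<le> 2 * L"
    and C: "C \<ge> 0"
    and \<delta>: "\<And>m a. m > 0 \<Longrightarrow> coprime a m \<Longrightarrow> cmod (\<Sum>v\<in>{1..N'}. \<beta> v * ap_kernel m (int a) v) \<le> C * (V / L ^ (20 * k))"
    and Q: "Q \<ge> 1" "real Q \<le> sqrt x / L ^ k"
    and a: "\<And>q. q \<in> {1..Q} \<Longrightarrow> coprime (a q) q"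
  shows "(\<Sum>q\<in>{1..Q}. cmod (\<Sum>u\<in>{1..N}. \<Sum>v\<in>{1..N'}. \<alpha> u * \<beta> v * ap_kernel q (int (a q)) (u * v)))
    \<le> (4096 + 128 * (8 * C + 2)) * (x * L ^ 6 / L ^ k)"
proof -
  define P where "P = L ^ k"
  have P: "P \<ge> 1" unfolding P_def using L by simp
  have Pw: "L ^ (n * k) = P ^ n" for n unfolding P_def by (simp add: power_mult mult.commute)
  have UP: "P\<^sup>2 \<le> U" "P\<^sup>2 \<le> V" using UV(2,3) Pw[of 2] by simp_all
  have P2: "P\<^sup>2 \<ge> 1" using P by simp
  have UV0: "U \<ge> 1" "V \<ge> 1" using UP P2 by linarith+
  have x1: "x \<ge> 1" unfolding UV(1)[symmetric] using UV0 mult_mono[of 1 U 1 V] by simp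
  define l where "l = 1 + ln (real Q)"
  have Qx: "real Q \<le> x"
  proof -
    have "sqrt x / L ^ k \<le> sqrt x / 1" using P x1 unfolding P_def by (intro divide_left_mono) auto
    moreover have "sqrt x \<le> x" using x1 by (intro real_le_lsqrt) (auto simp: power2_eq_square)
    ultimately show ?thesis using Q by linarith
  qed
  have l: "1 \<le> l" "l \<le> 2 * L"
  proof -
    have "ln (real Q) \<le> ln x" using Q Qx by (subst ln_le_cancel_iff) auto
    then show "l \<le> 2 * L" "1 \<le> l" unfolding l_def using L Q by auto
  qed
  define R where "R = nat \<lceil>P\<rceil>"
  define D where "D = nat \<lceil>P ^ 5\<rceil>"
  have P5: "P ^ 5 \<ge> 1" using P by simp
  have R: "P \<le> real R" "real R \<le> 2 * P" "R \<ge> 1" using P unfolding R_def by linarith+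
  have D: "P ^ 5 \<le> real D" "real D \<le> 2 * P ^ 5" "D \<ge> 1" using P5 unfolding D_def by linarith+
  define X where "X = sqrt U"
  define Y where "Y = sqrt V"
  have XY: "X * Y = sqrt x" unfolding X_def Y_def UV(1)[symmetric] by (rule real_sqrt_mult[symmetric])
  have XP: "P \<le> X" "P \<le> Y" unfolding X_def Y_def using UP by (intro real_le_rsqrt; simp)+
  have XY2: "(X * Y) * (X * Y) = x" unfolding XY using x1 by simp
  have Q': "real Q \<le> X * Y / P" using Q(2) unfolding XY P_def .
  have N': "sqrt (real N) \<le> X" "sqrt (real N') \<le> Y" unfolding X_def Y_def using N by auto
  have X0: "X > 0" "Y > 0" using XP P by linarith+
  have x0: "x * L ^ 6 / P \<ge> 0" using x1 L P by simp
  have "(\<Sum>q\<in>{1..Q}. cmod (\<Sum>u\<in>{1..N}. \<Sum>v\<in>{1..N'}. \<alpha> u * \<beta> v * ap_kernel q (int (a q)) (u * v)))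
    \<le> 16 * l ^ 4 * (2 * L)\<^sup>2 * sqrt (real N) * sqrt (real N')
        * (sqrt (real N) * sqrt (real N') / real R + sqrt (real N) + sqrt (real N') + real Q)
      + 2 * l\<^sup>2 * real R ^ 3 * (2 * L) * real N * (real D ^ 3 * (C * (V / L ^ (20 * k))) + (2 * L) * real N' / real D)"
    unfolding l_def using L by (intro bilinear_bound Q R D \<alpha> \<beta> \<delta> a) auto
  also have "\<dots> \<le> 4096 * (x * L ^ 6 / P) + 128 * (8 * C + 2) * (x * L ^ 6 / P)"
  proof (rule add_mono)
    have "16 * l ^ 4 * (2 * L)\<^sup>2 * sqrt (real N) * sqrt (real N')
        * (sqrt (real N) * sqrt (real N') / real R + sqrt (real N) + sqrt (real N') + real Q)
      \<le> 16 * (2 * L) ^ 4 * (2 * L)\<^sup>2 * X * Y * (X * Y / P + X + Y + X * Y / P)"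
      using l L N' X0 R Q' P by (intro mult_mono add_mono frac_le power_mono) (auto intro!: add_nonneg_nonneg mult_nonneg_nonneg)
    also have "\<dots> \<le> 16 * (2 * L) ^ 4 * (2 * L)\<^sup>2 * X * Y * (4 * (X * Y / P))"
    proof -
      have "X * P \<le> X * Y" "Y * P \<le> X * Y" using XP X0 by (auto intro: mult_left_mono mult_right_mono simp: mult.commute)
      then have "X \<le> X * Y / P" "Y \<le> X * Y / P" using P by (simp_all add: pos_le_divide_eq)
      then have "X * Y / P + X + Y + X * Y / P \<le> 4 * (X * Y / P)" by linarith
      then show ?thesis using L X0 by (intro mult_left_mono) auto
    qed
    also have "\<dots> = 4096 * (((X * Y) * (X * Y)) * L ^ 6 / P)"
      by (simp add: power_mult_distrib power2_eq_square power4_eq_xxxx numeral_eq_Suc)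
    also have "\<dots> = 4096 * (x * L ^ 6 / P)" unfolding XY2 ..
    finally show "16 * l ^ 4 * (2 * L)\<^sup>2 * sqrt (real N) * sqrt (real N')
        * (sqrt (real N) * sqrt (real N') / real R + sqrt (real N) + sqrt (real N') + real Q) \<le> 4096 * (x * L ^ 6 / P)" .
    have e: "real D ^ 3 * (C * (V / L ^ (20 * k))) + (2 * L) * real N' / real D \<le> (8 * C + 2) * L * (V / P ^ 5)"
    proof -
      have "real D ^ 3 * (C * (V / L ^ (20 * k))) \<le> (2 * P ^ 5) ^ 3 * (C * (V / P ^ 20))"
        unfolding Pw using D C UV0 P by (intro mult_right_mono power_mono) auto
      also have "\<dots> = 8 * C * (V / P ^ 5)"
      proof -
        have "(2 * P ^ 5) ^ 3 = 8 * P ^ 15" by (simp add: power_mult_distrib flip: power_mult)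
        moreover have "P ^ 20 = P ^ 15 * P ^ 5" by (simp flip: power_add)
        ultimately have "(2 * P ^ 5) ^ 3 * (C * (V / P ^ 20)) = 8 * P ^ 15 * (C * (V / (P ^ 15 * P ^ 5)))"
          by (simp only:)
        also have "\<dots> = 8 * C * (V / P ^ 5)"
        proof -
          have gen: "8 * b * (C * (V / (b * c))) = 8 * C * (V / c)" if "b \<noteq> 0" for b c :: real using that by simp
          show ?thesis by (rule gen) (use P in simp)
        qed
        finally show ?thesis .
      qed
      also have "\<dots> \<le> 8 * C * L * (V / P ^ 5)"
      proof -
        have "8 * C * 1 \<le> 8 * C * L" using L C by (intro mult_left_mono) auto
        then show ?thesis using UV0 P by (intro mult_right_mono) auto
      qed
      finally have 1: "real D ^ 3 * (C * (V / L ^ (20 * k))) \<le> 8 * C * L * (V / P ^ 5)" .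
      have "(2 * L) * real N' / real D \<le> (2 * L) * V / P ^ 5"
        using L N D UV0 P by (intro frac_le mult_left_mono) auto
      with 1 show ?thesis by (simp add: algebra_simps)
    qed
    have e0: "0 \<le> real D ^ 3 * (C * (V / L ^ (20 * k))) + (2 * L) * real N' / real D"
      using C L UV0 by (intro add_nonneg_nonneg mult_nonneg_nonneg divide_nonneg_nonneg) auto
    have "2 * l\<^sup>2 * real R ^ 3 * (2 * L) * real N * (real D ^ 3 * (C * (V / L ^ (20 * k))) + (2 * L) * real N' / real D)
      \<le> 2 * (2 * L)\<^sup>2 * (2 * P) ^ 3 * (2 * L) * U * ((8 * C + 2) * L * (V / P ^ 5))"
      using l L R N UV0 e e0 P by (intro mult_mono power_mono) (auto intro!: mult_nonneg_nonneg)
    also have "\<dots> = 128 * (8 * C + 2) * ((U * V) * L ^ 4 / (P ^ 5 / P ^ 3))"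
      by (simp add: power_mult_distrib power2_eq_square power4_eq_xxxx power3_eq_cube)
    also have "P ^ 5 / P ^ 3 = P * P" using P by (simp add: power_numeral_reduce)
    also have "128 * (8 * C + 2) * ((U * V) * L ^ 4 / (P * P)) \<le> 128 * (8 * C + 2) * (x * L ^ 6 / P)"
      unfolding UV(1) using C x1 P L mult_mono[of 1 P 1 P]
      by (intro mult_left_mono frac_le power_increasing mult_mono) (auto simp: mult_le_cancel_left1)
    finally show "2 * l\<^sup>2 * real R ^ 3 * (2 * L) * real N * (real D ^ 3 * (C * (V / L ^ (20 * k))) + (2 * L) * real N' / real D)
      \<le> 128 * (8 * C + 2) * (x * L ^ 6 / P)" .
  qed
  also have "\<dots> = (4096 + 128 * (8 * C + 2)) * (x * L ^ 6 / P)" by (simp only: distrib_right)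
  finally show ?thesis unfolding P_def .
qed

text \<open>The range begins at \<open>sqrt x / 2\<close> instead of \<open>sqrt x\<close> because
  it must contain the lower end of a block whose upper end exceeds \<open>sqrt x\<close>; the ratio
  of the two ends is at most 2.\<close>

lemma sw_bound_obtain:
  assumes "sw_bound h"
  obtains C :: real where "C \<ge> 0"
    "\<forall>\<^sub>F x in at_top. \<forall>y q a. sqrt x / 2 \<le> y \<and> y \<le> x \<and> q > 0 \<and> coprime a q
       \<longrightarrow> cmod (nat_discrepancy h (nat \<lfloor>y\<rfloor>) q (int a)) \<le> C * (y / ln x ^ k)"
proof -
  from assms obtain C where "\<forall>\<^sub>F x in at_top. \<forall>q a. q > 0 \<longrightarrow> coprime a q \<longrightarrow>
      cmod (nat_discrepancy h (nat \<lfloor>x\<rfloor>) q (int a)) \<le> C * (x / ln x ^ k)"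
    unfolding sw_bound_def by blast
  then obtain x0 where x0: "\<And>y q a. y \<ge> x0 \<Longrightarrow> q > 0 \<Longrightarrow> coprime a q \<Longrightarrow>
      cmod (nat_discrepancy h (nat \<lfloor>y\<rfloor>) q (int a)) \<le> C * (y / ln y ^ k)"
    unfolding eventually_at_top_linorder by blast
  show ?thesis
  proof (rule that[of "\<bar>C\<bar> * 4 ^ k"])
    show "\<forall>\<^sub>F x in at_top. \<forall>y q a. sqrt x / 2 \<le> y \<and> y \<le> x \<and> q > 0 \<and> coprime a q
       \<longrightarrow> cmod (nat_discrepancy h (nat \<lfloor>y\<rfloor>) q (int a)) \<le> \<bar>C\<bar> * 4 ^ k * (y / ln x ^ k)"
    proof (use eventually_ge_at_top[of "(2 * max x0 0)\<^sup>2"] eventually_ln_ge[of 4] eventually_ge_at_top[of 4] in eventually_elim, intro allI impI, elim conjE)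
      fix x y :: real and q a :: nat
      assume x: "(2 * max x0 0)\<^sup>2 \<le> x" "4 \<le> ln x" "4 \<le> x" and y: "sqrt x / 2 \<le> y" "y \<le> x" and q: "q > 0" "coprime a q"
      have "2 * max x0 0 \<le> sqrt x" using x(1) by (rule real_le_rsqrt)
      then have yx0: "y \<ge> x0" using y by linarith
      have s: "sqrt x \<ge> 2" using x(3) real_le_rsqrt[of 2 x] by simp
      have y1: "y \<ge> 1" using s y by linarith
      have "ln (sqrt x / 2) \<le> ln y" using y s y1 by (subst ln_le_cancel_iff) auto
      then have "ln x / 2 - ln 2 \<le> ln y" using s x by (simp add: ln_div ln_sqrt)
      moreover have "ln (2::real) \<le> 1" using ln_2_less_1 by simp
      ultimately have ly: "ln x / 4 \<le> ln y" using x by linarith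
      have ly0: "ln y > 0" using ly x by linarith
      then have y1': "y > 1" using y1 by (simp add: ln_gt_zero_iff)
      have "cmod (nat_discrepancy h (nat \<lfloor>y\<rfloor>) q (int a)) \<le> C * (y / ln y ^ k)" by (rule x0[OF yx0 q])
      also have "\<dots> \<le> \<bar>C\<bar> * (y / (ln x / 4) ^ k)"
        using ly x y1 by (intro mult_mono divide_left_mono power_mono mult_pos_pos zero_less_power) (auto simp: y1')
      also have "\<dots> = \<bar>C\<bar> * 4 ^ k * (y / ln x ^ k)" by (simp add: power_divide)
      finally show "cmod (nat_discrepancy h (nat \<lfloor>y\<rfloor>) q (int a)) \<le> \<bar>C\<bar> * 4 ^ k * (y / ln x ^ k)" .
    qed
  qed simp
qed

lemma nat_discrepancy_diff:
  assumes "M \<le> N"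
  shows "(\<Sum>n\<in>{1..N}. (if M < n then h n else 0) * ap_kernel q a n) = nat_discrepancy h N q a - nat_discrepancy h M q a"
proof -
  have e: "{1..N} = {1..M} \<union> {M<..N}" using assms by auto
  have "nat_discrepancy h N q a = nat_discrepancy h M q a + (\<Sum>n\<in>{M<..N}. h n * ap_kernel q a n)"
    unfolding nat_discrepancy_def e by (intro sum.union_disjoint) auto
  moreover have "(\<Sum>n\<in>{1..N}. (if M < n then h n else 0) * ap_kernel q a n) = (\<Sum>n\<in>{M<..N}. h n * ap_kernel q a n)"
    by (rule sum.mono_neutral_cong_right) auto
  ultimately show ?thesis by simp
qed

text \<open>One of u and v is at most \<open>sqrt x\<close>; by symmetry let it be u, at the cost of
  a factor 2. Division by u modulo q makes the inner sum one over v in an interval of length (x - y)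
  / u, and the rounding errors add up to a multiple of \<open>sqrt x\<close>.\<close>

lemma short_interval_pairs:
  assumes q: "q > 0" and a: "coprime a q" and y: "0 \<le> y" "y \<le> x" "1 \<le> x"
  shows "(\<Sum>u\<in>{1..N}. \<Sum>v\<in>{1..N}. if y < real u * real v \<and> real u * real v \<le> x then cmod (ap_kernel q (int a) (u * v)) else 0)
    \<le> 4 * ((x - y) / real q * (1 + ln x) + 2 * sqrt x)"
proof -
  define M where "M = nat \<lfloor>sqrt x\<rfloor>"
  define e where "e u v = (if y < real u * real v \<and> real u * real v \<le> x then cmod (ap_kernel q (int a) (u * v)) else 0)" for u v
  have e0: "e u v \<ge> 0" for u v by (simp add: e_def)
  have e_comm: "e u v = e v u" for u v by (simp add: e_def mult.commute)
  have s1: "sqrt x \<ge> 1" using y by simp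
  have M: "M \<ge> 1" "real M \<le> sqrt x" using s1 unfolding M_def by linarith+
  have M_iff: "real u \<le> sqrt x \<longleftrightarrow> u \<le> M" for u unfolding M_def using s1 by (auto simp: le_nat_floor, linarith)
  have row: "(\<Sum>v\<in>{1..N}. e u v) \<le> 2 * (((x - y) / real u + 1) / real q + 1)" if u: "u \<ge> 1" for u
  proof (cases "coprime u q")
    case False
    have "e u v = 0" for v using ap_kernel_mult_not_coprime[OF a False, of v] by (simp add: e_def)
    then show ?thesis using y by simp
  next
    case True
    obtain a' where a': "\<And>v. ap_kernel q (int a) (u * v) = ap_kernel q (int a') v"
      using ap_kernel_mult_coprime[OF a True q] by blast
    let ?lo = "nat \<lfloor>y / real u\<rfloor>" and ?hi = "nat \<lfloor>x / real u\<rfloor>"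
    have sub: "{v\<in>{1..N}. y < real u * real v \<and> real u * real v \<le> x} \<subseteq> {?lo<..?hi}"
    proof
      fix v assume v: "v \<in> {v\<in>{1..N}. y < real u * real v \<and> real u * real v \<le> x}"
      then have "y / real u < real v" "real v \<le> x / real u" using u by (auto simp: field_simps)
      moreover have "y / real u \<ge> 0" using y by simp
      ultimately show "v \<in> {?lo<..?hi}" by (auto simp: le_nat_floor) linarith
    qed
    have "(\<Sum>v\<in>{1..N}. e u v) = (\<Sum>v\<in>{v\<in>{1..N}. y < real u * real v \<and> real u * real v \<le> x}. cmod (ap_kernel q (int a') v))"
      unfolding e_def a' by (rule sum.inter_filter[symmetric]) simp
    also have "\<dots> \<le> (\<Sum>v\<in>{?lo<..?hi}. cmod (ap_kernel q (int a') v))"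
      by (intro sum_mono2 sub) auto
    also have "\<dots> \<le> 2 * (real (?hi - ?lo) / real q + 1)" by (rule sum_ap_kernel_interval_le[OF q])
    also have "real (?hi - ?lo) \<le> (x - y) / real u + 1"
    proof -
      have "y / real u \<ge> 0" "x / real u \<ge> y / real u" using y u by (auto intro: divide_right_mono)
      then have "real (?hi - ?lo) \<le> x / real u - y / real u + 1" by linarith
      then show ?thesis by (simp add: diff_divide_distrib)
    qed
    finally show ?thesis using q by (simp add: divide_right_mono)
  qed
  have q1: "real q \<ge> 1" using q by simp
  have lM: "(\<Sum>u\<in>{1..M}. 1 / real u) \<le> 1 + ln x"
  proof -
    have "sqrt x \<le> x" using y by (intro real_le_lsqrt) (auto simp: power2_eq_square)
    then have "ln (real M) \<le> ln x" using M by (subst ln_le_cancel_iff) auto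
    then show ?thesis using sum_inverse_le_ln[OF M(1)] by linarith
  qed
  have "(\<Sum>u\<in>{1..N}. \<Sum>v\<in>{1..N}. e u v) \<le> (\<Sum>u\<in>{1..N}. \<Sum>v\<in>{1..N}. (if u \<le> M then e u v else 0) + (if v \<le> M then e u v else 0))"
  proof (intro sum_mono)
    fix u v
    show "e u v \<le> (if u \<le> M then e u v else 0) + (if v \<le> M then e u v else 0)"
    proof (cases "u \<le> M \<or> v \<le> M")
      case False
      then have uv: "sqrt x < real u" "sqrt x < real v" using M_iff by (auto simp: not_le[symmetric])
      have "0 < real u" using uv(1) s1 by linarith
      moreover have "0 \<le> sqrt x" using s1 by linarith
      ultimately have "sqrt x * sqrt x < real u * real v" by (rule mult_strict_mono[OF uv])
      then have "e u v = 0" using y by (simp add: e_def)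
      then show ?thesis by simp
    qed (use e0 in auto)
  qed
  also have "\<dots> = 2 * (\<Sum>u\<in>{1..N}. \<Sum>v\<in>{1..N}. if u \<le> M then e u v else 0)"
  proof -
    have "(\<Sum>u\<in>{1..N}. \<Sum>v\<in>{1..N}. if v \<le> M then e u v else 0) = (\<Sum>u\<in>{1..N}. \<Sum>v\<in>{1..N}. if u \<le> M then e u v else 0)"
      by (subst sum.swap) (intro sum.cong refl if_cong e_comm)
    then show ?thesis by (simp add: sum.distrib)
  qed
  also have "(\<Sum>u\<in>{1..N}. \<Sum>v\<in>{1..N}. if u \<le> M then e u v else 0) \<le> (\<Sum>u\<in>{1..M}. \<Sum>v\<in>{1..N}. e u v)"
  proof -
    have "(\<Sum>u\<in>{1..N}. \<Sum>v\<in>{1..N}. if u \<le> M then e u v else 0) = (\<Sum>u\<in>{1..N}. if u \<le> M then \<Sum>v\<in>{1..N}. e u v else 0)"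
      by (intro sum.cong) auto
    also have "\<dots> = (\<Sum>u\<in>{u\<in>{1..N}. u \<le> M}. \<Sum>v\<in>{1..N}. e u v)" by (rule sum.inter_filter[symmetric]) simp
    also have "\<dots> \<le> (\<Sum>u\<in>{1..M}. \<Sum>v\<in>{1..N}. e u v)" by (intro sum_mono2 sum_nonneg e0) auto
    finally show ?thesis .
  qed
  also have "(\<Sum>u\<in>{1..M}. \<Sum>v\<in>{1..N}. e u v) \<le> (\<Sum>u\<in>{1..M}. 2 * ((x - y) / real q * (1 / real u) + 2))"
  proof (rule sum_mono)
    fix u assume "u \<in> {1..M}"
    then have "(\<Sum>v\<in>{1..N}. e u v) \<le> 2 * (((x - y) / real u + 1) / real q + 1)" by (intro row) simp
    also have "((x - y) / real u + 1) / real q = (x - y) / real q * (1 / real u) + 1 / real q"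
      by (simp add: add_divide_distrib)
    also have "1 / real q \<le> 1" using q1 by simp
    finally show "(\<Sum>v\<in>{1..N}. e u v) \<le> 2 * ((x - y) / real q * (1 / real u) + 2)" by simp
  qed
  also have "\<dots> = 2 * ((x - y) / real q * (\<Sum>u\<in>{1..M}. 1 / real u) + 2 * real M)"
    by (simp only: sum_distrib_left[symmetric] sum.distrib) simp
  also have "2 * (2 * ((x - y) / real q * (\<Sum>u\<in>{1..M}. 1 / real u) + 2 * real M))
      \<le> 2 * (2 * ((x - y) / real q * (1 + ln x) + 2 * sqrt x))"
    using lM M y q1 by (intro mult_left_mono add_mono) auto
  also have "\<dots> = 4 * ((x - y) / real q * (1 + ln x) + 2 * sqrt x)" by simp
  finally show ?thesis unfolding e_def by simp
qed

text \<open>Uniqueness of j is recorded as well: in the sum over all blocks a given u must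
  contribute once.\<close>

lemma geometric_blocks:
  fixes z :: real
  assumes "1 < z" "0 < P" "P < t" "t \<le> P * z ^ J"
  obtains j where "j < J" "P * z ^ j < t" "t \<le> P * z ^ Suc j"
    "\<And>i. P * z ^ i < t \<Longrightarrow> t \<le> P * z ^ Suc i \<Longrightarrow> i = j"
proof -
  define i where "i = (LEAST i. t \<le> P * z ^ i)"
  have i: "t \<le> P * z ^ i" "i \<le> J" unfolding i_def using assms(4) by (auto intro: LeastI Least_le)
  have "i \<noteq> 0" using i(1) assms(3) by (intro notI) simp
  then obtain j where j: "i = Suc j" by (cases i) auto
  have jt: "P * z ^ j < t" using not_less_Least[of j "\<lambda>i. t \<le> P * z ^ i"] j unfolding i_def by auto
  have uniq: "i' = j" if h: "P * z ^ i' < t" "t \<le> P * z ^ Suc i'" for i'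
  proof -
    have mono: "P * z ^ Suc a \<le> P * z ^ b" if "a < b" for a b
      using assms that by (intro mult_left_mono power_increasing) auto
    consider "i' < j" | "i' = j" | "j < i'" by linarith
    then show ?thesis
    proof cases
      case 1
      then show ?thesis using mono[of i' j] h(2) jt by linarith
    next
      case 3
      then show ?thesis using mono[of j i'] h(1) i(1) unfolding j by linarith
    qed
  qed
  show ?thesis
  proof (rule that[of j])
    show "j < J" using i(2) j by simp
    show "t \<le> P * z ^ Suc j" using i(1) unfolding j .
  qed (rule jt, rule uniq)
qed

text \<open>A lower bound for powers of z = 1 + \<eta>, by which the number of blocks that reach up
  to x is estimated.\<close>

lemma exp_half_le:
  fixes t :: real
  assumes "0 \<le> t" "t \<le> 1"
  shows "exp (t / 2) \<le> 1 + t"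
proof -
  have "exp (t / 2) \<le> 1 + t / 2 + (t / 2)\<^sup>2" using assms by (intro exp_bound) auto
  moreover have "t * t \<le> t * 1" using assms by (intro mult_left_mono) auto
  moreover have "(t / 2)\<^sup>2 = t * t / 4" by (simp add: power2_eq_square)
  ultimately show ?thesis using assms by linarith
qed

text \<open>
  The variable \<open>u\<close> is cut into blocks \<open>(P z\<^sup>j, P z\<^sup>j\<^sup>+\<^sup>1]\<close> with \<open>z = 1 + (ln x)\<^sup>-\<^sup>k\<^sup>-\<^sup>4\<close>. On each block the
  condition \<open>u v \<le> x\<close> is replaced by one on \<open>v\<close> alone, at the cost of pairs with \<open>u v\<close> in a short
  interval below \<open>x\<close>. The Siegel-Walfisz bound is used for the longer of the two variables.
\<close>

lemma bilinear_range_bound: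
  assumes lb: "log_bounded \<alpha>" "log_bounded \<beta>" and sw: "sw_bound \<alpha>" "sw_bound \<beta>"
  shows "\<exists>C. \<forall>\<^sub>F x in at_top. \<forall>Q (a :: nat \<Rightarrow> nat). real Q \<le> sqrt x / ln x ^ (2 * k + 12) \<longrightarrow> (\<forall>q\<in>{1..Q}. coprime (a q) q) \<longrightarrow>
    (\<Sum>q\<in>{1..Q}. cmod (\<Sum>u\<in>{1..nat \<lfloor>x\<rfloor>}. \<Sum>v\<in>{1..nat \<lfloor>x\<rfloor>}.
       if ln x ^ (2 * (2 * k + 12)) < real u \<and> ln x ^ (2 * (2 * k + 12)) < real v \<and> real u * real v \<le> x
       then \<alpha> u * \<beta> v * ap_kernel q (int (a q)) (u * v) else 0)) \<le> C * (x / ln x ^ k)"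
proof -
  \<comment> \<open>There are at most 3 L^(k + 5) blocks and each costs x L^6 / L^k1, so a saving of
    L^k requires k1 \<ge> 2 k + 11.\<close>
  define k1 where "k1 = 2 * k + 12"
  obtain C1 where C1: "C1 \<ge> 0" and ev1: "\<forall>\<^sub>F x in at_top. \<forall>y q a. sqrt x / 2 \<le> y \<and> y \<le> x \<and> q > 0 \<and> coprime a q
       \<longrightarrow> cmod (nat_discrepancy \<alpha> (nat \<lfloor>y\<rfloor>) q (int a)) \<le> C1 * (y / ln x ^ (20 * k1))"
    using sw_bound_obtain[OF sw(1)] by blast
  obtain C2 where C2: "C2 \<ge> 0" and ev2: "\<forall>\<^sub>F x in at_top. \<forall>y q a. sqrt x / 2 \<le> y \<and> y \<le> x \<and> q > 0 \<and> coprime a q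
       \<longrightarrow> cmod (nat_discrepancy \<beta> (nat \<lfloor>y\<rfloor>) q (int a)) \<le> C2 * (y / ln x ^ (20 * k1))"
    using sw_bound_obtain[OF sw(2)] by blast
  \<comment> \<open>The discrepancy of \<alpha> on a block is a difference of two values, which
    accounts for 2 C1; for \<beta> the second value belongs to an initial segment up to P and is
    bounded trivially, which accounts for C2 + 1.\<close>
  define C where "C = 2 * C1 + C2 + 1"
  have C: "C \<ge> 0" using C1 C2 by (simp add: C_def)
  define E where "E = 4096 + 128 * (8 * C + 2)"
  have E: "E \<ge> 0" using C by (simp add: E_def)
  show ?thesis unfolding k1_def[symmetric]
  proof (intro exI[of _ "3 * E + 96"], use ev1 ev2 eventually_ln_ge[of 4] eventually_ge_at_top[of 4] eventually_ln_power_le_sqrt[of "23 * k1"] in eventually_elim,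
      intro allI impI)
    fix x :: real and Q :: nat and a :: "nat \<Rightarrow> nat"
    assume SA: "\<forall>y q a. sqrt x / 2 \<le> y \<and> y \<le> x \<and> q > 0 \<and> coprime a q
       \<longrightarrow> cmod (nat_discrepancy \<alpha> (nat \<lfloor>y\<rfloor>) q (int a)) \<le> C1 * (y / ln x ^ (20 * k1))"
      and SB: "\<forall>y q a. sqrt x / 2 \<le> y \<and> y \<le> x \<and> q > 0 \<and> coprime a q
       \<longrightarrow> cmod (nat_discrepancy \<beta> (nat \<lfloor>y\<rfloor>) q (int a)) \<le> C2 * (y / ln x ^ (20 * k1))"
      and L4: "4 \<le> ln x" and x4: "4 \<le> x" and Lx: "ln x ^ (23 * k1) \<le> sqrt x"
      and Qx: "real Q \<le> sqrt x / ln x ^ k1" and a: "\<forall>q\<in>{1..Q}. coprime (a q) q"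
    define L where "L = ln x"
    define N where "N = nat \<lfloor>x\<rfloor>"
    define P where "P = L ^ (2 * k1)"
    \<comment> \<open>The pairs in the short interval contribute x \<eta> times four logarithms: one
      from the sum of 1 / u, one from the sum of 1 / q and two from the coefficients.\<close>
    define \<eta> where "\<eta> = 1 / L ^ (k + 4)"
    define z where "z = 1 + \<eta>"
    \<comment> \<open>z^J \<ge> exp (\<eta> J / 2) reaches x = exp L as soon as J \<ge> 2 L /
      \<eta>.\<close>
    define J where "J = nat \<lceil>2 * L ^ (k + 5)\<rceil>"
    define K where "K q u v = ap_kernel q (int (a q)) (u * v)" for q u v
    define A where "A j u = (if P * z ^ j < real u \<and> real u \<le> P * z ^ Suc j then \<alpha> u else 0)" for j u
    \<comment> \<open>The upper end of the block, not u, bounds v. All chosen pairs then satisfy u v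
      \<le> x, and the pairs that are lost have u v > x / z.\<close>
    define B where "B j v = (if P < real v \<and> real v \<le> x / (P * z ^ Suc j) then \<beta> v else 0)" for j v
    define F where "F q u v = (if P < real u \<and> P < real v \<and> real u * real v \<le> x then \<alpha> u * \<beta> v * K q u v else 0)" for q u v
    have L: "L \<ge> 4" using L4 by (simp add: L_def)
    have Lp: "L ^ n \<ge> 1" for n using L by (intro one_le_power) simp
    have Lp0: "L ^ n > 0" for n using L by simp
    have \<eta>: "0 < \<eta>" "\<eta> \<le> 1" using Lp[of "k + 4"] Lp0[of "k + 4"] by (auto simp: \<eta>_def)
    have z: "1 < z" "z \<le> 2" using \<eta> by (auto simp: z_def)
    have P: "P \<ge> 1" unfolding P_def by (rule Lp)
    have zp: "z ^ n \<ge> 1" for n using z by (intro one_le_power) simp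
    have Uj: "P * z ^ n \<ge> P" for n using P zp[of n] by simp
    have sx: "sqrt x \<ge> 2" using x4 real_le_rsqrt[of 2 x] by simp
    have ssx: "sqrt x * sqrt x = x" using x4 by simp
    have N: "real N \<le> x" unfolding N_def using x4 by simp
    have J: "2 * L ^ (k + 5) \<le> real J" "real J \<le> 3 * L ^ (k + 5)" using Lp[of "k + 5"] unfolding J_def by linarith+
    have zJ: "x \<le> P * z ^ J"
    proof -
      have "L \<le> real J * (\<eta> / 2)"
      proof -
        have "2 * L ^ (k + 5) * (\<eta> / 2) \<le> real J * (\<eta> / 2)" using J \<eta> by (intro mult_right_mono) auto
        moreover have "2 * L ^ (k + 5) * (\<eta> / 2) = L" using L by (simp add: \<eta>_def power_add numeral_eq_Suc)
        ultimately show ?thesis by simp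
      qed
      then have "exp L \<le> exp (real J * (\<eta> / 2))" by simp
      also have "\<dots> = exp (\<eta> / 2) ^ J" by (rule exp_of_nat_mult)
      also have "\<dots> \<le> z ^ J" unfolding z_def using \<eta> by (intro power_mono exp_half_le) auto
      also have "\<dots> \<le> P * z ^ J" using P zp[of J] by simp
      finally show ?thesis using x4 by (simp add: L_def)
    qed
    have bnd: "cmod (\<alpha> n) \<le> 2 * L" "cmod (\<beta> n) \<le> 2 * L" if "n \<in> {1..N}" for n
      using log_boundedD[OF lb(1) that N] log_boundedD[OF lb(2) that N] L unfolding L_def by linarith+
    have diff: "cmod (F q u v - (\<Sum>j<J. A j u * B j v * K q u v))
       \<le> (2 * L)\<^sup>2 * (if x / z < real u * real v \<and> real u * real v \<le> x then cmod (K q u v) else 0)"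
      if uv: "u \<in> {1..N}" "v \<in> {1..N}" for q u v
    proof (cases "P < real u \<and> P < real v \<and> real u * real v \<le> x")
      case False
      have "A j u * B j v = 0" for j
      proof (rule ccontr)
        assume "A j u * B j v \<noteq> 0"
        then have h: "P * z ^ j < real u" "real u \<le> P * z ^ Suc j" "P < real v" "real v \<le> x / (P * z ^ Suc j)"
          by (auto simp: A_def B_def split: if_splits)
        have U0: "P * z ^ Suc j > 0" using Uj[of "Suc j"] P by linarith
        have "real u * real v \<le> (P * z ^ Suc j) * (x / (P * z ^ Suc j))"
          using h U0 by (intro mult_mono) auto
        also have "\<dots> = x" using U0 by (metis less_irrefl nonzero_mult_div_cancel_left times_divide_eq_right)
        finally show False using False h Uj[of j] by linarith
      qed
      then have "(\<Sum>j<J. A j u * B j v * K q u v) = 0" by (simp only: mult_zero_left sum.neutral_const)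
      moreover have "F q u v = 0" using False unfolding F_def by (rule if_not_P)
      ultimately show ?thesis by simp
    next
      case True
      have "real u \<le> x" using uv N by auto
      then have prem: "0 < P" "P < real u" "real u \<le> P * z ^ J" using P True zJ by linarith+
      obtain j where j: "j < J" "P * z ^ j < real u" "real u \<le> P * z ^ Suc j"
        "\<And>i. P * z ^ i < real u \<Longrightarrow> real u \<le> P * z ^ Suc i \<Longrightarrow> i = j"
        using geometric_blocks[OF z(1) prem] by blast
      have U0: "P * z ^ Suc j > 0" using Uj[of "Suc j"] P by linarith
      have "(\<Sum>i<J. A i u * B i v * K q u v) = (\<Sum>i<J. if i = j then A j u * B j v * K q u v else 0)"
      proof (rule sum.cong[OF refl])
        fix i
        have "A i u = 0" if "i \<noteq> j" using that j(4)[of i] unfolding A_def by meson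
        then show "A i u * B i v * K q u v = (if i = j then A j u * B j v * K q u v else 0)"
          by (cases "i = j") (simp_all only: if_True if_False mult_zero_left refl not_False_eq_True True_implies_equals)
      qed
      also have "\<dots> = A j u * B j v * K q u v" using j(1) by (subst sum.delta) simp_all
      also have "A j u = \<alpha> u" unfolding A_def using j(2,3) by (intro if_P conjI)
      finally have S: "(\<Sum>i<J. A i u * B i v * K q u v) = \<alpha> u * B j v * K q u v" .
      show ?thesis
      proof (cases "real v \<le> x / (P * z ^ Suc j)")
        case v: True
        then have "F q u v - (\<Sum>j<J. A j u * B j v * K q u v) = 0" using True unfolding S by (simp add: F_def B_def)
        then show ?thesis by simp
      next
        case v: False
        have "x / z = (P * z ^ j) * (x / (P * z ^ Suc j))" using z P by simp
        also have "\<dots> < real u * real v"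
        proof (rule mult_strict_mono)
          show "x / (P * z ^ Suc j) < real v" using v by simp
          show "0 \<le> x / (P * z ^ Suc j)" using U0 x4 by (intro divide_nonneg_nonneg) linarith+
          show "0 < real u" using prem by linarith
        qed (rule j(2))
        finally have sh: "x / z < real u * real v" .
        have "cmod (F q u v - (\<Sum>j<J. A j u * B j v * K q u v)) = cmod (\<alpha> u) * cmod (\<beta> v) * cmod (K q u v)"
          using True v unfolding S by (simp add: F_def B_def norm_mult)
        also have "\<dots> \<le> (2 * L) * (2 * L) * cmod (K q u v)"
          using bnd uv L by (intro mult_right_mono mult_mono) auto
        finally show ?thesis using sh True by (simp add: power2_eq_square)
      qed
    qed
    have block: "(\<Sum>q\<in>{1..Q}. cmod (\<Sum>u\<in>{1..N}. \<Sum>v\<in>{1..N}. A j u * B j v * K q u v)) \<le> E * (x * L ^ 6 / L ^ k1)" for j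
    proof -
      define U where "U = P * z ^ Suc j"
      define V where "V = x / U"
      have U: "P \<le> U" "U > 0" using Uj[of "Suc j"] P unfolding U_def by linarith+
      have UVx: "U * V = x" "V * U = x" unfolding V_def using U by auto
      have r0: "0 \<le> E * (x * L ^ 6 / L ^ k1)" using E x4 L by simp
      show ?thesis
      proof (cases "V < P \<or> Q = 0")
        case True
        then show ?thesis
        proof
          assume "V < P"
          then have "B j v = 0" for v unfolding B_def U_def[symmetric] V_def[symmetric] by auto
          then show ?thesis using r0 by simp
        qed (use r0 in simp)
      next
        case False
        then have V: "P \<le> V" and Q1: "Q \<ge> 1" by auto
        have UVle: "U \<le> x" "V \<le> x"
          unfolding UVx(1)[symmetric] using U V P mult_left_mono[of 1 V U] mult_right_mono[of 1 U V] by auto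
        define M where "M = nat \<lfloor>U\<rfloor>"
        define M' where "M' = nat \<lfloor>V\<rfloor>"
        have MN: "M \<le> N" "M' \<le> N" unfolding M_def M'_def N_def using UVle by (auto intro!: nat_mono floor_mono)
        have M: "real M \<le> U" "real M' \<le> V" unfolding M_def M'_def using U V P by auto
        have Mi: "real n \<le> U \<longleftrightarrow> n \<le> M" "real n \<le> V \<longleftrightarrow> n \<le> M'" for n
          unfolding M_def M'_def using U V P by (auto simp: le_nat_floor, linarith+)
        have red: "(\<Sum>u\<in>{1..N}. \<Sum>v\<in>{1..N}. A j u * B j v * K q u v) = (\<Sum>u\<in>{1..M}. \<Sum>v\<in>{1..M'}. A j u * B j v * K q u v)" for q
        proof -
          have A0: "A j u = 0" if "u \<notin> {1..M}" "u \<in> {1..N}" for u using that Mi unfolding A_def U_def[symmetric] by auto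
          have B0: "B j v = 0" if "v \<notin> {1..M'}" "v \<in> {1..N}" for v using that Mi unfolding B_def U_def[symmetric] V_def[symmetric] by auto
          have "(\<Sum>v\<in>{1..N}. A j u * B j v * K q u v) = (\<Sum>v\<in>{1..M'}. A j u * B j v * K q u v)" for u
            using MN B0 by (intro sum.mono_neutral_right) auto
          then have "(\<Sum>u\<in>{1..N}. \<Sum>v\<in>{1..N}. A j u * B j v * K q u v) = (\<Sum>u\<in>{1..N}. \<Sum>v\<in>{1..M'}. A j u * B j v * K q u v)" by simp
          also have "\<dots> = (\<Sum>u\<in>{1..M}. \<Sum>v\<in>{1..M'}. A j u * B j v * K q u v)"
            using MN A0 by (intro sum.mono_neutral_right) auto
          finally show ?thesis .
        qed
        have bA: "cmod (A j n) \<le> 2 * L" if "n \<in> {1..M}" for n using bnd(1)[of n] that MN L by (auto simp: A_def)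
        have bB: "cmod (B j n) \<le> 2 * L" if "n \<in> {1..M'}" for n using bnd(2)[of n] that MN L by (auto simp: B_def)
        have L1: "1 \<le> L" using L by simp
        have Q2: "real Q \<le> sqrt x / L ^ k1" using Qx unfolding L_def .
        show ?thesis
        proof (cases "U \<le> sqrt x")
          case True
          have Vs: "sqrt x \<le> V"
          proof -
            have "sqrt x * U \<le> sqrt x * sqrt x" using True x4 by (intro mult_left_mono) auto
            then show ?thesis unfolding V_def ssx using U by (simp add: pos_le_divide_eq)
          qed
          have "(\<Sum>q\<in>{1..Q}. cmod (\<Sum>u\<in>{1..M}. \<Sum>v\<in>{1..M'}. A j u * B j v * ap_kernel q (int (a q)) (u * v)))
             \<le> (4096 + 128 * (8 * C + 2)) * (x * L ^ 6 / L ^ k1)"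
          proof (rule bilinear_block_bound[OF L1 L_def UVx(1) _ _ M bA bB C _ Q1 Q2])
            show "L ^ (2 * k1) \<le> U" "L ^ (2 * k1) \<le> V" using U V by (simp_all add: P_def)
            show "coprime (a q) q" if "q \<in> {1..Q}" for q using a that by blast
            fix m b :: nat assume m: "m > 0" "coprime b m"
            have le: "nat \<lfloor>P\<rfloor> \<le> M'" unfolding M'_def using V by (intro nat_mono floor_mono)
            have "(\<Sum>v\<in>{1..M'}. B j v * ap_kernel m (int b) v) = (\<Sum>v\<in>{1..M'}. (if nat \<lfloor>P\<rfloor> < v then \<beta> v else 0) * ap_kernel m (int b) v)"
            proof (intro sum.cong refl arg_cong2[where f = "(*)"])
              fix v assume "v \<in> {1..M'}"
              moreover have "P < real v \<longleftrightarrow> nat \<lfloor>P\<rfloor> < v" using P by (simp add: nat_less_iff floor_less_iff)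
              ultimately show "B j v = (if nat \<lfloor>P\<rfloor> < v then \<beta> v else 0)"
                using Mi unfolding B_def U_def[symmetric] V_def[symmetric] by auto
            qed
            also have "\<dots> = nat_discrepancy \<beta> M' m (int b) - nat_discrepancy \<beta> (nat \<lfloor>P\<rfloor>) m (int b)"
              by (rule nat_discrepancy_diff[OF le])
            finally have eq: "(\<Sum>v\<in>{1..M'}. B j v * ap_kernel m (int b) v)
              = nat_discrepancy \<beta> M' m (int b) - nat_discrepancy \<beta> (nat \<lfloor>P\<rfloor>) m (int b)" .
            have 1: "cmod (nat_discrepancy \<beta> M' m (int b)) \<le> C2 * (V / L ^ (20 * k1))"
              using SB Vs UVle sx m unfolding M'_def L_def by auto
            have "cmod (nat_discrepancy \<beta> (nat \<lfloor>P\<rfloor>) m (int b)) \<le> (\<Sum>v\<in>{1..nat \<lfloor>P\<rfloor>}. 2 * L * 1)"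
              unfolding nat_discrepancy_def
            proof (intro order_trans[OF norm_sum] sum_mono)
              fix v assume "v \<in> {1..nat \<lfloor>P\<rfloor>}"
              then have "v \<in> {1..N}" using le MN by auto
              then show "cmod (\<beta> v * ap_kernel m (int b) v) \<le> 2 * L * 1"
                unfolding norm_mult using bnd cmod_ap_kernel_le_1[OF m(1)] L by (intro mult_mono) auto
            qed
            also have "\<dots> = real (nat \<lfloor>P\<rfloor>) * (2 * L)" by simp
            also have "\<dots> \<le> P * (2 * L)" using P L by (intro mult_right_mono) auto
            \<comment> \<open>P contributes L^(2 k1), the factor 2 L at most L^k1, and the saving
              asked for is L^(20 k1); the total L^(23 k1) is at most \<open>sqrt x\<close>, hence at
              most V.\<close>
            also have "\<dots> \<le> V / L ^ (20 * k1)"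
            proof -
              have "2 * L \<le> L ^ k1"
              proof -
                have "2 * L \<le> L * L" using L by (intro mult_right_mono) auto
                also have "\<dots> = L ^ 2" by (simp add: power2_eq_square)
                also have "\<dots> \<le> L ^ k1" using L by (intro power_increasing) (auto simp: k1_def)
                finally show ?thesis .
              qed
              then have "P * (2 * L) * L ^ (20 * k1) \<le> P * L ^ k1 * L ^ (20 * k1)"
                using P Lp0 by (intro mult_right_mono mult_left_mono) (auto simp: less_imp_le)
              also have "\<dots> = L ^ (23 * k1)" unfolding P_def by (simp flip: power_add)
              also have "\<dots> \<le> V" using Lx Vs unfolding L_def by linarith
              finally show ?thesis using Lp0 by (simp add: pos_le_divide_eq)
            qed
            finally have 2: "cmod (nat_discrepancy \<beta> (nat \<lfloor>P\<rfloor>) m (int b)) \<le> V / L ^ (20 * k1)" .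
            have "cmod (\<Sum>v\<in>{1..M'}. B j v * ap_kernel m (int b) v) \<le> (C2 + 1) * (V / L ^ (20 * k1))"
              unfolding eq distrib_right using norm_triangle_ineq4 1 2 by (smt (verit))
            also have "\<dots> \<le> C * (V / L ^ (20 * k1))"
              using C1 C2 V P Lp0[of "20 * k1"] by (intro mult_right_mono) (auto simp: C_def)
            finally show "cmod (\<Sum>v\<in>{1..M'}. B j v * ap_kernel m (int b) v) \<le> C * (V / L ^ (20 * k1))" .
          qed
          then show ?thesis unfolding red unfolding K_def E_def .
        next
          case False
          \<comment> \<open>W is the lower end of the block. As z \<le> 2 and U exceeds
            \<open>sqrt x\<close>, it is still at least \<open>sqrt x / 2\<close>, so both values of
            \<alpha> fall under the Siegel-Walfisz bound.\<close>
          define W where "W = P * z ^ j"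
          have W: "U = W * z" "P \<le> W" unfolding U_def W_def using Uj[of j] by simp_all
          have WU: "sqrt x / 2 \<le> W" "W \<le> U"
          proof -
            have "W * 1 \<le> W * z" using W P z by (intro mult_left_mono) auto
            then show "W \<le> U" using W by simp
            have "W * z \<le> W * 2" using W P z by (intro mult_left_mono) auto
            then show "sqrt x / 2 \<le> W" using W False by simp
          qed
          have "(\<Sum>q\<in>{1..Q}. cmod (\<Sum>v\<in>{1..M'}. \<Sum>u\<in>{1..M}. B j v * A j u * ap_kernel q (int (a q)) (v * u)))
             \<le> (4096 + 128 * (8 * C + 2)) * (x * L ^ 6 / L ^ k1)"
          proof (rule bilinear_block_bound[OF L1 L_def UVx(2) _ _ M(2) M(1) bB bA C _ Q1 Q2])
            show "L ^ (2 * k1) \<le> U" "L ^ (2 * k1) \<le> V" using U V by (simp_all add: P_def)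
            show "coprime (a q) q" if "q \<in> {1..Q}" for q using a that by blast
            fix m b :: nat assume m: "m > 0" "coprime b m"
            have le: "nat \<lfloor>W\<rfloor> \<le> M" unfolding M_def using WU by (intro nat_mono floor_mono)
            have "(\<Sum>v\<in>{1..M}. A j v * ap_kernel m (int b) v) = (\<Sum>v\<in>{1..M}. (if nat \<lfloor>W\<rfloor> < v then \<alpha> v else 0) * ap_kernel m (int b) v)"
            proof (intro sum.cong refl arg_cong2[where f = "(*)"])
              fix v assume "v \<in> {1..M}"
              moreover have "W < real v \<longleftrightarrow> nat \<lfloor>W\<rfloor> < v" using W P by (simp add: nat_less_iff floor_less_iff)
              ultimately show "A j v = (if nat \<lfloor>W\<rfloor> < v then \<alpha> v else 0)"
                using Mi unfolding A_def U_def[symmetric] W_def[symmetric] by auto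
            qed
            also have "\<dots> = nat_discrepancy \<alpha> M m (int b) - nat_discrepancy \<alpha> (nat \<lfloor>W\<rfloor>) m (int b)"
              by (rule nat_discrepancy_diff[OF le])
            finally have eq: "(\<Sum>v\<in>{1..M}. A j v * ap_kernel m (int b) v)
              = nat_discrepancy \<alpha> M m (int b) - nat_discrepancy \<alpha> (nat \<lfloor>W\<rfloor>) m (int b)" .
            have 1: "cmod (nat_discrepancy \<alpha> M m (int b)) \<le> C1 * (U / L ^ (20 * k1))"
              using SA WU UVle m unfolding M_def L_def by auto
            have "cmod (nat_discrepancy \<alpha> (nat \<lfloor>W\<rfloor>) m (int b)) \<le> C1 * (W / L ^ (20 * k1))"
              using SA WU UVle m unfolding L_def by auto
            also have "\<dots> \<le> C1 * (U / L ^ (20 * k1))"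
              using C1 WU Lp0 by (intro mult_left_mono divide_right_mono) (auto simp: less_imp_le)
            finally have 2: "cmod (nat_discrepancy \<alpha> (nat \<lfloor>W\<rfloor>) m (int b)) \<le> C1 * (U / L ^ (20 * k1))" .
            have "cmod (\<Sum>v\<in>{1..M}. A j v * ap_kernel m (int b) v) \<le> (C1 + C1) * (U / L ^ (20 * k1))"
              unfolding eq distrib_right using norm_triangle_ineq4 1 2 by (smt (verit))
            also have "\<dots> \<le> C * (U / L ^ (20 * k1))"
              using C1 C2 U P Lp0[of "20 * k1"] by (intro mult_right_mono) (auto simp: C_def)
            finally show "cmod (\<Sum>v\<in>{1..M}. A j v * ap_kernel m (int b) v) \<le> C * (U / L ^ (20 * k1))" .
          qed
          moreover have "(\<Sum>u\<in>{1..M}. \<Sum>v\<in>{1..M'}. A j u * B j v * K q u v)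
              = (\<Sum>v\<in>{1..M'}. \<Sum>u\<in>{1..M}. B j v * A j u * ap_kernel q (int (a q)) (v * u))" for q
            unfolding K_def by (subst sum.swap) (simp only: mult_ac)
          ultimately show ?thesis unfolding red E_def by simp
        qed
      qed
    qed
    have err: "(\<Sum>q\<in>{1..Q}. \<Sum>u\<in>{1..N}. \<Sum>v\<in>{1..N}. (2 * L)\<^sup>2 * (if x / z < real u * real v \<and> real u * real v \<le> x then cmod (K q u v) else 0))
       \<le> 96 * (x / L ^ k)"
    proof -
      have xz: "x - x / z \<le> x * \<eta>"
      proof -
        have "x - x / z = x * \<eta> / z" using z by (simp add: z_def field_simps)
        also have "\<dots> \<le> x * \<eta> / 1" using z x4 \<eta> by (intro divide_left_mono) auto
        finally show ?thesis by simp
      qed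
      have xz0: "0 \<le> x / z" "x / z \<le> x" using z x4 by (auto simp: pos_divide_le_eq)
      have "(\<Sum>q\<in>{1..Q}. \<Sum>u\<in>{1..N}. \<Sum>v\<in>{1..N}. if x / z < real u * real v \<and> real u * real v \<le> x then cmod (K q u v) else 0)
         \<le> (\<Sum>q\<in>{1..Q}. 4 * (x * \<eta> * (2 * L) * (1 / real q) + 2 * sqrt x))"
      proof (rule sum_mono)
        fix q assume q: "q \<in> {1..Q}"
        have "(\<Sum>u\<in>{1..N}. \<Sum>v\<in>{1..N}. if x / z < real u * real v \<and> real u * real v \<le> x then cmod (K q u v) else 0)
          \<le> 4 * ((x - x / z) / real q * (1 + ln x) + 2 * sqrt x)"
          unfolding K_def using q a xz0 x4 by (intro short_interval_pairs) auto
        also have "\<dots> \<le> 4 * ((x * \<eta>) / real q * (2 * L) + 2 * sqrt x)"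
          using xz xz0 L x4 \<eta> unfolding L_def by (intro mult_left_mono add_mono mult_mono divide_right_mono) auto
        also have "\<dots> = 4 * (x * \<eta> * (2 * L) * (1 / real q) + 2 * sqrt x)" by simp
        finally show "(\<Sum>u\<in>{1..N}. \<Sum>v\<in>{1..N}. if x / z < real u * real v \<and> real u * real v \<le> x then cmod (K q u v) else 0)
          \<le> 4 * (x * \<eta> * (2 * L) * (1 / real q) + 2 * sqrt x)" .
      qed
      also have "\<dots> = 4 * (x * \<eta> * (2 * L) * (\<Sum>q\<in>{1..Q}. 1 / real q) + 2 * sqrt x * real Q)"
        by (simp only: sum_distrib_left[symmetric] sum.distrib) simp
      also have "\<dots> \<le> 4 * (x * \<eta> * (2 * L) * (2 * L) + 2 * sqrt x * (sqrt x / L ^ k1))"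
      proof (intro mult_left_mono add_mono)
        show "(\<Sum>q\<in>{1..Q}. 1 / real q) \<le> 2 * L"
        proof (cases "Q \<ge> 1")
          case True
          have "sqrt x / L ^ k1 \<le> sqrt x / 1" using Lp[of k1] Lp0[of k1] x4 by (intro divide_left_mono) auto
          then have "real Q \<le> sqrt x" using Qx unfolding L_def by simp
          moreover have "sqrt x \<le> x" using x4 by (intro real_le_lsqrt) (auto simp: power2_eq_square)
          ultimately have "ln (real Q) \<le> L" unfolding L_def using True by (subst ln_le_cancel_iff) auto
          then show ?thesis using sum_inverse_le_ln[OF True] L by linarith
        qed (use L in simp)
        show "real Q \<le> sqrt x / L ^ k1" using Qx unfolding L_def .
      qed (use x4 \<eta> L in auto)
      also have "\<dots> = 16 * (x * (\<eta> * L\<^sup>2)) + 8 * ((sqrt x * sqrt x) / L ^ k1)" by (simp add: power2_eq_square)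
      also have "\<dots> = 16 * (x / L ^ (k + 2)) + 8 * (x / L ^ k1)"
      proof -
        have "\<eta> * L\<^sup>2 = 1 / L ^ (k + 2)" using L unfolding \<eta>_def by (simp add: power_add power2_eq_square numeral_eq_Suc)
        then show ?thesis unfolding ssx by simp
      qed
      also have "\<dots> \<le> 16 * (x / L ^ (k + 2)) + 8 * (x / L ^ (k + 2))"
        using x4 L Lp0 by (intro add_left_mono mult_left_mono divide_left_mono power_increasing) (auto simp: k1_def)
      also have "\<dots> = 24 * (x / L ^ (k + 2))" by simp
      finally have "(2 * L)\<^sup>2 * (\<Sum>q\<in>{1..Q}. \<Sum>u\<in>{1..N}. \<Sum>v\<in>{1..N}. if x / z < real u * real v \<and> real u * real v \<le> x then cmod (K q u v) else 0)
        \<le> (2 * L)\<^sup>2 * (24 * (x / L ^ (k + 2)))" by (intro mult_left_mono) auto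
      also have "\<dots> = 96 * (x / L ^ k)" using L by (simp add: power_add power2_eq_square)
      finally show ?thesis by (simp only: sum_distrib_left)
    qed
    have "(\<Sum>q\<in>{1..Q}. cmod (\<Sum>u\<in>{1..N}. \<Sum>v\<in>{1..N}. F q u v))
      \<le> (\<Sum>q\<in>{1..Q}. (\<Sum>j<J. cmod (\<Sum>u\<in>{1..N}. \<Sum>v\<in>{1..N}. A j u * B j v * K q u v))
        + (\<Sum>u\<in>{1..N}. \<Sum>v\<in>{1..N}. (2 * L)\<^sup>2 * (if x / z < real u * real v \<and> real u * real v \<le> x then cmod (K q u v) else 0)))"
    proof (rule sum_mono)
      fix q
      have sw1: "(\<Sum>u\<in>{1..N}. \<Sum>v\<in>{1..N}. \<Sum>j<J. A j u * B j v * K q u v) = (\<Sum>j<J. \<Sum>u\<in>{1..N}. \<Sum>v\<in>{1..N}. A j u * B j v * K q u v)"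
      proof -
        have "(\<Sum>u\<in>{1..N}. \<Sum>v\<in>{1..N}. \<Sum>j<J. A j u * B j v * K q u v) = (\<Sum>u\<in>{1..N}. \<Sum>j<J. \<Sum>v\<in>{1..N}. A j u * B j v * K q u v)"
          by (rule sum.cong[OF refl]) (rule sum.swap)
        also have "\<dots> = (\<Sum>j<J. \<Sum>u\<in>{1..N}. \<Sum>v\<in>{1..N}. A j u * B j v * K q u v)" by (rule sum.swap)
        finally show ?thesis .
      qed
      have eq: "(\<Sum>u\<in>{1..N}. \<Sum>v\<in>{1..N}. F q u v) = (\<Sum>j<J. \<Sum>u\<in>{1..N}. \<Sum>v\<in>{1..N}. A j u * B j v * K q u v)
         + (\<Sum>u\<in>{1..N}. \<Sum>v\<in>{1..N}. F q u v - (\<Sum>j<J. A j u * B j v * K q u v))"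
        unfolding sum_subtractf sw1 by simp
      have "cmod (\<Sum>u\<in>{1..N}. \<Sum>v\<in>{1..N}. F q u v - (\<Sum>j<J. A j u * B j v * K q u v))
          \<le> (\<Sum>u\<in>{1..N}. \<Sum>v\<in>{1..N}. (2 * L)\<^sup>2 * (if x / z < real u * real v \<and> real u * real v \<le> x then cmod (K q u v) else 0))"
        by (rule sum_norm_le, rule sum_norm_le, rule diff)
      then show "cmod (\<Sum>u\<in>{1..N}. \<Sum>v\<in>{1..N}. F q u v) \<le> (\<Sum>j<J. cmod (\<Sum>u\<in>{1..N}. \<Sum>v\<in>{1..N}. A j u * B j v * K q u v))
         + (\<Sum>u\<in>{1..N}. \<Sum>v\<in>{1..N}. (2 * L)\<^sup>2 * (if x / z < real u * real v \<and> real u * real v \<le> x then cmod (K q u v) else 0))"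
        unfolding eq by (rule order_trans[OF norm_triangle_ineq add_mono[OF norm_sum]])
    qed
    also have "\<dots> = (\<Sum>j<J. \<Sum>q\<in>{1..Q}. cmod (\<Sum>u\<in>{1..N}. \<Sum>v\<in>{1..N}. A j u * B j v * K q u v))
        + (\<Sum>q\<in>{1..Q}. \<Sum>u\<in>{1..N}. \<Sum>v\<in>{1..N}. (2 * L)\<^sup>2 * (if x / z < real u * real v \<and> real u * real v \<le> x then cmod (K q u v) else 0))"
      unfolding sum.distrib by (subst sum.swap) (rule refl)
    also have "\<dots> \<le> (\<Sum>j<J. E * (x * L ^ 6 / L ^ k1)) + 96 * (x / L ^ k)"
      by (intro add_mono sum_mono block err)
    also have "(\<Sum>j<J. E * (x * L ^ 6 / L ^ k1)) \<le> 3 * E * (x / L ^ k)"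
    proof -
      have "(\<Sum>j<J. E * (x * L ^ 6 / L ^ k1)) = real J * (E * (x * L ^ 6 / L ^ k1))" by simp
      also have "\<dots> \<le> (3 * L ^ (k + 5)) * (E * (x * L ^ 6 / L ^ k1))"
        using J E x4 L by (intro mult_right_mono) auto
      also have "\<dots> = 3 * E * (x * (L ^ (k + 11) / L ^ k1))" by (simp add: power_add numeral_eq_Suc)
      also have "\<dots> \<le> 3 * E * (x * (1 / L ^ k))"
      proof (intro mult_left_mono)
        have "L ^ (k + 11) * L ^ k \<le> L ^ k1" unfolding power_add[symmetric] k1_def using L by (intro power_increasing) auto
        then show "L ^ (k + 11) / L ^ k1 \<le> 1 / L ^ k" using Lp0 by (simp add: field_simps)
      qed (use E x4 in auto)
      finally show ?thesis by simp
    qed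
    finally show "(\<Sum>q\<in>{1..Q}. cmod (\<Sum>u\<in>{1..nat \<lfloor>x\<rfloor>}. \<Sum>v\<in>{1..nat \<lfloor>x\<rfloor>}.
       if ln x ^ (2 * k1) < real u \<and> ln x ^ (2 * k1) < real v \<and> real u * real v \<le> x
       then \<alpha> u * \<beta> v * ap_kernel q (int (a q)) (u * v) else 0)) \<le> (3 * E + 96) * (x / ln x ^ k)"
      unfolding F_def K_def P_def N_def L_def distrib_right by simp
  qed
qed

section \<open>Dirichlet convolutions\<close>

lemma nat_discrepancy_dirichlet_conv:
  assumes N: "N = nat \<lfloor>x\<rfloor>"
  shows "nat_discrepancy (dirichlet_conv \<alpha> \<beta>) N q a
    = (\<Sum>u\<in>{1..N}. \<Sum>v\<in>{1..N}. if real u * real v \<le> x then \<alpha> u * \<beta> v * ap_kernel q a (u * v) else 0)"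
proof -
  have iff: "real u * real v \<le> x \<longleftrightarrow> u * v \<le> N" if "u \<ge> 1" "v \<ge> 1" for u v
  proof -
    have "u * v \<ge> 1" using that by simp
    from real_le_iff_le_floor[OF this, of x] show ?thesis unfolding N by simp
  qed
  have "nat_discrepancy (dirichlet_conv \<alpha> \<beta>) N q a
      = (\<Sum>n\<in>{1..N}. \<Sum>d | d dvd n. \<alpha> d * \<beta> (n div d) * ap_kernel q a n)"
    unfolding nat_discrepancy_def dirichlet_conv_def by (simp add: sum_distrib_right)
  also have "\<dots> = (\<Sum>(n, d)\<in>Sigma {1..N} (\<lambda>n. {d. d dvd n}). \<alpha> d * \<beta> (n div d) * ap_kernel q a n)"
    by (subst sum.Sigma) auto
  also have "\<dots> = (\<Sum>(u, v)\<in>{p\<in>{1..N} \<times> {1..N}. fst p * snd p \<le> N}. \<alpha> u * \<beta> v * ap_kernel q a (u * v))"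
  proof (rule sum.reindex_bij_witness[where i = "\<lambda>(u, v). (u * v, u)" and j = "\<lambda>(n, d). (d, n div d)"])
    fix p assume p: "p \<in> Sigma {1..N} (\<lambda>n. {d. d dvd n})"
    obtain n d where nd: "p = (n, d)" by (cases p)
    with p have h: "1 \<le> n" "n \<le> N" "d dvd n" by auto
    then obtain e where e: "n = d * e" by blast
    have de: "d \<ge> 1" "e \<ge> 1" using h e by (cases d; cases e; auto)+
    have "d \<le> n" "e \<le> n" using de unfolding e by auto
    then have "d \<le> N" "e \<le> N" using h(2) by linarith+
    then show "(case p of (n, d) \<Rightarrow> (d, n div d)) \<in> {p\<in>{1..N} \<times> {1..N}. fst p * snd p \<le> N}"
      using nd h e de by auto
    show "(case case p of (n, d) \<Rightarrow> (d, n div d) of (u, v) \<Rightarrow> (u * v, u)) = p" using nd e de by simp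
    show "(case case p of (n, d) \<Rightarrow> (d, n div d) of (u, v) \<Rightarrow> \<alpha> u * \<beta> v * ap_kernel q a (u * v))
      = (case p of (n, d) \<Rightarrow> \<alpha> d * \<beta> (n div d) * ap_kernel q a n)" using nd e de by simp
  next
    fix p assume p: "p \<in> {p\<in>{1..N} \<times> {1..N}. fst p * snd p \<le> N}"
    obtain u v where uv: "p = (u, v)" by (cases p)
    with p have h: "1 \<le> u" "1 \<le> v" "u * v \<le> N" by auto
    show "(case case p of (u, v) \<Rightarrow> (u * v, u) of (n, d) \<Rightarrow> (d, n div d)) = p" using uv h by simp
    have "1 \<le> u * v" using h by simp
    then show "(case p of (u, v) \<Rightarrow> (u * v, u)) \<in> Sigma {1..N} (\<lambda>n. {d. d dvd n})" using uv h by auto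
  qed
  also have "\<dots> = (\<Sum>p\<in>{1..N} \<times> {1..N}. if fst p * snd p \<le> N then (case p of (u, v) \<Rightarrow> \<alpha> u * \<beta> v * ap_kernel q a (u * v)) else 0)"
    by (rule sum.inter_filter) simp
  also have "\<dots> = (\<Sum>u\<in>{1..N}. \<Sum>v\<in>{1..N}. if u * v \<le> N then \<alpha> u * \<beta> v * ap_kernel q a (u * v) else 0)"
    unfolding sum.cartesian_product by (intro sum.cong refl) auto
  also have "\<dots> = (\<Sum>u\<in>{1..N}. \<Sum>v\<in>{1..N}. if real u * real v \<le> x then \<alpha> u * \<beta> v * ap_kernel q a (u * v) else 0)"
    using iff by (intro sum.cong refl if_cong) auto
  finally show ?thesis .
qed

text \<open>For each q the factor v is divided out of the residue, or the kernel vanishes if v and q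
  have a common factor. The new residues vary with v, which the maxima in \<open>bv_sum\<close>
  absorb.\<close>

lemma inner_sum_le_bv_sum:
  assumes N: "N = nat \<lfloor>x\<rfloor>" and x: "x \<ge> 0" and a: "\<And>q. q \<in> {1..Q} \<Longrightarrow> coprime (a q) q" and v: "v \<ge> 1"
  shows "(\<Sum>q\<in>{1..Q}. cmod (\<Sum>u\<in>{1..N}. if real u * real v \<le> x then h u * ap_kernel q (int (a q)) (v * u) else 0))
    \<le> bv_sum h (nat \<lfloor>x / real v\<rfloor>) Q"
proof -
  let ?M = "nat \<lfloor>x / real v\<rfloor>"
  have iff: "real u * real v \<le> x \<longleftrightarrow> u \<le> ?M" if "u \<ge> 1" for u
    using real_le_iff_le_floor[OF that, of "x / real v"] v by (simp add: pos_le_divide_eq)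
  have "x / real v \<le> x / 1" using v x by (intro divide_left_mono) auto
  then have MN: "?M \<le> N" unfolding N by (intro nat_mono floor_mono) simp
  have ex: "\<exists>a'. coprime a' q \<and> cmod (\<Sum>u\<in>{1..N}. if real u * real v \<le> x then h u * ap_kernel q (int (a q)) (v * u) else 0)
      \<le> cmod (nat_discrepancy h ?M q (int a'))" if q: "q \<in> {1..Q}" for q
  proof (cases "coprime v q")
    case False
    have "(\<Sum>u\<in>{1..N}. if real u * real v \<le> x then h u * ap_kernel q (int (a q)) (v * u) else 0) = 0"
      using ap_kernel_mult_not_coprime[OF a[OF q] False] by (intro sum.neutral) simp
    then show ?thesis by (intro exI[of _ 1]) simp
  next
    case True
    obtain a' where a': "coprime a' q" "\<And>u. ap_kernel q (int (a q)) (v * u) = ap_kernel q (int a') u"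
      using ap_kernel_mult_coprime[OF a[OF q] True] q by auto
    have "(\<Sum>u\<in>{1..N}. if real u * real v \<le> x then h u * ap_kernel q (int (a q)) (v * u) else 0)
       = nat_discrepancy h ?M q (int a')"
      unfolding nat_discrepancy_def a'(2)
      using MN iff by (intro sum.mono_neutral_cong_right) auto
    then show ?thesis using a'(1) by (intro exI[of _ a']) simp
  qed
  then have "\<forall>q\<in>{1..Q}. \<exists>a'. coprime a' q \<and> cmod (\<Sum>u\<in>{1..N}. if real u * real v \<le> x then h u * ap_kernel q (int (a q)) (v * u) else 0)
      \<le> cmod (nat_discrepancy h ?M q (int a'))" by blast
  from bchoice[OF this] obtain a' where a': "\<forall>q\<in>{1..Q}. coprime (a' q) q \<and> cmod (\<Sum>u\<in>{1..N}. if real u * real v \<le> x then h u * ap_kernel q (int (a q)) (v * u) else 0)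
      \<le> cmod (nat_discrepancy h ?M q (int (a' q)))" ..
  have "(\<Sum>q\<in>{1..Q}. cmod (\<Sum>u\<in>{1..N}. if real u * real v \<le> x then h u * ap_kernel q (int (a q)) (v * u) else 0))
    \<le> (\<Sum>q\<in>{1..Q}. cmod (nat_discrepancy h ?M q (int (a' q))))"
    using a' by (intro sum_mono) blast
  also have "\<dots> \<le> bv_sum h ?M Q" using a' by (intro sum_nat_discrepancy_le_bv_sum) simp
  finally show ?thesis .
qed

lemma eventually_lnln_le:
  fixes p :: nat
  shows "\<forall>\<^sub>F x in at_top. (1 + real p * ln (ln x))\<^sup>2 \<le> ln x powr (1/2)"
proof -
  have "\<forall>\<^sub>F t :: real in at_top. (1 + real p * ln t)\<^sup>2 \<le> t powr (1/2)"
  proof -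
    have "((\<lambda>t :: real. ln t / t powr (1/4)) \<longlongrightarrow> 0) at_top" by real_asymp
    then have "((\<lambda>t :: real. 1 / t powr (1/4) + real p * (ln t / t powr (1/4))) \<longlongrightarrow> 0 + real p * 0) at_top"
      by (intro tendsto_add tendsto_mult tendsto_const) (real_asymp)
    then have "\<forall>\<^sub>F t :: real in at_top. 1 / t powr (1/4) + real p * (ln t / t powr (1/4)) < 1"
      by (rule order_tendstoD(2)) simp
    then show ?thesis using eventually_ge_at_top[of 1]
    proof eventually_elim
      case (elim t)
      have "1 + real p * ln t \<le> t powr (1/4)" using elim by (simp add: field_simps)
      moreover have "0 \<le> 1 + real p * ln t" using elim by simp
      ultimately have "(1 + real p * ln t)\<^sup>2 \<le> (t powr (1/4))\<^sup>2" by (intro power_mono)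
      also have "\<dots> = t powr (1/2)" by (simp add: power2_eq_square flip: powr_add)
      finally show ?case .
    qed
  qed
  then show ?thesis using ln_at_top by (rule eventually_compose_filterlim)
qed

text \<open>
  The loss of \<open>1/2\<close> in the exponent pays for the sum of \<open>\<bar>\<alpha> u\<bar> / u\<close> over \<open>u \<le> (ln x)\<^sup>p\<close>, which is at most a
  power of \<open>ln (ln x)\<close>.
\<close>

lemma bv_level_dirichlet_conv:
  assumes lb: "log_bounded \<alpha>" "log_bounded \<beta>" and sw: "sw_bound \<alpha>" "sw_bound \<beta>"
    and lv: "bv_level \<alpha> k" "bv_level \<beta> k"
  shows "bv_level (dirichlet_conv \<alpha> \<beta>) (k - 1/2)"
proof -
  \<comment> \<open>A natural number at least k: the range where both variables are large allows any
    saving, and \<open>bilinear_range_bound\<close> states it in natural powers.\<close>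
  define k0 where "k0 = nat \<lceil>\<bar>k\<bar>\<rceil>"
  define k1 where "k1 = 2 * k0 + 12"
  define p where "p = 2 * k1"
  obtain m1 C1 where C1: "C1 \<ge> 0" and ev1: "\<forall>\<^sub>F x in at_top. \<forall>y Q. sqrt x \<le> y \<and> y \<le> x \<and> real Q \<le> sqrt y / ln x ^ m1
       \<longrightarrow> bv_sum \<alpha> (nat \<lfloor>y\<rfloor>) Q \<le> C1 * (y / ln x powr k)" using bv_level_obtain[OF lv(1)] by blast
  obtain m2 C2 where C2: "C2 \<ge> 0" and ev2: "\<forall>\<^sub>F x in at_top. \<forall>y Q. sqrt x \<le> y \<and> y \<le> x \<and> real Q \<le> sqrt y / ln x ^ m2
       \<longrightarrow> bv_sum \<beta> (nat \<lfloor>y\<rfloor>) Q \<le> C2 * (y / ln x powr k)" using bv_level_obtain[OF lv(2)] by blast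
  obtain C3 where ev3: "\<forall>\<^sub>F x in at_top. \<forall>Q (a :: nat \<Rightarrow> nat). real Q \<le> sqrt x / ln x ^ k1 \<longrightarrow> (\<forall>q\<in>{1..Q}. coprime (a q) q) \<longrightarrow>
    (\<Sum>q\<in>{1..Q}. cmod (\<Sum>u\<in>{1..nat \<lfloor>x\<rfloor>}. \<Sum>v\<in>{1..nat \<lfloor>x\<rfloor>}.
       if ln x ^ p < real u \<and> ln x ^ p < real v \<and> real u * real v \<le> x
       then \<alpha> u * \<beta> v * ap_kernel q (int (a q)) (u * v) else 0)) \<le> C3 * (x / ln x ^ k0)"
    using bilinear_range_bound[OF lb sw, of k0] unfolding k1_def p_def by blast
  \<comment> \<open>Passing from x to x / v with v \<le> L^p shrinks the admissible range of Q by at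
    most L^p, whence the summand p; the summand k1 is the range of
    \<open>bilinear_range_bound\<close>.\<close>
  define m where "m = m1 + m2 + p + k1"
  show ?thesis unfolding bv_level_def
  proof (intro exI[of _ m] exI[of _ "C1 + C2 + 4 + \<bar>C3\<bar>"],
      use ev1 ev2 ev3 eventually_ln_ge[of 2] eventually_ge_at_top[of 4] eventually_ln_power_le_sqrt[of "2 + 2 * p + k0"] eventually_lnln_le[of p] in eventually_elim,
      intro allI impI, rule bv_sum_le)
    fix x :: real and Q :: nat and a :: "nat \<Rightarrow> nat"
    assume B1: "\<forall>y Q. sqrt x \<le> y \<and> y \<le> x \<and> real Q \<le> sqrt y / ln x ^ m1 \<longrightarrow> bv_sum \<alpha> (nat \<lfloor>y\<rfloor>) Q \<le> C1 * (y / ln x powr k)"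
      and B2: "\<forall>y Q. sqrt x \<le> y \<and> y \<le> x \<and> real Q \<le> sqrt y / ln x ^ m2 \<longrightarrow> bv_sum \<beta> (nat \<lfloor>y\<rfloor>) Q \<le> C2 * (y / ln x powr k)"
      and B3: "\<forall>Q (a :: nat \<Rightarrow> nat). real Q \<le> sqrt x / ln x ^ k1 \<longrightarrow> (\<forall>q\<in>{1..Q}. coprime (a q) q) \<longrightarrow>
        (\<Sum>q\<in>{1..Q}. cmod (\<Sum>u\<in>{1..nat \<lfloor>x\<rfloor>}. \<Sum>v\<in>{1..nat \<lfloor>x\<rfloor>}.
           if ln x ^ p < real u \<and> ln x ^ p < real v \<and> real u * real v \<le> x
           then \<alpha> u * \<beta> v * ap_kernel q (int (a q)) (u * v) else 0)) \<le> C3 * (x / ln x ^ k0)"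
      and L2: "2 \<le> ln x" and x4: "4 \<le> x" and Lx: "ln x ^ (2 + 2 * p + k0) \<le> sqrt x"
      and LL: "(1 + real p * ln (ln x))\<^sup>2 \<le> ln x powr (1/2)"
      and Qx: "real Q \<le> sqrt x / ln x ^ m" and a: "\<And>q. q \<in> {1..Q} \<Longrightarrow> coprime (a q) q"
    define L where "L = ln x"
    define N where "N = nat \<lfloor>x\<rfloor>"
    define P where "P = L ^ p"
    define T where "T = x / L powr (k - 1/2)"
    define K where "K q u v = ap_kernel q (int (a q)) (u * v)" for q u v
    have L: "L \<ge> 2" using L2 by (simp add: L_def)
    have L0: "L > 0" using L by linarith
    have Lp: "L ^ n \<ge> 1" "L ^ n > 0" for n using L by (auto intro!: one_le_power)
    have P: "P \<ge> 1" unfolding P_def by (rule Lp)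
    have sx: "sqrt x \<ge> 2" using x4 real_le_rsqrt[of 2 x] by simp
    have ssx: "sqrt x * sqrt x = x" using x4 by simp
    have N: "real N \<le> x" unfolding N_def using x4 by simp
    have sxx: "sqrt x \<le> x" using x4 by (intro real_le_lsqrt) (auto simp: power2_eq_square)
    have T0: "T \<ge> 0" unfolding T_def using x4 by simp
    have Pn: "L ^ n \<le> L ^ (2 + 2 * p + k0)" if "n \<le> 2 + 2 * p + k0" for n
      using that L by (intro power_increasing) auto
    have Ps: "P \<le> sqrt x" using Pn[of p] Lx unfolding P_def L_def by simp
    have lnP: "1 + ln P = 1 + real p * ln L" unfolding P_def using L0 by (simp add: ln_realpow)
    have LL': "(1 + ln P)\<^sup>2 \<le> L powr (1/2)" unfolding lnP using LL unfolding L_def .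
    have lnP0: "1 + ln P \<ge> 0" using P by simp
    have k0T: "x / L ^ k0 \<le> T"
    proof -
      have "L ^ k0 = L powr real k0" using L0 by (simp add: powr_realpow)
      moreover have "L powr (k - 1/2) \<le> L powr real k0" using L unfolding k0_def by (intro powr_mono) linarith+
      ultimately show ?thesis unfolding T_def using x4 L0 by (intro divide_left_mono) auto
    qed
    have bP: "cmod (h n) \<le> 1 + ln P" if "log_bounded h" "n \<ge> 1" "real n \<le> P" for h :: "nat \<Rightarrow> complex" and n
      using log_boundedD[OF that(1), of n n P] that by simp
    have bL: "cmod (h n) \<le> 2 * L" if "log_bounded h" "n \<ge> 1" "real n \<le> P" for h :: "nat \<Rightarrow> complex" and n
    proof -
      have "real n \<le> x" using that Ps sxx by linarith
      then show ?thesis using log_boundedD[OF that(1), of n n x] that L unfolding L_def by simp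
    qed
    have yQ: "sqrt x \<le> x / real v" "x / real v \<le> x" "real Q \<le> sqrt (x / real v) / L ^ m'"
      if v: "v \<ge> 1" "real v \<le> P" and m': "m' + p \<le> m" for v m'
    proof -
      have "sqrt x * real v \<le> sqrt x * sqrt x" using v Ps x4 by (intro mult_left_mono) auto
      then show "sqrt x \<le> x / real v" unfolding ssx using v by (simp add: pos_le_divide_eq)
      have "x / real v \<le> x / 1" using v x4 by (intro divide_left_mono) auto
      then show "x / real v \<le> x" by simp
      have "sqrt (real v) \<le> real v" using v by (intro real_le_lsqrt) (auto simp: power2_eq_square)
      then have "sqrt (real v) \<le> P" using v by linarith
      then have "sqrt x / P \<le> sqrt x / sqrt (real v)" using v x4 P by (intro divide_left_mono) auto
      then have "sqrt x / P / L ^ m' \<le> sqrt (x / real v) / L ^ m'"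
        unfolding real_sqrt_divide using Lp[of m'] by (intro divide_right_mono) auto
      moreover have "sqrt x / L ^ m \<le> sqrt x / P / L ^ m'"
      proof -
        have "sqrt x / L ^ m \<le> sqrt x / L ^ (m' + p)" using m' L x4 Lp by (intro divide_left_mono power_increasing) auto
        then show ?thesis unfolding P_def by (simp add: power_add mult.commute)
      qed
      ultimately show "real Q \<le> sqrt (x / real v) / L ^ m'" using Qx unfolding L_def by linarith
    qed
    define I where "I = {n\<in>{1..N}. real n \<le> P}"
    have I: "n \<ge> 1" "real n \<le> P" if "n \<in> I" for n using that by (auto simp: I_def)
    have sumI: "(\<Sum>n\<in>I. 1 / real n) \<le> 1 + ln P"
    proof -
      have "I \<subseteq> {1..nat \<lfloor>P\<rfloor>}" unfolding I_def by (auto intro: le_nat_floor)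
      then have "(\<Sum>n\<in>I. 1 / real n) \<le> (\<Sum>n\<in>{1..nat \<lfloor>P\<rfloor>}. 1 / real n)" by (intro sum_mono2) auto
      also have "\<dots> \<le> 1 + ln (real (nat \<lfloor>P\<rfloor>))" using P by (intro sum_inverse_le_ln) linarith
      also have "\<dots> \<le> 1 + ln P" using P by simp
      finally show ?thesis .
    qed
    have cardI: "real (card I) \<le> P"
    proof -
      have "I \<subseteq> {1..nat \<lfloor>P\<rfloor>}" unfolding I_def by (auto intro: le_nat_floor)
      then have "card I \<le> nat \<lfloor>P\<rfloor>" using card_mono[of "{1..nat \<lfloor>P\<rfloor>}" I] by simp
      then show ?thesis using P by linarith
    qed
    have weighted: "(\<Sum>n\<in>I. cmod (h n) * (C * ((x / real n) / L powr k))) \<le> C * T"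
      if h: "log_bounded h" and C: "C \<ge> 0" for h :: "nat \<Rightarrow> complex" and C
    proof -
      have "(\<Sum>n\<in>I. cmod (h n) * (C * ((x / real n) / L powr k))) \<le> (\<Sum>n\<in>I. (1 + ln P) * (C * ((x / real n) / L powr k)))"
        using I bP[OF h] C x4 by (intro sum_mono mult_right_mono) auto
      also have "\<dots> = (1 + ln P) * (C * (x / L powr k)) * (\<Sum>n\<in>I. 1 / real n)"
        unfolding sum_distrib_left by (intro sum.cong refl) simp
      also have "\<dots> \<le> (1 + ln P) * (C * (x / L powr k)) * (1 + ln P)"
        using sumI lnP0 C x4 by (intro mult_left_mono mult_nonneg_nonneg) auto
      also have "\<dots> = C * (x / L powr k) * (1 + ln P)\<^sup>2" by (simp add: power2_eq_square)
      also have "\<dots> \<le> C * (x / L powr k) * L powr (1/2)" using LL' C x4 by (intro mult_left_mono) auto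
      also have "\<dots> = C * T" unfolding T_def using L0 by (simp add: powr_diff)
      finally show ?thesis .
    qed
    define S1 where "S1 q = (\<Sum>v\<in>I. \<beta> v * (\<Sum>u\<in>{1..N}. if real u * real v \<le> x then \<alpha> u * ap_kernel q (int (a q)) (v * u) else 0))" for q
    define S2 where "S2 q = (\<Sum>u\<in>I. \<alpha> u * (\<Sum>v\<in>{1..N}. if real v * real u \<le> x then \<beta> v * ap_kernel q (int (a q)) (u * v) else 0))" for q
    \<comment> \<open>The pairs with both variables at most P occur in S1 and in S2 and are taken
      off once.\<close>
    define S2' where "S2' q = (\<Sum>u\<in>I. \<alpha> u * (\<Sum>v\<in>I. if real v * real u \<le> x then \<beta> v * ap_kernel q (int (a q)) (u * v) else 0))" for q
    define S3 where "S3 q = (\<Sum>u\<in>{1..N}. \<Sum>v\<in>{1..N}.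
           if P < real u \<and> P < real v \<and> real u * real v \<le> x
           then \<alpha> u * \<beta> v * ap_kernel q (int (a q)) (u * v) else 0)" for q
    have decomp: "nat_discrepancy (dirichlet_conv \<alpha> \<beta>) N q (int (a q)) = S1 q + (S2 q - S2' q) + S3 q" for q
    proof -
      define t where "t u v = (if real u * real v \<le> x then \<alpha> u * \<beta> v * K q u v else 0)" for u v
      have filt: "(\<Sum>n\<in>I. f n) = (\<Sum>n\<in>{1..N}. if real n \<le> P then f n else 0)" for f :: "nat \<Rightarrow> complex"
        unfolding I_def by (rule sum.inter_filter) simp
      have 1: "S1 q = (\<Sum>u\<in>{1..N}. \<Sum>v\<in>{1..N}. if real v \<le> P then t u v else 0)"
        unfolding S1_def filt sum_distrib_left
        by (subst sum.swap) (intro sum.cong refl, auto simp: t_def K_def mult_ac intro!: sum.cong)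
      have 2: "S2 q = (\<Sum>u\<in>{1..N}. \<Sum>v\<in>{1..N}. if real u \<le> P then t u v else 0)"
        unfolding S2_def filt sum_distrib_left by (intro sum.cong refl) (auto simp: t_def K_def mult_ac intro!: sum.cong)
      have 3: "S2' q = (\<Sum>u\<in>{1..N}. \<Sum>v\<in>{1..N}. if real u \<le> P \<and> real v \<le> P then t u v else 0)"
        unfolding S2'_def filt sum_distrib_left by (intro sum.cong refl) (auto simp: t_def K_def mult_ac intro!: sum.cong)
      have 4: "S3 q = (\<Sum>u\<in>{1..N}. \<Sum>v\<in>{1..N}. if P < real u \<and> P < real v then t u v else 0)"
        unfolding S3_def by (intro sum.cong refl) (auto simp: t_def K_def)
      have "nat_discrepancy (dirichlet_conv \<alpha> \<beta>) N q (int (a q)) = (\<Sum>u\<in>{1..N}. \<Sum>v\<in>{1..N}. t u v)"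
        unfolding t_def K_def by (rule nat_discrepancy_dirichlet_conv[OF N_def])
      also have "\<dots> = S1 q + (S2 q - S2' q) + S3 q"
        unfolding 1 2 3 4 sum_subtractf[symmetric] sum.distrib[symmetric] by (intro sum.cong refl) auto
      finally show ?thesis .
    qed
    have e1: "(\<Sum>q\<in>{1..Q}. cmod (S1 q)) \<le> C1 * T"
    proof -
      have "(\<Sum>q\<in>{1..Q}. cmod (S1 q)) \<le> (\<Sum>q\<in>{1..Q}. \<Sum>v\<in>I. cmod (\<beta> v) * cmod (\<Sum>u\<in>{1..N}. if real u * real v \<le> x then \<alpha> u * ap_kernel q (int (a q)) (v * u) else 0))"
        unfolding S1_def by (intro sum_mono order_trans[OF norm_sum]) (simp add: norm_mult)
      also have "\<dots> = (\<Sum>v\<in>I. cmod (\<beta> v) * (\<Sum>q\<in>{1..Q}. cmod (\<Sum>u\<in>{1..N}. if real u * real v \<le> x then \<alpha> u * ap_kernel q (int (a q)) (v * u) else 0)))"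
        by (subst sum.swap) (simp only: sum_distrib_left)
      also have "\<dots> \<le> (\<Sum>v\<in>I. cmod (\<beta> v) * (C1 * ((x / real v) / L powr k)))"
      proof (intro sum_mono mult_left_mono)
        fix v assume v: "v \<in> I"
        have "(\<Sum>q\<in>{1..Q}. cmod (\<Sum>u\<in>{1..N}. if real u * real v \<le> x then \<alpha> u * ap_kernel q (int (a q)) (v * u) else 0))
          \<le> bv_sum \<alpha> (nat \<lfloor>x / real v\<rfloor>) Q" using v I x4 a by (intro inner_sum_le_bv_sum N_def) auto
        also have "\<dots> \<le> C1 * ((x / real v) / L powr k)"
          using B1[rule_format, of "x / real v" Q] yQ[OF I[OF v], of m1] unfolding L_def m_def by simp
        finally show "(\<Sum>q\<in>{1..Q}. cmod (\<Sum>u\<in>{1..N}. if real u * real v \<le> x then \<alpha> u * ap_kernel q (int (a q)) (v * u) else 0))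
          \<le> C1 * ((x / real v) / L powr k)" .
      qed simp
      also have "\<dots> \<le> C1 * T" by (rule weighted[OF lb(2) C1])
      finally show ?thesis .
    qed
    have e2: "(\<Sum>q\<in>{1..Q}. cmod (S2 q)) \<le> C2 * T"
    proof -
      have "(\<Sum>q\<in>{1..Q}. cmod (S2 q)) \<le> (\<Sum>q\<in>{1..Q}. \<Sum>u\<in>I. cmod (\<alpha> u) * cmod (\<Sum>v\<in>{1..N}. if real v * real u \<le> x then \<beta> v * ap_kernel q (int (a q)) (u * v) else 0))"
        unfolding S2_def by (intro sum_mono order_trans[OF norm_sum]) (simp add: norm_mult)
      also have "\<dots> = (\<Sum>u\<in>I. cmod (\<alpha> u) * (\<Sum>q\<in>{1..Q}. cmod (\<Sum>v\<in>{1..N}. if real v * real u \<le> x then \<beta> v * ap_kernel q (int (a q)) (u * v) else 0)))"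
        by (subst sum.swap) (simp only: sum_distrib_left)
      also have "\<dots> \<le> (\<Sum>u\<in>I. cmod (\<alpha> u) * (C2 * ((x / real u) / L powr k)))"
      proof (intro sum_mono mult_left_mono)
        fix u assume u: "u \<in> I"
        have "(\<Sum>q\<in>{1..Q}. cmod (\<Sum>v\<in>{1..N}. if real v * real u \<le> x then \<beta> v * ap_kernel q (int (a q)) (u * v) else 0))
          \<le> bv_sum \<beta> (nat \<lfloor>x / real u\<rfloor>) Q" using u I x4 a by (intro inner_sum_le_bv_sum N_def) auto
        also have "\<dots> \<le> C2 * ((x / real u) / L powr k)"
          using B2[rule_format, of "x / real u" Q] yQ[OF I[OF u], of m2] unfolding L_def m_def by simp
        finally show "(\<Sum>q\<in>{1..Q}. cmod (\<Sum>v\<in>{1..N}. if real v * real u \<le> x then \<beta> v * ap_kernel q (int (a q)) (u * v) else 0))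
          \<le> C2 * ((x / real u) / L powr k)" .
      qed simp
      also have "\<dots> \<le> C2 * T" by (rule weighted[OF lb(1) C2])
      finally show ?thesis .
    qed
    \<comment> \<open>With at most P^2 pairs for each of at most \<open>sqrt x\<close> moduli this
      is of size \<open>sqrt x\<close> up to logarithms, so trivial bounds suffice.\<close>
    have e2': "(\<Sum>q\<in>{1..Q}. cmod (S2' q)) \<le> 4 * T"
    proof -
      have Qs: "real Q \<le> sqrt x"
      proof -
        have "sqrt x / L ^ m \<le> sqrt x / 1" using Lp x4 by (intro divide_left_mono) auto
        then show ?thesis using Qx unfolding L_def by simp
      qed
      have "cmod (S2' q) \<le> P * (2 * L * (P * (2 * L)))" if q: "q \<in> {1..Q}" for q
      proof -
        have inner: "cmod (\<Sum>v\<in>I. if real v * real u \<le> x then \<beta> v * ap_kernel q (int (a q)) (u * v) else 0) \<le> P * (2 * L)" for u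
        proof -
          have "cmod (\<Sum>v\<in>I. if real v * real u \<le> x then \<beta> v * ap_kernel q (int (a q)) (u * v) else 0) \<le> (\<Sum>v\<in>I. 2 * L)"
          proof (rule sum_norm_le)
            fix v assume v: "v \<in> I"
            have "cmod (\<beta> v) * cmod (ap_kernel q (int (a q)) (u * v)) \<le> 2 * L * 1"
              using bL[OF lb(2) I[OF v]] q L by (intro mult_mono cmod_ap_kernel_le_1) auto
            then show "cmod (if real v * real u \<le> x then \<beta> v * ap_kernel q (int (a q)) (u * v) else 0) \<le> 2 * L"
              using L by (simp add: norm_mult)
          qed
          also have "\<dots> = real (card I) * (2 * L)" by simp
          also have "\<dots> \<le> P * (2 * L)" using cardI L by (intro mult_right_mono) auto
          finally show ?thesis .
        qed
        have "cmod (S2' q) \<le> (\<Sum>u\<in>I. 2 * L * (P * (2 * L)))"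
          unfolding S2'_def
        proof (rule sum_norm_le)
          fix u assume u: "u \<in> I"
          show "cmod (\<alpha> u * (\<Sum>v\<in>I. if real v * real u \<le> x then \<beta> v * ap_kernel q (int (a q)) (u * v) else 0)) \<le> 2 * L * (P * (2 * L))"
            unfolding norm_mult using bL[OF lb(1) I[OF u]] inner L by (intro mult_mono) auto
        qed
        also have "\<dots> = real (card I) * (2 * L * (P * (2 * L)))" by simp
        also have "\<dots> \<le> P * (2 * L * (P * (2 * L)))" using cardI L P by (intro mult_right_mono) auto
        finally show ?thesis .
      qed
      then have "(\<Sum>q\<in>{1..Q}. cmod (S2' q)) \<le> (\<Sum>q\<in>{1..Q}. P * (2 * L * (P * (2 * L))))" by (rule sum_mono)
      also have "\<dots> = real Q * (P * (2 * L * (P * (2 * L))))" by simp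
      also have "\<dots> \<le> sqrt x * (P * (2 * L * (P * (2 * L))))" using Qs P L by (intro mult_right_mono) auto
      also have "\<dots> = 4 * (sqrt x * L ^ (2 + 2 * p))"
      proof -
        have "L ^ (2 + 2 * p) = L * L * (P * P)" unfolding P_def by (simp only: power_add power2_eq_square mult_2)
        then show ?thesis by (simp only:) simp
      qed
      also have "sqrt x * L ^ (2 + 2 * p) \<le> x / L ^ k0"
      proof -
        have "sqrt x * L ^ (2 + 2 * p) * L ^ k0 = sqrt x * L ^ (2 + 2 * p + k0)" by (simp only: power_add mult_ac)
        also have "\<dots> \<le> sqrt x * sqrt x" using Lx x4 unfolding L_def by (intro mult_left_mono) auto
        finally show ?thesis unfolding ssx using Lp[of k0] by (simp add: pos_le_divide_eq)
      qed
      finally show ?thesis using k0T by simp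
    qed
    have e3: "(\<Sum>q\<in>{1..Q}. cmod (S3 q)) \<le> \<bar>C3\<bar> * T"
    proof -
      have "sqrt x / L ^ m \<le> sqrt x / L ^ k1" using L x4 Lp by (intro divide_left_mono power_increasing) (auto simp: m_def)
      then have "real Q \<le> sqrt x / L ^ k1" using Qx unfolding L_def by linarith
      then have "(\<Sum>q\<in>{1..Q}. cmod (S3 q)) \<le> C3 * (x / L ^ k0)"
        unfolding S3_def P_def N_def L_def using B3 a by blast
      also have "\<dots> \<le> \<bar>C3\<bar> * T" using k0T x4 Lp[of k0] by (intro mult_mono) auto
      finally show ?thesis .
    qed
    have "(\<Sum>q\<in>{1..Q}. cmod (nat_discrepancy (dirichlet_conv \<alpha> \<beta>) N q (int (a q))))
      \<le> (\<Sum>q\<in>{1..Q}. cmod (S1 q) + (cmod (S2 q) + cmod (S2' q)) + cmod (S3 q))"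
      unfolding decomp by (intro sum_mono order_trans[OF norm_triangle_ineq] add_mono norm_triangle_ineq4 order_refl)
    also have "\<dots> = (\<Sum>q\<in>{1..Q}. cmod (S1 q)) + ((\<Sum>q\<in>{1..Q}. cmod (S2 q)) + (\<Sum>q\<in>{1..Q}. cmod (S2' q))) + (\<Sum>q\<in>{1..Q}. cmod (S3 q))"
      by (simp only: sum.distrib)
    also have "\<dots> \<le> C1 * T + (C2 * T + 4 * T) + \<bar>C3\<bar> * T" by (intro add_mono e1 e2 e2' e3)
    also have "\<dots> = (C1 + C2 + 4 + \<bar>C3\<bar>) * T" by (simp add: algebra_simps)
    finally show "(\<Sum>q\<in>{1..Q}. cmod (nat_discrepancy (dirichlet_conv \<alpha> \<beta>) (nat \<lfloor>x\<rfloor>) q (int (a q))))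
       \<le> (C1 + C2 + 4 + \<bar>C3\<bar>) * (x / ln x powr (k - 1/2))" unfolding N_def T_def L_def .
  qed
qed

section \<open>Algebra of Dirichlet convolution\<close>

lemma dirichlet_conv_assoc:
  assumes "n > 0"
  shows "dirichlet_conv (dirichlet_conv f g) h n = dirichlet_conv f (dirichlet_conv g h) n"
proof -
  have "dirichlet_conv (dirichlet_conv f g) h n = (\<Sum>d | d dvd n. \<Sum>e | e dvd d. f e * g (d div e) * h (n div d))"
    by (simp add: dirichlet_conv_def sum_distrib_right)
  also have "\<dots> = (\<Sum>(d, e)\<in>Sigma {d. d dvd n} (\<lambda>d. {e. e dvd d}). f e * g (d div e) * h (n div d))"
    using assms by (subst sum.Sigma) (auto intro: finite_divisors_nat dvd_pos_nat)
  also have "\<dots> = (\<Sum>(e, k)\<in>Sigma {e. e dvd n} (\<lambda>e. {k. k dvd n div e}). f e * (g k * h (n div e div k)))"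
  proof (rule sum.reindex_bij_witness[where i = "\<lambda>(e, k). (e * k, e)" and j = "\<lambda>(d, e). (e, d div e)"])
    fix p assume p: "p \<in> Sigma {d. d dvd n} (\<lambda>d. {e. e dvd d})"
    obtain d e where de: "p = (d, e)" by (cases p)
    with p have h: "d dvd n" "e dvd d" by auto
    then obtain k l where k: "d = e * k" and l: "n = e * k * l" by (auto elim!: dvdE)
    have pos: "e > 0" "k > 0" using assms l by (auto intro!: Nat.gr0I)
    show "(case case p of (d, e) \<Rightarrow> (e, d div e) of (e, k) \<Rightarrow> (e * k, e)) = p" using de k pos by simp
    show "(case p of (d, e) \<Rightarrow> (e, d div e)) \<in> Sigma {e. e dvd n} (\<lambda>e. {k. k dvd n div e})"
      using de k l pos by (simp add: mult.assoc)
    show "(case case p of (d, e) \<Rightarrow> (e, d div e) of (e, k) \<Rightarrow> f e * (g k * h (n div e div k)))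
       = (case p of (d, e) \<Rightarrow> f e * g (d div e) * h (n div d))"
      using de k pos by (simp add: div_mult2_eq mult.assoc)
  next
    fix p assume p: "p \<in> Sigma {e. e dvd n} (\<lambda>e. {k. k dvd n div e})"
    obtain e k where ek: "p = (e, k)" by (cases p)
    with p have h: "e dvd n" "k dvd n div e" by auto
    then obtain m where m: "n = e * m" by blast
    have pos: "e > 0" using assms m by (auto intro!: Nat.gr0I)
    show "(case case p of (e, k) \<Rightarrow> (e * k, e) of (d, e) \<Rightarrow> (e, d div e)) = p" using ek pos by simp
    show "(case p of (e, k) \<Rightarrow> (e * k, e)) \<in> Sigma {d. d dvd n} (\<lambda>d. {e. e dvd d})"
      using ek h m pos by simp
  qed
  also have "\<dots> = (\<Sum>e | e dvd n. \<Sum>k | k dvd n div e. f e * (g k * h (n div e div k)))"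
    using assms by (subst sum.Sigma) (auto intro!: finite_divisors_nat dest: dvd_div_eq_0_iff)
  also have "\<dots> = dirichlet_conv f (dirichlet_conv g h) n" by (simp add: dirichlet_conv_def sum_distrib_left)
  finally show ?thesis .
qed

lemma dirichlet_conv_cong:
  assumes "n > 0" "\<And>m. m > 0 \<Longrightarrow> f m = f' m" "\<And>m. m > 0 \<Longrightarrow> g m = g' m"
  shows "dirichlet_conv f g n = dirichlet_conv f' g' n"
  unfolding dirichlet_conv_def
proof (intro sum.cong refl arg_cong2[where f = "(*)"] assms(2,3))
  fix d assume "d \<in> {d. d dvd n}"
  then obtain e where e: "n = d * e" by blast
  then show "d > 0" using assms(1) by (auto intro!: Nat.gr0I)
  then show "n div d > 0" using e assms(1) by (auto intro!: Nat.gr0I)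
qed

lemma dirichlet_conv_delta_right:
  assumes "n > 0"
  shows "dirichlet_conv f (\<lambda>m. if m = 1 then 1 else 0) n = f n"
proof -
  have "dirichlet_conv f (\<lambda>m. if m = 1 then 1 else 0) n = (\<Sum>d | d dvd n. if d = n then f n else 0)"
    unfolding dirichlet_conv_def using assms
    by (intro sum.cong refl) (auto elim!: dvdE)
  also have "\<dots> = f n" using assms by simp
  finally show ?thesis .
qed

section \<open>The class of the theorem\<close>

lemma class_CD:
  assumes "f \<in> class_C"
  shows "f 1 = 1" "n \<ge> 1 \<Longrightarrow> cmod (Lambda_of f n) \<le> mangoldt n"
  using assms by (auto simp: class_C_def multiplicative_fun_def)

text \<open>In the expansion of f(n) log n as the sum of \<Lambda>_f(d) f(n / d) the term d = 1
  vanishes, since \<Lambda>(1) = 0. By induction the other values f(n / d) are at most 1 in modulus,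
  so the sum is at most that of \<Lambda>(d) over the divisors of n, which is log n.\<close>

lemma class_C_norm_le_1:
  assumes f: "f \<in> class_C" and n: "n \<ge> 1"
  shows "cmod (f n) \<le> 1"
  using n
proof (induction n rule: less_induct)
  case (less n)
  show ?case
  proof (cases "n = 1")
    case True
    then show ?thesis using class_CD(1)[OF f] by simp
  next
    case False
    then have n2: "n \<ge> 2" using less.prems by simp
    have "cmod (f n) * ln (real n) = cmod (f n * complex_of_real (ln (real n)))"
      using n2 by (simp add: norm_mult)
    also have "\<dots> = cmod (\<Sum>d | d dvd n. Lambda_of f d * f (n div d))"
      using Lambda_of_conv[of f, OF class_CD(1)[OF f], of n] n2 by (simp add: dirichlet_conv_def)
    also have "\<dots> \<le> (\<Sum>d | d dvd n. mangoldt d)"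
    proof (rule sum_norm_le)
      fix d assume "d \<in> {d. d dvd n}"
      then obtain e where e: "n = d * e" by blast
      have pos: "d \<ge> 1" "e \<ge> 1" using e n2 by (cases d; cases e; auto)+
      show "cmod (Lambda_of f d * f (n div d)) \<le> mangoldt d"
      proof (cases "d = 1")
        case True
        then show ?thesis using class_CD(2)[OF f, of 1] by (simp add: norm_mult)
      next
        case False
        then have "n div d < n" using pos n2 by (intro div_less_dividend) auto
        moreover have "n div d \<ge> 1" using e pos by simp
        ultimately have "cmod (f (n div d)) \<le> 1" by (rule less.IH)
        then have "cmod (Lambda_of f d) * cmod (f (n div d)) \<le> mangoldt d * 1"
          using class_CD(2)[OF f pos(1)] by (intro mult_mono) (auto simp: mangoldt_nonneg)
        then show ?thesis by (simp add: norm_mult)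
      qed
    qed
    also have "\<dots> = ln (real n)" using mangoldt_sum[of n, where ?'a = real] n2 by simp
    finally have "cmod (f n) * ln (real n) \<le> 1 * ln (real n)" by simp
    then show ?thesis using n2 by (subst (asm) mult_le_cancel_right) auto
  qed
qed

lemma class_C_Lambda_le_ln:
  assumes "f \<in> class_C" "n \<ge> 1"
  shows "cmod (Lambda_of f n) \<le> ln (real n)"
  using class_CD(2)[OF assms] mangoldt_le[of n] assms(2) by simp

lemma Lambda_of_prime:
  assumes f: "f \<in> class_C" and p: "prime p"
  shows "Lambda_of f p = f p * complex_of_real (ln (real p))"
proof -
  have "p > 1" using p by (rule prime_gt_1_nat)
  have "{d. d dvd p} = {1, p}" using p by (auto simp: prime_nat_iff)
  then have "f p * complex_of_real (ln (real p)) = Lambda_of f 1 * f p + Lambda_of f p * f 1"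
    using Lambda_of_conv[of f, OF class_CD(1)[OF f], of p] \<open>p > 1\<close> by (simp add: dirichlet_conv_def)
  moreover have "Lambda_of f 1 = 0" using class_CD(2)[OF f, of 1] by simp
  ultimately show ?thesis using class_CD(1)[OF f] by simp
qed

section \<open>Sums of functions and negligible functions\<close>

lemma bv_sum_cong:
  assumes "\<And>n. n \<ge> 1 \<Longrightarrow> h n = h' n"
  shows "bv_sum h N Q = bv_sum h' N Q"
proof -
  have "nat_discrepancy h N q a = nat_discrepancy h' N q a" for q a
    unfolding nat_discrepancy_def using assms by (intro sum.cong) auto
  then show ?thesis by (simp add: bv_sum_def)
qed

lemma bv_level_cong:
  assumes "\<And>n. n \<ge> 1 \<Longrightarrow> h n = h' n"
  shows "bv_level h k \<longleftrightarrow> bv_level h' k"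
  unfolding bv_level_def using bv_sum_cong[OF assms] by simp

lemma bv_sum_add: "bv_sum (\<lambda>n. h n + h' n) N Q \<le> bv_sum h N Q + bv_sum h' N Q"
proof (rule bv_sum_le)
  fix a :: "nat \<Rightarrow> nat" assume a: "\<And>q. q \<in> {1..Q} \<Longrightarrow> coprime (a q) q"
  have "(\<Sum>q\<in>{1..Q}. cmod (nat_discrepancy (\<lambda>n. h n + h' n) N q (int (a q))))
    \<le> (\<Sum>q\<in>{1..Q}. cmod (nat_discrepancy h N q (int (a q))) + cmod (nat_discrepancy h' N q (int (a q))))"
    by (intro sum_mono) (simp add: nat_discrepancy_def distrib_right sum.distrib norm_triangle_ineq)
  also have "\<dots> \<le> bv_sum h N Q + bv_sum h' N Q"
    unfolding sum.distrib using a by (intro add_mono sum_nat_discrepancy_le_bv_sum) auto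
  finally show "(\<Sum>q\<in>{1..Q}. cmod (nat_discrepancy (\<lambda>n. h n + h' n) N q (int (a q)))) \<le> bv_sum h N Q + bv_sum h' N Q" .
qed

lemma bv_level_add:
  assumes "bv_level h k" "bv_level h' k"
  shows "bv_level (\<lambda>n. h n + h' n) k"
proof -
  from assms obtain m C m' C' where
    ev: "\<forall>\<^sub>F x in at_top. \<forall>Q::nat. real Q \<le> sqrt x / ln x ^ m \<longrightarrow> bv_sum h (nat \<lfloor>x\<rfloor>) Q \<le> C * (x / ln x powr k)"
    and ev': "\<forall>\<^sub>F x in at_top. \<forall>Q::nat. real Q \<le> sqrt x / ln x ^ m' \<longrightarrow> bv_sum h' (nat \<lfloor>x\<rfloor>) Q \<le> C' * (x / ln x powr k)"
    unfolding bv_level_def by blast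
  show ?thesis unfolding bv_level_def
  proof (intro exI[of _ "m + m'"] exI[of _ "C + C'"], use ev ev' eventually_ln_ge[of 1] eventually_ge_at_top[of 1] in eventually_elim,
      intro allI impI)
    fix x :: real and Q :: nat
    assume B: "\<forall>Q::nat. real Q \<le> sqrt x / ln x ^ m \<longrightarrow> bv_sum h (nat \<lfloor>x\<rfloor>) Q \<le> C * (x / ln x powr k)"
      and B': "\<forall>Q::nat. real Q \<le> sqrt x / ln x ^ m' \<longrightarrow> bv_sum h' (nat \<lfloor>x\<rfloor>) Q \<le> C' * (x / ln x powr k)"
      and L: "1 \<le> ln x" and x: "1 \<le> x" and Q: "real Q \<le> sqrt x / ln x ^ (m + m')"
    have L0: "ln x > 0" using L by linarith
    have "sqrt x / ln x ^ (m + m') \<le> sqrt x / ln x ^ i" if "i \<le> m + m'" for i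
      using L x that by (intro divide_left_mono power_increasing mult_pos_pos zero_less_power L0) auto
    then have "real Q \<le> sqrt x / ln x ^ m" "real Q \<le> sqrt x / ln x ^ m'" using Q by (meson le_add1 le_add2 order_trans)+
    then have "bv_sum h (nat \<lfloor>x\<rfloor>) Q \<le> C * (x / ln x powr k)" "bv_sum h' (nat \<lfloor>x\<rfloor>) Q \<le> C' * (x / ln x powr k)"
      using B B' by blast+
    then show "bv_sum (\<lambda>n. h n + h' n) (nat \<lfloor>x\<rfloor>) Q \<le> (C + C') * (x / ln x powr k)"
      using bv_sum_add[of h h' "nat \<lfloor>x\<rfloor>" Q] unfolding distrib_right by linarith
  qed
qed

text \<open>The kernel is at most 1 in modulus, so every modulus costs at most the total mass of r,
  and Q is below \<open>sqrt x\<close> by any wanted power of the logarithm. Mass of order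
  \<open>sqrt x\<close> up to logarithms is therefore negligible at every level; this disposes of
  the proper prime powers and of single points.\<close>

lemma bv_level_of_small_sum:
  assumes ev: "\<forall>\<^sub>F x in at_top. (\<Sum>n\<in>{1..nat \<lfloor>x\<rfloor>}. cmod (r n)) \<le> C * (sqrt x * ln x ^ 2)"
  shows "bv_level r k"
  unfolding bv_level_def
proof (intro exI[of _ "nat \<lceil>k\<rceil> + 2"] exI[of _ "\<bar>C\<bar>"], use ev eventually_ln_ge[of 1] eventually_ge_at_top[of 1] in eventually_elim,
    intro allI impI, rule bv_sum_le)
  fix x :: real and Q :: nat and a :: "nat \<Rightarrow> nat"
  assume S: "(\<Sum>n\<in>{1..nat \<lfloor>x\<rfloor>}. cmod (r n)) \<le> C * (sqrt x * ln x ^ 2)" and L: "1 \<le> ln x" and x: "1 \<le> x"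
    and Q: "real Q \<le> sqrt x / ln x ^ (nat \<lceil>k\<rceil> + 2)"
  have L0: "ln x > 0" using L by linarith
  define k0 where "k0 = nat \<lceil>k\<rceil>"
  have k0: "ln x powr k \<le> ln x ^ k0"
  proof -
    have "ln x powr k \<le> ln x powr real k0" using L unfolding k0_def by (intro powr_mono) linarith+
    also have "\<dots> = ln x ^ k0" using L0 by (rule powr_realpow)
    finally show ?thesis .
  qed
  have "(\<Sum>q\<in>{1..Q}. cmod (nat_discrepancy r (nat \<lfloor>x\<rfloor>) q (int (a q)))) \<le> (\<Sum>q\<in>{1..Q}. \<bar>C\<bar> * (sqrt x * ln x ^ 2))"
  proof (rule sum_mono)
    fix q assume q: "q \<in> {1..Q}"
    have "cmod (nat_discrepancy r (nat \<lfloor>x\<rfloor>) q (int (a q))) \<le> (\<Sum>n\<in>{1..nat \<lfloor>x\<rfloor>}. cmod (r n))"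
      unfolding nat_discrepancy_def
    proof (rule sum_norm_le)
      fix n
      have "cmod (r n) * cmod (ap_kernel q (int (a q)) n) \<le> cmod (r n) * 1"
        using q by (intro mult_left_mono cmod_ap_kernel_le_1) auto
      then show "cmod (r n * ap_kernel q (int (a q)) n) \<le> cmod (r n)" by (simp add: norm_mult)
    qed
    also have "\<dots> \<le> C * (sqrt x * ln x ^ 2)" by (rule S)
    also have "\<dots> \<le> \<bar>C\<bar> * (sqrt x * ln x ^ 2)" using x by (intro mult_right_mono) auto
    finally show "cmod (nat_discrepancy r (nat \<lfloor>x\<rfloor>) q (int (a q))) \<le> \<bar>C\<bar> * (sqrt x * ln x ^ 2)" .
  qed
  also have "\<dots> = real Q * (\<bar>C\<bar> * (sqrt x * ln x ^ 2))" by simp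
  also have "\<dots> \<le> sqrt x / ln x ^ (k0 + 2) * (\<bar>C\<bar> * (sqrt x * ln x ^ 2))"
    using Q x unfolding k0_def by (intro mult_right_mono) auto
  also have "\<dots> = \<bar>C\<bar> * ((sqrt x * sqrt x) / ln x ^ k0)"
  proof -
    have cancel: "s / (u * v) * (w * (s * v)) = w * ((s * s) / u)" if "v \<noteq> 0" for s u v w :: real using that by simp
    show ?thesis unfolding power_add by (rule cancel) (use L0 in simp)
  qed
  also have "\<dots> = \<bar>C\<bar> * (x / ln x ^ k0)" using x by simp
  also have "\<dots> \<le> \<bar>C\<bar> * (x / ln x powr k)"
    using k0 x L0 by (intro mult_left_mono divide_left_mono mult_pos_pos) (auto simp: powr_gt_zero simp del: ln_gt_zero_iff)
  finally show "(\<Sum>q\<in>{1..Q}. cmod (nat_discrepancy r (nat \<lfloor>x\<rfloor>) q (int (a q)))) \<le> \<bar>C\<bar> * (x / ln x powr k)" .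
qed

section \<open>Proper prime powers\<close>

lemma card_proper_prime_powers_le:
  assumes x: "x \<ge> 1"
  shows "real (card {n\<in>{1..nat \<lfloor>x\<rfloor>}. primepow n \<and> \<not> prime n}) \<le> sqrt x * (2 * ln x + 1)"
proof -
  let ?S = "{n\<in>{1..nat \<lfloor>x\<rfloor>}. primepow n \<and> \<not> prime n}"
  let ?A = "{1..nat \<lfloor>sqrt x\<rfloor>}" and ?B = "{..nat \<lfloor>2 * ln x\<rfloor>}"
  have sub: "?S \<subseteq> (\<lambda>(p, j). p ^ j) ` (?A \<times> ?B)"
  proof
    fix n assume n: "n \<in> ?S"
    then obtain p j where pj: "prime p" "j > 0" "n = p ^ j" by (auto simp: primepow_def)
    have "j \<noteq> 1" using n pj by auto
    then have j2: "j \<ge> 2" using pj by simp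
    have nx: "real n \<le> x" using n x by (auto simp: le_nat_floor le_floor_iff nat_le_iff) linarith
    have p2: "p \<ge> 2" using pj(1) by (rule prime_ge_2_nat)
    have "p ^ 2 \<le> p ^ j" using p2 j2 by (intro power_increasing) auto
    then have "real (p ^ 2) \<le> x" using nx pj by linarith
    then have "real p \<le> sqrt x" by (intro real_le_rsqrt) simp
    then have pA: "p \<in> ?A" using p2 by (auto intro: le_nat_floor)
    have "2 ^ j \<le> p ^ j" using p2 by (intro power_mono) auto
    then have "real (2 ^ j) \<le> x" using nx pj by linarith
    then have "ln (2 ^ j) \<le> ln x" by (subst ln_le_cancel_iff) (use x in auto)
    then have "real j * ln 2 \<le> ln x" by (simp add: ln_realpow)
    moreover have "real j * (1 / 2) \<le> real j * ln 2" using ln2_ge_two_thirds by (intro mult_left_mono) auto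
    ultimately have "real j \<le> 2 * ln x" by linarith
    then have "j \<in> ?B" by (auto intro: le_nat_floor)
    then show "n \<in> (\<lambda>(p, j). p ^ j) ` (?A \<times> ?B)" using pA pj by force
  qed
  have "card ?S \<le> card ((\<lambda>(p, j). p ^ j) ` (?A \<times> ?B))" using sub by (intro card_mono) auto
  also have "\<dots> \<le> card (?A \<times> ?B)" by (rule card_image_le) simp
  also have "\<dots> = nat \<lfloor>sqrt x\<rfloor> * (nat \<lfloor>2 * ln x\<rfloor> + 1)" by (simp add: card_cartesian_product)
  finally have "real (card ?S) \<le> real (nat \<lfloor>sqrt x\<rfloor> * (nat \<lfloor>2 * ln x\<rfloor> + 1))" by (rule of_nat_mono)
  also have "\<dots> = real (nat \<lfloor>sqrt x\<rfloor>) * (real (nat \<lfloor>2 * ln x\<rfloor>) + 1)" by (simp add: algebra_simps)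
  also have "\<dots> \<le> sqrt x * (2 * ln x + 1)" using x by (intro mult_mono add_mono) auto
  finally show ?thesis .
qed

lemma bv_level_proper_prime_powers:
  assumes lb: "\<And>n. n \<ge> 1 \<Longrightarrow> cmod (r n) \<le> ln (real n)" and z: "\<And>n. n \<ge> 1 \<Longrightarrow> \<not> (primepow n \<and> \<not> prime n) \<Longrightarrow> r n = 0"
  shows "bv_level r k"
proof (rule bv_level_of_small_sum[where C = 3])
  show "\<forall>\<^sub>F x in at_top. (\<Sum>n\<in>{1..nat \<lfloor>x\<rfloor>}. cmod (r n)) \<le> 3 * (sqrt x * ln x ^ 2)"
    using eventually_ln_ge[of 1] eventually_ge_at_top[of 1]
  proof eventually_elim
    case (elim x)
    let ?S = "{n\<in>{1..nat \<lfloor>x\<rfloor>}. primepow n \<and> \<not> prime n}"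
    have "(\<Sum>n\<in>{1..nat \<lfloor>x\<rfloor>}. cmod (r n)) = (\<Sum>n\<in>?S. cmod (r n))"
      using z by (intro sum.mono_neutral_right) auto
    also have "\<dots> \<le> (\<Sum>n\<in>?S. ln x)"
    proof (rule sum_mono)
      fix n assume n: "n \<in> ?S"
      then have "real n \<le> x" using elim(2) real_le_iff_le_floor[of n x] by auto
      then have "ln (real n) \<le> ln x" using n by simp
      then show "cmod (r n) \<le> ln x" using lb[of n] n by force
    qed
    also have "\<dots> = real (card ?S) * ln x" by simp
    also have "\<dots> \<le> (sqrt x * (2 * ln x + 1)) * ln x"
      using card_proper_prime_powers_le[OF elim(2)] elim by (intro mult_right_mono) auto
    also have "\<dots> \<le> (sqrt x * (3 * ln x)) * ln x" using elim by (intro mult_right_mono mult_left_mono) auto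
    also have "\<dots> = 3 * (sqrt x * ln x ^ 2)" by (simp add: power2_eq_square)
    finally show ?case .
  qed
qed

section \<open>The logarithm and its reciprocal as weights\<close>

lemma ln_Suc_diff: "n \<ge> 1 \<Longrightarrow> 0 \<le> ln (real (Suc n)) - ln (real n) \<and> ln (real (Suc n)) - ln (real n) \<le> 1 / real n"
proof
  assume n: "n \<ge> 1"
  then show "0 \<le> ln (real (Suc n)) - ln (real n)" by simp
  have "ln (real (Suc n)) - ln (real n) = ln (real (Suc n) / real n)" using n by (simp add: ln_div)
  also have "real (Suc n) / real n = 1 + 1 / real n" using n by (simp add: field_simps)
  also have "ln (1 + 1 / real n) \<le> 1 / real n" by (rule ln_add_one_self_le_self) simp
  finally show "ln (real (Suc n)) - ln (real n) \<le> 1 / real n" .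
qed

lemma bv_level_times_ln:
  assumes "log_bounded h" "bv_level h k"
  shows "bv_level (\<lambda>n. h n * of_real (ln (real n))) (k - 1)"
proof (rule bv_level_weight[OF assms, of 1])
  show "\<bar>ln (real n) - ln (real (Suc n))\<bar> \<le> 1 / real n" if "n \<ge> 1" for n
    using ln_Suc_diff[OF that] by linarith
  show "\<forall>\<^sub>F x in at_top. \<forall>n::nat. sqrt x \<le> real n \<and> real n \<le> x \<longrightarrow>
      \<bar>ln (real n) - ln (real (Suc n))\<bar> \<le> 1 * ln x powr 1 / real n \<and> \<bar>ln (real n)\<bar> \<le> 1 * ln x powr 1"
    using eventually_ln_ge[of 1] eventually_ge_at_top[of 1]
  proof (eventually_elim, intro allI impI, elim conjE)
    fix x :: real and n :: nat
    assume x: "1 \<le> ln x" "1 \<le> x" and n: "sqrt x \<le> real n" "real n \<le> x"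
    have "sqrt x \<ge> 1" using x by simp
    then have n1: "n \<ge> 1" using n by linarith
    have "1 / real n \<le> ln x / real n" using x by (intro divide_right_mono) auto
    moreover have "ln x powr 1 = ln x" using x by simp
    moreover have "ln (real n) \<le> ln x" "0 \<le> ln (real n)" using n n1 by auto
    ultimately show "\<bar>ln (real n) - ln (real (Suc n))\<bar> \<le> 1 * ln x powr 1 / real n \<and> \<bar>ln (real n)\<bar> \<le> 1 * ln x powr 1"
      using ln_Suc_diff[OF n1] by simp
  qed
qed simp

text \<open>At \<open>1\<close> the expression \<open>1 / ln n\<close> would have the junk value \<open>0\<close>; the value chosen makes the function monotone.\<close>

definition inv_ln :: "nat \<Rightarrow> real" where
  "inv_ln n = (if n \<le> 1 then 1 / ln 2 else 1 / ln (real n))"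

lemma inv_ln_diff:
  assumes "n \<ge> 2"
  shows "\<bar>inv_ln n - inv_ln (Suc n)\<bar> \<le> 1 / (real n * (ln (real n))\<^sup>2)"
proof -
  define A where "A = ln (real n)"
  define B where "B = ln (real (Suc n))"
  have AB: "A > 0" "A \<le> B" "B - A \<le> 1 / real n" unfolding A_def B_def using assms ln_Suc_diff[of n] by auto
  have "inv_ln n - inv_ln (Suc n) = 1 / A - 1 / B" using assms by (simp add: inv_ln_def A_def B_def)
  also have "\<dots> = (B - A) / (A * B)" using AB by (simp add: field_simps)
  finally have e: "inv_ln n - inv_ln (Suc n) = (B - A) / (A * B)" .
  have "0 \<le> (B - A) / (A * B)" using AB by simp
  then have "\<bar>inv_ln n - inv_ln (Suc n)\<bar> = (B - A) / (A * B)" unfolding e by (rule abs_of_nonneg)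
  also have "\<dots> \<le> (1 / real n) / (A * A)" using AB by (intro frac_le mult_left_mono) auto
  finally show ?thesis unfolding A_def by (simp add: power2_eq_square)
qed

lemma bv_level_times_inv_ln:
  assumes "log_bounded h" "bv_level h k"
  shows "bv_level (\<lambda>n. h n * of_real (inv_ln n)) (k + 1)"
proof -
  have ln2: "ln (2::real) \<ge> 1 / 2" using ln2_ge_two_thirds by linarith
  have "bv_level (\<lambda>n. h n * of_real (inv_ln n)) (k - (-1))"
  \<comment> \<open>In the bound for all n the constant 4 comes from \<open>ln n \<ge> 1 / 2\<close>
    for n \<ge> 2; for n at least \<open>sqrt x\<close> the inequality
    \<open>ln n \<ge> ln x / 2\<close> yields the same constant.\<close>
  proof (rule bv_level_weight[OF assms, of 4])
    show "\<bar>inv_ln n - inv_ln (Suc n)\<bar> \<le> 4 / real n" if n: "n \<ge> 1" for n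
    \<comment> \<open>At n = 1 the difference is 0, since
      \<open>inv_ln 1 = inv_ln 2\<close>.\<close>
    proof (cases "n = 1")
      case True
      then show ?thesis by (simp add: inv_ln_def numeral_2_eq_2)
    next
      case False
      then have n2: "n \<ge> 2" using n by simp
      have "ln (real n) \<ge> ln 2" using n2 by simp
      then have "(ln (real n))\<^sup>2 \<ge> (1 / 2)\<^sup>2" using ln2 by (intro power_mono) auto
      then have "1 / (real n * (ln (real n))\<^sup>2) \<le> 1 / (real n * (1 / 2)\<^sup>2)"
        using n2 by (intro divide_left_mono mult_left_mono) auto
      also have "\<dots> = 4 / real n" by (simp add: power2_eq_square)
      finally show ?thesis using inv_ln_diff[OF n2] by linarith
    qed
    show "\<forall>\<^sub>F x in at_top. \<forall>n::nat. sqrt x \<le> real n \<and> real n \<le> x \<longrightarrow>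
      \<bar>inv_ln n - inv_ln (Suc n)\<bar> \<le> 4 * ln x powr (-1) / real n \<and> \<bar>inv_ln n\<bar> \<le> 4 * ln x powr (-1)"
      using eventually_ln_ge[of 1] eventually_ge_at_top[of 4]
    proof (eventually_elim, intro allI impI, elim conjE)
      fix x :: real and n :: nat
      assume x: "1 \<le> ln x" "4 \<le> x" and n: "sqrt x \<le> real n" "real n \<le> x"
      have sx: "sqrt x \<ge> 2" using x(2) real_le_rsqrt[of 2 x] by simp
      then have n2: "n \<ge> 2" using n by linarith
      have "ln (sqrt x) \<le> ln (real n)" using n sx n2 by (subst ln_le_cancel_iff) auto
      then have ln: "ln x / 2 \<le> ln (real n)" using x by (simp add: ln_sqrt)
      have L0: "ln x > 0" using x by linarith
      have pw: "ln x powr (-1) = 1 / ln x" using L0 by (simp add: powr_minus_divide)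
      have "1 / (real n * (ln (real n))\<^sup>2) \<le> 1 / (real n * (ln x / 2)\<^sup>2)"
        using n2 ln L0 by (intro divide_left_mono mult_left_mono power_mono mult_pos_pos zero_less_power) auto
      also have "\<dots> = 4 * (1 / (ln x * ln x)) / real n" by (simp add: power2_eq_square)
      also have "\<dots> \<le> 4 * (1 / (ln x * 1)) / real n"
        using x L0 by (intro divide_right_mono mult_left_mono divide_left_mono mult_pos_pos) auto
      finally have 1: "\<bar>inv_ln n - inv_ln (Suc n)\<bar> \<le> 4 * ln x powr (-1) / real n"
        using inv_ln_diff[OF n2] unfolding pw by simp
      have "\<bar>inv_ln n\<bar> = 1 / ln (real n)" using n2 by (simp add: inv_ln_def)
      also have "\<dots> \<le> 1 / (ln x / 2)" using ln L0 n2 by (intro divide_left_mono mult_pos_pos) auto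
      also have "\<dots> \<le> 4 * (1 / ln x)" using L0 by (simp add: field_simps)
      finally have 2: "\<bar>inv_ln n\<bar> \<le> 4 * ln x powr (-1)" unfolding pw .
      from 1 2 show "\<bar>inv_ln n - inv_ln (Suc n)\<bar> \<le> 4 * ln x powr (-1) / real n \<and> \<bar>inv_ln n\<bar> \<le> 4 * ln x powr (-1)" by simp
    qed
  qed simp
  then show ?thesis by simp
qed

theorem theorem1p1:
  fixes f g :: "nat \<Rightarrow> complex"
  assumes "f \<in> class_C" and "g \<in> class_C"
    and "\<And>n. n \<ge> 1 \<Longrightarrow> dirichlet_conv f g n = (if n = 1 then 1 else 0)"
  shows "(bombieri_vinogradov_hyp f \<and> bombieri_vinogradov_hyp g
            \<longrightarrow> bombieri_vinogradov_hyp (prime_restrict f))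
       \<and> (bombieri_vinogradov_hyp (prime_restrict f) \<and> siegel_walfisz_crit f
            \<longrightarrow> bombieri_vinogradov_hyp f)"
proof -
  define F where "F = (\<lambda>n. f n * complex_of_real (ln (real n)))"
  \<comment> \<open>The primes with logarithmic weight: \<theta> agrees with
    \<open>Lambda_of f\<close> except at proper prime powers.\<close>
  define \<theta> where "\<theta> = (\<lambda>n. prime_restrict f n * complex_of_real (ln (real n)))"
  let ?\<Lambda> = "Lambda_of f"
  have f1: "f 1 = 1" by (rule class_CD(1)[OF assms(1)])
  have lbI: "log_bounded h" if h: "\<And>n. n \<ge> 1 \<Longrightarrow> cmod (h n) \<le> ln (real n)" for h
    unfolding log_bounded_def using h by (meson add_increasing order_trans zero_le_one order_refl)
  have lbC: "log_bounded h" if "h \<in> class_C" for h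
    unfolding log_bounded_def
  proof (intro allI impI)
    fix n :: nat assume n: "n \<ge> 1"
    then have "ln (real n) \<ge> 0" by simp
    then show "cmod (h n) \<le> 1 + ln (real n)" using class_C_norm_le_1[OF that n] by linarith
  qed
  have lbf: "log_bounded f" and lbg: "log_bounded g" using lbC assms by auto
  have F_le: "cmod (F n) \<le> ln (real n)" if "n \<ge> 1" for n
  proof -
    have "cmod (f n) * ln (real n) \<le> 1 * ln (real n)"
      using class_C_norm_le_1[OF assms(1) that] that by (intro mult_right_mono) auto
    then show ?thesis using that by (simp add: F_def norm_mult)
  qed
  have \<theta>_le: "cmod (\<theta> n) \<le> ln (real n)" if "n \<ge> 1" for n
    using F_le[OF that] that by (simp add: \<theta>_def F_def prime_restrict_def)
  have lbF: "log_bounded F" and lb\<theta>: "log_bounded \<theta>" and lb\<Lambda>: "log_bounded ?\<Lambda>"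
    by (intro lbI F_le \<theta>_le class_C_Lambda_le_ln[OF assms(1)]; assumption)+
  have lbp: "log_bounded (prime_restrict f)"
    using lbf by (auto simp: log_bounded_def prime_restrict_def)
  have \<Lambda>_conv: "?\<Lambda> n = dirichlet_conv F g n" if n: "n \<ge> 1" for n
  proof -
    have "dirichlet_conv F g n = dirichlet_conv (dirichlet_conv ?\<Lambda> f) g n"
      unfolding F_def using n Lambda_of_conv[of f, OF f1] by (intro dirichlet_conv_cong) auto
    also have "\<dots> = dirichlet_conv ?\<Lambda> (dirichlet_conv f g) n" using n by (intro dirichlet_conv_assoc) simp
    also have "\<dots> = dirichlet_conv ?\<Lambda> (\<lambda>m. if m = 1 then 1 else 0) n"
      using n assms(3) by (intro dirichlet_conv_cong) auto
    also have "\<dots> = ?\<Lambda> n" using n by (intro dirichlet_conv_delta_right) simp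
    finally show ?thesis by simp
  qed
  have F_conv: "F n = dirichlet_conv ?\<Lambda> f n" if "n \<ge> 1" for n
    unfolding F_def using Lambda_of_conv[of f, OF f1, of n] that by simp
  have diff0: "?\<Lambda> n = \<theta> n" if n: "n \<ge> 1" and "\<not> (primepow n \<and> \<not> prime n)" for n
  proof (cases "prime n")
    case True
    then show ?thesis using Lambda_of_prime[OF assms(1) True] by (simp add: \<theta>_def prime_restrict_def)
  next
    case False
    then have "mangoldt n = (0::real)" using that by (simp add: mangoldt_def)
    then have "?\<Lambda> n = 0" using class_CD(2)[OF assms(1) n] by simp
    then show ?thesis using False by (simp add: \<theta>_def prime_restrict_def)
  qed
  have diff_le: "cmod (?\<Lambda> n - \<theta> n) \<le> ln (real n)" if n: "n \<ge> 1" for n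
  proof (cases "prime n")
    case True
    then show ?thesis using diff0[OF n] n by simp
  next
    case False
    then show ?thesis using class_C_Lambda_le_ln[OF assms(1) n] by (simp add: \<theta>_def prime_restrict_def)
  qed
  have "bv_level (\<lambda>n. ?\<Lambda> n - \<theta> n) k" for k
  proof (rule bv_level_proper_prime_powers)
    show "?\<Lambda> n - \<theta> n = 0" if "n \<ge> 1" "\<not> (primepow n \<and> \<not> prime n)" for n
      unfolding diff0[OF that] by simp
  qed (rule diff_le)
  moreover have "bv_level (\<lambda>n. \<theta> n - ?\<Lambda> n) k" for k
  proof (rule bv_level_proper_prime_powers)
    show "\<theta> n - ?\<Lambda> n = 0" if "n \<ge> 1" "\<not> (primepow n \<and> \<not> prime n)" for n
      unfolding diff0[OF that] by simp
    show "cmod (\<theta> n - ?\<Lambda> n) \<le> ln (real n)" if "n \<ge> 1" for n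
      unfolding norm_minus_commute[of "\<theta> n"] by (rule diff_le[OF that])
  qed
  ultimately have \<theta>\<Lambda>: "bv_level \<theta> k \<longleftrightarrow> bv_level ?\<Lambda> k" for k
    using bv_level_add[of \<theta> k "\<lambda>n. ?\<Lambda> n - \<theta> n"] bv_level_add[of ?\<Lambda> k "\<lambda>n. \<theta> n - ?\<Lambda> n"] by auto
  \<comment> \<open>The hypotheses speak of positive exponents, but later steps shift k freely;
    monotonicity supplies the rest.\<close>
  have all_levels: "bv_level h k" if "\<And>k. k > 0 \<Longrightarrow> bv_level h k" for h k
    using bv_level_mono[OF that[of "\<bar>k\<bar> + 1"], of k] by linarith
  show ?thesis
  proof (intro conjI impI; elim conjE)
    assume "bombieri_vinogradov_hyp f" "bombieri_vinogradov_hyp g"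
    then have lf: "bv_level f k" and lg: "bv_level g k" for k
      unfolding bombieri_vinogradov_iff_bv_level using all_levels by blast+
    have lF: "bv_level F k" for k
      using bv_level_times_ln[OF lbf lf, of "k + 1"] by (simp add: F_def)
    have "bv_level ?\<Lambda> k" for k
    proof -
      have "bv_level (dirichlet_conv F g) (k + 1/2 - 1/2)"
        by (intro bv_level_dirichlet_conv lbF lbg bv_levels_imp_sw_bound lF lg)
      then show ?thesis using bv_level_cong[of ?\<Lambda> "dirichlet_conv F g" k] \<Lambda>_conv by simp
    qed
    then have "bv_level \<theta> k" for k by (simp add: \<theta>\<Lambda>)
    then have l: "bv_level (\<lambda>n. \<theta> n * of_real (inv_ln n)) k" for k
      using bv_level_times_inv_ln[OF lb\<theta>, of "k - 1"] by simp
    have "\<theta> n * of_real (inv_ln n) = prime_restrict f n" for n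
      using prime_gt_1_nat[of n] by (auto simp: \<theta>_def prime_restrict_def inv_ln_def)
    then show "bombieri_vinogradov_hyp (prime_restrict f)"
      unfolding bombieri_vinogradov_iff_bv_level using l by simp
  next
    assume bv: "bombieri_vinogradov_hyp (prime_restrict f)" and sw: "siegel_walfisz_crit f"
    then have lp: "bv_level (prime_restrict f) k" for k
      unfolding bombieri_vinogradov_iff_bv_level using all_levels by blast
    have "bv_level \<theta> k" for k
      using bv_level_times_ln[OF lbp lp, of "k + 1"] by (simp add: \<theta>_def)
    then have l\<Lambda>: "bv_level ?\<Lambda> k" for k by (simp add: \<theta>\<Lambda>)
    \<comment> \<open>For \<open>Lambda_of f\<close> the Siegel-Walfisz bound follows from the
      estimates at all levels. For f these are still to be proved, and the hypothesis
      \<open>sw\<close> takes their place.\<close>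
    have sw\<Lambda>: "sw_bound ?\<Lambda>" by (intro bv_levels_imp_sw_bound lb\<Lambda> l\<Lambda>)
    \<comment> \<open>\<open>F\<close> vanishes at \<open>1\<close> and so forgets \<open>f 1\<close>, which \<open>e\<close> restores.\<close>
    define e where "e = (\<lambda>n::nat. if n = 1 then complex_of_real (ln 2) else 0)"
    have le: "bv_level e k" for k
    proof (rule bv_level_of_small_sum[where C = 1])
      show "\<forall>\<^sub>F x in at_top. (\<Sum>n\<in>{1..nat \<lfloor>x\<rfloor>}. cmod (e n)) \<le> 1 * (sqrt x * ln x ^ 2)"
        using eventually_ln_ge[of 1] eventually_ge_at_top[of 1]
      proof eventually_elim
        case (elim x)
        have "(\<Sum>n\<in>{1..nat \<lfloor>x\<rfloor>}. cmod (e n)) \<le> (\<Sum>n\<in>{1..nat \<lfloor>x\<rfloor>}. if n = 1 then 1 else 0)"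
          using ln_2_less_1 by (intro sum_mono) (auto simp: e_def)
        also have "\<dots> \<le> 1" by (simp add: sum.delta)
        finally have "(\<Sum>n\<in>{1..nat \<lfloor>x\<rfloor>}. cmod (e n)) \<le> 1" .
        moreover have "1 * 1 \<le> sqrt x * ln x ^ 2" using elim by (intro mult_mono one_le_power) auto
        ultimately show ?case by linarith
      qed
    qed
    have lbFe: "log_bounded (\<lambda>n. F n + e n)"
      unfolding log_bounded_def
    proof (intro allI impI)
      fix n :: nat assume n: "n \<ge> 1"
      show "cmod (F n + e n) \<le> 1 + ln (real n)"
      proof (cases "n = 1")
        case True
        then show ?thesis using ln_2_less_1 by (simp add: F_def e_def)
      next
        case False
        then show ?thesis using F_le[OF n] by (simp add: e_def)
      qed
    qed
    \<comment> \<open>At n = 1 this reads ln 2 * (1 / ln 2) = 1, because F vanishes there.\<close>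
    have split: "(F n + e n) * of_real (inv_ln n) = f n" if n: "n \<ge> 1" for n
      using n f1 by (cases "n = 1") (auto simp: F_def e_def inv_ln_def)
    have "bv_level f (real j / 2 - 2)" for j :: nat
    proof (induction j)
      case 0
      then show ?case using bv_level_minus_2[OF lbf] by simp
    next
      case (Suc j)
      define k where "k = real j / 2 - 2"
      have "bv_level (dirichlet_conv ?\<Lambda> f) (k - 1/2)"
        using Suc siegel_walfisz_imp_sw_bound[OF sw] unfolding k_def
        by (intro bv_level_dirichlet_conv lb\<Lambda> lbf sw\<Lambda> l\<Lambda>)
      then have "bv_level F (k - 1/2)" using bv_level_cong[of F "dirichlet_conv ?\<Lambda> f"] F_conv by simp
      then have "bv_level (\<lambda>n. F n + e n) (k - 1/2)" by (intro bv_level_add le)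
      then have "bv_level (\<lambda>n. (F n + e n) * of_real (inv_ln n)) (k - 1/2 + 1)"
        by (rule bv_level_times_inv_ln[OF lbFe])
      then have "bv_level f (k - 1/2 + 1)"
        using bv_level_cong[of "\<lambda>n. (F n + e n) * of_real (inv_ln n)" f] split by simp
      moreover have "k - 1/2 + 1 = real (Suc j) / 2 - 2" by (simp add: k_def field_simps)
      ultimately show ?case by simp
    qed
    then have "bv_level f k" for k
    proof -
      have "2 * (k + 2) \<le> real (nat \<lceil>2 * (k + 2)\<rceil>)" by (rule real_nat_ceiling_ge)
      then have "k \<le> real (nat \<lceil>2 * (k + 2)\<rceil>) / 2 - 2" by simp
      then show ?thesis using bv_level_mono \<open>\<And>j. bv_level f (real j / 2 - 2)\<close> by blast
    qed
    then show "bombieri_vinogradov_hyp f" unfolding bombieri_vinogradov_iff_bv_level by blast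
  qed
qed

end
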